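(* Let $\Omega\subset\mathbb{R}^n$ be a bounded Lipschitz domain and let $\mathcal{F}[u]=\int_\Omega F(x,u,\nabla u)\,dx$, where $F:\Omega\times\mathbb{R}\times\mathbb{R}^n\to\mathbb{R}$ is measurable with respect to the first variable and continuous with respect to the second and the third variable. Let $M:\Omega\times\mathbb{R}^n\to[0,\infty)$ be a weak $N$-function that is continuous with respect to both variables, and suppose that there exist constants $0<\nu,\beta<1<L$ such that $$\nu M(x,\beta\xi)\le F(x,z,\xi)\le L\,(M(x,\xi)+1)\qquad\text{for all } x\in\Omega,\ z\in\mathbb{R},\ \xi\in\mathbb{R}^n.$$ Then the following hold. (i) If $\gamma=0$, $u_0\in V^1E_M(\Omega)$, and $M$ satisfies condition $\mathsf{(B^{gen}_{\gamma+})}$ (with $\gamma=0$), then $$\inf_{u\in u_0+V^1_0E_M(\Omega)}\mathcal{F}[u]=\inf_{u\in u_0+C_c^\infty(\Omega)}\mathcal{F}[u].$$ (ii) If $\gamma\in(0,1]$, $u_0\in V^1E_M(\Omega)\cap C^{0,\gamma}(\Omega)$, and $M$ satisfies condition $\mathsf{(B^{gen}_{\gamma+})}$, then $$\inf_{u\in u_0+(V^1_0E_M(\Omega)\cap C^{0,\gamma}(\Omega))}\mathcal{F}[u]=\inf_{u\in u_0+C_c^\infty(\Omega)}\mathcal{F}[u].$$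
   Context: Weak $N$-functions. For $\ell\ge1$, a function $N:\Omega\times\mathbb{R}^\ell\to[0,\infty)$ is a weak $N$-function if: (1) it is Carathéodory (measurable in $x$, continuous in $\xi$); (2) $N(x,0)=0$ and $\xi\mapsto N(x,\xi)$ is convex for a.a. $x\in\Omega$; (3) $N(x,\xi)=N(x,-\xi)$ for a.a. $x\in\Omega$ and all $\xi$; (4) there exist convex functions $m_1,m_2:[0,\infty)\to[0,\infty)$ with $m_1(0)=0$, $m_1(s)>0$ for $s>0$, such that $m_1(|\xi|)\le N(x,\xi)\le m_2(|\xi|)$ for a.a. $x\in\Omega$ and all $\xi$. For a ball $B$ and a weak $N$-function $N$: $N_B^-(\xi)=\operatorname{ess\,inf}_{y\in B\cap\Omega}N(y,\xi)$ and $N_B^+(\xi)=\operatorname{ess\,sup}_{y\in B\cap\Omega}N(y,\xi)$. Condition $\mathsf{(B^{gen}_{\gamma+})}$: $M(x,\xi)=\sum_{j=1}^{K}M_j(x,\xi_j)$ for some $K\ge1$, where $\xi=(\xi_1,\dots,\xi_K)$ with $\xi_j\in\mathbb{R}^{\ell_j}$, $\mathbb{R}^{\ell_1}\times\dots\times\mathbb{R}^{\ell_K}=\mathbb{R}^n$, and $M_j:\Omega\times\mathbb{R}^{\ell_j}\to[0,\infty)$ are weak $N$-functions; and there exist a constant $C^\Diamond>1$ and a function $\vartheta:(0,1]\to(0,\infty)$ with $\vartheta(r)=\frac{1}{o(r^{1-\gamma})}$, i.e. $\lim_{r\to0}\frac{1}{\vartheta(r)\,r^{1-\gamma}}=0$,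 such that for every ball $B$ with radius $r\le1$, all $j$, and all $\xi_j\in\mathbb{R}^{\ell_j}$ satisfying $(M_j)_B^-(C^\Diamond\xi_j)\le\sup_{|\eta_j|=1}(M_j)_B^-(\eta_j\vartheta(r))$, there holds $(M_j)_B^+(\xi_j)\le(M_j)_B^-(C^\Diamond\xi_j)+1$. (The choice $K=1$ is allowed.) Function spaces. $L_M(\Omega;\mathbb{R}^n)$ is the smallest linear space containing all measurable $\xi:\Omega\to\mathbb{R}^n$ with $\int_\Omega M(x,\xi(x))\,dx<\infty$, equipped with the Luxemburg norm $\|\xi\|_{L_M}=\inf\{\lambda>0:\int_\Omega M(x,\xi(x)/\lambda)\,dx\le1\}$. $E_M(\Omega;\mathbb{R}^n)$ is the closure in this norm of the set of bounded functions (equivalently, the set of measurable $\xi$ with $\int_\Omega M(x,\xi(x)/\lambda)\,dx<\infty$ for every $\lambda>0$). $V^1E_M(\Omega)=\{f\in W^{1,1}(\Omega):\nabla f\in E_M(\Omega;\mathbb{R}^n)\}$ and $V^1_0E_M(\Omega)=\{f\in W^{1,1}_0(\Omega):\nabla f\in E_M(\Omega;\mathbb{R}^n)\}$. For $\gamma\in(0,1]$, $h\in C^{0,\gamma}(\Omega)$ means $\sup_{x\ne y\in\Omega}|h(x)-h(y)|/|x-y|^\gamma<\infty$. *)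

theory Defs
  imports "HOL-Analysis.Analysis" "HOL-Probability.Essential_Supremum"
begin

section \<open>Lipschitz domains\<close>

text \<open>Near every boundary point, up to a rotation, the set is the part of a ball lying strictly
  above the graph of a Lipschitz function. The direction \<open>e\<close> is the vertical axis and
  \<open>x - (x \<bullet> e) *\<^sub>R e\<close> is the horizontal component of \<open>x\<close>.\<close>

definition lipschitz_domain :: "'a::euclidean_space set \<Rightarrow> bool" where
  "lipschitz_domain \<Omega> \<longleftrightarrow> open \<Omega> \<and> connected \<Omega> \<and> \<Omega> \<noteq> {} \<and>
     (\<forall>p\<in>frontier \<Omega>. \<exists>r>0. \<exists>e \<phi> C. norm e = 1 \<and> lipschitz_on C {y. y \<bullet> e = 0} \<phi> \<and>
        \<Omega> \<inter> ball p r = {x \<in> ball p r. \<phi> (x - (x \<bullet> e) *\<^sub>R e) < x \<bullet> e})"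


section \<open>Weak N-functions\<close>

text \<open>The second argument ranges over a linear subspace \<open>V\<close> of the ambient Euclidean space. The
  choice \<open>V = UNIV\<close> gives functions on the whole space, and coordinate subspaces play the role of
  the factors in a decomposition of the ambient space as a product.\<close>

definition weak_N_function ::
  "'a::euclidean_space set \<Rightarrow> 'b::euclidean_space set \<Rightarrow> ('a \<Rightarrow> 'b \<Rightarrow> real) \<Rightarrow> bool" where
  "weak_N_function \<Omega> V N \<longleftrightarrow>
     (\<forall>x\<in>\<Omega>. \<forall>\<xi>\<in>V. 0 \<le> N x \<xi>) \<and>
     (\<forall>\<xi>\<in>V. (\<lambda>x. N x \<xi>) \<in> borel_measurable (lebesgue_on \<Omega>)) \<and>
     (\<forall>x\<in>\<Omega>. continuous_on V (N x)) \<and>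
     (AE x in lebesgue_on \<Omega>. N x 0 = 0 \<and> convex_on V (N x)) \<and>
     (AE x in lebesgue_on \<Omega>. \<forall>\<xi>\<in>V. N x \<xi> = N x (- \<xi>)) \<and>
     (\<exists>m1 m2 :: real \<Rightarrow> real.
        convex_on {0..} m1 \<and> convex_on {0..} m2 \<and>
        (\<forall>s\<ge>0. 0 \<le> m1 s) \<and> (\<forall>s\<ge>0. 0 \<le> m2 s) \<and>
        m1 0 = 0 \<and> (\<forall>s>0. 0 < m1 s) \<and>
        (AE x in lebesgue_on \<Omega>. \<forall>\<xi>\<in>V. m1 (norm \<xi>) \<le> N x \<xi> \<and> N x \<xi> \<le> m2 (norm \<xi>)))"

text \<open>Essential bounds over \<open>B \<inter> \<Omega>\<close> are taken in the extended reals, so that a ball missing \<open>\<Omega>\<close>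
  gives the conventional values \<open>\<infinity>\<close> and \<open>-\<infinity>\<close>.\<close>

definition N_plus :: "'a::euclidean_space set \<Rightarrow> ('a \<Rightarrow> 'b \<Rightarrow> real) \<Rightarrow> 'a set \<Rightarrow> 'b \<Rightarrow> ereal" where
  "N_plus \<Omega> N B \<xi> = esssup (lebesgue_on (B \<inter> \<Omega>)) (\<lambda>y. ereal (N y \<xi>))"

definition N_minus :: "'a::euclidean_space set \<Rightarrow> ('a \<Rightarrow> 'b \<Rightarrow> real) \<Rightarrow> 'a set \<Rightarrow> 'b \<Rightarrow> ereal" where
  "N_minus \<Omega> N B \<xi> = - esssup (lebesgue_on (B \<inter> \<Omega>)) (\<lambda>y. - ereal (N y \<xi>))"


section \<open>The balance condition\<close>

text \<open>A decomposition of the coordinate space into \<open>K\<close> factors of positive dimension is given by a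
  map \<open>b\<close> from the coordinate indices onto \<open>{..<K}\<close>: the \<open>j\<close>-th factor is embedded as the
  subspace of vectors supported on the coordinates \<open>i\<close> with \<open>b i = j\<close>, and \<open>block_proj b j \<xi>\<close> is
  the embedded component \<open>\<xi>\<^sub>j\<close> of \<open>\<xi>\<close>.\<close>

definition block_space :: "('n::finite \<Rightarrow> nat) \<Rightarrow> nat \<Rightarrow> (real^'n) set" where
  "block_space b j = {\<xi>. \<forall>i. b i \<noteq> j \<longrightarrow> \<xi> $ i = 0}"

definition block_proj :: "('n::finite \<Rightarrow> nat) \<Rightarrow> nat \<Rightarrow> real^'n \<Rightarrow> real^'n" where
  "block_proj b j \<xi> = (\<chi> i. if b i = j then \<xi> $ i else 0)"

definition cond_B_gen_plus ::
  "real \<Rightarrow> (real^'n::finite) set \<Rightarrow> (real^'n \<Rightarrow> real^'n \<Rightarrow> real) \<Rightarrow> bool" where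
  "cond_B_gen_plus \<gamma> \<Omega> M \<longleftrightarrow>
     (\<exists>(K::nat) (b :: 'n \<Rightarrow> nat) (Mj :: nat \<Rightarrow> real^'n \<Rightarrow> real^'n \<Rightarrow> real).
        K \<ge> 1 \<and> range b = {..<K} \<and>
        (\<forall>j<K. weak_N_function \<Omega> (block_space b j) (Mj j)) \<and>
        (\<forall>x\<in>\<Omega>. \<forall>\<xi>. M x \<xi> = (\<Sum>j<K. Mj j x (block_proj b j \<xi>))) \<and>
        (\<exists>(C::real) (\<theta>::real \<Rightarrow> real).
           C > 1 \<and> (\<forall>r\<in>{0<..1}. \<theta> r > 0) \<and>
           ((\<lambda>r. 1 / (\<theta> r * r powr (1 - \<gamma>))) \<longlongrightarrow> 0) (at_right 0) \<and>
           (\<forall>c. \<forall>r\<in>{0<..1}. \<forall>j<K. \<forall>\<xi>\<in>block_space b j.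
              N_minus \<Omega> (Mj j) (ball c r) (C *\<^sub>R \<xi>)
                \<le> (SUP \<eta>\<in>{\<eta> \<in> block_space b j. norm \<eta> = 1}.
                     N_minus \<Omega> (Mj j) (ball c r) (\<theta> r *\<^sub>R \<eta>)) \<longrightarrow>
              N_plus \<Omega> (Mj j) (ball c r) \<xi> \<le> N_minus \<Omega> (Mj j) (ball c r) (C *\<^sub>R \<xi>) + 1)))"


section \<open>Test functions, weak gradients and Sobolev spaces\<close>

primrec C_k :: "nat \<Rightarrow> ('a::euclidean_space \<Rightarrow> real) \<Rightarrow> bool" where
  "C_k 0 f \<longleftrightarrow> continuous_on UNIV f"
| "C_k (Suc k) f \<longleftrightarrow> (\<forall>x. f differentiable (at x)) \<and>
     (\<forall>e\<in>Basis. C_k k (\<lambda>x. frechet_derivative f (at x) e))"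

definition test_functions :: "'a::euclidean_space set \<Rightarrow> ('a \<Rightarrow> real) set" where
  "test_functions \<Omega> = {\<phi>. (\<forall>k. C_k k \<phi>) \<and>
     compact (closure {x. \<phi> x \<noteq> 0}) \<and> closure {x. \<phi> x \<noteq> 0} \<subseteq> \<Omega>}"

text \<open>Functions on \<open>\<Omega>\<close> are represented by total functions of which only the restriction to \<open>\<Omega>\<close> is
  relevant.\<close>

definition locally_integrable ::
  "'a::euclidean_space set \<Rightarrow> ('a \<Rightarrow> 'b::euclidean_space) \<Rightarrow> bool" where
  "locally_integrable \<Omega> f \<longleftrightarrow> (\<forall>K. compact K \<and> K \<subseteq> \<Omega> \<longrightarrow> integrable (lebesgue_on K) f)"

definition has_weak_gradient ::
  "'a::euclidean_space set \<Rightarrow> ('a \<Rightarrow> real) \<Rightarrow> ('a \<Rightarrow> 'a) \<Rightarrow> bool" where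
  "has_weak_gradient \<Omega> f g \<longleftrightarrow> locally_integrable \<Omega> f \<and> locally_integrable \<Omega> g \<and>
     (\<forall>\<phi>\<in>test_functions \<Omega>. \<forall>e\<in>Basis.
        (LINT x|lebesgue_on \<Omega>. f x * frechet_derivative \<phi> (at x) e)
          = - (LINT x|lebesgue_on \<Omega>. (g x \<bullet> e) * \<phi> x))"

text \<open>The weak gradient is unique only up to null sets; the choice of representative is immaterial
  below.\<close>

definition weak_gradient :: "'a::euclidean_space set \<Rightarrow> ('a \<Rightarrow> real) \<Rightarrow> 'a \<Rightarrow> 'a" where
  "weak_gradient \<Omega> f = (SOME g. has_weak_gradient \<Omega> f g)"

definition W11 :: "'a::euclidean_space set \<Rightarrow> ('a \<Rightarrow> real) set" where
  "W11 \<Omega> = {f. integrable (lebesgue_on \<Omega>) f \<and>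
     (\<exists>g. has_weak_gradient \<Omega> f g \<and> integrable (lebesgue_on \<Omega>) g)}"

definition W11_norm :: "'a::euclidean_space set \<Rightarrow> ('a \<Rightarrow> real) \<Rightarrow> real" where
  "W11_norm \<Omega> f = (LINT x|lebesgue_on \<Omega>. \<bar>f x\<bar>) + (LINT x|lebesgue_on \<Omega>. norm (weak_gradient \<Omega> f x))"

text \<open>The closure of the test functions in the Sobolev norm.\<close>

definition W11_0 :: "'a::euclidean_space set \<Rightarrow> ('a \<Rightarrow> real) set" where
  "W11_0 \<Omega> = {f \<in> W11 \<Omega>. \<forall>\<epsilon>>0. \<exists>\<phi>\<in>test_functions \<Omega>. W11_norm \<Omega> (\<lambda>x. f x - \<phi> x) < \<epsilon>}"

definition holder_space :: "real \<Rightarrow> 'a::euclidean_space set \<Rightarrow> ('a \<Rightarrow> real) set" where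
  "holder_space \<gamma> \<Omega> =
     {h. bdd_above {\<bar>h x - h y\<bar> / dist x y powr \<gamma> | x y. x \<in> \<Omega> \<and> y \<in> \<Omega> \<and> x \<noteq> y}}"


section \<open>Musielak--Orlicz spaces\<close>

definition modular ::
  "'a::euclidean_space set \<Rightarrow> ('a \<Rightarrow> 'b::euclidean_space \<Rightarrow> real) \<Rightarrow> ('a \<Rightarrow> 'b) \<Rightarrow> ennreal" where
  "modular \<Omega> M \<xi> = (\<integral>\<^sup>+x. ennreal (M x (\<xi> x)) \<partial>lebesgue_on \<Omega>)"

definition is_linear_space :: "('a \<Rightarrow> 'b::real_vector) set \<Rightarrow> bool" where
  "is_linear_space S \<longleftrightarrow> (\<lambda>x. 0) \<in> S \<and> (\<forall>f\<in>S. \<forall>g\<in>S. (\<lambda>x. f x + g x) \<in> S) \<and>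
     (\<forall>c. \<forall>f\<in>S. (\<lambda>x. c *\<^sub>R f x) \<in> S)"

definition L_space ::
  "'a::euclidean_space set \<Rightarrow> ('a \<Rightarrow> 'b::euclidean_space \<Rightarrow> real) \<Rightarrow> ('a \<Rightarrow> 'b) set" where
  "L_space \<Omega> M = \<Inter>{S. is_linear_space S \<and>
     {\<xi> \<in> borel_measurable (lebesgue_on \<Omega>). modular \<Omega> M \<xi> < \<infinity>} \<subseteq> S}"

definition luxemburg_norm ::
  "'a::euclidean_space set \<Rightarrow> ('a \<Rightarrow> 'b::euclidean_space \<Rightarrow> real) \<Rightarrow> ('a \<Rightarrow> 'b) \<Rightarrow> real" where
  "luxemburg_norm \<Omega> M \<xi> = Inf {l. l > 0 \<and> modular \<Omega> M (\<lambda>x. \<xi> x /\<^sub>R l) \<le> 1}"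

text \<open>The closure of the bounded functions in the Luxemburg norm.\<close>

definition E_space ::
  "'a::euclidean_space set \<Rightarrow> ('a \<Rightarrow> 'b::euclidean_space \<Rightarrow> real) \<Rightarrow> ('a \<Rightarrow> 'b) set" where
  "E_space \<Omega> M = {\<xi> \<in> L_space \<Omega> M. \<forall>\<epsilon>>0. \<exists>\<zeta>\<in>L_space \<Omega> M.
     bounded (\<zeta> ` \<Omega>) \<and> luxemburg_norm \<Omega> M (\<lambda>x. \<xi> x - \<zeta> x) < \<epsilon>}"

definition V1E :: "'a::euclidean_space set \<Rightarrow> ('a \<Rightarrow> 'a \<Rightarrow> real) \<Rightarrow> ('a \<Rightarrow> real) set" where
  "V1E \<Omega> M = {f \<in> W11 \<Omega>. weak_gradient \<Omega> f \<in> E_space \<Omega> M}"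

definition V1E_0 :: "'a::euclidean_space set \<Rightarrow> ('a \<Rightarrow> 'a \<Rightarrow> real) \<Rightarrow> ('a \<Rightarrow> real) set" where
  "V1E_0 \<Omega> M = {f \<in> W11_0 \<Omega>. weak_gradient \<Omega> f \<in> E_space \<Omega> M}"


section \<open>The functional\<close>

text \<open>The value is the Lebesgue integral of the integrand in the extended reals, as the difference
  of the integrals of its positive and negative parts. For an integrand bounded below by a
  nonnegative function the second integral vanishes.\<close>

definition energy ::
  "'a::euclidean_space set \<Rightarrow> ('a \<Rightarrow> real \<Rightarrow> 'a \<Rightarrow> real) \<Rightarrow> ('a \<Rightarrow> real) \<Rightarrow> ereal" where
  "energy \<Omega> F u =
     enn2ereal (\<integral>\<^sup>+x. ennreal (F x (u x) (weak_gradient \<Omega> u x)) \<partial>lebesgue_on \<Omega>)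
       - enn2ereal (\<integral>\<^sup>+x. ennreal (- F x (u x) (weak_gradient \<Omega> u x)) \<partial>lebesgue_on \<Omega>)"

definition translate :: "('a \<Rightarrow> real) \<Rightarrow> ('a \<Rightarrow> real) set \<Rightarrow> ('a \<Rightarrow> real) set" where
  "translate u A = (\<lambda>v x. u x + v x) ` A"

end

theory Submission
  imports Defs
begin

text \<open>
  Test functions are admissible in both problems, so the infimum over them is the larger one. For
  the other inequality a competitor \<open>u0 + v\<close> has to be reached by functions \<open>u0 + \<phi>\<^sub>n\<close>, with test
  functions \<open>\<phi>\<^sub>n\<close>, in such a way that the energies converge. If \<open>\<phi>\<^sub>n \<rightarrow> v\<close> and \<open>\<nabla>\<phi>\<^sub>n \<rightarrow> \<nabla>v\<close> in \<open>L\<^sup>1\<close>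
  and the modular of \<open>2 (\<nabla>\<phi>\<^sub>n - \<nabla>v)\<close> tends to \<open>0\<close>, then convexity of \<open>M\<close> bounds the integrands
  \<open>F(x, u0 + \<phi>\<^sub>n, \<nabla>u0 + \<nabla>\<phi>\<^sub>n)\<close> by a fixed integrable function plus an error that vanishes in \<open>L\<^sup>1\<close>, and
  dominated convergence gives the limit (\<open>energy_recovery\<close>). The theorem thus reduces to the modular
  density of test functions, which is the predicate \<open>approximable\<close>.

  The approximants are mollifications of the extension \<open>w\<close> of \<open>v\<close> by zero. Since \<open>v\<close> has zero
  boundary values, the extension by zero \<open>g\<close> of its gradient is the gradient of \<open>w\<close> on the whole
  space (\<open>W11_0_extension\<close>). Near a boundary point the domain lies above a Lipschitz graph. A
  kernel that is supported in a small ball off the origin, in the direction into the domain, smooths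
  and at the same time shifts the support of \<open>w\<close> into a compact part of the domain. Convergence in
  \<open>L\<^sup>1\<close> is then automatic, and what remains is to dominate \<open>M(x, (k * g)(x))\<close> for a kernel \<open>k\<close> of
  radius \<open>\<delta>\<close>.

  Here the balance condition enters. Moving the derivative from \<open>w\<close> to the kernel and using that \<open>w\<close>
  is Hoelder continuous with exponent \<open>\<gamma>\<close> shows that \<open>k * g\<close> is of order \<open>\<delta>\<close> to the power \<open>\<gamma> - 1\<close>
  (\<open>conv_grad_bound\<close>), hence small compared with \<open>\<theta> \<delta>\<close>. The balance condition compares \<open>M(x, \<cdot>)\<close>
  with \<open>M(y, \<cdot>)\<close> only for arguments up to size \<open>\<theta> \<delta>\<close>, while \<open>g\<close> is unbounded. But the tangent to
  \<open>M(x, \<cdot>)\<close> at a point well inside this range lies below \<open>4 M(y, C \<cdot>) + 4\<close> everywhere: inside the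
  range by the condition, outside because along rays from \<open>0\<close> an affine function grows linearly and a
  convex function that vanishes at \<open>0\<close> at least linearly (\<open>tangent_minorant\<close>). Jensen's inequality with this tangent bounds \<open>M(x, (k * g)(x))\<close> by a multiple
  of the mollification of \<open>M(\<cdot>, C g)\<close> plus a constant (\<open>averaged_bound\<close>), and that mollification
  converges in \<open>L\<^sup>1\<close>.

  The global statement follows by splitting \<open>w\<close> with cut-off functions subordinate to a finite cover
  (\<open>approximable_cover\<close>). For \<open>\<gamma> = 0\<close> the Hoelder condition means bounded oscillation, which is
  achieved by truncating \<open>w\<close> (\<open>approximable_unbounded\<close>). For \<open>\<gamma> > 0\<close> the function \<open>v\<close> is Hoelder
  continuous in the domain only, and its zero extension is Hoelder continuous because a function with
  zero boundary values cannot jump across the boundary (\<open>no_positive_trace\<close>, \<open>holder_zero_extension\<close>).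
\<close>

section \<open>Smooth functions and bumps\<close>

text \<open>Cut-offs and compositions are needed with continuous derivatives only. Infinite
  differentiability is produced once, by the mollification at the end.\<close>

definition C1_grad :: "('a::euclidean_space \<Rightarrow> real) \<Rightarrow> ('a \<Rightarrow> 'a) \<Rightarrow> bool" where
  "C1_grad f f' \<longleftrightarrow> (\<forall>x. (f has_derivative (\<lambda>h. f' x \<bullet> h)) (at x)) \<and> continuous_on UNIV f'"

definition C1c :: "('a::euclidean_space \<Rightarrow> real) \<Rightarrow> ('a \<Rightarrow> 'a) \<Rightarrow> bool" where
  "C1c f f' \<longleftrightarrow> C1_grad f f' \<and> bounded {x. f x \<noteq> 0}"

definition grad :: "('a::euclidean_space \<Rightarrow> real) \<Rightarrow> 'a \<Rightarrow> 'a" where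
  "grad f x = (\<Sum>e\<in>Basis. frechet_derivative f (at x) e *\<^sub>R e)"

definition smooth :: "('a::euclidean_space \<Rightarrow> real) \<Rightarrow> bool" where
  "smooth f \<longleftrightarrow> (\<forall>k. C_k k f)"

text \<open>Iterated partial derivatives need not be computed: it is enough to exhibit a class of
  differentiable functions that contains the partial derivatives of its members.\<close>

lemma smooth_coinduct:
  assumes "P f"
    and step: "\<And>f. P f \<Longrightarrow> \<exists>D. (\<forall>x. (f has_derivative D x) (at x)) \<and> (\<forall>e\<in>Basis. P (\<lambda>x. D x e))"
  shows "smooth f"
proof -
  have "C_k k f" if "P f" for k f
    using that
  proof (induction k arbitrary: f)
    case 0
    then obtain D where D: "\<And>x. (f has_derivative D x) (at x)" using step by blast
    then show ?case
      by (auto intro!: continuous_at_imp_continuous_on has_derivative_continuous)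
  next
    case (Suc k)
    then obtain D where D: "\<And>x. (f has_derivative D x) (at x)" "\<forall>e\<in>Basis. P (\<lambda>x. D x e)"
      using step by blast
    have "(\<lambda>x. frechet_derivative f (at x) e) = (\<lambda>x. D x e)" for e
      using frechet_derivative_at[OF D(1)] by simp
    then show ?case using D Suc.IH by (auto simp: differentiable_def)
  qed
  then show ?thesis using assms(1) by (simp add: smooth_def)
qed

lemma smooth_D:
  assumes "smooth f"
  shows "(f has_derivative frechet_derivative f (at x)) (at x)"
    and "e \<in> Basis \<Longrightarrow> smooth (\<lambda>x. frechet_derivative f (at x) e)"
proof -
  have "C_k (Suc k) f" for k using assms by (simp add: smooth_def)
  then show "(f has_derivative frechet_derivative f (at x)) (at x)"
    and "e \<in> Basis \<Longrightarrow> smooth (\<lambda>x. frechet_derivative f (at x) e)"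
    by (auto simp: smooth_def frechet_derivative_works)
qed

lemma smooth_continuous: "smooth f \<Longrightarrow> continuous_on S f"
  by (metis smooth_D(1) has_derivative_continuous continuous_at_imp_continuous_on)

lemma grad_inner:
  assumes "linear (frechet_derivative f (at x))"
  shows "grad f x \<bullet> h = frechet_derivative f (at x) h"
proof -
  have "frechet_derivative f (at x) h = frechet_derivative f (at x) (\<Sum>e\<in>Basis. (h \<bullet> e) *\<^sub>R e)"
    by (simp add: euclidean_representation)
  also have "\<dots> = (\<Sum>e\<in>Basis. (h \<bullet> e) * frechet_derivative f (at x) e)"
    using assms by (simp add: linear_sum linear_cmul)
  finally show ?thesis
    by (simp add: grad_def inner_sum_left) (simp add: inner_commute mult.commute)
qed

lemma C1_grad_unique:
  assumes "C1_grad f f'" shows "grad f x = f' x" "frechet_derivative f (at x) h = f' x \<bullet> h"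
proof -
  have "frechet_derivative f (at x) = (\<lambda>h. f' x \<bullet> h)"
    using assms frechet_derivative_at unfolding C1_grad_def by metis
  then show "grad f x = f' x" "frechet_derivative f (at x) h = f' x \<bullet> h"
    by (auto simp: grad_def euclidean_representation)
qed

lemma smooth_C1_grad: assumes "smooth f" shows "C1_grad f (grad f)"
  unfolding C1_grad_def
proof safe
  fix x
  have "linear (frechet_derivative f (at x))"
    using smooth_D(1)[OF assms] has_derivative_linear by blast
  then show "(f has_derivative (\<bullet>) (grad f x)) (at x)"
    using smooth_D(1)[OF assms, of x] by (subst ext[OF grad_inner[of f x]])
  show "continuous_on UNIV (grad f)"
    unfolding grad_def[abs_def] using smooth_continuous smooth_D(2)[OF assms]
    by (intro continuous_intros) blast
qed

lemma smooth_add: assumes "smooth f" "smooth g" shows "smooth (\<lambda>x. f x + g x)"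
proof (rule smooth_coinduct[where P="\<lambda>h. \<exists>f g. smooth f \<and> smooth g \<and> h = (\<lambda>x. f x + g x)"])
  fix h assume "\<exists>f g. smooth f \<and> smooth g \<and> h = (\<lambda>x. f x + g x)"
  then obtain f g where fg: "smooth f" "smooth g" "h = (\<lambda>x. f x + g x)" by blast
  show "\<exists>D. (\<forall>x. (h has_derivative D x) (at x)) \<and>
     (\<forall>e\<in>Basis. \<exists>f g. smooth f \<and> smooth g \<and> (\<lambda>x. D x e) = (\<lambda>x. f x + g x))"
    using smooth_D[OF fg(1)] smooth_D[OF fg(2)]
    by (intro exI[of _ "\<lambda>x e. frechet_derivative f (at x) e + frechet_derivative g (at x) e"] conjI)
      (auto simp: fg(3) intro: has_derivative_add, blast)
qed (use assms in blast)

lemma smooth_affine: assumes "smooth f" shows "smooth (\<lambda>x. c * f (s *\<^sub>R (x - a)))"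
proof (rule smooth_coinduct[where P="\<lambda>h. \<exists>f c. smooth f \<and> h = (\<lambda>x. c * f (s *\<^sub>R (x - a)))"])
  fix h assume "\<exists>f c. smooth f \<and> h = (\<lambda>x. c * f (s *\<^sub>R (x - a)))"
  then obtain f c where fg: "smooth f" "h = (\<lambda>x. c * f (s *\<^sub>R (x - a)))" by blast
  have *: "((\<lambda>x. f (s *\<^sub>R (x - a))) has_derivative
      (\<lambda>e. frechet_derivative f (at (s *\<^sub>R (x - a))) (s *\<^sub>R e))) (at x)" for x
    by (rule has_derivative_compose[of "\<lambda>x. s *\<^sub>R (x - a)", OF _ smooth_D(1)[OF fg(1)]])
      (auto intro!: derivative_eq_intros)
  have "\<forall>x. (h has_derivative (\<lambda>e. (c * s) * frechet_derivative f (at (s *\<^sub>R (x - a))) e)) (at x)"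
    unfolding fg(2)
  proof
    fix x
    have "linear (frechet_derivative f (at (s *\<^sub>R (x - a))))"
      using smooth_D(1)[OF fg(1)] has_derivative_linear by blast
    then show "((\<lambda>x. c * f (s *\<^sub>R (x - a))) has_derivative
       (\<lambda>e. (c * s) * frechet_derivative f (at (s *\<^sub>R (x - a))) e)) (at x)"
      using has_derivative_mult_right[OF *[of x], of c] by (simp add: linear_cmul mult.assoc)
  qed
  then show "\<exists>D. (\<forall>x. (h has_derivative D x) (at x)) \<and>
     (\<forall>e\<in>Basis. \<exists>f c. smooth f \<and> (\<lambda>x. D x e) = (\<lambda>x. c * f (s *\<^sub>R (x - a))))"
    using smooth_D(2)[OF fg(1)] by (intro exI conjI) (assumption, blast)
qed (use assms in blast)

text \<open>The derivatives of the classical flat function \<open>exp (- 1 / t)\<close> are combinations of its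
  quotients by powers of \<open>t\<close>, so all exponents \<open>m\<close> are treated at once.\<close>

definition flat_exp :: "nat \<Rightarrow> real \<Rightarrow> real" where
  "flat_exp m t = (if t \<le> 0 then 0 else exp (- 1 / t) / t ^ m)"

text \<open>The exponential series dominates the power \<open>n = m + 2\<close> of \<open>1 / t\<close>. A quadratic bound is what
  makes the derivative at \<open>0\<close> vanish.\<close>

lemma flat_exp_bound: "\<bar>flat_exp m t\<bar> \<le> real (m + 2) ^ (m + 2) * t\<^sup>2"
proof (cases "t \<le> 0")
  case False
  then have t: "t > 0" by simp
  define n where "n = m + 2"
  have "(1 / (real n * t)) ^ n \<le> (1 + (1/t) / real n) ^ n"
    using t by (intro power_mono) (auto simp: n_def field_simps)
  also have "\<dots> \<le> exp (1/t)"
    by (rule exp_ge_one_plus_x_over_n_power_n)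
      (use t in \<open>auto simp: n_def intro: order_trans[of _ 0]\<close>)
  finally have "1 / exp (1/t) \<le> 1 / (1 / (real n * t)) ^ n"
    using t by (intro divide_left_mono) (auto simp: n_def)
  then have *: "1 / exp (1/t) \<le> (real n * t) ^ n"
    by (simp add: power_divide)
  have "flat_exp m t = (1 / exp (1/t)) / t ^ m"
    using t by (simp add: flat_exp_def exp_minus inverse_eq_divide)
  also have "\<dots> \<le> (real n * t) ^ n / t ^ m"
    using * t by (intro divide_right_mono) auto
  also have "\<dots> = real n ^ n * t\<^sup>2"
    using t by (simp add: n_def power_mult_distrib power_add power2_eq_square)
  finally show ?thesis using t by (simp add: flat_exp_def n_def)
qed (simp add: flat_exp_def)

lemma flat_exp_deriv:
  "(flat_exp m has_real_derivative (flat_exp (m + 2) t - real m * flat_exp (m + 1) t)) (at t)"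
proof -
  consider "t < 0" | "t = 0" | "t > 0" by linarith
  then show ?thesis
  proof cases
    case 1
    have "((\<lambda>_. 0::real) has_real_derivative 0) (at t)" by simp
    moreover have "eventually (\<lambda>x. (0::real) = flat_exp m x) (nhds t)"
      using eventually_nhds_in_open[of "{..<0}" t] 1 by (auto simp: flat_exp_def elim!: eventually_mono)
    ultimately have "(flat_exp m has_real_derivative 0) (at t)"
      using DERIV_cong_ev[of t t "\<lambda>_. 0" "flat_exp m" 0 0] by simp
    then show ?thesis using 1 by (simp add: flat_exp_def)
  next
    case 2
    have "((\<lambda>h. flat_exp m h / h) \<longlongrightarrow> 0) (at 0)"
    proof (rule Lim_null_comparison)
      show "((\<lambda>h. real (m + 2) ^ (m + 2) * \<bar>h\<bar>) \<longlongrightarrow> 0) (at 0)"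
        by (auto intro!: tendsto_eq_intros)
      have "norm (flat_exp m h / h) \<le> real (m + 2) ^ (m + 2) * \<bar>h\<bar>" if "h \<noteq> 0" for h
        using flat_exp_bound[of m h] that
        by (simp add: divide_le_eq power2_eq_square abs_mult[symmetric] mult.assoc)
      then show "\<forall>\<^sub>F h in at 0. norm (flat_exp m h / h) \<le> real (m + 2) ^ (m + 2) * \<bar>h\<bar>"
        by (simp add: eventually_at_filter)
    qed
    then have "(flat_exp m has_real_derivative 0) (at 0)"
      by (simp add: DERIV_def flat_exp_def[of m 0])
    then show ?thesis using 2 by (simp add: flat_exp_def)
  next
    case 3
    have "((\<lambda>x. exp (- 1 / x) / x ^ m) has_real_derivative
        (exp (- 1 / t) / t ^ (m+2) - real m * (exp (- 1 / t) / t ^ (m+1)))) (at t)"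
    proof (cases m)
      case 0
      then show ?thesis using 3 
        by (auto intro!: derivative_eq_intros simp: power2_eq_square field_simps)
    next
      case (Suc k)
      have "((\<lambda>x. exp (- 1 / x) / x ^ m) has_real_derivative
        ((exp (- 1 / t) * (1 / t^2)) * t ^ m - exp (- 1 / t) * (real m * t ^ (m - 1))) / (t ^ m * t ^ m)) (at t)"
        using 3 by (auto intro!: derivative_eq_intros simp: power2_eq_square)
      also have "((exp (- 1 / t) * (1 / t^2)) * t ^ m - exp (- 1 / t) * (real m * t ^ (m - 1))) / (t ^ m * t ^ m)
        = (exp (- 1 / t) / t ^ (m+2) - real m * (exp (- 1 / t) / t ^ (m+1)))"
        using 3 by (simp add: Suc field_simps power2_eq_square)
      finally show ?thesis .
    qed
    moreover have "eventually (\<lambda>x. exp (- 1 / x) / x ^ m = flat_exp m x) (nhds t)"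
      using eventually_nhds_in_open[of "{0<..}" t] 3 by (auto simp: flat_exp_def elim!: eventually_mono)
    ultimately have "(flat_exp m has_real_derivative (exp (- 1 / t) / t ^ (m+2) - real m * (exp (- 1 / t) / t ^ (m+1)))) (at t)"
      using DERIV_cong_ev[of t t "\<lambda>x. exp (- 1 / x) / x ^ m" "flat_exp m"] by simp
    then show ?thesis using 3 by (simp add: flat_exp_def)
  qed
qed

text \<open>A class that contains the standard bump and is closed under partial derivatives, as the
  coinduction principle for smoothness requires.\<close>

inductive bump_class :: "('a::euclidean_space \<Rightarrow> real) \<Rightarrow> bool" where
  base: "bump_class (\<lambda>x. flat_exp m (1 - x \<bullet> x))"
| coord: "bump_class f \<Longrightarrow> bump_class (\<lambda>x. (x \<bullet> e) * f x)"
| scale: "bump_class f \<Longrightarrow> bump_class (\<lambda>x. c * f x)"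
| add: "bump_class f \<Longrightarrow> bump_class g \<Longrightarrow> bump_class (\<lambda>x. f x + g x)"

lemma bump_class_deriv:
  assumes "bump_class f"
  shows "\<exists>D. (\<forall>x. (f has_derivative D x) (at x)) \<and> (\<forall>e. bump_class (\<lambda>x. D x e))"
  using assms
proof induction
  case (base m)
  let ?D = "\<lambda>x h. (- 2 * (x \<bullet> h)) * (flat_exp (m + 2) (1 - x \<bullet> x) - real m * flat_exp (m + 1) (1 - x \<bullet> x))"
  have "((\<lambda>x. flat_exp m (1 - x \<bullet> x)) has_derivative ?D x) (at x)" for x :: 'a
    by (rule DERIV_compose_FDERIV[OF flat_exp_deriv])
      (auto intro!: derivative_eq_intros simp: inner_commute)
  moreover have "bump_class (\<lambda>x. ?D x e)" for e :: 'a
  proof -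
    have "bump_class (\<lambda>x. (-2) * ((x \<bullet> e) * (flat_exp (m + 2) (1 - x \<bullet> x) + (- real m) * flat_exp (m + 1) (1 - x \<bullet> x))))"
      by (intro bump_class.intros)
    then show ?thesis by (simp add: mult.assoc)
  qed
  ultimately show ?case by (intro exI[of _ ?D]) blast
next
  case (coord f e)
  then obtain D where D: "\<And>x. (f has_derivative D x) (at x)" "\<And>e. bump_class (\<lambda>x. D x e)" by blast
  have "((\<lambda>x. (x \<bullet> e) * f x) has_derivative (\<lambda>h. (x \<bullet> e) * D x h + (h \<bullet> e) * f x)) (at x)" for x
    by (auto intro!: derivative_eq_intros D)
  moreover have "bump_class (\<lambda>x. (x \<bullet> e) * D x h + (h \<bullet> e) * f x)" for h
    by (intro bump_class.intros D coord)
  ultimately show ?case by (intro exI[of _ "\<lambda>x h. (x \<bullet> e) * D x h + (h \<bullet> e) * f x"]) auto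
next
  case (scale f c)
  then obtain D where D: "\<And>x. (f has_derivative D x) (at x)" "\<And>e. bump_class (\<lambda>x. D x e)" by blast
  then show ?case
    by (intro exI[of _ "\<lambda>x h. c * D x h"]) (auto intro!: derivative_eq_intros bump_class.intros)
next
  case (add f g)
  then obtain D E where D: "\<And>x. (f has_derivative D x) (at x)" "\<And>e. bump_class (\<lambda>x. D x e)"
    and E: "\<And>x. (g has_derivative E x) (at x)" "\<And>e. bump_class (\<lambda>x. E x e)" by blast
  then show ?case
    by (intro exI[of _ "\<lambda>x h. D x h + E x h"]) (auto intro!: derivative_eq_intros bump_class.intros)
qed

definition bump :: "'a::euclidean_space \<Rightarrow> real" where
  "bump x = flat_exp 0 (1 - x \<bullet> x)"

lemma smooth_bump: "smooth bump"
proof (rule smooth_coinduct[where P=bump_class])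
  show "bump_class bump" using bump_class.base[of 0] by (simp add: bump_def[abs_def])
qed (use bump_class_deriv in blast)

lemma bump_nonneg: "bump x \<ge> 0"
  by (simp add: bump_def flat_exp_def)

lemma bump_pos_iff: "bump x \<noteq> 0 \<longleftrightarrow> norm x < 1"
proof -
  have "bump x \<noteq> 0 \<longleftrightarrow> x \<bullet> x < 1" by (auto simp: bump_def flat_exp_def)
  also have "\<dots> \<longleftrightarrow> norm x < 1"
    by (metis norm_eq_sqrt_inner real_sqrt_lt_1_iff)
  finally show ?thesis .
qed

lemma C1c_zero_outside:
  assumes "C1c f f'" "x \<notin> closure {x. f x \<noteq> 0}"
  shows "f x = 0" "f' x = 0"
proof -
  have sub: "{x. f x \<noteq> 0} \<subseteq> closure {x. f x \<noteq> 0}" by (rule closure_subset)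
  show "f x = 0" using assms(2) sub by auto
  have "(f has_derivative (\<lambda>h. f' x \<bullet> h)) (at x)"
    using assms(1) by (simp add: C1c_def C1_grad_def)
  moreover have "(f has_derivative (\<lambda>h. 0)) (at x)"
  proof (rule has_derivative_transform_within_open[OF has_derivative_const])
    show "open (- closure {x. f x \<noteq> 0})" by auto
    show "x \<in> - closure {x. f x \<noteq> 0}" using assms(2) by simp
    show "\<And>y. y \<in> - closure {x. f x \<noteq> 0} \<Longrightarrow> 0 = f y" using sub by auto
  qed
  ultimately have "(\<lambda>h. f' x \<bullet> h) = (\<lambda>h. 0)" by (rule has_derivative_unique)
  then have "f' x \<bullet> f' x = 0" by meson
  then show "f' x = 0" by simp
qed

lemma C1_grad_continuous:
  assumes "C1_grad f f'" shows "continuous_on S f" "continuous_on S f'"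
proof -
  show "continuous_on S f"
    by (intro continuous_at_imp_continuous_on ballI has_derivative_continuous)
      (use assms in \<open>auto simp: C1_grad_def\<close>)
  show "continuous_on S f'"
    using assms continuous_on_subset[of UNIV f' S] by (simp add: C1_grad_def)
qed

lemma compact_support_bounded:
  fixes g :: "'a::euclidean_space \<Rightarrow> 'b::real_normed_vector"
  assumes "continuous_on UNIV g" "bounded S" "\<And>x. x \<notin> closure S \<Longrightarrow> g x = 0"
  obtains B where "B \<ge> 0" "\<And>x. norm (g x) \<le> B"
proof -
  have "compact (g ` closure S)"
    using compact_continuous_image[OF continuous_on_subset[OF assms(1), of "closure S"]] assms(2) by simp
  then obtain B where B: "\<And>x. x \<in> closure S \<Longrightarrow> norm (g x) \<le> B"
    using compact_imp_bounded[of "g ` closure S"] unfolding bounded_iff by auto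
  show ?thesis
  proof (rule that[of "max B 0"])
    show "norm (g x) \<le> max B 0" for x using B[of x] assms(3)[of x] by (cases "x \<in> closure S") auto
  qed simp
qed

lemma C1c_bounded:
  assumes "C1c f f'"
  obtains B where "B \<ge> 0" "\<And>x. \<bar>f x\<bar> \<le> B" "\<And>x. norm (f' x) \<le> B"
proof -
  have *: "C1_grad f f'" "bounded {x. f x \<noteq> 0}" using assms by (auto simp: C1c_def)
  obtain B1 where B1: "B1 \<ge> 0" "\<And>x. norm (f x) \<le> B1"
    using compact_support_bounded[OF C1_grad_continuous(1)[OF *(1)] *(2) C1c_zero_outside(1)[OF assms]] by blast
  obtain B2 where B2: "B2 \<ge> 0" "\<And>x. norm (f' x) \<le> B2"
    using compact_support_bounded[OF C1_grad_continuous(2)[OF *(1)] *(2) C1c_zero_outside(2)[OF assms]] by blast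
  show ?thesis
  proof (rule that[of "max B1 B2"])
    show "\<bar>f x\<bar> \<le> max B1 B2" "norm (f' x) \<le> max B1 B2" for x
      using B1(2)[of x] B2(2)[of x] by simp_all
  qed (use B1(1) in simp)
qed

text \<open>On a ball slightly larger than the support this is Heine's theorem. Two points closer than
  \<open>1\<close> that are not both in that ball both lie off the support.\<close>

lemma compact_support_uniformly_continuous:
  fixes g :: "'a::euclidean_space \<Rightarrow> 'b::real_normed_vector"
  assumes "continuous_on UNIV g" "bounded S" "\<And>x. x \<notin> closure S \<Longrightarrow> g x = 0"
  shows "uniformly_continuous_on UNIV g"
proof -
  obtain R where R: "closure S \<subseteq> cball 0 R"
    using bounded_closure[OF assms(2)] by (auto simp: bounded_iff subset_iff)
  have zero: "g x = 0" if "\<not> norm x \<le> R" for x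
    using assms(3) R that by (metis mem_cball_0 subsetD)
  have uc: "uniformly_continuous_on (cball 0 (R + 1)) g"
    by (rule compact_uniformly_continuous[OF continuous_on_subset[OF assms(1)]]) auto
  show ?thesis
    unfolding uniformly_continuous_on_def
  proof (intro allI impI)
    fix e :: real assume "e > 0"
    from uc[unfolded uniformly_continuous_on_def, rule_format, OF this]
    obtain d where d: "d > 0" "\<forall>x\<in>cball 0 (R + 1). \<forall>y\<in>cball 0 (R + 1). dist y x < d \<longrightarrow> dist (g y) (g x) < e"
      by (elim exE conjE)
    have *: "dist (g y) (g x) < e" if xy: "dist y x < min d 1" for x y
    proof (cases "norm x \<le> R \<or> norm y \<le> R")
      case True
      have "norm (y - x) < 1" using xy by (simp add: dist_norm)
      then have "norm x \<le> R + 1 \<and> norm y \<le> R + 1"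
        using True norm_triangle_sub[of x y] norm_triangle_sub[of y x] norm_minus_commute[of x y]
        by linarith
      then show ?thesis using d(2)[rule_format, of x y] xy by simp
    next
      case False
      then show ?thesis using zero[of x] zero[of y] \<open>e > 0\<close> by simp
    qed
    show "\<exists>d>0. \<forall>x\<in>UNIV. \<forall>x'\<in>UNIV. dist x' x < d \<longrightarrow> dist (g x') (g x) < e"
      by (intro exI[of _ "min d 1"] conjI ballI impI) (use d(1) * in simp_all)
  qed
qed

lemma integrable_scaleR_bounded:
  fixes f :: "'a \<Rightarrow> 'b::{banach,second_countable_topology}" and k :: "'a \<Rightarrow> real"
  assumes "integrable M f" "k \<in> borel_measurable M" "\<And>x. \<bar>k x\<bar> \<le> B"
  shows "integrable M (\<lambda>x. k x *\<^sub>R f x)"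
proof (rule Bochner_Integration.integrable_bound[where f="\<lambda>x. B * norm (f x)"])
  show "AE x in M. norm (k x *\<^sub>R f x) \<le> norm (B * norm (f x))"
  proof (intro AE_I2)
    fix x
    have "B \<ge> 0" using assms(3)[of x] by linarith
    then show "norm (k x *\<^sub>R f x) \<le> norm (B * norm (f x))"
      using assms(3)[of x] by (simp add: abs_mult mult_right_mono)
  qed
qed (use assms in auto)

section \<open>Convolution and mollifiers\<close>

text \<open>The second factor may be vector valued, so that gradients can be mollified as well as
  functions.\<close>

definition conv :: "('a::euclidean_space \<Rightarrow> real) \<Rightarrow> ('a \<Rightarrow> 'b::euclidean_space) \<Rightarrow> 'a \<Rightarrow> 'b" where
  "conv k w x = (LINT y|lborel. k (x - y) *\<^sub>R w y)"

lemma conv_integrable: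
  fixes k :: "'a::euclidean_space \<Rightarrow> real" and w :: "'a \<Rightarrow> 'b::euclidean_space"
  assumes "continuous_on UNIV k" "\<And>x. \<bar>k x\<bar> \<le> B" "integrable lborel w"
  shows "integrable lborel (\<lambda>y. k (x - y) *\<^sub>R w y)"
proof (rule integrable_scaleR_bounded[OF assms(3)])
  have "continuous_on UNIV (\<lambda>y. k (x - y))"
    by (intro continuous_on_compose2[OF assms(1)] continuous_intros) auto
  then show "(\<lambda>y. k (x - y)) \<in> borel_measurable lborel"
    using borel_measurable_continuous_onI by simp
qed (use assms in auto)

text \<open>Differentiation under the integral sign. As \<open>k'\<close> is uniformly continuous, the error of the
  linearisation of \<open>k\<close> is small uniformly in the point, and it is integrated against a fixed
  integrable function.\<close>

lemma conv_has_derivative: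
  fixes w :: "'a::euclidean_space \<Rightarrow> real"
  assumes k: "C1c k k'" and w: "integrable lborel w"
  shows "(conv k w has_derivative (\<lambda>h. conv (\<lambda>z. k' z \<bullet> h) w x)) (at x)"
proof -
  have k1: "C1_grad k k'" using k by (simp add: C1c_def)
  note cont = C1_grad_continuous[OF k1]
  obtain B where B: "B \<ge> 0" "\<And>x. \<bar>k x\<bar> \<le> B" "\<And>x. norm (k' x) \<le> B" using C1c_bounded[OF k] by blast
  have kd: "(k has_derivative (\<lambda>h. k' x \<bullet> h)) (at x)" for x using k1 by (simp add: C1_grad_def)
  have uc: "uniformly_continuous_on UNIV k'"
  proof (rule compact_support_uniformly_continuous[OF cont(2) _ C1c_zero_outside(2)[OF k]])
    show "bounded {x. k x \<noteq> 0}" using k by (simp add: C1c_def)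
  qed
  have ik: "integrable lborel (\<lambda>y. k (x - y) *\<^sub>R w y)" for x
    by (rule conv_integrable[OF cont(1) B(2) w])
  have ik': "integrable lborel (\<lambda>y. (k' (x - y) \<bullet> h) *\<^sub>R w y)" for x h
  proof (rule conv_integrable[OF _ _ w])
    show "continuous_on UNIV (\<lambda>z. k' z \<bullet> h)" using cont(2) by (intro continuous_intros) auto
    show "\<bar>k' z \<bullet> h\<bar> \<le> B * norm h" for z
      using Cauchy_Schwarz_ineq2[of "k' z" h] B(3)[of z]
      by (meson mult_right_mono norm_ge_zero order_trans)
  qed
  have lin: "linear (\<lambda>h. conv (\<lambda>z. k' z \<bullet> h) w x)"
  proof (rule linearI)
    fix a b :: 'a and r :: real
    show "conv (\<lambda>z. k' z \<bullet> (a + b)) w x = conv (\<lambda>z. k' z \<bullet> a) w x + conv (\<lambda>z. k' z \<bullet> b) w x"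
      unfolding conv_def inner_add_right scaleR_add_left by (rule Bochner_Integration.integral_add[OF ik' ik'])
    show "conv (\<lambda>z. k' z \<bullet> (r *\<^sub>R a)) w x = r *\<^sub>R conv (\<lambda>z. k' z \<bullet> a) w x"
      unfolding conv_def inner_scaleR_right scaleR_scaleR[symmetric] by simp
  qed
  show ?thesis
    unfolding has_derivative_at_alt
  proof (intro conjI allI impI)
    show "bounded_linear (\<lambda>h. conv (\<lambda>z. k' z \<bullet> h) w x)"
      using lin by (simp add: linear_conv_bounded_linear)
    fix e :: real assume e: "e > 0"
    define W where "W = (LINT y|lborel. \<bar>w y\<bar>)"
    have W: "W \<ge> 0" by (simp add: W_def)
    obtain d where d: "d > 0" "\<And>x y. dist y x < d \<Longrightarrow> dist (k' y) (k' x) < e / (W + 1)"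
    proof -
      have "e / (W + 1) > 0" using e W by simp
      then have "\<exists>d>0. \<forall>x\<in>UNIV. \<forall>x'\<in>UNIV. dist x' x < d \<longrightarrow> dist (k' x') (k' x) < e / (W + 1)"
        using uc unfolding uniformly_continuous_on_def by blast
      then show ?thesis using that by blast
    qed
    have bd: "\<bar>k (z + h) - k z - k' z \<bullet> h\<bar> \<le> norm h * (e / (W + 1))" if "norm h < d" for z h
    proof -
      have "norm (k (z + h) - k z - k' z \<bullet> (z + h - z)) \<le> norm (z + h - z) * (e / (W + 1))"
      proof (rule differentiable_bound_linearization[where S="ball z d" and f'="\<lambda>x h. k' x \<bullet> h"])
        fix t :: real assume t: "t \<in> {0..1}"
        have "\<bar>t\<bar> * norm h \<le> norm h" using t by (intro mult_left_le_one_le) auto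
        then show "z + t *\<^sub>R (z + h - z) \<in> ball z d" using that by (simp add: dist_norm)
      next
        fix y assume "y \<in> ball z d"
        then have *: "norm (k' y - k' z) \<le> e / (W + 1)"
          using d(2)[of y z] by (simp add: dist_norm norm_minus_commute)
        have "norm (k' y \<bullet> i - k' z \<bullet> i) \<le> e / (W + 1) * norm i" for i
          using Cauchy_Schwarz_ineq2[of "k' y - k' z" i] mult_right_mono[OF *, of "norm i"]
          by (simp add: inner_diff_left)
        then show "onorm ((\<lambda>h. k' y \<bullet> h) - (\<lambda>h. k' z \<bullet> h)) \<le> e / (W + 1)"
          using e W by (intro onorm_bound) (auto simp: fun_diff_def)
      qed (use d(1) in \<open>auto intro: has_derivative_at_withinI[OF kd]\<close>)
      then show ?thesis by simp
    qed
    show "\<exists>d>0. \<forall>y. norm (y - x) < d \<longrightarrow>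
       norm (conv k w y - conv k w x - conv (\<lambda>z. k' z \<bullet> (y - x)) w x) \<le> e * norm (y - x)"
    proof (intro exI[of _ d] conjI allI impI d(1))
      fix y assume y: "norm (y - x) < d"
      define h where "h = y - x"
      have "conv k w y - conv k w x - conv (\<lambda>z. k' z \<bullet> h) w x =
         (LINT t|lborel. (k ((x - t) + h) - k (x - t) - k' (x - t) \<bullet> h) * w t)"
      proof -
        have *: "x - t + h = y - t" for t by (simp add: h_def)
        show ?thesis
          unfolding conv_def *
          apply (subst Bochner_Integration.integral_diff[symmetric, OF ik ik])
          apply (subst Bochner_Integration.integral_diff[symmetric, OF Bochner_Integration.integrable_diff[OF ik ik] ik'])
          apply (simp only: real_scaleR_def left_diff_distrib)
          done
      qed
      also have "norm \<dots> \<le> (LINT t|lborel. norm h * (e / (W + 1)) * \<bar>w t\<bar>)"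
      proof (rule Bochner_Integration.integral_norm_bound_integral)
        have "integrable lborel (\<lambda>t. k (y - t) *\<^sub>R w t - k (x - t) *\<^sub>R w t - (k' (x - t) \<bullet> h) *\<^sub>R w t)"
          by (intro Bochner_Integration.integrable_diff ik ik')
        moreover have "x - t + h = y - t" for t by (simp add: h_def)
        ultimately show "integrable lborel (\<lambda>t. (k ((x - t) + h) - k (x - t) - k' (x - t) \<bullet> h) * w t)"
          by (simp only: real_scaleR_def left_diff_distrib)
        show "integrable lborel (\<lambda>t. norm h * (e / (W + 1)) * \<bar>w t\<bar>)" using w by auto
        show "norm ((k ((x - t) + h) - k (x - t) - k' (x - t) \<bullet> h) * w t) \<le> norm h * (e / (W + 1)) * \<bar>w t\<bar>" for t
          unfolding real_norm_def abs_mult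
          using bd[of h "x - t"] y by (intro mult_right_mono) (auto simp: h_def)
      qed
      also have "\<dots> = norm h * (e / (W + 1)) * W" by (simp add: W_def)
      also have "\<dots> \<le> e * norm h" using e W by (simp add: field_simps mult_left_mono)
      finally show "norm (conv k w y - conv k w x - conv (\<lambda>z. k' z \<bullet> (y - x)) w x) \<le> e * norm (y - x)"
        by (simp add: h_def)
    qed
  qed
qed

lemma smooth_C1c: "smooth f \<Longrightarrow> bounded {x. f x \<noteq> 0} \<Longrightarrow> C1c f (grad f)"
  by (simp add: C1c_def smooth_C1_grad)

text \<open>The derivatives of a convolution are convolutions with the derivatives of the kernel, so the
  coinduction principle applies.\<close>

lemma smooth_conv:
  fixes w :: "'a::euclidean_space \<Rightarrow> real"
  assumes "smooth k" "bounded {x. k x \<noteq> 0}" "integrable lborel w"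
  shows "smooth (conv k w)"
proof (rule smooth_coinduct[where P="\<lambda>f. \<exists>k. smooth k \<and> bounded {x. k x \<noteq> 0} \<and> f = conv k w"])
  fix f assume "\<exists>k. smooth k \<and> bounded {x. k x \<noteq> 0} \<and> f = conv k w"
  then obtain k where k: "smooth k" "bounded {x. k x \<noteq> 0}" "f = conv k w" by blast
  have c: "C1c k (grad k)" by (rule smooth_C1c[OF k(1,2)])
  have "smooth (\<lambda>z. grad k z \<bullet> e) \<and> bounded {z. grad k z \<bullet> e \<noteq> 0}" if "e \<in> Basis" for e
  proof
    have "(\<lambda>z. grad k z \<bullet> e) = (\<lambda>z. frechet_derivative k (at z) e)"
      using C1_grad_unique(2)[OF smooth_C1_grad[OF k(1)]] by auto
    then show "smooth (\<lambda>z. grad k z \<bullet> e)" using smooth_D(2)[OF k(1) that] by simp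
    have "{z. grad k z \<bullet> e \<noteq> 0} \<subseteq> closure {x. k x \<noteq> 0}"
      using C1c_zero_outside(2)[OF c] by (metis (mono_tags, lifting) inner_zero_left mem_Collect_eq subsetI)
    then show "bounded {z. grad k z \<bullet> e \<noteq> 0}"
      using k(2) bounded_closure bounded_subset by blast
  qed
  note * = this
  show "\<exists>D. (\<forall>x. (f has_derivative D x) (at x)) \<and>
     (\<forall>e\<in>Basis. \<exists>k. smooth k \<and> bounded {x. k x \<noteq> 0} \<and> (\<lambda>x. D x e) = conv k w)"
  proof (intro exI[of _ "\<lambda>x h. conv (\<lambda>z. grad k z \<bullet> h) w x"] conjI ballI allI)
    show "(f has_derivative (\<lambda>h. conv (\<lambda>z. grad k z \<bullet> h) w x)) (at x)" for x
      using conv_has_derivative[OF c assms(3)] k(3) by simp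
    fix e :: 'a assume "e \<in> Basis"
    then show "\<exists>k'. smooth k' \<and> bounded {x. k' x \<noteq> 0} \<and> (\<lambda>x. conv (\<lambda>z. grad k z \<bullet> e) w x) = conv k' w"
      using * by (intro exI[of _ "\<lambda>z. grad k z \<bullet> e"]) auto
  qed
qed (use assms in blast)

lemma lborel_integral_affine:
  fixes f :: "'a::euclidean_space \<Rightarrow> 'b::{banach,second_countable_topology}"
  assumes [measurable]: "f \<in> borel_measurable borel" and c: "c \<noteq> 0"
  shows "(LINT x|lborel. f x) = \<bar>c\<bar> ^ DIM('a) *\<^sub>R (LINT x|lborel. f (t + c *\<^sub>R x))"
proof -
  have "(LINT x|lborel. f x) = (LINT x|density (distr lborel borel (\<lambda>x. t + c *\<^sub>R x)) (\<lambda>_. ennreal (\<bar>c\<bar>^DIM('a))). f x)"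
    by (rule arg_cong[OF lborel_affine[OF c, of t], of "\<lambda>M. integral\<^sup>L M f"])
  also have "\<dots> = (LINT x|distr lborel borel (\<lambda>x. t + c *\<^sub>R x). (\<bar>c\<bar>^DIM('a)) *\<^sub>R f x)"
    by (rule integral_density) auto
  also have "\<dots> = \<bar>c\<bar> ^ DIM('a) *\<^sub>R (LINT x|lborel. f (t + c *\<^sub>R x))"
    by (subst integral_distr) auto
  finally show ?thesis .
qed

lemma lborel_nn_integral_affine:
  fixes f :: "'a::euclidean_space \<Rightarrow> ennreal"
  assumes [measurable]: "f \<in> borel_measurable borel" and c: "c \<noteq> 0"
  shows "(\<integral>\<^sup>+x. f x \<partial>lborel) = ennreal (\<bar>c\<bar> ^ DIM('a)) * (\<integral>\<^sup>+x. f (t + c *\<^sub>R x) \<partial>lborel)"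
proof -
  have "(\<integral>\<^sup>+x. f x \<partial>lborel) = (\<integral>\<^sup>+x. f x \<partial>density (distr lborel borel (\<lambda>x. t + c *\<^sub>R x)) (\<lambda>_. ennreal (\<bar>c\<bar>^DIM('a))))"
    by (rule arg_cong[OF lborel_affine[OF c, of t], of "\<lambda>M. nn_integral M f"])
  also have "\<dots> = ennreal (\<bar>c\<bar> ^ DIM('a)) * (\<integral>\<^sup>+x. f (t + c *\<^sub>R x) \<partial>lborel)"
    by (simp add: nn_integral_density nn_integral_distr nn_integral_cmult)
  finally show ?thesis .
qed

lemma lborel_integrable_affine:
  fixes f :: "'a::euclidean_space \<Rightarrow> 'b::{banach,second_countable_topology}"
  assumes f: "integrable lborel f" and c: "c \<noteq> 0"
  shows "integrable lborel (\<lambda>x. f (t + c *\<^sub>R x))"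
proof -
  have [measurable]: "f \<in> borel_measurable borel" using f by (simp add: integrable_iff_bounded)
  have "(\<integral>\<^sup>+x. norm (f x) \<partial>lborel) < \<infinity>" using f by (simp add: integrable_iff_bounded)
  then have "(\<integral>\<^sup>+x. norm (f (t + c *\<^sub>R x)) \<partial>lborel) < \<infinity>"
    using c by (subst (asm) lborel_nn_integral_affine[OF _ c, of _ t]) (auto simp: ennreal_mult_less_top)
  then show ?thesis by (simp add: integrable_iff_bounded)
qed

lemma C1c_integrable:
  assumes "C1c f f'"
  shows "integrable lborel f" "integrable lborel f'"
proof -
  have *: "C1_grad f f'" "bounded {x. f x \<noteq> 0}" using assms by (auto simp: C1c_def)
  let ?K = "closure {x. f x \<noteq> 0}"
  have K: "compact ?K" using *(2) by simp
  have "integrable lborel (\<lambda>x. indicator ?K x *\<^sub>R f x)" "integrable lborel (\<lambda>x. indicator ?K x *\<^sub>R f' x)"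
    by (rule borel_integrable_compact[OF K C1_grad_continuous(1)[OF *(1)]],
        rule borel_integrable_compact[OF K C1_grad_continuous(2)[OF *(1)]])
  moreover have "(\<lambda>x. indicator ?K x *\<^sub>R f x) = f"
  proof
    fix x show "indicator ?K x *\<^sub>R f x = f x"
      using C1c_zero_outside(1)[OF assms, of x]
      by (cases "x \<in> ?K") (simp only: indicator_simps scaleR_one scaleR_zero_right, simp only: not_False_eq_True scaleR_zero_right)
  qed
  moreover have "(\<lambda>x. indicator ?K x *\<^sub>R f' x) = f'"
  proof
    fix x show "indicator ?K x *\<^sub>R f' x = f' x"
      using C1c_zero_outside(2)[OF assms, of x]
      by (cases "x \<in> ?K") (simp only: indicator_simps scaleR_one scaleR_zero_right, simp only: not_False_eq_True scaleR_zero_right)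
  qed
  ultimately show "integrable lborel f" "integrable lborel f'" by metis+
qed

lemma bump_C1c: "C1c bump (grad bump)"
proof (rule smooth_C1c[OF smooth_bump])
  have "{x. bump x \<noteq> 0} \<subseteq> ball 0 1" by (auto simp: bump_pos_iff)
  then show "bounded {x::'a. bump x \<noteq> 0}" using bounded_ball bounded_subset by blast
qed

lemma bump_integral_pos: "(LINT x|lborel. bump (x::'a::euclidean_space)) > 0"
proof -
  have "(LINT x|lborel. bump (x::'a)) \<noteq> 0"
  proof
    assume "(LINT x|lborel. bump (x::'a)) = 0"
    then have "AE x in lborel. bump (x::'a) = 0"
      using integral_nonneg_eq_0_iff_AE[OF C1c_integrable(1)[OF bump_C1c]] bump_nonneg by auto
    then have "AE x in lborel. x \<notin> ball (0::'a) 1"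
      by eventually_elim (simp add: bump_pos_iff[symmetric])
    then have "emeasure lborel (ball (0::'a) 1) = 0"
      by (subst (asm) AE_iff_measurable[where N="ball 0 1"]) auto
    then have "ball (0::'a) 1 \<in> null_sets lborel" by auto
    then have "negligible (ball (0::'a) 1)"
      using negligible_iff_null_sets null_sets_completionI by blast
    then show False using open_not_negligible[of "ball (0::'a) 1"] by simp
  qed
  moreover have "(LINT x|lborel. bump (x::'a)) \<ge> 0" by (simp add: bump_nonneg)
  ultimately show ?thesis by linarith
qed

text \<open>The normalised bump in the ball of centre \<open>a\<close> and radius \<open>s\<close>. Convolution with an off-centre
  kernel shifts a function while it smooths it, which will move supports away from the boundary.\<close>

definition kern :: "'a::euclidean_space \<Rightarrow> real \<Rightarrow> 'a \<Rightarrow> real" where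
  "kern a s x = (1 / (s ^ DIM('a) * (LINT x|lborel. bump (x::'a)))) * bump ((1 / s) *\<^sub>R (x - a))"

lemma kern_smooth: "smooth (kern a s)"
  unfolding kern_def[abs_def] by (rule smooth_affine[OF smooth_bump])

lemma kern_nonneg: "s > 0 \<Longrightarrow> kern a s x \<ge> 0"
  unfolding kern_def using bump_integral_pos[where 'a='a] bump_nonneg by (auto intro!: mult_nonneg_nonneg divide_nonneg_nonneg)

lemma kern_support: "s > 0 \<Longrightarrow> kern a s x \<noteq> 0 \<Longrightarrow> dist a x < s"
  unfolding kern_def using bump_pos_iff[of "(1 / s) *\<^sub>R (x - a)"]
  by (auto simp: dist_norm norm_minus_commute)

lemma kern_C1c: "s > 0 \<Longrightarrow> C1c (kern a s) (grad (kern a s))"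
proof (rule smooth_C1c[OF kern_smooth])
  assume "s > 0"
  then have "{x. kern a s x \<noteq> 0} \<subseteq> ball a s" using kern_support by auto
  then show "bounded {x. kern a s x \<noteq> 0}" using bounded_ball bounded_subset by blast
qed

lemma kern_integral:
  fixes a :: "'a::euclidean_space"
  assumes "s > 0" shows "(LINT x|lborel. kern a s x) = 1"
proof -
  have "(\<lambda>x. kern a s x) \<in> borel_measurable borel"
    using smooth_continuous[OF kern_smooth, of UNIV] by (rule borel_measurable_continuous_onI)
  from lborel_integral_affine[OF this, of s a]
  have "(LINT x|lborel. kern a s x) = s ^ DIM('a) * (LINT x|lborel. kern a s (a + s *\<^sub>R x))"
    using assms by simp
  also have "(\<lambda>x. kern a s (a + s *\<^sub>R x)) = (\<lambda>x. (1 / (s ^ DIM('a) * (LINT x|lborel. bump (x::'a)))) * bump x)"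
    using assms by (simp add: kern_def)
  finally show ?thesis using assms bump_integral_pos[where 'a='a] by simp
qed

lemma kern_grad:
  fixes a :: "'a::euclidean_space"
  shows "grad (kern a s) x = (1 / (s ^ DIM('a) * (LINT x|lborel. bump (x::'a))) * (1 / s)) *\<^sub>R grad bump ((1 / s) *\<^sub>R (x - a))"
proof (rule C1_grad_unique(1))
  let ?c = "1 / (s ^ DIM('a) * (LINT x|lborel. bump (x::'a)))"
  have "((\<lambda>x. bump ((1 / s) *\<^sub>R (x - a))) has_derivative (\<lambda>h. grad bump ((1 / s) *\<^sub>R (x - a)) \<bullet> ((1 / s) *\<^sub>R h))) (at x)" for x
    by (rule has_derivative_compose[of "\<lambda>x. (1 / s) *\<^sub>R (x - a)" _ _ _ bump])
      (use smooth_C1_grad[OF smooth_bump] in \<open>auto intro!: derivative_eq_intros simp: C1_grad_def\<close>)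
  from has_derivative_mult_right[OF this, of ?c]
  have "(kern a s has_derivative (\<lambda>h. ((?c * (1 / s)) *\<^sub>R grad bump ((1 / s) *\<^sub>R (x - a))) \<bullet> h)) (at x)" for x
    unfolding kern_def[abs_def] by (simp add: mult.assoc)
  moreover have "continuous_on UNIV (\<lambda>x. (?c * (1 / s)) *\<^sub>R grad bump ((1 / s) *\<^sub>R (x - a)))"
    by (intro continuous_intros continuous_on_compose2[OF C1_grad_continuous(2)[OF smooth_C1_grad[OF smooth_bump]]]) auto
  ultimately show "C1_grad (kern a s) (\<lambda>x. (?c * (1 / s)) *\<^sub>R grad bump ((1 / s) *\<^sub>R (x - a)))"
    by (simp add: C1_grad_def)
qed

text \<open>By scaling, the gradient of a kernel has an \<open>L\<^sup>1\<close> norm inversely proportional to the radius.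
  This is the factor that Hoelder continuity has to compensate.\<close>

lemma kern_grad_integral:
  obtains D where "D \<ge> 0"
    "\<And>a s. s > 0 \<Longrightarrow> (LINT x|lborel. norm (grad (kern (a::'a::euclidean_space) s) x)) = D / s"
proof
  let ?I = "LINT x|lborel. bump (x::'a)"
  let ?G = "LINT x|lborel. norm (grad bump (x::'a))"
  show "?G / ?I \<ge> 0" using bump_integral_pos[where 'a='a] by auto
  fix a :: 'a and s :: real assume s: "s > 0"
  have "(\<lambda>x. norm (grad (kern a s) x)) \<in> borel_measurable borel"
    using borel_measurable_integrable[OF C1c_integrable(2)[OF kern_C1c[OF s, of a]]] by simp
  from lborel_integral_affine[OF this, of s a]
  have "(LINT x|lborel. norm (grad (kern a s) x)) = s ^ DIM('a) * (LINT x|lborel. norm (grad (kern a s) (a + s *\<^sub>R x)))"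
    using s by simp
  also have "(\<lambda>x. norm (grad (kern a s) (a + s *\<^sub>R x))) = (\<lambda>x. (1 / (s ^ DIM('a) * ?I) * (1 / s)) * norm (grad bump x))"
    using s bump_integral_pos[where 'a='a] by (simp add: kern_grad abs_mult)
  finally show "(LINT x|lborel. norm (grad (kern a s) x)) = ?G / ?I / s"
    using s bump_integral_pos[where 'a='a] by simp
qed

section \<open>Convergence of mollifications in the mean\<close>

lemma nn_integral_translate:
  fixes f :: "'a::euclidean_space \<Rightarrow> ennreal"
  assumes "f \<in> borel_measurable borel"
  shows "(\<integral>\<^sup>+x. f (x - z) \<partial>lborel) = (\<integral>\<^sup>+x. f x \<partial>lborel)"
  using lborel_nn_integral_affine[OF assms, of 1 "-z"] by simp

text \<open>By regularity \<open>A\<close> lies in an open set \<open>U\<close> of nearly the same measure, and \<open>U\<close> contains a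
  compact set \<open>V\<close> of nearly the same measure. Translations shorter than the distance from \<open>V\<close> to the
  complement of \<open>U\<close> move \<open>V\<close> inside \<open>U\<close>, so a point counted by the integrand, or its translate, is in
  \<open>U - A\<close> or in \<open>U - V\<close>.\<close>

lemma indicator_translation_L1:
  fixes A :: "'a::euclidean_space set"
  assumes A: "A \<in> sets borel" "emeasure lborel A < \<infinity>" and e: "e > 0"
  shows "\<exists>d>0. \<forall>z. norm z < d \<longrightarrow> (\<integral>\<^sup>+x. ennreal \<bar>indicator A (x - z) - indicator A x\<bar> \<partial>lborel) \<le> ennreal e"
proof -
  have "e / 5 > 0" using e by simp
  from outer_regular_lborel[OF A(1) this]
  obtain U where U: "open U" "A \<subseteq> U" "emeasure lborel (U - A) < ennreal (e / 5)" by blast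
  have [measurable]: "U \<in> sets borel" "A \<in> sets borel" using U(1) A(1) by auto
  have "emeasure lborel U = emeasure lborel A + emeasure lborel (U - A)"
    using U(2) A(1) by (subst plus_emeasure) (auto simp: Un_absorb1)
  then have fin: "emeasure lborel U < \<infinity>"
    using A(2) U(3) by (simp add: less_top order_le_less_trans) (metis ennreal_less_top less_trans)
  obtain C where C: "\<And>n. compact (C n)" "\<And>n. C n \<subseteq> U" "\<And>n. C n \<subseteq> interior (C (Suc n))" "\<Union>(range C) = U"
    using open_Union_compact_subsets[OF U(1)] by metis
  have incC: "C n \<subseteq> C (Suc n)" for n using C(3)[of n] interior_subset[of "C (Suc n)"] by (rule subset_trans)
  have mC [measurable]: "C n \<in> sets borel" for n using borel_compact[OF C(1)] .
  have [measurable]: "U \<in> sets borel" using U(1) by simp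
  have "(\<lambda>n. emeasure lborel (U - C n)) \<longlonglongrightarrow> emeasure lborel (\<Inter>n. U - C n)"
  proof (rule Lim_emeasure_decseq)
    show "decseq (\<lambda>n. U - C n)" using incC by (intro decseq_SucI) blast
    show "emeasure lborel (U - C n) \<noteq> \<infinity>" for n
      using fin emeasure_mono[of "U - C n" U lborel] by (auto simp: top_unique)
  qed auto
  moreover have "(\<Inter>n. U - C n) = {}" using C(4) by blast
  ultimately have "(\<lambda>n. emeasure lborel (U - C n)) \<longlonglongrightarrow> 0" by (simp only: emeasure_empty)
  from order_tendstoD(2)[OF this, of "ennreal (e / 5)"]
  have "\<exists>n. emeasure lborel (U - C n) < ennreal (e / 5)"
    using e by (auto simp: eventually_sequentially)
  then obtain n where n: "emeasure lborel (U - C n) < ennreal (e / 5)" by blast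
  define V where "V = C n"
  have V: "compact V" "V \<subseteq> U" using C V_def by auto
  have [measurable]: "V \<in> sets borel" using V(1) by (rule borel_compact)
  have UV: "emeasure lborel (U - V) < ennreal (e / 5)"
    using n by (simp add: V_def)
  obtain d where d: "d > 0" "\<And>x y. x \<in> V \<Longrightarrow> y \<in> - U \<Longrightarrow> d \<le> dist x y"
  proof -
    have "V \<inter> - U = {}" using V(2) by blast
    from separate_compact_closed[OF V(1) _ this] U(1) show ?thesis using that by (auto simp: closed_Compl)
  qed
  show ?thesis
  proof (intro exI[of _ d] conjI allI impI d(1))
    fix z :: 'a assume z: "norm z < d"
    have pt: "ennreal \<bar>indicator A (x - z) - indicator A x\<bar> \<le>
        (indicator (U - A) (x - z) + indicator (U - A) x) + (indicator (U - V) (x - z) + indicator (U - V) x)" for x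
    proof -
      have "x \<in> V \<Longrightarrow> x - z \<in> U" using d(2)[of x "x - z"] z by (force simp: dist_norm)
      moreover have "x - z \<in> V \<Longrightarrow> x \<in> U" using d(2)[of "x - z" x] z by (force simp: dist_norm)
      ultimately show ?thesis using U(2) V(2) by (auto simp: indicator_def split: if_splits)
    qed
    have "(\<integral>\<^sup>+x. ennreal \<bar>indicator A (x - z) - indicator A x\<bar> \<partial>lborel) \<le>
       (\<integral>\<^sup>+x. (indicator (U - A) (x - z) + indicator (U - A) x) + (indicator (U - V) (x - z) + indicator (U - V) x) \<partial>lborel)"
      by (rule nn_integral_mono) (rule pt)
    also have "\<dots> = ((\<integral>\<^sup>+x. indicator (U - A) (x - z) \<partial>lborel) + (\<integral>\<^sup>+x. indicator (U - A) x \<partial>lborel)) +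
        ((\<integral>\<^sup>+x. indicator (U - V) (x - z) \<partial>lborel) + (\<integral>\<^sup>+x. indicator (U - V) x \<partial>lborel))"
      by (simp add: nn_integral_add)
    also have "\<dots> = (emeasure lborel (U - A) + emeasure lborel (U - A)) + (emeasure lborel (U - V) + emeasure lborel (U - V))"
      by (simp add: nn_integral_translate[of "indicator _"])
    also have "\<dots> \<le> (ennreal (e/5) + ennreal (e/5)) + (ennreal (e/5) + ennreal (e/5))"
      using U(3) UV by (intro add_mono less_imp_le)
    also have "\<dots> \<le> ennreal e" using e by (simp flip: ennreal_plus)
    finally show "(\<integral>\<^sup>+x. ennreal \<bar>indicator A (x - z) - indicator A x\<bar> \<partial>lborel) \<le> ennreal e" .
  qed
qed

text \<open>Continuity of translations in the mean holds for indicators and survives sums and \<open>L\<^sup>1\<close> limits.\<close>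

lemma translation_L1:
  fixes h :: "'a::euclidean_space \<Rightarrow> 'b::euclidean_space"
  assumes "integrable lborel h" "e > 0"
  shows "\<exists>d>0. \<forall>z. norm z < d \<longrightarrow> (\<integral>\<^sup>+x. ennreal (norm (h (x - z) - h x)) \<partial>lborel) \<le> ennreal e"
  using assms
proof (induction arbitrary: e rule: integrable_induct)
  case (base A c)
  have c1: "norm c / (norm c + 1) \<le> 1" by (simp add: divide_le_eq add_nonneg_pos)
  have "e / (norm c + 1) > 0" using base by (simp add: add_nonneg_pos)
  from indicator_translation_L1[OF _ _ this, of A] base
  obtain d where d: "d > 0" "\<And>z. norm z < d \<Longrightarrow> (\<integral>\<^sup>+x. ennreal \<bar>indicator A (x - z) - indicator A x\<bar> \<partial>lborel) \<le> ennreal (e / (norm c + 1))"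
    by auto
  show ?case
  proof (intro exI[of _ d] conjI allI impI d(1))
    fix z :: 'a assume z: "norm z < d"
    have [measurable]: "A \<in> sets borel" using base by simp
    have "norm (indicat_real A (x - z) *\<^sub>R c - indicat_real A x *\<^sub>R c) = norm c * \<bar>indicator A (x - z) - indicator A x\<bar>" for x
      by (simp add: scaleR_diff_left[symmetric])
    then have "(\<integral>\<^sup>+x. ennreal (norm (indicat_real A (x - z) *\<^sub>R c - indicat_real A x *\<^sub>R c)) \<partial>lborel) =
      ennreal (norm c) * (\<integral>\<^sup>+x. ennreal \<bar>indicator A (x - z) - indicator A x\<bar> \<partial>lborel)"
      by (simp add: nn_integral_cmult[symmetric] ennreal_mult'')
    also have "\<dots> \<le> ennreal (norm c) * ennreal (e / (norm c + 1))"
      using d(2)[OF z] by (intro mult_left_mono) auto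
    also have "\<dots> = ennreal (norm c * (e / (norm c + 1)))"
      using base(3) by (intro ennreal_mult[symmetric]) auto
    also have "\<dots> \<le> ennreal e"
      using mult_left_mono[OF c1, of e] base(3) by (intro ennreal_leI) (simp add: mult.commute)
    finally show "(\<integral>\<^sup>+x. ennreal (norm (indicat_real A (x - z) *\<^sub>R c - indicat_real A x *\<^sub>R c)) \<partial>lborel) \<le> ennreal e" .
  qed
next
  case (add f g)
  have "e / 2 > 0" using add by simp
  obtain d1 where d1: "d1 > 0" "\<And>z. norm z < d1 \<Longrightarrow> (\<integral>\<^sup>+x. ennreal (norm (f (x - z) - f x)) \<partial>lborel) \<le> ennreal (e/2)"
    using add.IH(1)[OF \<open>e / 2 > 0\<close>] by blast
  obtain d2 where d2: "d2 > 0" "\<And>z. norm z < d2 \<Longrightarrow> (\<integral>\<^sup>+x. ennreal (norm (g (x - z) - g x)) \<partial>lborel) \<le> ennreal (e/2)"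
    using add.IH(2)[OF \<open>e / 2 > 0\<close>] by blast
  have [measurable]: "f \<in> borel_measurable borel" "g \<in> borel_measurable borel" using add by auto
  show ?case
  proof (intro exI[of _ "min d1 d2"] conjI allI impI)
    fix z :: 'a assume z: "norm z < min d1 d2"
    have "(\<integral>\<^sup>+x. ennreal (norm (f (x - z) + g (x - z) - (f x + g x))) \<partial>lborel) \<le>
      (\<integral>\<^sup>+x. ennreal (norm (f (x - z) - f x)) + ennreal (norm (g (x - z) - g x)) \<partial>lborel)"
      by (intro nn_integral_mono) (simp flip: ennreal_plus add: norm_diff_triangle_ineq)
    also have "\<dots> = (\<integral>\<^sup>+x. ennreal (norm (f (x - z) - f x)) \<partial>lborel) + (\<integral>\<^sup>+x. ennreal (norm (g (x - z) - g x)) \<partial>lborel)"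
      by (rule nn_integral_add) auto
    also have "\<dots> \<le> ennreal (e/2) + ennreal (e/2)"
      using d1(2)[of z] d2(2)[of z] z by (intro add_mono) auto
    also have "\<dots> = ennreal e" using add.prems by (simp flip: ennreal_plus)
    finally show "(\<integral>\<^sup>+x. ennreal (norm (f (x - z) + g (x - z) - (f x + g x))) \<partial>lborel) \<le> ennreal e" .
  qed (use d1 d2 in auto)
next
  case (lim f s)
  have [measurable]: "f \<in> borel_measurable borel" "\<And>i. s i \<in> borel_measurable borel" using lim by auto
  have "(\<lambda>i. \<integral>\<^sup>+x. ennreal (norm (f x - s i x)) \<partial>lborel) \<longlonglongrightarrow> 0"
  proof (rule nn_integral_dominated_convergence_norm[where w="\<lambda>x. 2 * norm (f x)"])
    show "(\<integral>\<^sup>+x. ennreal (2 * norm (f x)) \<partial>lborel) < \<infinity>"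
      using lim(4) by (simp add: integrable_iff_bounded ennreal_mult' nn_integral_cmult ennreal_mult_less_top)
  qed (use lim in auto)
  moreover have "ennreal (e / 3) > 0" using lim.prems by simp
  ultimately have "\<exists>i. (\<integral>\<^sup>+x. ennreal (norm (f x - s i x)) \<partial>lborel) < ennreal (e / 3)"
    using order_tendstoD(2) by (fastforce simp: eventually_sequentially)
  then obtain i where i: "(\<integral>\<^sup>+x. ennreal (norm (f x - s i x)) \<partial>lborel) < ennreal (e / 3)" by blast
  have "e / 3 > 0" using lim.prems by simp
  then obtain d where d: "d > 0" "\<And>z. norm z < d \<Longrightarrow> (\<integral>\<^sup>+x. ennreal (norm (s i (x - z) - s i x)) \<partial>lborel) \<le> ennreal (e/3)"
    using lim.IH[of "e/3" i] by blast
  show ?case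
  proof (intro exI[of _ d] conjI allI impI d(1))
    fix z :: 'a assume z: "norm z < d"
    have *: "norm (f (x - z) - f x) \<le> norm (f (x - z) - s i (x - z)) + norm (s i (x - z) - s i x) + norm (f x - s i x)" for x
      using norm_triangle_ineq4[of "f (x - z) - s i (x - z) + (s i (x - z) - s i x)" "f x - s i x"]
        norm_triangle_ineq[of "f (x - z) - s i (x - z)" "s i (x - z) - s i x"] by simp
    have "(\<integral>\<^sup>+x. ennreal (norm (f (x - z) - f x)) \<partial>lborel) \<le>
      (\<integral>\<^sup>+x. ennreal (norm (f (x - z) - s i (x - z))) + ennreal (norm (s i (x - z) - s i x)) + ennreal (norm (f x - s i x)) \<partial>lborel)"
      by (intro nn_integral_mono) (use * in \<open>simp flip: ennreal_plus\<close>)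
    also have "\<dots> = (\<integral>\<^sup>+x. ennreal (norm (f (x - z) - s i (x - z))) \<partial>lborel) +
       (\<integral>\<^sup>+x. ennreal (norm (s i (x - z) - s i x)) \<partial>lborel) + (\<integral>\<^sup>+x. ennreal (norm (f x - s i x)) \<partial>lborel)"
      by (subst nn_integral_add, simp, simp)+ simp
    also have "(\<integral>\<^sup>+x. ennreal (norm (f (x - z) - s i (x - z))) \<partial>lborel) = (\<integral>\<^sup>+x. ennreal (norm (f x - s i x)) \<partial>lborel)"
      by (rule nn_integral_translate[of "\<lambda>x. ennreal (norm (f x - s i x))"]) auto
    also have "\<dots> + (\<integral>\<^sup>+x. ennreal (norm (s i (x - z) - s i x)) \<partial>lborel) + \<dots> \<le> ennreal (e/3) + ennreal (e/3) + ennreal (e/3)"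
      using i d(2)[OF z] by (intro add_mono) auto
    also have "\<dots> = ennreal e" using lim.prems by (simp flip: ennreal_plus)
    finally show "(\<integral>\<^sup>+x. ennreal (norm (f (x - z) - f x)) \<partial>lborel) \<le> ennreal e" .
  qed
qed

text \<open>The difference \<open>k * h - h\<close> is an average, with weight \<open>k\<close>, of the differences between \<open>h\<close> and its
  translates. Fubini's theorem moves the average outside the norm.\<close>

lemma conv_L1_bound:
  fixes h :: "'a::euclidean_space \<Rightarrow> 'b::euclidean_space"
  assumes k: "C1c k k'" "\<And>z. k z \<ge> 0" "(LINT z|lborel. k z) = 1"
    and h: "integrable lborel h"
    and b: "\<And>z. k z \<noteq> 0 \<Longrightarrow> (\<integral>\<^sup>+x. ennreal (norm (h (x - z) - h x)) \<partial>lborel) \<le> ennreal e"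
  shows "(\<integral>\<^sup>+x. ennreal (norm (conv k h x - h x)) \<partial>lborel) \<le> ennreal e"
proof -
  have [measurable]: "h \<in> borel_measurable borel" using h by simp
  have [measurable]: "k \<in> borel_measurable borel" using C1c_integrable(1)[OF k(1)] by simp
  have kc: "continuous_on UNIV k" using k(1) C1_grad_continuous(1) by (auto simp: C1c_def)
  obtain B where B: "\<And>x. \<bar>k x\<bar> \<le> B" using C1c_bounded[OF k(1)] by metis
  have ik: "integrable lborel k" by (rule C1c_integrable(1)[OF k(1)])
  have nnk: "(\<integral>\<^sup>+z. ennreal (k z) \<partial>lborel) = 1"
    using nn_integral_eq_integral[OF ik] k(2,3) by simp
  have pt: "ennreal (norm (conv k h x - h x)) \<le> (\<integral>\<^sup>+z. ennreal (k z) * ennreal (norm (h (x - z) - h x)) \<partial>lborel)" for x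
  proof -
    have m: "(\<lambda>y. k (x - y) *\<^sub>R h y) \<in> borel_measurable borel" by measurable
    have i1: "integrable lborel (\<lambda>z. k z *\<^sub>R h (x - z))"
      using lborel_integrable_affine[OF conv_integrable[OF kc B h, of x], of "-1" x] by simp
    have i2: "integrable lborel (\<lambda>z. k z *\<^sub>R h x)" using ik by auto
    have "conv k h x = (LINT z|lborel. k z *\<^sub>R h (x - z))"
      using lborel_integral_affine[OF m, of "-1" x] by (simp add: conv_def)
    moreover have "h x = (LINT z|lborel. k z *\<^sub>R h x)" using k(3) ik by simp
    ultimately have "conv k h x - h x = (LINT z|lborel. k z *\<^sub>R h (x - z)) - (LINT z|lborel. k z *\<^sub>R h x)" by simp
    also have "\<dots> = (LINT z|lborel. k z *\<^sub>R h (x - z) - k z *\<^sub>R h x)"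
      by (rule Bochner_Integration.integral_diff[symmetric, OF i1 i2])
    finally have "ennreal (norm (conv k h x - h x)) \<le> (\<integral>\<^sup>+z. ennreal (norm (k z *\<^sub>R h (x - z) - k z *\<^sub>R h x)) \<partial>lborel)"
      using integral_norm_bound_ennreal[OF Bochner_Integration.integrable_diff[OF i1 i2]] by simp
    also have "\<dots> = (\<integral>\<^sup>+z. ennreal (k z) * ennreal (norm (h (x - z) - h x)) \<partial>lborel)"
      using k(2) by (intro nn_integral_cong) (simp add: scaleR_diff_right[symmetric] ennreal_mult')
    finally show ?thesis .
  qed
  have "(\<integral>\<^sup>+x. ennreal (norm (conv k h x - h x)) \<partial>lborel) \<le>
    (\<integral>\<^sup>+x. (\<integral>\<^sup>+z. ennreal (k z) * ennreal (norm (h (x - z) - h x)) \<partial>lborel) \<partial>lborel)"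
    by (rule nn_integral_mono) (rule pt)
  also have "\<dots> = (\<integral>\<^sup>+z. (\<integral>\<^sup>+x. ennreal (k z) * ennreal (norm (h (x - z) - h x)) \<partial>lborel) \<partial>lborel)"
    by (rule lborel_pair.Fubini') measurable
  also have "\<dots> = (\<integral>\<^sup>+z. ennreal (k z) * (\<integral>\<^sup>+x. ennreal (norm (h (x - z) - h x)) \<partial>lborel) \<partial>lborel)"
    by (intro nn_integral_cong nn_integral_cmult) measurable
  also have "\<dots> \<le> (\<integral>\<^sup>+z. ennreal (k z) * ennreal e \<partial>lborel)"
  proof (rule nn_integral_mono)
    show "ennreal (k z) * (\<integral>\<^sup>+x. ennreal (norm (h (x - z) - h x)) \<partial>lborel) \<le> ennreal (k z) * ennreal e" for z
      using b[of z] by (cases "k z = 0") (auto intro: mult_left_mono)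
  qed
  also have "\<dots> = ennreal e" by (simp add: nn_integral_multc nnk)
  finally show ?thesis .
qed

lemma conv_measurable:
  fixes h :: "'a::euclidean_space \<Rightarrow> 'b::euclidean_space"
  assumes [measurable]: "k \<in> borel_measurable borel" "h \<in> borel_measurable borel"
  shows "conv k h \<in> borel_measurable borel"
  unfolding conv_def[abs_def] by measurable

text \<open>The radius \<open>d\<close> depends on \<open>h\<close> alone, so it serves off-centre kernels, too.\<close>

lemma conv_tendsto_L1:
  fixes h :: "'a::euclidean_space \<Rightarrow> 'b::euclidean_space"
  assumes "integrable lborel h" "e > 0"
  shows "\<exists>d>0. \<forall>k k'. C1c k k' \<and> (\<forall>z. k z \<ge> 0) \<and> (LINT z|lborel. k z) = 1 \<and> (\<forall>z. k z \<noteq> 0 \<longrightarrow> norm z < d)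
     \<longrightarrow> (\<integral>\<^sup>+x. ennreal (norm (conv k h x - h x)) \<partial>lborel) \<le> ennreal e"
proof -
  obtain d where d: "d > 0" "\<And>z. norm z < d \<Longrightarrow> (\<integral>\<^sup>+x. ennreal (norm (h (x - z) - h x)) \<partial>lborel) \<le> ennreal e"
    using translation_L1[OF assms] by blast
  show ?thesis
    by (intro exI[of _ d] conjI allI impI d(1)) (elim conjE, rule conv_L1_bound, use assms(1) d(2) in auto)
qed

lemma C1_grad_lipschitz:
  assumes "C1_grad f f'" "\<And>x. norm (f' x) \<le> B"
  shows "\<bar>f x - f y\<bar> \<le> B * norm (x - y)"
proof -
  have "norm (f x - f y) \<le> B * norm (x - y)"
  proof (rule differentiable_bound[OF convex_UNIV])
    show "(f has_derivative (\<lambda>h. f' z \<bullet> h)) (at z within UNIV)" for z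
      using assms(1) by (simp add: C1_grad_def)
    show "onorm (\<lambda>h. f' z \<bullet> h) \<le> B" for z
    proof (rule onorm_bound)
      show "B \<ge> 0" using assms(2)[of z] norm_ge_zero order_trans by blast
      show "norm (f' z \<bullet> h) \<le> B * norm h" for h
        using Cauchy_Schwarz_ineq2[of "f' z" h] mult_right_mono[OF assms(2)[of z] norm_ge_zero[of h]] by simp
    qed
  qed auto
  then show ?thesis by simp
qed

section \<open>Sobolev functions as limits of continuously differentiable functions\<close>

text \<open>The integrals of the difference quotients vanish by translation invariance, and the quotients
  converge boundedly with supports in a fixed ball.\<close>

lemma C1c_integral_deriv_zero:
  assumes f: "C1c f f'"
  shows "(LINT x|lborel. f' x \<bullet> e) = 0"
proof (rule LIMSEQ_unique)
  have f1: "C1_grad f f'" and bdd: "bounded {x. f x \<noteq> 0}" using f by (auto simp: C1c_def)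
  obtain B where B: "B \<ge> 0" "\<And>x. norm (f' x) \<le> B" using C1c_bounded[OF f] by metis
  obtain R where R: "\<And>x. f x \<noteq> 0 \<Longrightarrow> norm x \<le> R" using bdd unfolding bounded_iff by blast
  have [measurable]: "f \<in> borel_measurable borel" "f' \<in> borel_measurable borel"
    using C1c_integrable[OF f] by auto
  define t :: "nat \<Rightarrow> real" where "t n = inverse (real (Suc n))" for n
  have t: "t n > 0" "t n \<le> 1" for n by (auto simp: t_def field_simps)
  have t0: "t \<longlonglongrightarrow> 0" unfolding t_def by (rule LIMSEQ_inverse_real_of_nat)
  let ?g = "\<lambda>n x. (f (x + t n *\<^sub>R e) - f x) / t n"
  have int_shift: "integrable lborel (\<lambda>x. f (x + t n *\<^sub>R e))" for n
    using lborel_integrable_affine[OF C1c_integrable(1)[OF f], of 1 "t n *\<^sub>R e"] by (simp add: add.commute)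
  have "(LINT x|lborel. f (x + t n *\<^sub>R e)) = (LINT x|lborel. f x)" for n
    using lborel_integral_affine[of f 1 "t n *\<^sub>R e"] by (simp add: add.commute)
  then have z: "(LINT x|lborel. ?g n x) = 0" for n
    using int_shift[of n] C1c_integrable(1)[OF f] by simp
  show "(\<lambda>n. (LINT x|lborel. ?g n x)) \<longlonglongrightarrow> 0" unfolding z by (rule tendsto_const)
  show "(\<lambda>n. (LINT x|lborel. ?g n x)) \<longlonglongrightarrow> (LINT x|lborel. f' x \<bullet> e)"
  proof (rule integral_dominated_convergence)
    show "integrable lborel (\<lambda>x. indicator (cball 0 (R + norm e)) x *\<^sub>R (B * norm e))"
      by (rule borel_integrable_compact) auto
    show "AE x in lborel. (\<lambda>n. ?g n x) \<longlonglongrightarrow> f' x \<bullet> e"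
    proof (rule AE_I2)
      fix x
      have "((\<lambda>h. f (x + h *\<^sub>R e)) has_derivative (\<lambda>h. f' (x + 0 *\<^sub>R e) \<bullet> (h *\<^sub>R e))) (at 0)"
        by (rule has_derivative_compose[of "\<lambda>h. x + h *\<^sub>R e" _ _ _ f])
          (use f1 in \<open>auto intro!: derivative_eq_intros simp: C1_grad_def\<close>)
      then have "((\<lambda>h. f (x + h *\<^sub>R e)) has_real_derivative (f' x \<bullet> e)) (at 0)"
        by (simp add: has_field_derivative_def mult.commute[of _ "f' x \<bullet> e"] mult_commute_abs)
      then have "((\<lambda>h. (f (x + h *\<^sub>R e) - f x) / h) \<longlongrightarrow> f' x \<bullet> e) (at 0)"
        by (simp add: DERIV_def)
      moreover have "filterlim t (at 0) sequentially"
        unfolding filterlim_at using t0 less_imp_neq[OF t(1)] by (auto intro!: always_eventually)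
      ultimately show "(\<lambda>n. ?g n x) \<longlonglongrightarrow> f' x \<bullet> e"
        by (rule filterlim_compose)
    qed
    show "AE x in lborel. norm (?g n x) \<le> indicator (cball 0 (R + norm e)) x *\<^sub>R (B * norm e)" for n
    proof (rule AE_I2)
      fix x
      have "\<bar>f (x + t n *\<^sub>R e) - f x\<bar> \<le> t n * (B * norm e)"
        using C1_grad_lipschitz[OF f1 B(2), of "x + t n *\<^sub>R e" x] t[of n] by (simp add: mult.left_commute)
      moreover have "f (x + t n *\<^sub>R e) - f x = 0" if "x \<notin> cball 0 (R + norm e)"
      proof -
        have "t n * norm e \<le> norm e" using t[of n] by (intro mult_left_le_one_le) auto
        then have "norm (x + t n *\<^sub>R e) > R"
          using norm_diff_ineq[of x "t n *\<^sub>R e"] t[of n] that by simp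
        moreover have "norm x > R"
        proof -
          have "norm x > R + norm e" using that by simp
          then show ?thesis using norm_ge_zero[of e] by linarith
        qed
        ultimately show ?thesis using R[of x] R[of "x + t n *\<^sub>R e"] by linarith
      qed
      ultimately show "norm (?g n x) \<le> indicator (cball 0 (R + norm e)) x *\<^sub>R (B * norm e)"
        using t(1)[of n] by (auto simp: indicator_def field_simps)
    qed
  qed auto
qed

lemma C1_grad_mult:
  assumes "C1_grad f f'" "C1_grad g g'"
  shows "C1_grad (\<lambda>x. f x * g x) (\<lambda>x. g x *\<^sub>R f' x + f x *\<^sub>R g' x)"
proof -
  have "((\<lambda>x. f x * g x) has_derivative (\<lambda>h. (g x *\<^sub>R f' x + f x *\<^sub>R g' x) \<bullet> h)) (at x)" for x
    using assms by (auto simp: C1_grad_def intro!: derivative_eq_intros simp: inner_add_left)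
  then show ?thesis
    using assms C1_grad_continuous[OF assms(1)] C1_grad_continuous[OF assms(2)]
    by (auto simp: C1_grad_def intro!: continuous_intros)
qed

lemma C1c_mult:
  assumes "C1c f f'" "C1_grad g g'"
  shows "C1c (\<lambda>x. f x * g x) (\<lambda>x. g x *\<^sub>R f' x + f x *\<^sub>R g' x)"
proof -
  have "{x. f x * g x \<noteq> 0} \<subseteq> {x. f x \<noteq> 0}" by auto
  then have "bounded {x. f x * g x \<noteq> 0}"
    using assms(1) bounded_subset unfolding C1c_def by blast
  then show ?thesis using assms by (simp add: C1c_def C1_grad_mult)
qed

text \<open>The closure, in the Sobolev norm on the whole space, of the compactly supported continuously
  differentiable functions. The gradient is carried along as a second component, so that no
  representative has to be chosen and the rules of calculus pass to the limit directly.\<close>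

definition W0 :: "('a::euclidean_space \<Rightarrow> real) \<Rightarrow> ('a \<Rightarrow> 'a) \<Rightarrow> bool" where
  "W0 w g \<longleftrightarrow> integrable lborel w \<and> integrable lborel g \<and>
     (\<forall>\<epsilon>>0. \<exists>f f'. C1c f f' \<and> (LINT x|lborel. \<bar>f x - w x\<bar>) < \<epsilon> \<and> (LINT x|lborel. norm (f' x - g x)) < \<epsilon>)"

lemma W0_integrable: "W0 w g \<Longrightarrow> integrable lborel w" "W0 w g \<Longrightarrow> integrable lborel g"
  by (auto simp: W0_def)

lemma W0_sequence:
  assumes "W0 w g"
  obtains f f' where "\<And>n. C1c (f n) (f' n)"
    "(\<lambda>n. LINT x|lborel. \<bar>f n x - w x\<bar>) \<longlonglongrightarrow> 0" "(\<lambda>n. LINT x|lborel. norm (f' n x - g x)) \<longlonglongrightarrow> 0"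
proof -
  have "\<exists>f f'. C1c f f' \<and> (LINT x|lborel. \<bar>f x - w x\<bar>) < inverse (real (Suc n)) \<and> (LINT x|lborel. norm (f' x - g x)) < inverse (real (Suc n))" for n
    using assms by (auto simp: W0_def)
  then obtain f f' where f: "\<And>n. C1c (f n) (f' n)" "\<And>n. (LINT x|lborel. \<bar>f n x - w x\<bar>) < inverse (real (Suc n))"
     "\<And>n. (LINT x|lborel. norm (f' n x - g x)) < inverse (real (Suc n))" by metis
  have l: "(\<lambda>n. inverse (real (Suc n))) \<longlonglongrightarrow> 0" by (rule LIMSEQ_inverse_real_of_nat)
  show ?thesis
  proof (rule that[OF f(1)])
    show "(\<lambda>n. LINT x|lborel. \<bar>f n x - w x\<bar>) \<longlonglongrightarrow> 0"
      by (rule tendsto_sandwich[OF always_eventually always_eventually tendsto_const l])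
        (simp, intro allI less_imp_le[OF f(2)])
    show "(\<lambda>n. LINT x|lborel. norm (f' n x - g x)) \<longlonglongrightarrow> 0"
      by (rule tendsto_sandwich[OF always_eventually always_eventually tendsto_const l])
        (simp, intro allI less_imp_le[OF f(3)])
  qed
qed

lemma W0_I:
  assumes "integrable lborel w" "integrable lborel g" "\<And>n::nat. C1c (f n) (f' n)"
    and l1: "(\<lambda>n. LINT x|lborel. \<bar>f n x - w x\<bar>) \<longlonglongrightarrow> 0" and l2: "(\<lambda>n. LINT x|lborel. norm (f' n x - g x)) \<longlonglongrightarrow> 0"
  shows "W0 w g"
  unfolding W0_def
proof (intro conjI allI impI assms)
  fix e :: real assume "e > 0"
  with order_tendstoD(2)[OF l1] order_tendstoD(2)[OF l2]
  have "\<forall>\<^sub>F n in sequentially. (LINT x|lborel. \<bar>f n x - w x\<bar>) < e \<and> (LINT x|lborel. norm (f' n x - g x)) < e"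
    by (intro eventually_conj) auto
  then obtain n where "(LINT x|lborel. \<bar>f n x - w x\<bar>) < e \<and> (LINT x|lborel. norm (f' n x - g x)) < e"
    by (auto simp: eventually_sequentially)
  then show "\<exists>f f'. C1c f f' \<and> (LINT x|lborel. \<bar>f x - w x\<bar>) < e \<and> (LINT x|lborel. norm (f' x - g x)) < e"
    using assms(3) by blast
qed

lemma integral_scaleR_L1_tendsto:
  fixes h :: "'a::euclidean_space \<Rightarrow> 'b::euclidean_space" and p :: "'a \<Rightarrow> real"
  assumes "\<And>n. integrable lborel (f n)" "integrable lborel h"
    and l: "(\<lambda>n. LINT x|lborel. norm (f n x - h x)) \<longlonglongrightarrow> 0"
    and p: "p \<in> borel_measurable borel" "\<And>x. \<bar>p x\<bar> \<le> B"
  shows "(\<lambda>n. LINT x|lborel. norm (p x *\<^sub>R f n x - p x *\<^sub>R h x)) \<longlonglongrightarrow> 0"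
    "(\<lambda>n. LINT x|lborel. p x *\<^sub>R f n x) \<longlonglongrightarrow> (LINT x|lborel. p x *\<^sub>R h x)"
proof -
  have i: "integrable lborel (\<lambda>x. p x *\<^sub>R f n x)" "integrable lborel (\<lambda>x. p x *\<^sub>R h x)" for n
    using assms by (auto intro!: integrable_scaleR_bounded)
  have le: "(LINT x|lborel. norm (p x *\<^sub>R f n x - p x *\<^sub>R h x)) \<le> B * (LINT x|lborel. norm (f n x - h x))" for n
  proof -
    have "(LINT x|lborel. norm (p x *\<^sub>R f n x - p x *\<^sub>R h x)) \<le> (LINT x|lborel. B * norm (f n x - h x))"
    proof (rule integral_mono)
      show "integrable lborel (\<lambda>x. norm (p x *\<^sub>R f n x - p x *\<^sub>R h x))" using i by auto
      show "integrable lborel (\<lambda>x. B * norm (f n x - h x))" using assms by auto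
      show "norm (p x *\<^sub>R f n x - p x *\<^sub>R h x) \<le> B * norm (f n x - h x)" for x
        using p(2)[of x] by (simp add: scaleR_diff_right[symmetric] mult_right_mono)
    qed
    then show ?thesis by simp
  qed
  show l0: "(\<lambda>n. LINT x|lborel. norm (p x *\<^sub>R f n x - p x *\<^sub>R h x)) \<longlonglongrightarrow> 0"
    by (rule tendsto_sandwich[OF _ _ tendsto_const tendsto_mult_right_zero[OF l, of B]])
      (auto intro!: always_eventually le)
  have "(\<lambda>n. (LINT x|lborel. p x *\<^sub>R f n x) - (LINT x|lborel. p x *\<^sub>R h x)) \<longlonglongrightarrow> 0"
  proof (rule Lim_null_comparison[OF _ l0], intro always_eventually allI)
    fix n
    have "(LINT x|lborel. p x *\<^sub>R f n x) - (LINT x|lborel. p x *\<^sub>R h x) = (LINT x|lborel. p x *\<^sub>R f n x - p x *\<^sub>R h x)"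
      using i by simp
    then show "norm ((LINT x|lborel. p x *\<^sub>R f n x) - (LINT x|lborel. p x *\<^sub>R h x)) \<le> (LINT x|lborel. norm (p x *\<^sub>R f n x - p x *\<^sub>R h x))"
      using integral_norm_bound[of lborel "\<lambda>x. p x *\<^sub>R f n x - p x *\<^sub>R h x"] by simp
  qed
  then show "(\<lambda>n. LINT x|lborel. p x *\<^sub>R f n x) \<longlonglongrightarrow> (LINT x|lborel. p x *\<^sub>R h x)"
    by (simp add: LIM_zero_iff)
qed

lemma W0_integration_by_parts:
  assumes w: "W0 w g" and p: "C1_grad p p'" "\<And>x. \<bar>p x\<bar> \<le> B" "\<And>x. norm (p' x) \<le> B"
  shows "(LINT x|lborel. (p' x \<bullet> e) * w x) = - ((LINT x|lborel. p x *\<^sub>R g x) \<bullet> e)"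
proof -
  obtain f f' where f: "\<And>n. C1c (f n) (f' n)"
    "(\<lambda>n. LINT x|lborel. \<bar>f n x - w x\<bar>) \<longlonglongrightarrow> 0" "(\<lambda>n. LINT x|lborel. norm (f' n x - g x)) \<longlonglongrightarrow> 0"
    using W0_sequence[OF w] by blast
  note pc = C1_grad_continuous[OF p(1), of UNIV]
  have pm: "p \<in> borel_measurable borel" "(\<lambda>x. p' x \<bullet> e) \<in> borel_measurable borel"
    using pc by (auto intro!: borel_measurable_continuous_onI continuous_intros)
  have pb: "\<bar>p' x \<bullet> e\<bar> \<le> B * norm e" for x
    using Cauchy_Schwarz_ineq2[of "p' x" e] mult_right_mono[OF p(3)[of x] norm_ge_zero[of e]] by simp
  have i1: "integrable lborel (\<lambda>x. (p' x \<bullet> e) *\<^sub>R f n x)" and i2: "integrable lborel (\<lambda>x. p x *\<^sub>R f' n x)" for n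
    by (rule integrable_scaleR_bounded[OF C1c_integrable(1)[OF f(1)] _ pb], use pm in simp,
        rule integrable_scaleR_bounded[OF C1c_integrable(2)[OF f(1)] _ p(2)], use pm in simp)
  have "(LINT x|lborel. (p' x \<bullet> e) *\<^sub>R f n x) = - ((LINT x|lborel. p x *\<^sub>R f' n x) \<bullet> e)" for n
  proof -
    have "0 = (LINT x|lborel. (p x *\<^sub>R f' n x + f n x *\<^sub>R p' x) \<bullet> e)"
      using C1c_integral_deriv_zero[OF C1c_mult[OF f(1) p(1)]] by simp
    also have "\<dots> = (LINT x|lborel. p x *\<^sub>R f' n x \<bullet> e + (p' x \<bullet> e) *\<^sub>R f n x)"
      by (simp add: inner_add_left mult.commute)
    also have "\<dots> = (LINT x|lborel. p x *\<^sub>R f' n x \<bullet> e) + (LINT x|lborel. (p' x \<bullet> e) *\<^sub>R f n x)"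
      by (rule Bochner_Integration.integral_add[OF integrable_inner_left[OF i2] i1])
    also have "(LINT x|lborel. p x *\<^sub>R f' n x \<bullet> e) = (LINT x|lborel. p x *\<^sub>R f' n x) \<bullet> e"
      by (rule integral_inner_left) (rule i2)
    finally show ?thesis by simp
  qed
  moreover have "(\<lambda>n. LINT x|lborel. (p' x \<bullet> e) *\<^sub>R f n x) \<longlonglongrightarrow> (LINT x|lborel. (p' x \<bullet> e) *\<^sub>R w x)"
    by (rule integral_scaleR_L1_tendsto(2)[OF C1c_integrable(1)[OF f(1)] W0_integrable(1)[OF w] _ pm(2) pb])
      (use f(2) in simp)
  moreover have "(\<lambda>n. - ((LINT x|lborel. p x *\<^sub>R f' n x) \<bullet> e)) \<longlonglongrightarrow> - ((LINT x|lborel. p x *\<^sub>R g x) \<bullet> e)"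
    by (intro tendsto_intros integral_scaleR_L1_tendsto(2)[OF C1c_integrable(2)[OF f(1)] W0_integrable(2)[OF w] f(3) pm(1) p(2)])
  ultimately show ?thesis using LIMSEQ_unique by fastforce
qed

lemma W0_mult:
  assumes w: "W0 w g" and p: "C1_grad p p'" "\<And>x. \<bar>p x\<bar> \<le> B" "\<And>x. norm (p' x) \<le> B"
  shows "W0 (\<lambda>x. p x * w x) (\<lambda>x. p x *\<^sub>R g x + w x *\<^sub>R p' x)"
proof -
  obtain f f' where f: "\<And>n. C1c (f n) (f' n)"
    "(\<lambda>n. LINT x|lborel. \<bar>f n x - w x\<bar>) \<longlonglongrightarrow> 0" "(\<lambda>n. LINT x|lborel. norm (f' n x - g x)) \<longlonglongrightarrow> 0"
    using W0_sequence[OF w] by blast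
  note pc = C1_grad_continuous[OF p(1), of UNIV]
  have pm: "p \<in> borel_measurable borel" "p' \<in> borel_measurable borel"
    using pc by (auto intro!: borel_measurable_continuous_onI)
  note wi = W0_integrable[OF w]
  have [measurable]: "w \<in> borel_measurable borel" using wi by simp
  have *: "integrable lborel (\<lambda>x. v x *\<^sub>R p' x)" if "integrable lborel v" for v :: "'a \<Rightarrow> real"
  proof (rule Bochner_Integration.integrable_bound[where f="\<lambda>x. B * v x"])
    have [measurable]: "v \<in> borel_measurable borel" using that by simp
    show "(\<lambda>x. v x *\<^sub>R p' x) \<in> borel_measurable lborel" using pm by simp
    show "AE x in lborel. norm (v x *\<^sub>R p' x) \<le> norm (B * v x)"
    proof (rule AE_I2)
      fix x have "\<bar>B\<bar> \<ge> norm (p' x)" using p(3)[of x] by simp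
      then show "norm (v x *\<^sub>R p' x) \<le> norm (B * v x)"
        by (simp add: abs_mult mult.commute[of "\<bar>v x\<bar>"] mult_right_mono)
    qed
  qed (use that in auto)
  have i1: "integrable lborel (\<lambda>x. p x *\<^sub>R w x)" "integrable lborel (\<lambda>x. p x *\<^sub>R g x)"
    "integrable lborel (\<lambda>x. p x *\<^sub>R f n x)" "integrable lborel (\<lambda>x. p x *\<^sub>R f' n x)" for n
    using pm by (simp_all only: measurable_lborel2 integrable_scaleR_bounded[OF _ _ p(2)] C1c_integrable[OF f(1)] wi)
  show ?thesis
  proof (rule W0_I[where f="\<lambda>n x. f n x * p x" and f'="\<lambda>n x. p x *\<^sub>R f' n x + f n x *\<^sub>R p' x"])
    show "integrable lborel (\<lambda>x. p x * w x)" using i1(1) by simp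
    show "integrable lborel (\<lambda>x. p x *\<^sub>R g x + w x *\<^sub>R p' x)"
      using i1(2) *[OF wi(1)] by (rule Bochner_Integration.integrable_add)
    show "C1c (\<lambda>x. f n x * p x) (\<lambda>x. p x *\<^sub>R f' n x + f n x *\<^sub>R p' x)" for n
      by (rule C1c_mult[OF f(1) p(1)])
    show "(\<lambda>n. LINT x|lborel. \<bar>f n x * p x - p x * w x\<bar>) \<longlonglongrightarrow> 0"
      using integral_scaleR_L1_tendsto(1)[OF C1c_integrable(1)[OF f(1)] wi(1) _ pm(1) p(2)] f(2)
      by (simp add: mult.commute)
    have l1: "(\<lambda>n. LINT x|lborel. norm (p x *\<^sub>R f' n x - p x *\<^sub>R g x)) \<longlonglongrightarrow> 0"
      by (rule integral_scaleR_L1_tendsto(1)[OF C1c_integrable(2)[OF f(1)] wi(2) f(3) pm(1) p(2)])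
    show "(\<lambda>n. LINT x|lborel. norm (p x *\<^sub>R f' n x + f n x *\<^sub>R p' x - (p x *\<^sub>R g x + w x *\<^sub>R p' x))) \<longlonglongrightarrow> 0"
    proof (rule tendsto_sandwich[OF _ _ tendsto_const])
      show "(\<lambda>n. (LINT x|lborel. norm (p x *\<^sub>R f' n x - p x *\<^sub>R g x)) + B * (LINT x|lborel. \<bar>f n x - w x\<bar>)) \<longlonglongrightarrow> 0"
        using tendsto_add[OF l1 tendsto_mult_right_zero[OF f(2), of B]] by simp
      show "\<forall>\<^sub>F n in sequentially. (LINT x|lborel. norm (p x *\<^sub>R f' n x + f n x *\<^sub>R p' x - (p x *\<^sub>R g x + w x *\<^sub>R p' x)))
         \<le> (LINT x|lborel. norm (p x *\<^sub>R f' n x - p x *\<^sub>R g x)) + B * (LINT x|lborel. \<bar>f n x - w x\<bar>)"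
      proof (intro always_eventually allI)
        fix n
        have ia: "integrable lborel (\<lambda>x. norm (p x *\<^sub>R f' n x - p x *\<^sub>R g x))" "integrable lborel (\<lambda>x. B * \<bar>f n x - w x\<bar>)"
          using i1 wi C1c_integrable(1)[OF f(1)] by auto
        have "(LINT x|lborel. norm (p x *\<^sub>R f' n x + f n x *\<^sub>R p' x - (p x *\<^sub>R g x + w x *\<^sub>R p' x)))
          \<le> (LINT x|lborel. norm (p x *\<^sub>R f' n x - p x *\<^sub>R g x) + B * \<bar>f n x - w x\<bar>)"
        proof (rule integral_mono)
          show "integrable lborel (\<lambda>x. norm (p x *\<^sub>R f' n x + f n x *\<^sub>R p' x - (p x *\<^sub>R g x + w x *\<^sub>R p' x)))"
            by (intro integrable_norm Bochner_Integration.integrable_diff Bochner_Integration.integrable_add i1 * wi C1c_integrable(1)[OF f(1)])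
          show "integrable lborel (\<lambda>x. norm (p x *\<^sub>R f' n x - p x *\<^sub>R g x) + B * \<bar>f n x - w x\<bar>)"
            by (rule Bochner_Integration.integrable_add[OF ia])
          fix x
          have "norm ((f n x - w x) *\<^sub>R p' x) \<le> B * \<bar>f n x - w x\<bar>"
            using mult_right_mono[OF p(3)[of x], of "\<bar>f n x - w x\<bar>"] by (simp add: mult.commute)
          moreover have eq: "p x *\<^sub>R f' n x + f n x *\<^sub>R p' x - (p x *\<^sub>R g x + w x *\<^sub>R p' x) = (p x *\<^sub>R f' n x - p x *\<^sub>R g x) + (f n x - w x) *\<^sub>R p' x"
            by (simp add: algebra_simps)
          ultimately show "norm (p x *\<^sub>R f' n x + f n x *\<^sub>R p' x - (p x *\<^sub>R g x + w x *\<^sub>R p' x)) \<le> norm (p x *\<^sub>R f' n x - p x *\<^sub>R g x) + B * \<bar>f n x - w x\<bar>"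
            unfolding eq using norm_triangle_ineq[of "p x *\<^sub>R f' n x - p x *\<^sub>R g x" "(f n x - w x) *\<^sub>R p' x"] by linarith
        qed
        also have "\<dots> = (LINT x|lborel. norm (p x *\<^sub>R f' n x - p x *\<^sub>R g x)) + B * (LINT x|lborel. \<bar>f n x - w x\<bar>)"
          using ia by simp
        finally show "(LINT x|lborel. norm (p x *\<^sub>R f' n x + f n x *\<^sub>R p' x - (p x *\<^sub>R g x + w x *\<^sub>R p' x)))
         \<le> (LINT x|lborel. norm (p x *\<^sub>R f' n x - p x *\<^sub>R g x)) + B * (LINT x|lborel. \<bar>f n x - w x\<bar>)" .
      qed
    qed simp
  qed
qed

lemma C1_grad_compose:
  assumes f: "C1_grad f f'" and S: "\<And>s. (S has_real_derivative S' s) (at s)" "continuous_on UNIV S'"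
  shows "C1_grad (\<lambda>x. S (f x)) (\<lambda>x. S' (f x) *\<^sub>R f' x)"
proof -
  have "((\<lambda>x. S (f x)) has_derivative (\<lambda>h. (S' (f x) *\<^sub>R f' x) \<bullet> h)) (at x)" for x
    using DERIV_compose_FDERIV[OF S(1), of f "\<lambda>h. f' x \<bullet> h" x UNIV] f
    by (simp add: C1_grad_def mult.commute)
  moreover have "continuous_on UNIV (\<lambda>x. S' (f x) *\<^sub>R f' x)"
    by (intro continuous_intros continuous_on_compose2[OF S(2)] C1_grad_continuous[OF f]) auto
  ultimately show ?thesis unfolding C1_grad_def by blast
qed

lemma C1c_compose:
  assumes f: "C1c f f'" and S: "\<And>s. (S has_real_derivative S' s) (at s)" "continuous_on UNIV S'" "S 0 = 0"
  shows "C1c (\<lambda>x. S (f x)) (\<lambda>x. S' (f x) *\<^sub>R f' x)"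
proof -
  have "{x. S (f x) \<noteq> 0} \<subseteq> {x. f x \<noteq> 0}" using S(3) by auto
  then show ?thesis using f C1_grad_compose[OF _ S(1,2)] bounded_subset unfolding C1c_def by blast
qed

lemma L1_tendsto_zero_dominated:
  fixes u :: "nat \<Rightarrow> 'a \<Rightarrow> 'b::{banach,second_countable_topology}"
  assumes "\<And>n. u n \<in> borel_measurable M" "integrable M v" "\<And>n x. norm (u n x) \<le> v x"
    and "AE x in M. (\<lambda>n. u n x) \<longlonglongrightarrow> 0"
  shows "(\<lambda>n. LINT x|M. norm (u n x)) \<longlonglongrightarrow> 0"
proof -
  have "(\<lambda>n. LINT x|M. norm (u n x)) \<longlonglongrightarrow> (LINT x|M. 0)"
    by (rule integral_dominated_convergence[where w=v])
      (use assms in \<open>auto intro: tendsto_norm_zero elim: eventually_mono\<close>)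
  then show ?thesis by simp
qed

text \<open>The chain rule. With approximants \<open>f n\<close> of \<open>w\<close>, the difference of the gradients is
  \<open>S' (f n) (f' n - g) + (S' (f n) - S' w) g\<close>. The first term is small as \<open>S'\<close> is bounded. The second
  tends to zero by dominated convergence, which needs pointwise convergence and therefore a
  subsequence.\<close>

lemma W0_compose:
  assumes w: "W0 w g" and S: "\<And>s. (S has_real_derivative S' s) (at s)" "continuous_on UNIV S'" "S 0 = 0"
    and B: "\<And>s. \<bar>S' s\<bar> \<le> B"
  shows "W0 (\<lambda>x. S (w x)) (\<lambda>x. S' (w x) *\<^sub>R g x)"
proof -
  obtain f0 f0' where f0: "\<And>n. C1c (f0 n) (f0' n)"
    "(\<lambda>n. LINT x|lborel. \<bar>f0 n x - w x\<bar>) \<longlonglongrightarrow> 0" "(\<lambda>n. LINT x|lborel. norm (f0' n x - g x)) \<longlonglongrightarrow> 0"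
    using W0_sequence[OF w] by blast
  note wi = W0_integrable[OF w]
  have [measurable]: "w \<in> borel_measurable borel" "g \<in> borel_measurable borel" using wi by auto
  have Sc: "continuous_on UNIV S" by (intro continuous_at_imp_continuous_on ballI DERIV_isCont[OF S(1)])
  have [measurable]: "S \<in> borel_measurable borel" "S' \<in> borel_measurable borel"
    using Sc S(2) by (auto intro: borel_measurable_continuous_onI)
  have "\<exists>r. strict_mono r \<and> (AE x in lborel. (\<lambda>n. f0 (r n) x - w x) \<longlonglongrightarrow> 0)"
    by (rule tendsto_L1_AE_subseq[of lborel "\<lambda>n x. f0 n x - w x"])
      (use C1c_integrable(1)[OF f0(1)] wi f0(2) in auto)
  then obtain r :: "nat \<Rightarrow> nat" where r: "strict_mono r" "AE x in lborel. (\<lambda>n. f0 (r n) x - w x) \<longlonglongrightarrow> 0" by blast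
  define f where "f n = f0 (r n)" for n
  define f' where "f' n = f0' (r n)" for n
  have f: "\<And>n. C1c (f n) (f' n)" using f0(1) by (simp add: f_def f'_def)
  have fl: "(\<lambda>n. LINT x|lborel. \<bar>f n x - w x\<bar>) \<longlonglongrightarrow> 0" "(\<lambda>n. LINT x|lborel. norm (f' n x - g x)) \<longlonglongrightarrow> 0"
    using LIMSEQ_subseq_LIMSEQ[OF f0(2) r(1)] LIMSEQ_subseq_LIMSEQ[OF f0(3) r(1)] by (auto simp: f_def f'_def o_def)
  note fi = C1c_integrable[OF f]
  have [measurable]: "f n \<in> borel_measurable borel" "f' n \<in> borel_measurable borel" for n using fi by auto
  have Slip: "\<bar>S a - S b\<bar> \<le> B * \<bar>a - b\<bar>" for a b
    using field_differentiable_bound[of UNIV S S' B a b] S(1) B by auto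
  have Sle: "\<bar>S a\<bar> \<le> B * \<bar>a\<bar>" for a using Slip[of a 0] S(3) by simp
  have B0: "B \<ge> 0" using B[of 0] by linarith
  have i1: "integrable lborel (\<lambda>x. S (v x))" if "integrable lborel v" for v :: "'a \<Rightarrow> real"
  proof (rule Bochner_Integration.integrable_bound[where f="\<lambda>x. B * v x"])
    show "(\<lambda>x. S (v x)) \<in> borel_measurable lborel" using that by simp
    show "AE x in lborel. norm (S (v x)) \<le> norm (B * v x)" using Sle B0 by (simp add: abs_mult)
  qed (use that in auto)
  have i2: "integrable lborel (\<lambda>x. S' (v x) *\<^sub>R h x)" if "v \<in> borel_measurable borel" "integrable lborel h"
    for v :: "'a \<Rightarrow> real" and h :: "'a \<Rightarrow> 'a"
    by (rule integrable_scaleR_bounded[OF that(2) _ B]) (use that(1) in measurable)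
  show ?thesis
  proof (rule W0_I[where f="\<lambda>n x. S (f n x)" and f'="\<lambda>n x. S' (f n x) *\<^sub>R f' n x"])
    show "integrable lborel (\<lambda>x. S (w x))" by (rule i1[OF wi(1)])
    show "integrable lborel (\<lambda>x. S' (w x) *\<^sub>R g x)" by (rule i2[OF _ wi(2)]) simp
    show "C1c (\<lambda>x. S (f n x)) (\<lambda>x. S' (f n x) *\<^sub>R f' n x)" for n by (rule C1c_compose[OF f S])
    show "(\<lambda>n. LINT x|lborel. \<bar>S (f n x) - S (w x)\<bar>) \<longlonglongrightarrow> 0"
    proof (rule tendsto_sandwich[OF _ _ tendsto_const tendsto_mult_right_zero[OF fl(1), of B]])
      show "\<forall>\<^sub>F n in sequentially. (LINT x|lborel. \<bar>S (f n x) - S (w x)\<bar>) \<le> B * (LINT x|lborel. \<bar>f n x - w x\<bar>)"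
      proof (intro always_eventually allI)
        fix n
        have "(LINT x|lborel. \<bar>S (f n x) - S (w x)\<bar>) \<le> (LINT x|lborel. B * \<bar>f n x - w x\<bar>)"
          by (rule integral_mono) (use i1[OF fi(1)] i1[OF wi(1)] fi wi Slip in auto)
        then show "(LINT x|lborel. \<bar>S (f n x) - S (w x)\<bar>) \<le> B * (LINT x|lborel. \<bar>f n x - w x\<bar>)" by simp
      qed
    qed simp
    have l2: "(\<lambda>n. LINT x|lborel. norm (S' (f n x) *\<^sub>R g x - S' (w x) *\<^sub>R g x)) \<longlonglongrightarrow> 0"
    proof (rule L1_tendsto_zero_dominated[where v="\<lambda>x. 2 * B * norm (g x)"])
      show "integrable lborel (\<lambda>x. 2 * B * norm (g x))" using wi by auto
      show "norm (S' (f n x) *\<^sub>R g x - S' (w x) *\<^sub>R g x) \<le> 2 * B * norm (g x)" for n x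
      proof -
        have "\<bar>S' (f n x) - S' (w x)\<bar> \<le> 2 * B" using B[of "f n x"] B[of "w x"] by linarith
        then show ?thesis by (simp add: scaleR_diff_left[symmetric] mult_right_mono)
      qed
      show "AE x in lborel. (\<lambda>n. S' (f n x) *\<^sub>R g x - S' (w x) *\<^sub>R g x) \<longlonglongrightarrow> 0"
        using r(2)
      proof eventually_elim
        fix x assume "(\<lambda>n. f0 (r n) x - w x) \<longlonglongrightarrow> 0"
        then have "(\<lambda>n. f n x) \<longlonglongrightarrow> w x" by (simp add: f_def LIM_zero_iff)
        moreover have "isCont S' (w x)" using S(2) by (simp add: continuous_on_eq_continuous_at)
        ultimately have "(\<lambda>n. S' (f n x)) \<longlonglongrightarrow> S' (w x)" by (rule isCont_tendsto_compose[rotated])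
        then have "(\<lambda>n. S' (f n x) *\<^sub>R g x) \<longlonglongrightarrow> S' (w x) *\<^sub>R g x" by (intro tendsto_intros)
        then show "(\<lambda>n. S' (f n x) *\<^sub>R g x - S' (w x) *\<^sub>R g x) \<longlonglongrightarrow> 0" by (simp add: LIM_zero)
      qed
    qed measurable
    show "(\<lambda>n. LINT x|lborel. norm (S' (f n x) *\<^sub>R f' n x - S' (w x) *\<^sub>R g x)) \<longlonglongrightarrow> 0"
    proof (rule tendsto_sandwich[OF _ _ tendsto_const])
      show "(\<lambda>n. B * (LINT x|lborel. norm (f' n x - g x)) + (LINT x|lborel. norm (S' (f n x) *\<^sub>R g x - S' (w x) *\<^sub>R g x))) \<longlonglongrightarrow> 0"
        using tendsto_add[OF tendsto_mult_right_zero[OF fl(2), of B] l2] by simp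
      show "\<forall>\<^sub>F n in sequentially. (LINT x|lborel. norm (S' (f n x) *\<^sub>R f' n x - S' (w x) *\<^sub>R g x))
        \<le> B * (LINT x|lborel. norm (f' n x - g x)) + (LINT x|lborel. norm (S' (f n x) *\<^sub>R g x - S' (w x) *\<^sub>R g x))"
      proof (intro always_eventually allI)
        fix n
        have ia: "integrable lborel (\<lambda>x. B * norm (f' n x - g x))" "integrable lborel (\<lambda>x. norm (S' (f n x) *\<^sub>R g x - S' (w x) *\<^sub>R g x))"
          using fi wi i2[OF _ wi(2)] by auto
        have "(LINT x|lborel. norm (S' (f n x) *\<^sub>R f' n x - S' (w x) *\<^sub>R g x)) \<le>
          (LINT x|lborel. B * norm (f' n x - g x) + norm (S' (f n x) *\<^sub>R g x - S' (w x) *\<^sub>R g x))"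
        proof (rule integral_mono)
          show "integrable lborel (\<lambda>x. norm (S' (f n x) *\<^sub>R f' n x - S' (w x) *\<^sub>R g x))"
            by (intro integrable_norm Bochner_Integration.integrable_diff i2 wi fi) auto
          show "integrable lborel (\<lambda>x. B * norm (f' n x - g x) + norm (S' (f n x) *\<^sub>R g x - S' (w x) *\<^sub>R g x))"
            by (rule Bochner_Integration.integrable_add[OF ia])
          fix x
          have "norm (S' (f n x) *\<^sub>R (f' n x - g x)) \<le> B * norm (f' n x - g x)"
            using B[of "f n x"] by (simp add: mult_right_mono)
          moreover have eq: "S' (f n x) *\<^sub>R f' n x - S' (w x) *\<^sub>R g x =
            S' (f n x) *\<^sub>R (f' n x - g x) + (S' (f n x) *\<^sub>R g x - S' (w x) *\<^sub>R g x)" by (simp add: algebra_simps)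
          ultimately show "norm (S' (f n x) *\<^sub>R f' n x - S' (w x) *\<^sub>R g x) \<le> B * norm (f' n x - g x) + norm (S' (f n x) *\<^sub>R g x - S' (w x) *\<^sub>R g x)"
            unfolding eq using norm_triangle_ineq[of "S' (f n x) *\<^sub>R (f' n x - g x)" "S' (f n x) *\<^sub>R g x - S' (w x) *\<^sub>R g x"] by linarith
        qed
        also have "\<dots> = B * (LINT x|lborel. norm (f' n x - g x)) + (LINT x|lborel. norm (S' (f n x) *\<^sub>R g x - S' (w x) *\<^sub>R g x))"
          by (subst Bochner_Integration.integral_add[OF ia]) simp
        finally show "(LINT x|lborel. norm (S' (f n x) *\<^sub>R f' n x - S' (w x) *\<^sub>R g x))
        \<le> B * (LINT x|lborel. norm (f' n x - g x)) + (LINT x|lborel. norm (S' (f n x) *\<^sub>R g x - S' (w x) *\<^sub>R g x))" .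
      qed
    qed simp
  qed
qed

text \<open>Mollification commutes with the gradient: integrate by parts against the reflected kernel.\<close>

lemma conv_grad_W0:
  assumes w: "W0 w g" and k: "C1c k k'"
  shows "conv (\<lambda>z. k' z \<bullet> h) w x = conv k g x \<bullet> h"
proof -
  have k1: "C1_grad k k'" using k by (simp add: C1c_def)
  obtain B where B: "\<And>x. \<bar>k x\<bar> \<le> B" "\<And>x. norm (k' x) \<le> B" using C1c_bounded[OF k] by metis
  have "C1_grad (\<lambda>y. k (x - y)) (\<lambda>y. - k' (x - y))"
  proof -
    have "((\<lambda>y. k (x - y)) has_derivative (\<lambda>h. - k' (x - y) \<bullet> h)) (at y)" for y
    proof -
      have "((\<lambda>y. x - y) has_derivative (\<lambda>h. - h)) (at y)" by (auto intro!: derivative_eq_intros)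
      from has_derivative_compose[OF this, of k "\<lambda>h. k' (x - y) \<bullet> h"] k1
      show ?thesis by (simp add: C1_grad_def)
    qed
    moreover have "continuous_on UNIV (\<lambda>y. - k' (x - y))"
      by (intro continuous_intros continuous_on_compose2[OF C1_grad_continuous(2)[OF k1]]) auto
    ultimately show ?thesis by (simp add: C1_grad_def)
  qed
  from W0_integration_by_parts[OF w this, of B h] B
  have "(LINT y|lborel. (- k' (x - y) \<bullet> h) * w y) = - ((LINT y|lborel. k (x - y) *\<^sub>R g y) \<bullet> h)" by simp
  then show ?thesis by (simp add: conv_def)
qed

lemma grad_conv:
  assumes w: "W0 w g" and k: "C1c k k'"
  shows "grad (conv k w) x = conv k g x" "(conv k w has_derivative (\<lambda>h. conv k g x \<bullet> h)) (at x)"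
proof -
  show d: "(conv k w has_derivative (\<lambda>h. conv k g x \<bullet> h)) (at x)"
    using conv_has_derivative[OF k W0_integrable(1)[OF w], of x] conv_grad_W0[OF w k] by simp
  have "frechet_derivative (conv k w) (at x) = (\<lambda>h. conv k g x \<bullet> h)"
    using frechet_derivative_at[OF d] by metis
  then show "grad (conv k w) x = conv k g x"
    by (simp add: grad_def euclidean_representation)
qed

text \<open>The derivative is moved to the kernel. As \<open>k'\<close> has mean zero, the value \<open>w x\<close> can be subtracted,
  and only the oscillation of \<open>w\<close> on the scale of the kernel matters. Testing with the vector
  \<open>v = conv k g x\<close> itself turns the bound for each direction into one for the norm.\<close>

lemma conv_grad_bound:
  assumes w: "W0 w g" and k: "C1c k k'"
    and supp: "\<And>z. k' z \<noteq> 0 \<Longrightarrow> norm z \<le> d"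
    and osc: "\<And>y. norm (x - y) \<le> d \<Longrightarrow> \<bar>w y - w x\<bar> \<le> E" and E: "E \<ge> 0"
  shows "norm (conv k g x) \<le> E * (LINT z|lborel. norm (k' z))"
proof -
  define v where "v = conv k g x"
  have k1: "C1_grad k k'" using k by (simp add: C1c_def)
  obtain B where B: "\<And>x. \<bar>k x\<bar> \<le> B" "\<And>x. norm (k' x) \<le> B" using C1c_bounded[OF k] by metis
  have [measurable]: "k' \<in> borel_measurable borel" using C1c_integrable[OF k] by simp
  have [measurable]: "w \<in> borel_measurable borel" using W0_integrable[OF w] by simp
  have ik: "integrable lborel (\<lambda>y. k' (x - y))"
    using lborel_integrable_affine[OF C1c_integrable(2)[OF k], of "-1" x] by simp
  have ik0: "(LINT y|lborel. k' (x - y) \<bullet> v) = 0"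
    using lborel_integral_affine[of "\<lambda>y. k' y \<bullet> v" "-1" x] C1c_integral_deriv_zero[OF k] by simp
  have i1: "integrable lborel (\<lambda>y. (k' (x - y) \<bullet> v) *\<^sub>R w y)"
  proof (rule conv_integrable[OF _ _ W0_integrable(1)[OF w]])
    show "continuous_on UNIV (\<lambda>z. k' z \<bullet> v)" using C1_grad_continuous[OF k1] by (intro continuous_intros) auto
    show "\<bar>k' z \<bullet> v\<bar> \<le> B * norm v" for z
      using Cauchy_Schwarz_ineq2[of "k' z" v] mult_right_mono[OF B(2)[of z] norm_ge_zero[of v]] by simp
  qed
  have i2: "integrable lborel (\<lambda>y. (k' (x - y) \<bullet> v) * w x)"
    using ik by auto
  have "norm v ^ 2 = conv (\<lambda>z. k' z \<bullet> v) w x"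
    using conv_grad_W0[OF w k] by (simp add: v_def power2_norm_eq_inner)
  also have "\<dots> = (LINT y|lborel. (k' (x - y) \<bullet> v) *\<^sub>R w y) - (LINT y|lborel. (k' (x - y) \<bullet> v) * w x)"
    using ik0 by (simp add: conv_def)
  also have "\<dots> = (LINT y|lborel. (k' (x - y) \<bullet> v) *\<^sub>R w y - (k' (x - y) \<bullet> v) * w x)"
    by (rule Bochner_Integration.integral_diff[symmetric, OF i1 i2])
  also have "\<dots> \<le> (LINT y|lborel. norm (k' (x - y)) * (norm v * E))"
  proof (rule integral_mono)
    show "integrable lborel (\<lambda>y. (k' (x - y) \<bullet> v) *\<^sub>R w y - (k' (x - y) \<bullet> v) * w x)"
      by (rule Bochner_Integration.integrable_diff[OF i1 i2])
    show "integrable lborel (\<lambda>y. norm (k' (x - y)) * (norm v * E))" using ik by auto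
    fix y
    have "(k' (x - y) \<bullet> v) * (w y - w x) \<le> \<bar>k' (x - y) \<bullet> v\<bar> * \<bar>w y - w x\<bar>"
      by (metis abs_ge_self abs_mult)
    also have "\<dots> \<le> (norm (k' (x - y)) * norm v) * E"
    proof (cases "k' (x - y) = 0")
      case False
      then show ?thesis using supp[of "x - y"] osc[of y] Cauchy_Schwarz_ineq2[of "k' (x - y)" v] E
        by (intro mult_mono) auto
    qed simp
    finally show "(k' (x - y) \<bullet> v) *\<^sub>R w y - (k' (x - y) \<bullet> v) * w x \<le> norm (k' (x - y)) * (norm v * E)"
      by (simp add: algebra_simps)
  qed
  also have "\<dots> = (norm v * E) * (LINT y|lborel. norm (k' (x - y)))" by simp
  also have "(LINT y|lborel. norm (k' (x - y))) = (LINT z|lborel. norm (k' z))"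
    using lborel_integral_affine[of "\<lambda>z. norm (k' z)" "-1" x] by simp
  finally have "norm v * norm v \<le> norm v * (E * (LINT z|lborel. norm (k' z)))"
    by (simp add: power2_eq_square mult.assoc)
  moreover have "E * (LINT z|lborel. norm (k' z)) \<ge> 0" using E by simp
  ultimately have "norm v \<le> E * (LINT z|lborel. norm (k' z))"
    by (cases "norm v = 0") (auto simp del: norm_eq_zero simp: mult_le_cancel_left)
  then show ?thesis by (simp add: v_def)
qed

section \<open>Weak gradients and extension by zero\<close>

text \<open>Sobolev functions on \<open>\<Omega>\<close> are measurable for the completed measure on \<open>\<Omega>\<close>, while mollification
  takes place on the whole space with Borel functions. A Borel function that vanishes off \<open>\<Omega>\<close> has the
  same integrals in both settings.\<close>

lemma lebesgue_on_borel_transfer: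
  fixes f :: "'a::euclidean_space \<Rightarrow> 'b::euclidean_space"
  assumes \<Omega>: "open \<Omega>" and f: "f \<in> borel_measurable borel" "\<And>x. x \<notin> \<Omega> \<Longrightarrow> f x = 0"
  shows "integrable (lebesgue_on \<Omega>) f \<longleftrightarrow> integrable lborel f"
    "(LINT x|lebesgue_on \<Omega>. f x) = (LINT x|lborel. f x)"
    "(\<integral>\<^sup>+x. ennreal (norm (f x)) \<partial>lebesgue_on \<Omega>) = (\<integral>\<^sup>+x. ennreal (norm (f x)) \<partial>lborel)"
proof -
  have s: "\<Omega> \<inter> space lebesgue \<in> sets lebesgue" using \<Omega> by simp
  have e: "(\<lambda>x. indicator \<Omega> x *\<^sub>R f x) = f" using f(2) by (auto simp: indicator_def)
  have e2: "(\<lambda>x. ennreal (norm (f x)) * indicator \<Omega> x) = (\<lambda>x. ennreal (norm (f x)))"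
    using f(2) by (auto simp: indicator_def)
  have m: "f \<in> borel_measurable lborel" using f(1) by simp
  show "integrable (lebesgue_on \<Omega>) f \<longleftrightarrow> integrable lborel f"
    unfolding integrable_restrict_space[OF s] e integrable_completion[OF m] ..
  show "(LINT x|lebesgue_on \<Omega>. f x) = (LINT x|lborel. f x)"
    unfolding integral_restrict_space[OF s] e integral_completion[OF m] ..
  show "(\<integral>\<^sup>+x. ennreal (norm (f x)) \<partial>lebesgue_on \<Omega>) = (\<integral>\<^sup>+x. ennreal (norm (f x)) \<partial>lborel)"
    unfolding nn_integral_restrict_space[OF s] e2 nn_integral_completion ..
qed

lemma AE_lebesgue_on_iff:
  "open \<Omega> \<Longrightarrow> (AE x in lebesgue_on \<Omega>. P x) \<longleftrightarrow> (AE x in lborel. x \<in> \<Omega> \<longrightarrow> P x)"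
  by (subst AE_restrict_space_iff) (auto simp: AE_completion_iff)

lemma borel_measurable_ex_vector:
  fixes f :: "'a::euclidean_space \<Rightarrow> 'b::euclidean_space"
  assumes "f \<in> borel_measurable lebesgue"
  shows "\<exists>f'\<in>borel_measurable borel. (AE x in lborel. f x = f' x)"
proof -
  have "\<forall>e. \<exists>g. g \<in> borel_measurable lborel \<and> (AE x in lborel. f x \<bullet> e = g x)"
  proof
    fix e :: 'b
    have "(\<lambda>x. f x \<bullet> e) \<in> borel_measurable lebesgue" using assms by simp
    from completion_ex_borel_measurable_real[OF this]
    show "\<exists>g. g \<in> borel_measurable lborel \<and> (AE x in lborel. f x \<bullet> e = g x)" unfolding Bex_def .
  qed
  from choice[OF this] obtain g where "\<forall>e. g e \<in> borel_measurable lborel \<and> (AE x in lborel. f x \<bullet> e = g e x)" ..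
  then have g: "\<And>e. g e \<in> borel_measurable lborel" "\<And>e. AE x in lborel. f x \<bullet> e = g e x" by blast+
  have "(\<lambda>x. \<Sum>e\<in>Basis. g e x *\<^sub>R e) \<in> borel_measurable borel"
  proof (rule borel_measurable_sum)
    fix e :: 'b
    have [measurable]: "g e \<in> borel_measurable borel" using g(1)[of e] by simp
    show "(\<lambda>x. g e x *\<^sub>R e) \<in> borel_measurable borel" by simp
  qed
  moreover have "AE x in lborel. \<forall>e\<in>Basis. f x \<bullet> e = g e x"
    by (rule AE_finite_allI) (auto intro: g(2))
  then have "AE x in lborel. f x = (\<Sum>e\<in>Basis. g e x *\<^sub>R e)"
  proof eventually_elim
    fix x assume "\<forall>e\<in>Basis. f x \<bullet> e = g e x"
    then have "(\<Sum>e\<in>Basis. g e x *\<^sub>R e) = (\<Sum>e\<in>Basis. (f x \<bullet> e) *\<^sub>R e)" by (intro sum.cong) auto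
    then show "f x = (\<Sum>e\<in>Basis. g e x *\<^sub>R e)" by (simp add: euclidean_representation)
  qed
  ultimately show ?thesis by (intro bexI)
qed

lemma borel_representative:
  fixes f :: "'a::euclidean_space \<Rightarrow> 'b::euclidean_space"
  assumes \<Omega>: "open \<Omega>" and f: "f \<in> borel_measurable (lebesgue_on \<Omega>)"
  obtains g where "g \<in> borel_measurable borel" "\<And>x. x \<notin> \<Omega> \<Longrightarrow> g x = 0"
    "AE x in lebesgue_on \<Omega>. f x = g x"
proof -
  have s: "\<Omega> \<inter> space lebesgue \<in> sets lebesgue" using \<Omega> by simp
  have "(\<lambda>x. indicator \<Omega> x *\<^sub>R f x) \<in> borel_measurable lebesgue"
    using f unfolding borel_measurable_restrict_space_iff[OF s] .
  from borel_measurable_ex_vector[OF this]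
  obtain g where g: "g \<in> borel_measurable borel" "AE x in lborel. indicator \<Omega> x *\<^sub>R f x = g x" by blast
  have [measurable]: "\<Omega> \<in> sets borel" using \<Omega> by simp
  show ?thesis
  proof (rule that[of "\<lambda>x. indicator \<Omega> x *\<^sub>R g x"])
    show "(\<lambda>x. indicator \<Omega> x *\<^sub>R g x) \<in> borel_measurable borel" using g(1) by measurable
    show "AE x in lebesgue_on \<Omega>. f x = indicator \<Omega> x *\<^sub>R g x"
      unfolding AE_lebesgue_on_iff[OF \<Omega>] using g(2) by eventually_elim auto
  qed auto
qed

lemma borel_representative_integrable:
  fixes f :: "'a::euclidean_space \<Rightarrow> 'b::euclidean_space"
  assumes \<Omega>: "open \<Omega>" and f: "integrable (lebesgue_on \<Omega>) f"
  obtains g where "g \<in> borel_measurable borel" "\<And>x. x \<notin> \<Omega> \<Longrightarrow> g x = 0"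
    "AE x in lebesgue_on \<Omega>. f x = g x" "integrable lborel g"
proof -
  obtain g where g: "g \<in> borel_measurable borel" "\<And>x. x \<notin> \<Omega> \<Longrightarrow> g x = 0"
    "AE x in lebesgue_on \<Omega>. f x = g x"
    using borel_representative[OF \<Omega> borel_measurable_integrable[OF f]] by blast
  have "g \<in> borel_measurable (lebesgue_on \<Omega>)"
    by (intro measurable_restrict_space1 measurable_completion) (use g(1) in simp)
  then have "integrable (lebesgue_on \<Omega>) g"
    using integrable_cong_AE[OF _ _ g(3)] f by (simp add: borel_measurable_integrable)
  then show ?thesis using that[OF g(1,2,3)] lebesgue_on_borel_transfer(1)[OF \<Omega> g(1,2)] by blast
qed

lemma test_functionsD:
  assumes "\<phi> \<in> test_functions \<Omega>"
  shows "smooth \<phi>" "compact (closure {x. \<phi> x \<noteq> 0})" "closure {x. \<phi> x \<noteq> 0} \<subseteq> \<Omega>" "C1c \<phi> (grad \<phi>)"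
    "\<And>x. x \<notin> \<Omega> \<Longrightarrow> \<phi> x = 0" "\<And>x. x \<notin> \<Omega> \<Longrightarrow> grad \<phi> x = 0"
proof -
  show 1: "smooth \<phi>" "compact (closure {x. \<phi> x \<noteq> 0})" "closure {x. \<phi> x \<noteq> 0} \<subseteq> \<Omega>"
    using assms by (auto simp: test_functions_def smooth_def)
  have "bounded {x. \<phi> x \<noteq> 0}"
    using bounded_subset[OF compact_imp_bounded[OF 1(2)] closure_subset] .
  then show 2: "C1c \<phi> (grad \<phi>)" using 1 smooth_C1c by blast
  show "\<phi> x = 0" "grad \<phi> x = 0" if "x \<notin> \<Omega>" for x
    using C1c_zero_outside[OF 2, of x] that 1(3) by blast+
qed

lemma test_functionsI:
  assumes "smooth \<phi>" "{x. \<phi> x \<noteq> 0} \<subseteq> K" "compact K" "K \<subseteq> \<Omega>"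
  shows "\<phi> \<in> test_functions \<Omega>"
proof -
  have "closure {x. \<phi> x \<noteq> 0} \<subseteq> K" using assms(2,3) by (simp add: closure_minimal compact_imp_closed)
  moreover have "compact (closure {x. \<phi> x \<noteq> 0})"
    using bounded_subset[OF compact_imp_bounded[OF assms(3)] assms(2)] by (simp add: compact_closure)
  ultimately show ?thesis using assms by (auto simp: test_functions_def smooth_def)
qed

lemma test_functions_frechet:
  "\<phi> \<in> test_functions \<Omega> \<Longrightarrow> frechet_derivative \<phi> (at x) e = grad \<phi> x \<bullet> e"
  using C1_grad_unique(2)[OF smooth_C1_grad[OF test_functionsD(1)]] by metis

lemma test_functions_add:
  assumes "\<phi> \<in> test_functions \<Omega>" "\<psi> \<in> test_functions \<Omega>"
  shows "(\<lambda>x. \<phi> x + \<psi> x) \<in> test_functions \<Omega>"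
proof (rule test_functionsI[where K="closure {x. \<phi> x \<noteq> 0} \<union> closure {x. \<psi> x \<noteq> 0}"])
  show "{x. \<phi> x + \<psi> x \<noteq> 0} \<subseteq> closure {x. \<phi> x \<noteq> 0} \<union> closure {x. \<psi> x \<noteq> 0}"
  proof
    fix x assume "x \<in> {x. \<phi> x + \<psi> x \<noteq> 0}"
    then have "x \<in> {x. \<phi> x \<noteq> 0} \<or> x \<in> {x. \<psi> x \<noteq> 0}" by auto
    then show "x \<in> closure {x. \<phi> x \<noteq> 0} \<union> closure {x. \<psi> x \<noteq> 0}"
      using closure_subset[of "{x. \<phi> x \<noteq> 0}"] closure_subset[of "{x. \<psi> x \<noteq> 0}"] by blast
  qed
qed (use test_functionsD[OF assms(1)] test_functionsD[OF assms(2)] in \<open>auto intro: smooth_add\<close>)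

lemma grad_add:
  assumes "smooth \<phi>" "smooth \<psi>" shows "grad (\<lambda>x. \<phi> x + \<psi> x) x = grad \<phi> x + grad \<psi> x"
proof (rule C1_grad_unique(1))
  show "C1_grad (\<lambda>x. \<phi> x + \<psi> x) (\<lambda>x. grad \<phi> x + grad \<psi> x)"
    using smooth_C1_grad[OF assms(1)] smooth_C1_grad[OF assms(2)]
    by (auto simp: C1_grad_def intro!: derivative_eq_intros continuous_intros simp: inner_add_left)
qed

lemma locally_integrable_mult:
  fixes f :: "'a::euclidean_space \<Rightarrow> 'b::euclidean_space"
  assumes f: "locally_integrable \<Omega> f" and \<Omega>: "open \<Omega>" and p: "continuous_on UNIV p" "\<And>x. x \<notin> K \<Longrightarrow> p x = 0"
    and K: "compact K" "K \<subseteq> \<Omega>"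
  shows "integrable (lebesgue_on \<Omega>) (\<lambda>x. p x *\<^sub>R f x)"
proof -
  have s: "\<Omega> \<inter> space lebesgue \<in> sets lebesgue" using \<Omega> by simp
  have sK: "K \<inter> space lebesgue \<in> sets lebesgue" using borel_compact[OF K(1)] by simp
  have pm: "p \<in> borel_measurable borel" using p(1) by (rule borel_measurable_continuous_onI)
  have "p x = 0" if "x \<notin> closure K" for x
    using that p(2) closure_subset[of K] by blast
  from compact_support_bounded[OF p(1) compact_imp_bounded[OF K(1)] this]
  obtain B where B: "\<And>x. \<bar>p x\<bar> \<le> B" by (metis real_norm_def)
  have "integrable (lebesgue_on K) f" using f K by (simp add: locally_integrable_def)
  then have "integrable (lebesgue_on K) (\<lambda>x. p x *\<^sub>R f x)"
    by (rule integrable_scaleR_bounded[OF _ _ B])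
      (intro measurable_restrict_space1 measurable_completion, use pm in simp)
  then have "integrable lebesgue (\<lambda>x. indicator K x *\<^sub>R (p x *\<^sub>R f x))"
    unfolding integrable_restrict_space[OF sK] .
  also have "(\<lambda>x. indicator K x *\<^sub>R (p x *\<^sub>R f x)) = (\<lambda>x. indicator \<Omega> x *\<^sub>R (p x *\<^sub>R f x))"
  proof
    fix x show "indicator K x *\<^sub>R (p x *\<^sub>R f x) = indicator \<Omega> x *\<^sub>R (p x *\<^sub>R f x)"
      using p(2)[of x] K(2) by (cases "x \<in> K") auto
  qed
  finally show ?thesis unfolding integrable_restrict_space[OF s] .
qed

lemma locally_integrable_test:
  fixes f :: "'a::euclidean_space \<Rightarrow> 'b::euclidean_space"
  assumes f: "locally_integrable \<Omega> f" and \<Omega>: "open \<Omega>" and p: "\<phi> \<in> test_functions \<Omega>"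
  shows "integrable (lebesgue_on \<Omega>) (\<lambda>x. \<phi> x *\<^sub>R f x)"
    "integrable (lebesgue_on \<Omega>) (\<lambda>x. (grad \<phi> x \<bullet> e) *\<^sub>R f x)"
proof -
  note t = test_functionsD[OF p]
  show "integrable (lebesgue_on \<Omega>) (\<lambda>x. \<phi> x *\<^sub>R f x)"
    by (rule locally_integrable_mult[OF f \<Omega> smooth_continuous[OF t(1)] _ t(2,3)])
      (rule C1c_zero_outside(1)[OF t(4)])
  show "integrable (lebesgue_on \<Omega>) (\<lambda>x. (grad \<phi> x \<bullet> e) *\<^sub>R f x)"
  proof (rule locally_integrable_mult[OF f \<Omega> _ _ t(2,3)])
    show "continuous_on UNIV (\<lambda>x. grad \<phi> x \<bullet> e)"
      using C1_grad_continuous(2)[OF smooth_C1_grad[OF t(1)]] by (intro continuous_intros) auto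
    show "\<And>x. x \<notin> closure {x. \<phi> x \<noteq> 0} \<Longrightarrow> grad \<phi> x \<bullet> e = 0"
      using C1c_zero_outside(2)[OF t(4)] inner_zero_left by metis
  qed
qed

lemma locally_integrable_add:
  "locally_integrable \<Omega> f \<Longrightarrow> locally_integrable \<Omega> g \<Longrightarrow> locally_integrable \<Omega> (\<lambda>x. f x + c *\<^sub>R g x)"
  unfolding locally_integrable_def by (intro allI impI Bochner_Integration.integrable_add integrable_scaleR_right) auto

lemma integrable_imp_locally_integrable:
  fixes f :: "'a::euclidean_space \<Rightarrow> 'b::euclidean_space"
  assumes f: "integrable (lebesgue_on \<Omega>) f" and \<Omega>: "open \<Omega>" shows "locally_integrable \<Omega> f"
  unfolding locally_integrable_def
proof (intro allI impI)
  fix K assume K: "compact K \<and> K \<subseteq> \<Omega>"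
  have s: "\<Omega> \<inter> space lebesgue \<in> sets lebesgue" using \<Omega> by simp
  have sK: "K \<inter> space lebesgue \<in> sets lebesgue" using borel_compact[of K] K by simp
  have "integrable lebesgue (\<lambda>x. indicator \<Omega> x *\<^sub>R f x)"
    using f unfolding integrable_restrict_space[OF s] .
  from integrable_mult_indicator[OF _ this, of K] borel_compact[of K] K
  have "integrable lebesgue (\<lambda>x. indicator K x *\<^sub>R (indicator \<Omega> x *\<^sub>R f x))" by simp
  also have "(\<lambda>x. indicator K x *\<^sub>R (indicator \<Omega> x *\<^sub>R f x)) = (\<lambda>x. indicator K x *\<^sub>R f x)"
  proof
    fix x show "indicator K x *\<^sub>R (indicator \<Omega> x *\<^sub>R f x) = indicator K x *\<^sub>R f x"
      using K by (cases "x \<in> K") auto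
  qed
  finally show "integrable (lebesgue_on K) f" unfolding integrable_restrict_space[OF sK] .
qed

text \<open>The mollification at \<open>x\<close> of \<open>h\<close>, cut off near the ball, is an integral of \<open>h\<close> against a test
  function once the kernel is small, so it is zero. As it converges in the mean to \<open>h\<close>, also \<open>h\<close> is
  zero.\<close>

lemma fundamental_lemma_local:
  fixes h :: "'a::euclidean_space \<Rightarrow> real"
  assumes \<Omega>: "open \<Omega>" and h: "locally_integrable \<Omega> h"
    and orth: "\<And>\<phi>. \<phi> \<in> test_functions \<Omega> \<Longrightarrow> (LINT x|lebesgue_on \<Omega>. \<phi> x * h x) = 0"
    and r: "r > 0" "cball x0 (2 * r) \<subseteq> \<Omega>"
  shows "AE x in lborel. x \<in> ball x0 r \<longrightarrow> h x = 0"
proof -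
  let ?U = "ball x0 (2 * r)"
  have U: "open ?U" "?U \<subseteq> \<Omega>" using r(2) ball_subset_cball by (auto dest: subsetD)
  have "integrable (lebesgue_on (cball x0 (2 * r))) h"
    using h r by (simp add: locally_integrable_def)
  then have "integrable (lebesgue_on ?U) h"
  proof -
    assume *: "integrable (lebesgue_on (cball x0 (2 * r))) h"
    have s1: "cball x0 (2 * r) \<inter> space lebesgue \<in> sets lebesgue" by simp
    have s2: "?U \<inter> space lebesgue \<in> sets lebesgue" by simp
    have "integrable lebesgue (\<lambda>x. indicator ?U x *\<^sub>R (indicator (cball x0 (2 * r)) x *\<^sub>R h x))"
      using * unfolding integrable_restrict_space[OF s1] by (rule integrable_mult_indicator[rotated]) simp
    also have "(\<lambda>x. indicator ?U x *\<^sub>R (indicator (cball x0 (2 * r)) x *\<^sub>R h x)) = (\<lambda>x. indicator ?U x *\<^sub>R h x)"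
      by (intro ext) (simp add: indicator_def)
    finally show ?thesis unfolding integrable_restrict_space[OF s2] .
  qed
  then obtain g where g: "g \<in> borel_measurable borel" "\<And>x. x \<notin> ?U \<Longrightarrow> g x = 0"
    "AE x in lebesgue_on ?U. h x = g x" "integrable lborel g"
    using borel_representative_integrable[OF U(1)] by blast
  have [measurable]: "g \<in> borel_measurable borel" by (rule g(1))
  have gh: "AE x in lborel. x \<in> ?U \<longrightarrow> h x = g x" using g(3) unfolding AE_lebesgue_on_iff[OF U(1)] .
  have conv0: "conv (kern 0 d) g x = 0" if d: "0 < d" "d < r" and x: "x \<in> ball x0 r" for d x
  proof -
    let ?p = "\<lambda>y. kern 0 d (x - y)"
    have sub: "cball x d \<subseteq> ?U"
    proof
      fix y assume "y \<in> cball x d"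
      then show "y \<in> ?U" using d x dist_triangle[of x0 y x] by simp
    qed
    have "smooth ?p"
      using smooth_affine[OF kern_smooth, of 1 0 d "-1" x] by simp
    moreover have "{y. ?p y \<noteq> 0} \<subseteq> cball x d"
    proof
      fix y assume "y \<in> {y. ?p y \<noteq> 0}"
      then have "kern 0 d (x - y) \<noteq> 0" by simp
      from kern_support[OF d(1) this] show "y \<in> cball x d" by (simp add: dist_norm norm_minus_commute)
    qed
    ultimately have p: "?p \<in> test_functions \<Omega>"
      by (rule test_functionsI) (use sub U(2) in auto)
    have pz: "?p y = 0" if "y \<notin> ?U" for y
    proof (rule ccontr)
      assume "?p y \<noteq> 0"
      from kern_support[OF d(1) this] have "y \<in> cball x d" by (simp add: dist_norm norm_minus_commute)
      then show False using sub that by blast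
    qed
    have [measurable]: "?p \<in> borel_measurable borel"
      by (rule borel_measurable_continuous_onI[OF smooth_continuous[OF \<open>smooth ?p\<close>]])
    have "conv (kern 0 d) g x = (LINT y|lborel. ?p y * g y)" by (simp add: conv_def)
    also have "\<dots> = (LINT y|lebesgue_on \<Omega>. ?p y * g y)"
    proof (rule lebesgue_on_borel_transfer(2)[OF \<Omega>, symmetric])
      fix y assume "y \<notin> \<Omega>"
      then have "y \<notin> ?U" using U(2) by blast
      then show "?p y * g y = 0" using pz by simp
    qed simp
    also have "\<dots> = (LINT y|lebesgue_on \<Omega>. ?p y * h y)"
    proof (rule integral_cong_AE)
      show "(\<lambda>y. ?p y * g y) \<in> borel_measurable (lebesgue_on \<Omega>)"
        by (intro measurable_restrict_space1 measurable_completion) simp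
      show "(\<lambda>y. ?p y * h y) \<in> borel_measurable (lebesgue_on \<Omega>)"
        using borel_measurable_integrable[OF locally_integrable_test(1)[OF h \<Omega> p]] by simp
      show "AE y in lebesgue_on \<Omega>. ?p y * g y = ?p y * h y"
        unfolding AE_lebesgue_on_iff[OF \<Omega>] using gh
      proof eventually_elim
        fix y assume "y \<in> ?U \<longrightarrow> h y = g y"
        then show "y \<in> \<Omega> \<longrightarrow> ?p y * g y = ?p y * h y" using pz[of y] by (cases "y \<in> ?U") auto
      qed
    qed
    also have "\<dots> = 0" by (rule orth[OF p])
    finally show ?thesis .
  qed
  have le: "(\<integral>\<^sup>+x. ennreal \<bar>g x\<bar> * indicator (ball x0 r) x \<partial>lborel) \<le> ennreal e" if e: "e > 0" for e
  proof -
    obtain d where d: "d > 0" "\<And>k k'. C1c k k' \<Longrightarrow> (\<And>z. k z \<ge> 0) \<Longrightarrow> (LINT z|lborel. k z) = 1 \<Longrightarrow>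
      (\<And>z. k z \<noteq> 0 \<Longrightarrow> norm z < d) \<Longrightarrow> (\<integral>\<^sup>+x. ennreal (norm (conv k g x - g x)) \<partial>lborel) \<le> ennreal e"
      using conv_tendsto_L1[OF g(4) e] by blast
    define d' where "d' = min d r / 2"
    have d': "0 < d'" "d' < r" "d' < d" using d(1) r(1) by (auto simp: d'_def)
    have "(\<integral>\<^sup>+x. ennreal \<bar>g x\<bar> * indicator (ball x0 r) x \<partial>lborel) \<le>
      (\<integral>\<^sup>+x. ennreal (norm (conv (kern 0 d') g x - g x)) \<partial>lborel)"
      by (intro nn_integral_mono) (simp add: indicator_def conv0[OF d'(1,2)])
    also have "\<dots> \<le> ennreal e"
    proof (rule d(2)[OF kern_C1c[OF d'(1)] kern_nonneg[OF d'(1)] kern_integral[OF d'(1)]])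
      show "norm z < d" if "kern 0 d' z \<noteq> 0" for z :: 'a
        using kern_support[OF d'(1) that] d'(3) by (simp add: dist_norm)
    qed
    finally show ?thesis .
  qed
  have "(\<integral>\<^sup>+x. ennreal \<bar>g x\<bar> * indicator (ball x0 r) x \<partial>lborel) = 0"
    by (rule antisym[OF ennreal_le_epsilon]) (use le in auto)
  moreover have "(\<lambda>x. ennreal \<bar>g x\<bar> * indicator (ball x0 r) x) \<in> borel_measurable lborel"
    by (intro borel_measurable_times_ennreal borel_measurable_indicator) auto
  ultimately have "AE x in lborel. ennreal \<bar>g x\<bar> * indicator (ball x0 r) x = 0"
    by (simp only: nn_integral_0_iff_AE)
  with gh show ?thesis
  proof eventually_elim
    fix x assume *: "x \<in> ?U \<longrightarrow> h x = g x" "ennreal \<bar>g x\<bar> * indicator (ball x0 r) x = 0"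
    show "x \<in> ball x0 r \<longrightarrow> h x = 0"
    proof
      assume x: "x \<in> ball x0 r"
      then have "g x = 0" using *(2) by simp
      moreover have "x \<in> ?U" using x r(1) by simp
      ultimately show "h x = 0" using *(1) by simp
    qed
  qed
qed

lemma AE_lborel_negligible:
  fixes P :: "'a::euclidean_space \<Rightarrow> bool"
  shows "(AE x in lborel. P x) \<longleftrightarrow> negligible {x. \<not> P x}"
proof -
  have "(AE x in lborel. P x) \<longleftrightarrow> (AE x in lebesgue. P x)" by (simp add: AE_completion_iff)
  also have "\<dots> \<longleftrightarrow> {x. \<not> P x} \<in> null_sets lebesgue"
    unfolding eventually_ae_filter
    by (auto intro: completion.complete2)
  finally show ?thesis by (simp add: negligible_iff_null_sets)
qed

lemma fundamental_lemma:
  fixes h :: "'a::euclidean_space \<Rightarrow> real"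
  assumes \<Omega>: "open \<Omega>" and h: "locally_integrable \<Omega> h"
    and orth: "\<And>\<phi>. \<phi> \<in> test_functions \<Omega> \<Longrightarrow> (LINT x|lebesgue_on \<Omega>. \<phi> x * h x) = 0"
  shows "AE x in lebesgue_on \<Omega>. h x = 0"
proof -
  have "negligible {x. \<not> (x \<in> \<Omega> \<longrightarrow> h x = 0)}"
  proof (subst locally_negligible_alt, rule ballI)
    fix x0 assume x0: "x0 \<in> {x. \<not> (x \<in> \<Omega> \<longrightarrow> h x = 0)}"
    then obtain s where s: "s > 0" "cball x0 s \<subseteq> \<Omega>" using \<Omega> open_contains_cball by blast
    have "AE x in lborel. x \<in> ball x0 (s/2) \<longrightarrow> h x = 0"
      by (rule fundamental_lemma_local[OF \<Omega> h orth]) (use s in auto)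
    then have n: "negligible {x. \<not> (x \<in> ball x0 (s/2) \<longrightarrow> h x = 0)}" by (simp add: AE_lborel_negligible)
    let ?S = "{x. \<not> (x \<in> \<Omega> \<longrightarrow> h x = 0)}"
    show "\<exists>U. openin (top_of_set ?S) U \<and> x0 \<in> U \<and> negligible U"
    proof (intro exI conjI)
      show "openin (top_of_set ?S) (?S \<inter> ball x0 (s/2))" by (simp add: openin_open_Int)
      show "x0 \<in> ?S \<inter> ball x0 (s/2)" using x0 s by simp
      show "negligible (?S \<inter> ball x0 (s/2))" by (rule negligible_subset[OF n]) auto
    qed
  qed
  then show ?thesis unfolding AE_lebesgue_on_iff[OF \<Omega>] AE_lborel_negligible .
qed

lemma has_weak_gradientD:
  assumes "has_weak_gradient \<Omega> f g" "\<phi> \<in> test_functions \<Omega>" "e \<in> Basis"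
  shows "(LINT x|lebesgue_on \<Omega>. (grad \<phi> x \<bullet> e) * f x) = - (LINT x|lebesgue_on \<Omega>. \<phi> x * (g x \<bullet> e))"
  using assms by (auto simp: has_weak_gradient_def test_functions_frechet mult.commute)

lemma locally_integrable_inner:
  "locally_integrable \<Omega> f \<Longrightarrow> locally_integrable \<Omega> (\<lambda>x. f x \<bullet> e)"
  unfolding locally_integrable_def by auto

lemma has_weak_gradient_unique:
  fixes f :: "'a::euclidean_space \<Rightarrow> real"
  assumes \<Omega>: "open \<Omega>" and g: "has_weak_gradient \<Omega> f g1" "has_weak_gradient \<Omega> f g2"
  shows "AE x in lebesgue_on \<Omega>. g1 x = g2 x"
proof -
  have l: "locally_integrable \<Omega> g1" "locally_integrable \<Omega> g2"
    using g by (auto simp: has_weak_gradient_def)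
  have "AE x in lebesgue_on \<Omega>. g1 x \<bullet> e + (-1) *\<^sub>R (g2 x \<bullet> e) = 0" if e: "e \<in> Basis" for e
  proof (rule fundamental_lemma[OF \<Omega>])
    note le = locally_integrable_inner[OF l(1), of e] locally_integrable_inner[OF l(2), of e]
    show "locally_integrable \<Omega> (\<lambda>x. g1 x \<bullet> e + (-1) *\<^sub>R (g2 x \<bullet> e))"
      by (rule locally_integrable_add[OF le])
    fix \<phi> assume p: "\<phi> \<in> test_functions \<Omega>"
    note i = locally_integrable_test(1)[OF le(1) \<Omega> p] locally_integrable_test(1)[OF le(2) \<Omega> p]
    have "(LINT x|lebesgue_on \<Omega>. \<phi> x * (g1 x \<bullet> e)) = (LINT x|lebesgue_on \<Omega>. \<phi> x * (g2 x \<bullet> e))"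
      using has_weak_gradientD[OF g(1) p e] has_weak_gradientD[OF g(2) p e] by simp
    then show "(LINT x|lebesgue_on \<Omega>. \<phi> x * (g1 x \<bullet> e + (-1) *\<^sub>R (g2 x \<bullet> e))) = 0"
      using i by (simp add: right_diff_distrib)
  qed
  then have "AE x in lebesgue_on \<Omega>. \<forall>e\<in>Basis. g1 x \<bullet> e + (-1) *\<^sub>R (g2 x \<bullet> e) = 0"
    by (intro AE_finite_allI) auto
  then show ?thesis
  proof eventually_elim
    fix x assume *: "\<forall>e\<in>Basis. g1 x \<bullet> e + (-1) *\<^sub>R (g2 x \<bullet> e) = 0"
    show "g1 x = g2 x"
    proof (rule euclidean_eqI)
      fix e :: 'a assume "e \<in> Basis"
      then show "g1 x \<bullet> e = g2 x \<bullet> e" using *[rule_format, of e] by simp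
    qed
  qed
qed

text \<open>By the fundamental lemma weak gradients are unique almost everywhere, so the arbitrary choice made
  by \<open>weak_gradient\<close> can be replaced by any weak gradient at hand.\<close>

lemma weak_gradient_AE:
  assumes "open \<Omega>" "has_weak_gradient \<Omega> f g"
  shows "has_weak_gradient \<Omega> f (weak_gradient \<Omega> f)" "AE x in lebesgue_on \<Omega>. weak_gradient \<Omega> f x = g x"
proof -
  show 1: "has_weak_gradient \<Omega> f (weak_gradient \<Omega> f)"
    unfolding weak_gradient_def by (rule someI[of "has_weak_gradient \<Omega> f", OF assms(2)])
  show "AE x in lebesgue_on \<Omega>. weak_gradient \<Omega> f x = g x"
    by (rule has_weak_gradient_unique[OF assms(1) 1 assms(2)])
qed

lemma has_weak_gradient_add:
  assumes \<Omega>: "open \<Omega>" and g: "has_weak_gradient \<Omega> f1 g1" "has_weak_gradient \<Omega> f2 g2"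
  shows "has_weak_gradient \<Omega> (\<lambda>x. f1 x + c *\<^sub>R f2 x) (\<lambda>x. g1 x + c *\<^sub>R g2 x)"
proof -
  have l: "locally_integrable \<Omega> f1" "locally_integrable \<Omega> f2" "locally_integrable \<Omega> g1" "locally_integrable \<Omega> g2"
    using g by (auto simp: has_weak_gradient_def)
  have "(LINT x|lebesgue_on \<Omega>. (f1 x + c *\<^sub>R f2 x) * frechet_derivative \<phi> (at x) e)
          = - (LINT x|lebesgue_on \<Omega>. ((g1 x + c *\<^sub>R g2 x) \<bullet> e) * \<phi> x)"
    if p: "\<phi> \<in> test_functions \<Omega>" and e: "e \<in> Basis" for \<phi> e
  proof -
    note i = locally_integrable_test(2)[OF l(1) \<Omega> p, of e] locally_integrable_test(2)[OF l(2) \<Omega> p, of e]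
      locally_integrable_test(1)[OF locally_integrable_inner[OF l(3), of e] \<Omega> p]
      locally_integrable_test(1)[OF locally_integrable_inner[OF l(4), of e] \<Omega> p]
    have "(LINT x|lebesgue_on \<Omega>. (f1 x + c *\<^sub>R f2 x) * frechet_derivative \<phi> (at x) e)
       = (LINT x|lebesgue_on \<Omega>. (grad \<phi> x \<bullet> e) *\<^sub>R f1 x + c * ((grad \<phi> x \<bullet> e) *\<^sub>R f2 x))"
      by (simp add: test_functions_frechet[OF p] algebra_simps)
    also have "\<dots> = (LINT x|lebesgue_on \<Omega>. (grad \<phi> x \<bullet> e) * f1 x) + c * (LINT x|lebesgue_on \<Omega>. (grad \<phi> x \<bullet> e) * f2 x)"
      using i by simp
    also have "\<dots> = - ((LINT x|lebesgue_on \<Omega>. \<phi> x * (g1 x \<bullet> e)) + c * (LINT x|lebesgue_on \<Omega>. \<phi> x * (g2 x \<bullet> e)))"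
      using has_weak_gradientD[OF g(1) p e] has_weak_gradientD[OF g(2) p e] by simp
    also have "\<dots> = - (LINT x|lebesgue_on \<Omega>. \<phi> x *\<^sub>R (g1 x \<bullet> e) + c * (\<phi> x *\<^sub>R (g2 x \<bullet> e)))"
      using i by simp
    also have "\<dots> = - (LINT x|lebesgue_on \<Omega>. ((g1 x + c *\<^sub>R g2 x) \<bullet> e) * \<phi> x)"
      by (simp add: inner_add_left algebra_simps)
    finally show ?thesis .
  qed
  then show ?thesis unfolding has_weak_gradient_def
    using l by (auto intro!: locally_integrable_add simp del: real_scaleR_def)
qed

lemma W0_has_weak_gradient:
  assumes \<Omega>: "open \<Omega>" and w: "W0 w g"
  shows "has_weak_gradient \<Omega> w g"
proof -
  note wi = W0_integrable[OF w]
  have [measurable]: "w \<in> borel_measurable borel" "g \<in> borel_measurable borel" using wi by auto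
  have s: "\<Omega> \<inter> space lebesgue \<in> sets lebesgue" using \<Omega> by simp
  have "integrable (lebesgue_on \<Omega>) w" "integrable (lebesgue_on \<Omega>) g"
    unfolding integrable_restrict_space[OF s]
    by (intro integrable_mult_indicator, use wi \<Omega> in \<open>auto simp: integrable_completion\<close>)+
  then have l: "locally_integrable \<Omega> w" "locally_integrable \<Omega> g"
    using \<Omega> integrable_imp_locally_integrable by blast+
  have "(LINT x|lebesgue_on \<Omega>. w x * frechet_derivative \<phi> (at x) e) = - (LINT x|lebesgue_on \<Omega>. (g x \<bullet> e) * \<phi> x)"
    if p: "\<phi> \<in> test_functions \<Omega>" for \<phi> e
  proof -
    note t = test_functionsD[OF p]
    obtain B where B: "\<And>x. \<bar>\<phi> x\<bar> \<le> B" "\<And>x. norm (grad \<phi> x) \<le> B" using C1c_bounded[OF t(4)] by metis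
    have [measurable]: "\<phi> \<in> borel_measurable borel" "grad \<phi> \<in> borel_measurable borel"
      using C1c_integrable[OF t(4)] by auto
    have ipg: "integrable lborel (\<lambda>x. \<phi> x *\<^sub>R g x)"
      by (rule integrable_scaleR_bounded[OF wi(2) _ B(1)]) simp
    have "(LINT x|lebesgue_on \<Omega>. w x * frechet_derivative \<phi> (at x) e) = (LINT x|lebesgue_on \<Omega>. (grad \<phi> x \<bullet> e) * w x)"
      by (simp add: test_functions_frechet[OF p] mult.commute)
    also have "\<dots> = (LINT x|lborel. (grad \<phi> x \<bullet> e) * w x)"
      by (rule lebesgue_on_borel_transfer(2)[OF \<Omega>]) (simp_all add: t(6))
    also have "\<dots> = - ((LINT x|lborel. \<phi> x *\<^sub>R g x) \<bullet> e)"
      by (rule W0_integration_by_parts[OF w smooth_C1_grad[OF t(1)] B])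
    also have "(LINT x|lborel. \<phi> x *\<^sub>R g x) \<bullet> e = (LINT x|lborel. \<phi> x *\<^sub>R g x \<bullet> e)"
      by (rule integral_inner_left[OF ipg, symmetric])
    also have "\<dots> = (LINT x|lebesgue_on \<Omega>. \<phi> x *\<^sub>R g x \<bullet> e)"
      by (rule lebesgue_on_borel_transfer(2)[OF \<Omega>, symmetric]) (simp_all add: t(5))
    also have "\<dots> = (LINT x|lebesgue_on \<Omega>. (g x \<bullet> e) * \<phi> x)" by (simp add: mult.commute)
    finally show ?thesis .
  qed
  then show ?thesis using l by (simp add: has_weak_gradient_def)
qed

lemma C1c_W0: assumes "C1c f f'" shows "W0 f f'"
  unfolding W0_def using C1c_integrable[OF assms]
  by (auto intro!: exI[of _ f] exI[of _ f'] assms)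

lemma test_functions_weak_gradient:
  "open \<Omega> \<Longrightarrow> \<phi> \<in> test_functions \<Omega> \<Longrightarrow> has_weak_gradient \<Omega> \<phi> (grad \<phi>)"
  by (rule W0_has_weak_gradient[OF _ C1c_W0[OF test_functionsD(4)]])

lemma test_functions_integrable:
  assumes "open \<Omega>" "\<phi> \<in> test_functions \<Omega>"
  shows "integrable (lebesgue_on \<Omega>) \<phi>" "integrable (lebesgue_on \<Omega>) (grad \<phi>)"
proof -
  note t = test_functionsD[OF assms(2)]
  note i = C1c_integrable[OF t(4)]
  show "integrable (lebesgue_on \<Omega>) \<phi>"
    using lebesgue_on_borel_transfer(1)[OF assms(1) _ t(5)] i(1) by simp
  show "integrable (lebesgue_on \<Omega>) (grad \<phi>)"
    using lebesgue_on_borel_transfer(1)[OF assms(1) _ t(6)] i(2) by simp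
qed

lemma test_functions_W11_0:
  assumes \<Omega>: "open \<Omega>" and p: "\<phi> \<in> test_functions \<Omega>"
  shows "\<phi> \<in> W11_0 \<Omega>"
proof -
  have "\<phi> \<in> W11 \<Omega>"
    unfolding W11_def using test_functions_integrable[OF \<Omega> p] test_functions_weak_gradient[OF \<Omega> p] by blast
  moreover have "W11_norm \<Omega> (\<lambda>x. \<phi> x - \<phi> x) = 0"
  proof -
    have "C1c (\<lambda>x. 0::real) (\<lambda>x. 0::'a)" by (simp add: C1c_def C1_grad_def)
    from W0_has_weak_gradient[OF \<Omega> C1c_W0[OF this]]
    have z: "has_weak_gradient \<Omega> (\<lambda>x. 0::real) (\<lambda>x. 0)" .
    have "(LINT x|lebesgue_on \<Omega>. norm (weak_gradient \<Omega> (\<lambda>x. 0) x)) = 0"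
      by (rule integral_eq_zero_AE) (use weak_gradient_AE(2)[OF \<Omega> z] in \<open>auto elim: eventually_mono\<close>)
    then show ?thesis by (simp add: W11_norm_def)
  qed
  ultimately have "\<forall>\<epsilon>>0. \<exists>\<psi>\<in>test_functions \<Omega>. W11_norm \<Omega> (\<lambda>x. \<phi> x - \<psi> x) < \<epsilon>" "\<phi> \<in> W11 \<Omega>"
    using p by (metis, simp)
  then show ?thesis unfolding W11_0_def by simp
qed

lemma W11_weak_gradient:
  assumes "open \<Omega>" "f \<in> W11 \<Omega>"
  shows "has_weak_gradient \<Omega> f (weak_gradient \<Omega> f)" "integrable (lebesgue_on \<Omega>) f" "integrable (lebesgue_on \<Omega>) (weak_gradient \<Omega> f)"
proof -
  obtain g where g: "has_weak_gradient \<Omega> f g" "integrable (lebesgue_on \<Omega>) g" "integrable (lebesgue_on \<Omega>) f"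
    using assms(2) by (auto simp: W11_def)
  show 1: "has_weak_gradient \<Omega> f (weak_gradient \<Omega> f)" by (rule weak_gradient_AE(1)[OF assms(1) g(1)])
  show "integrable (lebesgue_on \<Omega>) f" by (rule g(3))
  have s: "\<Omega> \<inter> space lebesgue \<in> sets lebesgue" using assms(1) by simp
  have ae: "AE x in lebesgue_on \<Omega>. g x = weak_gradient \<Omega> f x"
    using weak_gradient_AE(2)[OF assms(1) g(1)] by eventually_elim simp
  then have "AE x in lebesgue. x \<in> \<Omega> \<longrightarrow> g x = weak_gradient \<Omega> f x"
    by (simp add: AE_restrict_space_iff[OF s])
  then have ae2: "AE x in lebesgue. indicator \<Omega> x *\<^sub>R g x = indicator \<Omega> x *\<^sub>R weak_gradient \<Omega> f x"
    by eventually_elim (auto simp: indicator_def)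
  have m: "(\<lambda>x. indicator \<Omega> x *\<^sub>R g x) \<in> borel_measurable lebesgue"
    using g(2) unfolding integrable_restrict_space[OF s] by simp
  have m2: "(\<lambda>x. indicator \<Omega> x *\<^sub>R weak_gradient \<Omega> f x) \<in> borel_measurable lebesgue"
    by (rule borel_measurable_AE[OF m ae2])
  show "integrable (lebesgue_on \<Omega>) (weak_gradient \<Omega> f)"
    unfolding integrable_restrict_space[OF s]
    using integrable_cong_AE[OF m m2 ae2] g(2) unfolding integrable_restrict_space[OF s] by simp
qed

lemma LINT_norm_transfer:
  fixes f g :: "'a::euclidean_space \<Rightarrow> 'b::euclidean_space"
  assumes \<Omega>: "open \<Omega>" and g: "g \<in> borel_measurable borel" "\<And>x. x \<notin> \<Omega> \<Longrightarrow> g x = 0"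
    and ae: "AE x in lebesgue_on \<Omega>. f x = g x" and f: "f \<in> borel_measurable (lebesgue_on \<Omega>)"
  shows "(LINT x|lborel. norm (g x)) = (LINT x|lebesgue_on \<Omega>. norm (f x))"
proof -
  have "(LINT x|lborel. norm (g x)) = (LINT x|lebesgue_on \<Omega>. norm (g x))"
    by (rule lebesgue_on_borel_transfer(2)[OF \<Omega>, symmetric]) (use g in auto)
  also have "\<dots> = (LINT x|lebesgue_on \<Omega>. norm (f x))"
  proof (rule integral_cong_AE)
    show "(\<lambda>x. norm (g x)) \<in> borel_measurable (lebesgue_on \<Omega>)"
      by (intro measurable_restrict_space1 measurable_completion) (use g(1) in simp)
    show "(\<lambda>x. norm (f x)) \<in> borel_measurable (lebesgue_on \<Omega>)" using f by simp
    show "AE x in lebesgue_on \<Omega>. norm (g x) = norm (f x)" using ae by eventually_elim simp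
  qed
  finally show ?thesis .
qed

text \<open>Test functions vanish with their gradients off \<open>\<Omega>\<close>, so approximation in the Sobolev norm of \<open>\<Omega>\<close> is
  approximation of the zero extensions on the whole space.\<close>

lemma W11_0_extension:
  assumes \<Omega>: "open \<Omega>" and v: "v \<in> W11_0 \<Omega>"
    and w: "w \<in> borel_measurable borel" "\<And>x. x \<notin> \<Omega> \<Longrightarrow> w x = 0" "AE x in lebesgue_on \<Omega>. v x = w x"
    and g: "g \<in> borel_measurable borel" "\<And>x. x \<notin> \<Omega> \<Longrightarrow> g x = 0" "AE x in lebesgue_on \<Omega>. weak_gradient \<Omega> v x = g x"
  shows "W0 w g"
proof -
  have v1: "v \<in> W11 \<Omega>" using v by (simp add: W11_0_def)
  note vw = W11_weak_gradient[OF \<Omega> v1]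
  have mw: "w \<in> borel_measurable (lebesgue_on \<Omega>)" and mg: "g \<in> borel_measurable (lebesgue_on \<Omega>)"
    using w(1) g(1) by (auto intro!: measurable_restrict_space1 measurable_completion)
  have iw: "integrable lborel w"
    using lebesgue_on_borel_transfer(1)[OF \<Omega> w(1,2)] integrable_cong_AE[OF borel_measurable_integrable[OF vw(2)] mw w(3)] vw(2) by simp
  have ig: "integrable lborel g"
    using lebesgue_on_borel_transfer(1)[OF \<Omega> g(1,2)] integrable_cong_AE[OF borel_measurable_integrable[OF vw(3)] mg g(3)] vw(3) by simp
  show ?thesis unfolding W0_def
  proof (intro conjI allI impI iw ig)
    fix e :: real assume "e > 0"
    then obtain \<phi> where p: "\<phi> \<in> test_functions \<Omega>" "W11_norm \<Omega> (\<lambda>x. v x - \<phi> x) < e"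
      using v by (auto simp: W11_0_def)
    note t = test_functionsD[OF p(1)]
    note tm = borel_measurable_integrable[OF C1c_integrable(1)[OF t(4)]] borel_measurable_integrable[OF C1c_integrable(2)[OF t(4)]]
    have "has_weak_gradient \<Omega> (\<lambda>x. v x + (-1) *\<^sub>R \<phi> x) (\<lambda>x. weak_gradient \<Omega> v x + (-1) *\<^sub>R grad \<phi> x)"
      by (rule has_weak_gradient_add[OF \<Omega> vw(1) test_functions_weak_gradient[OF \<Omega> p(1)]])
    then have "has_weak_gradient \<Omega> (\<lambda>x. v x - \<phi> x) (\<lambda>x. weak_gradient \<Omega> v x - grad \<phi> x)" by simp
    note d = weak_gradient_AE[OF \<Omega> this]
    have "\<phi> \<in> W11 \<Omega>" using test_functions_W11_0[OF \<Omega> p(1)] by (simp add: W11_0_def)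
    have "(\<lambda>x. v x - \<phi> x) \<in> W11 \<Omega>"
      unfolding W11_def using vw test_functions_integrable[OF \<Omega> p(1)] \<open>has_weak_gradient \<Omega> (\<lambda>x. v x - \<phi> x) (\<lambda>x. weak_gradient \<Omega> v x - grad \<phi> x)\<close>
      by (auto intro!: exI[of _ "\<lambda>x. weak_gradient \<Omega> v x - grad \<phi> x"])
    note dm = W11_weak_gradient[OF \<Omega> this]
    have 1: "(LINT x|lborel. norm (w x - \<phi> x)) = (LINT x|lebesgue_on \<Omega>. norm (v x - \<phi> x))"
    proof (rule LINT_norm_transfer[OF \<Omega>])
      show "AE x in lebesgue_on \<Omega>. v x - \<phi> x = w x - \<phi> x" using w(3) by eventually_elim simp
    qed (use w t(5) tm dm(2) in auto)
    have 2: "(LINT x|lborel. norm (g x - grad \<phi> x)) = (LINT x|lebesgue_on \<Omega>. norm (weak_gradient \<Omega> (\<lambda>x. v x - \<phi> x) x))"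
    proof (rule LINT_norm_transfer[OF \<Omega>])
      show "AE x in lebesgue_on \<Omega>. weak_gradient \<Omega> (\<lambda>x. v x - \<phi> x) x = g x - grad \<phi> x"
        using g(3) d(2) by eventually_elim simp
    qed (use g t(6) tm dm(3) in auto)
    have "(LINT x|lborel. norm (w x - \<phi> x)) \<ge> 0" "(LINT x|lborel. norm (g x - grad \<phi> x)) \<ge> 0" by simp_all
    moreover have "(LINT x|lborel. norm (w x - \<phi> x)) + (LINT x|lborel. norm (g x - grad \<phi> x)) < e"
      using p(2) unfolding W11_norm_def 1 2 by simp
    ultimately have "(LINT x|lborel. norm (w x - \<phi> x)) < e" "(LINT x|lborel. norm (g x - grad \<phi> x)) < e"
      by linarith+
    then show "\<exists>f f'. C1c f f' \<and> (LINT x|lborel. \<bar>f x - w x\<bar>) < e \<and> (LINT x|lborel. norm (f' x - g x)) < e"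
      using t(4) by (intro exI[of _ \<phi>] exI[of _ "grad \<phi>"]) (simp add: norm_minus_commute abs_minus_commute)
  qed
qed

section \<open>Two tools from convexity and integration\<close>

text \<open>A hyperplane separates \<open>(x0, f x0)\<close> from the strict epigraph of \<open>f\<close>. It is not vertical, because \<open>f\<close>
  is finite on the whole space.\<close>

lemma convex_subgradient:
  fixes f :: "'a::euclidean_space \<Rightarrow> real"
  assumes f: "convex_on UNIV f"
  shows "\<exists>p. \<forall>x. f x0 + p \<bullet> (x - x0) \<le> f x"
proof -
  define E where "E = {(x::'a, t::real). f x < t}"
  have cE: "convex E"
  proof (rule convexI)
    fix a b :: "'a \<times> real" and u v :: real
    assume a: "a \<in> E" "b \<in> E" and uv: "0 \<le> u" "0 \<le> v" "u + v = 1"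
    obtain x s y t where xy: "a = (x, s)" "b = (y, t)" by (cases a, cases b)
    have st: "f x < s" "f y < t" using a xy by (auto simp: E_def)
    have "f (u *\<^sub>R x + v *\<^sub>R y) \<le> u * f x + v * f y"
      using f uv by (simp add: convex_on_def)
    also have "\<dots> < u * s + v * t"
    proof (cases "u = 0")
      case True then show ?thesis using uv st by simp
    next
      case False
      then have "u * f x < u * s" using uv st by simp
      moreover have "v * f y \<le> v * t" using uv st by (simp add: mult_left_mono)
      ultimately show ?thesis by linarith
    qed
    finally show "u *\<^sub>R a + v *\<^sub>R b \<in> E" by (simp add: E_def xy)
  qed
  have "E \<noteq> {}" using lt_ex[of "f x0 + 1"] by (auto simp: E_def intro!: exI[of _ x0] exI[of _ "f x0 + 1"])
  moreover have "{(x0, f x0)} \<inter> E = {}" by (auto simp: E_def)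
  ultimately obtain a b where ab: "a \<noteq> 0" "a \<bullet> (x0, f x0) \<le> b" "\<And>z. z \<in> E \<Longrightarrow> a \<bullet> z \<ge> b"
    using separating_hyperplane_sets[OF convex_singleton cE, of "(x0, f x0)"] by blast
  obtain q s where a: "a = (q, s)" by (cases a)
  have sep: "q \<bullet> x0 + s * f x0 \<le> q \<bullet> x + s * t" if "f x < t" for x t
    using ab(2) ab(3)[of "(x, t)"] that by (simp add: a E_def)
  have "s \<ge> 0"
    using sep[of x0 "f x0 + 1"] by (simp add: algebra_simps)
  moreover have "s \<noteq> 0"
  proof
    assume "s = 0"
    then have "q \<bullet> x0 \<le> q \<bullet> x" for x using sep[of x "f x + 1"] by simp
    from this[of "x0 - q"] have "q \<bullet> q \<le> 0" by (simp add: inner_diff_right)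
    then have "q = 0" using inner_ge_zero[of q] by (metis antisym inner_eq_zero_iff)
    then show False using ab(1) a \<open>s = 0\<close> by (simp add: zero_prod_def)
  qed
  ultimately have s: "s > 0" by simp
  have "f x0 + (- (1 / s) *\<^sub>R q) \<bullet> (x - x0) \<le> f x" for x
  proof (rule field_le_epsilon)
    fix e :: real assume "e > 0"
    then have "q \<bullet> x0 + s * f x0 \<le> q \<bullet> x + s * (f x + e)" by (intro sep) simp
    then have "s * f x0 \<le> s * (f x + e) + q \<bullet> (x - x0)" by (simp add: inner_diff_right)
    then have "f x0 \<le> (f x + e) + (q \<bullet> (x - x0)) / s" using s by (simp add: field_simps)
    then show "f x0 + (- (1 / s) *\<^sub>R q) \<bullet> (x - x0) \<le> f x + e" by simp
  qed
  then show ?thesis by blast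
qed

text \<open>One half of dominated convergence when the majorant \<open>G\<close> may be exceeded by an error that vanishes in
  the mean: the theorem applies to \<open>min (F n) G\<close>, and the excess is at most \<open>E n\<close>.\<close>

lemma nn_integral_dominated_perturbed:
  fixes F :: "nat \<Rightarrow> 'a \<Rightarrow> ennreal"
  assumes [measurable]: "\<And>n. F n \<in> borel_measurable N" "F' \<in> borel_measurable N" "G \<in> borel_measurable N"
      "\<And>n. E n \<in> borel_measurable N"
    and le: "\<And>n. AE x in N. F n x \<le> G x + E n x" "AE x in N. F' x \<le> G x" and G: "(\<integral>\<^sup>+x. G x \<partial>N) < \<infinity>"
    and E: "(\<lambda>n. \<integral>\<^sup>+x. E n x \<partial>N) \<longlonglongrightarrow> 0"
    and lim: "AE x in N. (\<lambda>n. F n x) \<longlonglongrightarrow> F' x"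
    and e: "e > (\<integral>\<^sup>+x. F' x \<partial>N)"
  shows "\<forall>\<^sub>F n in sequentially. (\<integral>\<^sup>+x. F n x \<partial>N) < e"
proof -
  have "(\<lambda>n. \<integral>\<^sup>+x. min (F n x) (G x) \<partial>N) \<longlonglongrightarrow> (\<integral>\<^sup>+x. F' x \<partial>N)"
  proof (rule nn_integral_dominated_convergence[where w=G])
    show "AE x in N. (\<lambda>n. min (F n x) (G x)) \<longlonglongrightarrow> F' x"
      using lim le(2)
    proof eventually_elim
      fix x assume "(\<lambda>n. F n x) \<longlonglongrightarrow> F' x" and le: "F' x \<le> G x"
      then have "(\<lambda>n. min (F n x) (G x)) \<longlonglongrightarrow> min (F' x) (G x)" by (intro tendsto_min tendsto_const)
      then show "(\<lambda>n. min (F n x) (G x)) \<longlonglongrightarrow> F' x" using le by (simp add: min_absorb1)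
    qed
  qed (use G in auto)
  from tendsto_add[OF this E] have "(\<lambda>n. (\<integral>\<^sup>+x. min (F n x) (G x) \<partial>N) + (\<integral>\<^sup>+x. E n x \<partial>N)) \<longlonglongrightarrow> (\<integral>\<^sup>+x. F' x \<partial>N)" by simp
  from order_tendstoD(2)[OF this e]
  show ?thesis
  proof eventually_elim
    fix n assume *: "(\<integral>\<^sup>+x. min (F n x) (G x) \<partial>N) + (\<integral>\<^sup>+x. E n x \<partial>N) < e"
    have "(\<integral>\<^sup>+x. F n x \<partial>N) \<le> (\<integral>\<^sup>+x. min (F n x) (G x) + E n x \<partial>N)"
    proof (rule nn_integral_mono_AE)
      show "AE x in N. F n x \<le> min (F n x) (G x) + E n x"
        using le(1)[of n] by eventually_elim (auto simp: min_def)
    qed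
    also have "\<dots> = (\<integral>\<^sup>+x. min (F n x) (G x) \<partial>N) + (\<integral>\<^sup>+x. E n x \<partial>N)"
      by (rule nn_integral_add) auto
    finally show "(\<integral>\<^sup>+x. F n x \<partial>N) < e" using * by simp
  qed
qed

lemma L1_rate:
  fixes d :: "nat \<Rightarrow> 'a \<Rightarrow> 'b::euclidean_space"
  assumes m: "\<And>n. d n \<in> borel_measurable N"
    and le: "\<And>n. (\<integral>\<^sup>+x. ennreal (norm (d n x)) \<partial>N) \<le> ennreal (inverse (real (Suc n)))"
  shows "integrable N (d n)" and "(\<lambda>n. LINT x|N. norm (d n x)) \<longlonglongrightarrow> 0"
proof -
  have i: "integrable N (d n)" for n
    unfolding integrable_iff_bounded using m[of n] order_le_less_trans[OF le[of n]] by simp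
  show "integrable N (d n)" by (rule i)
  have "(LINT x|N. norm (d n x)) \<le> inverse (real (Suc n))" for n
  proof -
    have "ennreal (LINT x|N. norm (d n x)) = (\<integral>\<^sup>+x. ennreal (norm (d n x)) \<partial>N)"
      using i[of n] by (intro nn_integral_eq_integral[symmetric] integrable_norm) auto
    also have "\<dots> \<le> ennreal (inverse (real (Suc n)))" by (rule le)
    finally show ?thesis by (subst (asm) ennreal_le_iff) simp_all
  qed
  then show "(\<lambda>n. LINT x|N. norm (d n x)) \<longlonglongrightarrow> 0"
    by (intro tendsto_sandwich[OF always_eventually always_eventually tendsto_const LIMSEQ_inverse_real_of_nat]) auto
qed

lemma conv_scaleR: "conv k (\<lambda>x. c *\<^sub>R f x) x = c *\<^sub>R conv k f x"
proof -
  have "(\<lambda>y. k (x - y) *\<^sub>R c *\<^sub>R f y) = (\<lambda>y. c *\<^sub>R k (x - y) *\<^sub>R f y)"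
    by (simp add: mult.commute)
  then have "conv k (\<lambda>x. c *\<^sub>R f x) x = (LINT y|lborel. c *\<^sub>R k (x - y) *\<^sub>R f y)"
    unfolding conv_def by (rule arg_cong)
  also have "\<dots> = c *\<^sub>R conv k f x" unfolding conv_def by (rule integral_scaleR_right)
  finally show ?thesis .
qed

section \<open>Modular approximation by test functions\<close>

text \<open>For a continuous \<open>M\<close> the almost-everywhere conditions on a weak \<open>N\<close>-function hold everywhere. Of the
  convex bounds \<open>m1\<close> and \<open>m2\<close> two consequences are kept: \<open>M\<close> is bounded on bounded sets of gradients,
  and it is at least \<open>1\<close> for large gradients, both uniformly on \<open>\<Omega>\<close>.\<close>

locale musielak =
  fixes \<Omega> :: "'a::euclidean_space set" and M :: "'a \<Rightarrow> 'a \<Rightarrow> real"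
  assumes open_Omega: "open \<Omega>" and bounded_Omega: "bounded \<Omega>"
    and M_cont: "continuous_on (\<Omega> \<times> UNIV) (\<lambda>(x, \<xi>). M x \<xi>)"
    and M_convex: "x \<in> \<Omega> \<Longrightarrow> convex_on UNIV (M x)"
    and M_zero: "x \<in> \<Omega> \<Longrightarrow> M x 0 = 0"
    and M_nonneg: "x \<in> \<Omega> \<Longrightarrow> 0 \<le> M x \<xi>"
    and M_even: "x \<in> \<Omega> \<Longrightarrow> M x (- \<xi>) = M x \<xi>"
    and M_upper: "\<exists>B. \<forall>x\<in>\<Omega>. \<forall>\<xi>. norm \<xi> \<le> R \<longrightarrow> M x \<xi> \<le> B"
    and M_lower: "\<exists>R. \<forall>x\<in>\<Omega>. \<forall>\<xi>. R \<le> norm \<xi> \<longrightarrow> 1 \<le> M x \<xi>"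
begin

lemma M_conv:
  assumes "x \<in> \<Omega>" "0 \<le> u" "0 \<le> v" "u + v = 1"
  shows "M x (u *\<^sub>R a + v *\<^sub>R b) \<le> u * M x a + v * M x b"
  using M_convex[OF assms(1)] assms(2-4) unfolding convex_on_def by blast

lemma M_scale: assumes "x \<in> \<Omega>" "0 \<le> s" "s \<le> 1" shows "M x (s *\<^sub>R \<xi>) \<le> s * M x \<xi>"
proof -
  have "M x ((1 - s) *\<^sub>R 0 + s *\<^sub>R \<xi>) \<le> (1 - s) * M x 0 + s * M x \<xi>"
    by (rule M_conv) (use assms in auto)
  then show ?thesis using M_zero[OF assms(1)] by simp
qed

lemma M_mono_scale: assumes "x \<in> \<Omega>" "0 \<le> s" "s \<le> t" shows "M x (s *\<^sub>R \<xi>) \<le> M x (t *\<^sub>R \<xi>)"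
proof (cases "t = 0")
  case False
  then have "t > 0" using assms by simp
  then have "M x ((s / t) *\<^sub>R (t *\<^sub>R \<xi>)) \<le> (s / t) * M x (t *\<^sub>R \<xi>)"
    using assms by (intro M_scale) auto
  also have "\<dots> \<le> M x (t *\<^sub>R \<xi>)"
    using assms \<open>t > 0\<close> M_nonneg[OF assms(1)] by (intro mult_left_le_one_le) auto
  finally show ?thesis using False by simp
qed (use assms in simp)

lemma M_add: assumes "x \<in> \<Omega>" shows "M x (a + b) \<le> M x (2 *\<^sub>R a) / 2 + M x (2 *\<^sub>R b) / 2"
proof -
  have "M x ((1/2) *\<^sub>R (2 *\<^sub>R a) + (1/2) *\<^sub>R (2 *\<^sub>R b)) \<le> (1/2) * M x (2 *\<^sub>R a) + (1/2) * M x (2 *\<^sub>R b)"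
    by (rule M_conv) (use assms in auto)
  then show ?thesis by simp
qed

lemma M_diff: assumes "x \<in> \<Omega>" shows "M x (a - b) \<le> M x (2 *\<^sub>R a) / 2 + M x (2 *\<^sub>R b) / 2"
  using M_add[OF assms, of a "- b"] M_even[OF assms, of "2 *\<^sub>R b"] by simp

text \<open>Extended by zero, so that modulars are integrals over the whole space, where convolutions live.\<close>

definition M0 :: "'a \<Rightarrow> 'a \<Rightarrow> real" where "M0 x \<xi> = (if x \<in> \<Omega> then M x \<xi> else 0)"

lemma M0_nonneg: "0 \<le> M0 x \<xi>" by (simp add: M0_def M_nonneg)
lemma M0_zero: "M0 x 0 = 0" by (simp add: M0_def M_zero)
lemma M0_add: "M0 x (a + b) \<le> M0 x (2 *\<^sub>R a) / 2 + M0 x (2 *\<^sub>R b) / 2" by (simp add: M0_def M_add)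
lemma M0_diff: "M0 x (a - b) \<le> M0 x (2 *\<^sub>R a) / 2 + M0 x (2 *\<^sub>R b) / 2" by (simp add: M0_def M_diff)
lemma M0_mono_scale: "0 \<le> s \<Longrightarrow> s \<le> t \<Longrightarrow> M0 x (s *\<^sub>R \<xi>) \<le> M0 x (t *\<^sub>R \<xi>)" by (simp add: M0_def M_mono_scale)

lemma M0_measurable:
  assumes [measurable]: "h \<in> borel_measurable borel"
  shows "(\<lambda>x. M0 x (h x)) \<in> borel_measurable borel"
proof -
  have "(\<lambda>p. indicator (\<Omega> \<times> UNIV) p *\<^sub>R (case p of (x, \<xi>) \<Rightarrow> M x \<xi>)) \<in> borel_measurable borel"
    by (rule borel_measurable_continuous_on_indicator[OF _ M_cont]) (simp add: open_Omega open_Times)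
  moreover have "(\<lambda>x. (x, h x)) \<in> borel_measurable borel" by simp
  ultimately have "(\<lambda>x. indicator (\<Omega> \<times> UNIV) (x, h x) *\<^sub>R (case (x, h x) of (x, \<xi>) \<Rightarrow> M x \<xi>)) \<in> borel_measurable borel"
    by (rule measurable_compose[rotated])
  moreover have "(\<lambda>x. indicator (\<Omega> \<times> UNIV) (x, h x) *\<^sub>R (case (x, h x) of (x, \<xi>) \<Rightarrow> M x \<xi>)) = (\<lambda>x. M0 x (h x))"
    by (auto simp: M0_def indicator_def)
  ultimately show ?thesis by simp
qed

lemma M0_tendsto_zero:
  assumes "u \<longlonglongrightarrow> 0" shows "(\<lambda>n. M0 x (u n)) \<longlonglongrightarrow> 0"
proof (cases "x \<in> \<Omega>")
  case True
  have "continuous_on UNIV (\<lambda>\<xi>. (\<lambda>(x, \<xi>). M x \<xi>) (x, \<xi>))"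
    by (rule continuous_on_compose2[OF M_cont]) (use True in \<open>auto intro!: continuous_intros\<close>)
  then have "isCont (M x) 0" by (simp add: continuous_on_eq_continuous_at)
  from isCont_tendsto_compose[OF this assms] show ?thesis using True by (simp add: M0_def M_zero)
qed (simp add: M0_def)

definition modular0 :: "('a \<Rightarrow> 'a) \<Rightarrow> ennreal" where
  "modular0 h = (\<integral>\<^sup>+x. ennreal (M0 x (h x)) \<partial>lborel)"

lemma modular0_add:
  assumes [measurable]: "f \<in> borel_measurable borel" "g \<in> borel_measurable borel"
  shows "modular0 (\<lambda>x. f x + g x) \<le> modular0 (\<lambda>x. 2 *\<^sub>R f x) + modular0 (\<lambda>x. 2 *\<^sub>R g x)"
proof -
  note [measurable] = M0_measurable
  have "modular0 (\<lambda>x. f x + g x) \<le> (\<integral>\<^sup>+x. ennreal (M0 x (2 *\<^sub>R f x)) + ennreal (M0 x (2 *\<^sub>R g x)) \<partial>lborel)"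
    unfolding modular0_def
  proof (rule nn_integral_mono)
    fix x
    have "M0 x (f x + g x) \<le> M0 x (2 *\<^sub>R f x) + M0 x (2 *\<^sub>R g x)"
      using M0_add[of x "f x" "g x"] M0_nonneg[of x "2 *\<^sub>R f x"] M0_nonneg[of x "2 *\<^sub>R g x"] by linarith
    then show "ennreal (M0 x (f x + g x)) \<le> ennreal (M0 x (2 *\<^sub>R f x)) + ennreal (M0 x (2 *\<^sub>R g x))"
      using M0_nonneg by (simp flip: ennreal_plus add: ennreal_leI)
  qed
  also have "\<dots> = modular0 (\<lambda>x. 2 *\<^sub>R f x) + modular0 (\<lambda>x. 2 *\<^sub>R g x)"
    unfolding modular0_def by (rule nn_integral_add) (auto intro!: M0_measurable measurable_compose[OF _ measurable_ennreal])
  finally show ?thesis .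
qed

lemma modular0_bounded:
  assumes "\<And>x. norm (h x) \<le> B" shows "modular0 (\<lambda>x. s *\<^sub>R h x) < \<infinity>"
proof -
  obtain D where D: "\<And>x \<xi>. x \<in> \<Omega> \<Longrightarrow> norm \<xi> \<le> \<bar>s\<bar> * B \<Longrightarrow> M x \<xi> \<le> D" using M_upper[of "\<bar>s\<bar> * B"] by blast
  have "modular0 (\<lambda>x. s *\<^sub>R h x) \<le> (\<integral>\<^sup>+x. ennreal D * indicator \<Omega> x \<partial>lborel)"
    unfolding modular0_def
  proof (rule nn_integral_mono)
    fix x
    show "ennreal (M0 x (s *\<^sub>R h x)) \<le> ennreal D * indicator \<Omega> x"
      using D[of x "s *\<^sub>R h x"] mult_left_mono[OF assms[of x], of "\<bar>s\<bar>"] by (auto simp: M0_def intro!: ennreal_leI)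
  qed
  also have "\<dots> = ennreal D * emeasure lborel \<Omega>"
    using open_Omega by (simp add: nn_integral_cmult_indicator)
  also have "\<dots> < \<infinity>"
    using emeasure_bounded_finite[OF bounded_Omega] by (simp add: ennreal_mult_less_top)
  finally show ?thesis .
qed

text \<open>Modular convergence is required for every multiplier \<open>l\<close>. This makes the notion stable under sums
  and limits, where convexity of \<open>M\<close> costs a factor \<open>2\<close> in the argument.\<close>

definition approximable :: "('a \<Rightarrow> real) \<Rightarrow> ('a \<Rightarrow> 'a) \<Rightarrow> bool" where
  "approximable w g \<longleftrightarrow> (\<forall>l>0. \<forall>\<epsilon>>0. \<exists>\<phi>\<in>test_functions \<Omega>.
     (\<integral>\<^sup>+x. ennreal \<bar>\<phi> x - w x\<bar> \<partial>lborel) \<le> ennreal \<epsilon> \<and>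
     (\<integral>\<^sup>+x. ennreal (norm (grad \<phi> x - g x)) \<partial>lborel) \<le> ennreal \<epsilon> \<and>
     modular0 (\<lambda>x. l *\<^sub>R (grad \<phi> x - g x)) \<le> ennreal \<epsilon>)"

lemma nn_integral_norm_triangle:
  fixes a b :: "'a \<Rightarrow> 'b::euclidean_space"
  assumes [measurable]: "a \<in> borel_measurable borel" "b \<in> borel_measurable borel"
  shows "(\<integral>\<^sup>+x. ennreal (norm (a x + b x)) \<partial>lborel) \<le> (\<integral>\<^sup>+x. ennreal (norm (a x)) \<partial>lborel) + (\<integral>\<^sup>+x. ennreal (norm (b x)) \<partial>lborel)"
proof -
  have "(\<integral>\<^sup>+x. ennreal (norm (a x + b x)) \<partial>lborel) \<le> (\<integral>\<^sup>+x. ennreal (norm (a x)) + ennreal (norm (b x)) \<partial>lborel)"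
    by (rule nn_integral_mono) (simp flip: ennreal_plus add: norm_triangle_ineq)
  also have "\<dots> = (\<integral>\<^sup>+x. ennreal (norm (a x)) \<partial>lborel) + (\<integral>\<^sup>+x. ennreal (norm (b x)) \<partial>lborel)"
    by (rule nn_integral_add) auto
  finally show ?thesis .
qed

lemma test_borel:
  assumes "\<phi> \<in> test_functions S"
  shows "\<phi> \<in> borel_measurable borel" "grad \<phi> \<in> borel_measurable borel"
  using C1c_integrable[OF test_functionsD(4)[OF assms]] by auto

lemma ennreal_half_add: "e > 0 \<Longrightarrow> a \<le> ennreal (e / 2) \<Longrightarrow> b \<le> ennreal (e / 2) \<Longrightarrow> c \<le> a + b \<Longrightarrow> c \<le> ennreal e"
proof -
  assume *: "e > 0" "a \<le> ennreal (e / 2)" "b \<le> ennreal (e / 2)" "c \<le> a + b"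
  have "c \<le> ennreal (e / 2) + ennreal (e / 2)" using *(4) add_mono[OF *(2,3)] by (rule order_trans)
  also have "\<dots> = ennreal e" using *(1) by (simp flip: ennreal_plus)
  finally show "c \<le> ennreal e" .
qed

lemma approximable_add:
  assumes b: "w \<in> borel_measurable borel" "g \<in> borel_measurable borel" "w' \<in> borel_measurable borel" "g' \<in> borel_measurable borel"
    and a: "approximable w g" "approximable w' g'"
  shows "approximable (\<lambda>x. w x + w' x) (\<lambda>x. g x + g' x)"
  unfolding approximable_def
proof (intro allI impI)
  fix l e :: real assume l: "l > 0" "e > 0"
  then have l2: "2 * l > 0" "e / 2 > 0" by auto
  obtain p where p: "p \<in> test_functions \<Omega>" "(\<integral>\<^sup>+x. ennreal \<bar>p x - w x\<bar> \<partial>lborel) \<le> ennreal (e/2)"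
     "(\<integral>\<^sup>+x. ennreal (norm (grad p x - g x)) \<partial>lborel) \<le> ennreal (e/2)"
     "modular0 (\<lambda>x. (2 * l) *\<^sub>R (grad p x - g x)) \<le> ennreal (e/2)"
    using a(1)[unfolded approximable_def, rule_format, OF l2] by blast
  obtain q where q: "q \<in> test_functions \<Omega>" "(\<integral>\<^sup>+x. ennreal \<bar>q x - w' x\<bar> \<partial>lborel) \<le> ennreal (e/2)"
     "(\<integral>\<^sup>+x. ennreal (norm (grad q x - g' x)) \<partial>lborel) \<le> ennreal (e/2)"
     "modular0 (\<lambda>x. (2 * l) *\<^sub>R (grad q x - g' x)) \<le> ennreal (e/2)"
    using a(2)[unfolded approximable_def, rule_format, OF l2] by blast
  note [measurable] = b test_borel[OF p(1)] test_borel[OF q(1)]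
  have gr: "grad (\<lambda>x. p x + q x) x = grad p x + grad q x" for x
    by (rule grad_add[OF test_functionsD(1)[OF p(1)] test_functionsD(1)[OF q(1)]])
  show "\<exists>\<phi>\<in>test_functions \<Omega>.
     (\<integral>\<^sup>+x. ennreal \<bar>\<phi> x - (w x + w' x)\<bar> \<partial>lborel) \<le> ennreal e \<and>
     (\<integral>\<^sup>+x. ennreal (norm (grad \<phi> x - (g x + g' x))) \<partial>lborel) \<le> ennreal e \<and>
     modular0 (\<lambda>x. l *\<^sub>R (grad \<phi> x - (g x + g' x))) \<le> ennreal e"
  proof (intro bexI[OF _ test_functions_add[OF p(1) q(1)]] conjI)
    have e1: "p x + q x - (w x + w' x) = (p x - w x) + (q x - w' x)" for x by simp
    have e2: "grad (\<lambda>x. p x + q x) x - (g x + g' x) = (grad p x - g x) + (grad q x - g' x)" for x by (simp add: gr)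
    show "(\<integral>\<^sup>+x. ennreal \<bar>p x + q x - (w x + w' x)\<bar> \<partial>lborel) \<le> ennreal e"
      unfolding e1
      by (rule ennreal_half_add[OF l(2) p(2) q(2)])
        (rule nn_integral_norm_triangle[of "\<lambda>x. p x - w x" "\<lambda>x. q x - w' x", unfolded real_norm_def]; measurable)
    show "(\<integral>\<^sup>+x. ennreal (norm (grad (\<lambda>x. p x + q x) x - (g x + g' x))) \<partial>lborel) \<le> ennreal e"
      unfolding e2
      by (rule ennreal_half_add[OF l(2) p(3) q(3)])
        (rule nn_integral_norm_triangle[of "\<lambda>x. grad p x - g x" "\<lambda>x. grad q x - g' x"]; measurable)
    show "modular0 (\<lambda>x. l *\<^sub>R (grad (\<lambda>x. p x + q x) x - (g x + g' x))) \<le> ennreal e"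
      unfolding e2 scaleR_add_right
    proof (rule ennreal_half_add[OF l(2) p(4) q(4)])
      show "modular0 (\<lambda>x. l *\<^sub>R (grad p x - g x) + l *\<^sub>R (grad q x - g' x)) \<le>
        modular0 (\<lambda>x. (2 * l) *\<^sub>R (grad p x - g x)) + modular0 (\<lambda>x. (2 * l) *\<^sub>R (grad q x - g' x))"
        using modular0_add[of "\<lambda>x. l *\<^sub>R (grad p x - g x)" "\<lambda>x. l *\<^sub>R (grad q x - g' x)"] by simp
    qed
  qed
qed

lemma approximable_limit:
  assumes b: "w \<in> borel_measurable borel" "g \<in> borel_measurable borel"
    and a: "\<And>l e. l > 0 \<Longrightarrow> e > 0 \<Longrightarrow> \<exists>w' g'. w' \<in> borel_measurable borel \<and> g' \<in> borel_measurable borel \<and> approximable w' g' \<and>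
      (\<integral>\<^sup>+x. ennreal \<bar>w' x - w x\<bar> \<partial>lborel) \<le> ennreal e \<and> (\<integral>\<^sup>+x. ennreal (norm (g' x - g x)) \<partial>lborel) \<le> ennreal e \<and>
      modular0 (\<lambda>x. l *\<^sub>R (g' x - g x)) \<le> ennreal e"
  shows "approximable w g"
  unfolding approximable_def
proof (intro allI impI)
  fix l e :: real assume l: "l > 0" "e > 0"
  then have l2: "2 * l > 0" "e / 2 > 0" by auto
  obtain w' g' where w': "w' \<in> borel_measurable borel" "g' \<in> borel_measurable borel" "approximable w' g'"
     "(\<integral>\<^sup>+x. ennreal \<bar>w' x - w x\<bar> \<partial>lborel) \<le> ennreal (e/2)" "(\<integral>\<^sup>+x. ennreal (norm (g' x - g x)) \<partial>lborel) \<le> ennreal (e/2)"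
     "modular0 (\<lambda>x. (2 * l) *\<^sub>R (g' x - g x)) \<le> ennreal (e/2)"
    using a[OF l2] by blast
  obtain q where q: "q \<in> test_functions \<Omega>" "(\<integral>\<^sup>+x. ennreal \<bar>q x - w' x\<bar> \<partial>lborel) \<le> ennreal (e/2)"
     "(\<integral>\<^sup>+x. ennreal (norm (grad q x - g' x)) \<partial>lborel) \<le> ennreal (e/2)"
     "modular0 (\<lambda>x. (2 * l) *\<^sub>R (grad q x - g' x)) \<le> ennreal (e/2)"
    using w'(3)[unfolded approximable_def, rule_format, OF l2] by blast
  note [measurable] = b test_borel[OF q(1)] w'(1,2)
  show "\<exists>\<phi>\<in>test_functions \<Omega>.
     (\<integral>\<^sup>+x. ennreal \<bar>\<phi> x - w x\<bar> \<partial>lborel) \<le> ennreal e \<and>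
     (\<integral>\<^sup>+x. ennreal (norm (grad \<phi> x - g x)) \<partial>lborel) \<le> ennreal e \<and>
     modular0 (\<lambda>x. l *\<^sub>R (grad \<phi> x - g x)) \<le> ennreal e"
  proof (intro bexI[OF _ q(1)] conjI)
    have e1: "q x - w x = (w' x - w x) + (q x - w' x)" for x by simp
    have e2: "grad q x - g x = (g' x - g x) + (grad q x - g' x)" for x by simp
    show "(\<integral>\<^sup>+x. ennreal \<bar>q x - w x\<bar> \<partial>lborel) \<le> ennreal e"
      apply (subst e1)
      by (rule ennreal_half_add[OF l(2) w'(4) q(2)])
        (rule nn_integral_norm_triangle[of "\<lambda>x. w' x - w x" "\<lambda>x. q x - w' x", unfolded real_norm_def]; measurable)
    show "(\<integral>\<^sup>+x. ennreal (norm (grad q x - g x)) \<partial>lborel) \<le> ennreal e"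
      apply (subst e2)
      by (rule ennreal_half_add[OF l(2) w'(5) q(3)])
        (rule nn_integral_norm_triangle[of "\<lambda>x. g' x - g x" "\<lambda>x. grad q x - g' x"]; measurable)
    have "modular0 (\<lambda>x. l *\<^sub>R (g' x - g x) + l *\<^sub>R (grad q x - g' x)) \<le>
        modular0 (\<lambda>x. (2 * l) *\<^sub>R (g' x - g x)) + modular0 (\<lambda>x. (2 * l) *\<^sub>R (grad q x - g' x))"
      using modular0_add[of "\<lambda>x. l *\<^sub>R (g' x - g x)" "\<lambda>x. l *\<^sub>R (grad q x - g' x)"] by simp
    from ennreal_half_add[OF l(2) w'(6) q(4) this]
    show "modular0 (\<lambda>x. l *\<^sub>R (grad q x - g x)) \<le> ennreal e"
      by (simp add: scaleR_add_right[symmetric])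
  qed
qed

end

section \<open>The balance condition and averages\<close>

text \<open>The balance condition without reference to coordinates: \<open>P j\<close> are the projections to the factors. At the
  centre \<open>x\<close> of a ball, the comparison of essential bounds becomes an inequality between the values of \<open>M\<close>
  at \<open>x\<close> and at another point \<open>y\<close>. The threshold is expressed by a single unit vector \<open>\<eta>\<close>, whose
  direction can be chosen freely.\<close>

locale balanced_musielak = musielak \<Omega> M for \<Omega> :: "'a::euclidean_space set" and M +
  fixes K :: nat and P :: "nat \<Rightarrow> 'a \<Rightarrow> 'a" and C :: real and \<theta> :: "real \<Rightarrow> real" and \<gamma> :: real
  assumes P_linear: "linear (P j)" and P_norm: "norm (P j \<xi>) \<le> norm \<xi>" and P_proj: "P j (P j \<xi>) = P j \<xi>"
    and P_unit: "j < K \<Longrightarrow> \<exists>\<eta>. P j \<eta> = \<eta> \<and> norm \<eta> = 1"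
    and M_split: "x \<in> \<Omega> \<Longrightarrow> M x \<xi> = (\<Sum>j<K. M x (P j \<xi>))"
    and C_gt: "C > 1" and gamma: "0 \<le> \<gamma>" "\<gamma> \<le> 1"
    and theta_pos: "0 < r \<Longrightarrow> r \<le> 1 \<Longrightarrow> \<theta> r > 0"
    and theta_growth: "\<exists>d>0. \<forall>r. 0 < r \<and> r < d \<longrightarrow> A * r powr (\<gamma> - 1) \<le> \<theta> r"
    and balance: "x \<in> \<Omega> \<Longrightarrow> 0 < r \<Longrightarrow> r \<le> 1 \<Longrightarrow> j < K \<Longrightarrow> P j \<xi> = \<xi> \<Longrightarrow> P j \<eta> = \<eta> \<Longrightarrow> norm \<eta> = 1 \<Longrightarrow>
      (INF y\<in>ball x r \<inter> \<Omega>. M y (C *\<^sub>R \<xi>)) \<le> (INF y\<in>ball x r \<inter> \<Omega>. M y (\<theta> r *\<^sub>R \<eta>)) \<Longrightarrow>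
      y \<in> ball x r \<inter> \<Omega> \<Longrightarrow> M x \<xi> \<le> M y (C *\<^sub>R \<xi>) + 1"
begin

text \<open>Let \<open>l\<close> be the infimum of \<open>M\<close> over the ball and \<open>T\<close> its value at length \<open>\<theta> r\<close> in the direction of
  \<open>z0\<close>. The balance condition controls \<open>M x\<close>, and hence the tangent \<open>a\<close> at \<open>z0\<close>, at all \<open>z\<close> with
  \<open>l (C z) \<le> T\<close>. For the other \<open>z\<close> the bound is extrapolated along the ray from \<open>0\<close>: an affine function
  grows linearly on it, and \<open>l\<close> at least linearly. The smallness of \<open>z0\<close> ensures that \<open>2 z0\<close> is still in
  the controlled range, which bounds \<open>a 0\<close> from below by reflection at \<open>z0\<close>.\<close>

lemma tangent_minorant:
  assumes x: "x \<in> \<Omega>" and r: "0 < r" "r \<le> 1" and j: "j < K" and z0: "P j z0 = z0"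
    and small: "2 * C * norm z0 \<le> \<theta> r" and large: "\<And>y \<xi>. y \<in> \<Omega> \<Longrightarrow> \<theta> r \<le> norm \<xi> \<Longrightarrow> 1 \<le> M y \<xi>"
  shows "\<exists>p. (\<forall>z y. P j z = z \<longrightarrow> y \<in> ball x r \<inter> \<Omega> \<longrightarrow> M x z0 + p \<bullet> (z - z0) \<le> 4 * M y (C *\<^sub>R z) + 4) \<and> M x z0 - p \<bullet> z0 \<le> 0"
proof -
  define B where "B = ball x r \<inter> \<Omega>"
  define l where "l z = (INF y\<in>B. M y z)" for z
  have xB: "x \<in> B" using x r by (simp add: B_def)
  have BO: "y \<in> \<Omega>" if "y \<in> B" for y using that by (simp add: B_def)
  have bdd: "bdd_below ((\<lambda>y. M y z) ` B)" for z
    using M_nonneg BO by (intro bdd_belowI2[of _ 0]) auto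
  have l_le: "l z \<le> M y z" if "y \<in> B" for y z
    unfolding l_def by (rule cINF_lower[OF bdd that])
  have l_ge: "c \<le> l z" if "\<And>y. y \<in> B \<Longrightarrow> c \<le> M y z" for c z
    unfolding l_def by (rule cINF_greatest) (use xB that in auto)
  have l_scale: "l (s *\<^sub>R z) \<le> s * l z" if s: "0 \<le> s" "s \<le> 1" for s z
  proof (cases "s = 0")
    case True then show ?thesis using l_le[OF xB, of 0] M_zero[OF x] by simp
  next
    case False
    then have "s > 0" using s by simp
    have "l (s *\<^sub>R z) / s \<le> l z"
    proof (rule l_ge)
      fix y assume y: "y \<in> B"
      have "l (s *\<^sub>R z) \<le> s * M y z" using l_le[OF y, of "s *\<^sub>R z"] M_scale[OF BO[OF y] s] by (rule order_trans)
      then show "l (s *\<^sub>R z) / s \<le> M y z" using \<open>s > 0\<close> by (simp add: field_simps)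
    qed
    then show ?thesis using \<open>s > 0\<close> by (simp add: field_simps)
  qed
  have l_nn: "0 \<le> l z" for z using M_nonneg BO by (intro l_ge) auto
  note th = theta_pos[OF r]
  have sc: "P j (s *\<^sub>R z) = s *\<^sub>R z" if "P j z = z" for s z using that P_linear[of j] by (simp add: linear_cmul)
  \<comment> \<open>At the origin every direction of the factor will do.\<close>
  obtain h where h: "P j h = h" "norm h = 1" "z0 = norm z0 *\<^sub>R h"
  proof (cases "z0 = 0")
    case True
    then show ?thesis using P_unit[OF j] that by auto
  next
    case False
    show ?thesis by (rule that[of "(1 / norm z0) *\<^sub>R z0"]) (use False sc[OF z0] in auto)
  qed
  define T where "T = l (\<theta> r *\<^sub>R h)"
  have T1: "T \<ge> 1" unfolding T_def
    by (rule l_ge, rule large) (use BO h th in auto)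
  have key: "M x z \<le> l (C *\<^sub>R z) + 1" "M x z \<le> T + 1" if z: "P j z = z" "l (C *\<^sub>R z) \<le> T" for z
  proof -
    have "M x z - 1 \<le> l (C *\<^sub>R z)"
    proof (rule l_ge)
      fix y assume "y \<in> B"
      then have "M x z \<le> M y (C *\<^sub>R z) + 1"
        by (intro balance[OF x r j z(1) h(1,2)]) (use z(2) in \<open>auto simp: T_def l_def B_def\<close>)
      then show "M x z - 1 \<le> M y (C *\<^sub>R z)" by simp
    qed
    then show "M x z \<le> l (C *\<^sub>R z) + 1" "M x z \<le> T + 1" using z(2) by auto
  qed
  have z2: "l (C *\<^sub>R (2 *\<^sub>R z0)) \<le> T"
  proof -
    define t where "t = 2 * C * norm z0 / \<theta> r"
    have t: "0 \<le> t" "t \<le> 1" using small th C_gt by (auto simp: t_def)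
    have "C *\<^sub>R (2 *\<^sub>R z0) = t *\<^sub>R (\<theta> r *\<^sub>R h)"
      using th by (subst h(3)) (simp add: t_def mult.commute)
    then have "l (C *\<^sub>R (2 *\<^sub>R z0)) \<le> t * T"
      using l_scale[OF t, of "\<theta> r *\<^sub>R h"] by (simp only: T_def)
    also have "\<dots> \<le> T" using t T1 by (intro mult_left_le_one_le) auto
    finally show ?thesis .
  qed
  obtain p where p: "\<And>z. M x z0 + p \<bullet> (z - z0) \<le> M x z"
    using convex_subgradient[OF M_convex[OF x], of z0] by blast
  define a where "a z = M x z0 + p \<bullet> (z - z0)" for z
  have a_le: "a z \<le> M x z" for z using p by (simp add: a_def)
  have a0: "a 0 \<le> 0" using a_le[of 0] M_zero[OF x] by simp
  have "a (2 *\<^sub>R z0) \<le> T + 1" using a_le[of "2 *\<^sub>R z0"] key(2)[OF sc[OF z0] z2] by linarith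
  moreover have "a 0 = 2 * M x z0 - a (2 *\<^sub>R z0)" by (simp add: a_def inner_diff_right algebra_simps)
  ultimately have a0': "a 0 \<ge> - (T + 1)" using M_nonneg[OF x, of z0] by linarith
  have main: "a z \<le> 4 * M y (C *\<^sub>R z) + 4" if z: "P j z = z" and y: "y \<in> B" for z y
  proof (cases "l (C *\<^sub>R z) \<le> T")
    case True
    have "a z \<le> l (C *\<^sub>R z) + 1" using a_le[of z] key(1)[OF z True] by linarith
    then show ?thesis using l_le[OF y, of "C *\<^sub>R z"] l_nn[of "C *\<^sub>R z"] by linarith
  next
    case False
    \<comment> \<open>The factor s brings z back into the range controlled by the balance condition.\<close>
    define L where "L = l (C *\<^sub>R z)"
    define s where "s = T / L"
    have L: "L > T" "L > 0" using False T1 by (auto simp: L_def)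
    have s: "0 < s" "s \<le> 1" "s * L = T" using L T1 by (auto simp: s_def)
    have "l (C *\<^sub>R (s *\<^sub>R z)) \<le> T" using l_scale[of s "C *\<^sub>R z"] s by (simp add: L_def mult.commute)
    then have "a (s *\<^sub>R z) \<le> T + 1" using a_le[of "s *\<^sub>R z"] key(2)[OF sc[OF z]] by (meson order_trans)
    moreover define q where "q = (1 - s) * a 0"
    moreover have "a (s *\<^sub>R z) = s * a z + q"
      by (simp add: q_def a_def inner_diff_right algebra_simps)
    moreover have "q \<ge> - (T + 1)"
    proof -
      have "(1 - s) * (- a 0) \<le> 1 * (- a 0)" using s a0 by (intro mult_right_mono) auto
      then show ?thesis using a0' by (simp add: q_def)
    qed
    ultimately have qq: "a (s *\<^sub>R z) \<le> T + 1" "a (s *\<^sub>R z) = s * a z + q" "- (T + 1) \<le> q" by blast+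
    have "s * a z = a (s *\<^sub>R z) - q" using qq(2) by simp
    also have "\<dots> \<le> (T + 1) - (- (T + 1))" by (rule diff_mono[OF qq(1,3)])
    finally have "s * a z \<le> 2 * (T + 1)" by simp
    also have "\<dots> \<le> s * (4 * L)" using T1 s(3) by (simp add: algebra_simps)
    finally have "a z \<le> 4 * L" using s(1) by simp
    then show ?thesis using l_le[OF y, of "C *\<^sub>R z"] by (simp add: L_def)
  qed
  show ?thesis
    by (rule exI[of _ p]) (use main a0 in \<open>auto simp: a_def B_def inner_diff_right\<close>)
qed

text \<open>Jensen's inequality with the tangent minorant in place of \<open>M x\<close>: an affine function commutes with the
  average, and the minorant is compared with \<open>M y\<close> at each point \<open>y\<close> of the average. Off \<open>\<Omega>\<close> the function
  \<open>f\<close> vanishes, and there the minorant is nonpositive.\<close>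

lemma averaged_bound_component:
  assumes x: "x \<in> \<Omega>" and r: "0 < r" "r \<le> 1" and j: "j < K"
    and k: "C1c k k'" "\<And>z. k z \<ge> 0" "(LINT z|lborel. k z) = 1" "\<And>z. k z \<noteq> 0 \<Longrightarrow> norm z < r"
    and f: "integrable lborel f" "\<And>y. y \<notin> \<Omega> \<Longrightarrow> f y = 0"
    and h: "integrable lborel (\<lambda>y. M0 y (C *\<^sub>R P j (f y)))"
    and small: "2 * C * norm (conv k f x) \<le> \<theta> r" and large: "\<And>y \<xi>. y \<in> \<Omega> \<Longrightarrow> \<theta> r \<le> norm \<xi> \<Longrightarrow> 1 \<le> M y \<xi>"
  shows "M x (P j (conv k f x)) \<le> 4 * conv k (\<lambda>y. M0 y (C *\<^sub>R P j (f y))) x + 4"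
proof -
  define z0 where "z0 = P j (conv k f x)"
  have k1: "C1_grad k k'" using k(1) by (simp add: C1c_def)
  note kc = C1_grad_continuous(1)[OF k1, of UNIV]
  obtain B where B: "\<And>x. \<bar>k x\<bar> \<le> B" using C1c_bounded[OF k(1)] by metis
  have "2 * C * norm z0 \<le> 2 * C * norm (conv k f x)"
    using P_norm C_gt by (simp add: z0_def)
  with small have "2 * C * norm z0 \<le> \<theta> r" by linarith
  from tangent_minorant[OF x r j _ this large] P_proj[of j "conv k f x"]
  obtain p where p: "\<And>z y. P j z = z \<Longrightarrow> y \<in> ball x r \<inter> \<Omega> \<Longrightarrow> M x z0 + p \<bullet> (z - z0) \<le> 4 * M y (C *\<^sub>R z) + 4"
    "M x z0 - p \<bullet> z0 \<le> 0" by (auto simp: z0_def)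
  have ik: "integrable lborel (\<lambda>y. k (x - y))"
    using lborel_integrable_affine[OF C1c_integrable(1)[OF k(1)], of "-1" x] by simp
  have "k \<in> borel_measurable borel" using C1c_integrable(1)[OF k(1)] by simp
  from lborel_integral_affine[OF this, of "-1" x]
  have ik1: "(LINT y|lborel. k (x - y)) = 1" using k(3) by simp
  have bl: "bounded_linear (P j)" using P_linear by (simp add: linear_conv_bounded_linear)
  have iPf: "integrable lborel (\<lambda>y. P j (f y))" by (rule integrable_bounded_linear[OF bl f(1)])
  have ikf: "integrable lborel (\<lambda>y. k (x - y) *\<^sub>R f y)" by (rule conv_integrable[OF kc B f(1)])
  have ikPf: "integrable lborel (\<lambda>y. k (x - y) *\<^sub>R P j (f y))" by (rule conv_integrable[OF kc B iPf])
  have ikh: "integrable lborel (\<lambda>y. k (x - y) *\<^sub>R M0 y (C *\<^sub>R P j (f y)))" by (rule conv_integrable[OF kc B h])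
  have z0: "z0 = (LINT y|lborel. k (x - y) *\<^sub>R P j (f y))"
    using integral_bounded_linear[OF bl ikf] P_linear[of j] by (simp add: z0_def conv_def linear_cmul)
  have ikPfp: "integrable lborel (\<lambda>y. p \<bullet> (k (x - y) *\<^sub>R P j (f y)))"
    by (rule integrable_inner_right) (rule ikPf)
  have "M x z0 = (M x z0 - p \<bullet> z0) * (LINT y|lborel. k (x - y)) + p \<bullet> (LINT y|lborel. k (x - y) *\<^sub>R P j (f y))"
    using ik1 z0 by simp
  also have "p \<bullet> (LINT y|lborel. k (x - y) *\<^sub>R P j (f y)) = (LINT y|lborel. p \<bullet> (k (x - y) *\<^sub>R P j (f y)))"
    by (rule integral_inner_right[symmetric]) (rule ikPf)
  also have "(M x z0 - p \<bullet> z0) * (LINT y|lborel. k (x - y)) + (LINT y|lborel. p \<bullet> (k (x - y) *\<^sub>R P j (f y))) =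
      (LINT y|lborel. (M x z0 - p \<bullet> z0) * k (x - y) + p \<bullet> (k (x - y) *\<^sub>R P j (f y)))"
    using Bochner_Integration.integral_add[OF integrable_mult_right[OF ik] ikPfp, of "M x z0 - p \<bullet> z0"] by simp
  also have "\<dots> \<le> (LINT y|lborel. 4 * (k (x - y) *\<^sub>R M0 y (C *\<^sub>R P j (f y))) + 4 * k (x - y))"
  proof (rule integral_mono)
    show "integrable lborel (\<lambda>y. (M x z0 - p \<bullet> z0) * k (x - y) + p \<bullet> (k (x - y) *\<^sub>R P j (f y)))"
      using ik ikPfp by (intro Bochner_Integration.integrable_add integrable_mult_right) auto
    show "integrable lborel (\<lambda>y. 4 * (k (x - y) *\<^sub>R M0 y (C *\<^sub>R P j (f y))) + 4 * k (x - y))"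
      using ik ikh by (intro Bochner_Integration.integrable_add integrable_mult_right) auto
    fix y
    have le: "M x z0 + p \<bullet> (P j (f y) - z0) \<le> 4 * M0 y (C *\<^sub>R P j (f y)) + 4" if "k (x - y) \<noteq> 0"
    proof (cases "y \<in> \<Omega>")
      case True
      then have "y \<in> ball x r \<inter> \<Omega>" using k(4)[OF that] by (simp add: dist_norm)
      from p(1)[OF P_proj this] show ?thesis using True by (simp add: M0_def)
    next
      case False
      then have "P j (f y) = 0" using f(2)[OF False] P_linear[of j] by (simp add: linear_0)
      then show ?thesis using p(2) M0_nonneg[of y "C *\<^sub>R P j (f y)"] by (simp add: inner_diff_right M0_zero)
    qed
    have "k (x - y) * (M x z0 + p \<bullet> (P j (f y) - z0)) \<le> k (x - y) * (4 * M0 y (C *\<^sub>R P j (f y)) + 4)"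
      using le k(2)[of "x - y"] by (cases "k (x - y) = 0") (auto intro: mult_left_mono)
    then show "(M x z0 - p \<bullet> z0) * k (x - y) + p \<bullet> (k (x - y) *\<^sub>R P j (f y)) \<le>
        4 * (k (x - y) *\<^sub>R M0 y (C *\<^sub>R P j (f y))) + 4 * k (x - y)"
      by (simp add: inner_diff_right algebra_simps)
  qed
  also have "\<dots> = 4 * conv k (\<lambda>y. M0 y (C *\<^sub>R P j (f y))) x + 4"
    using ik ikh ik1 by (simp add: conv_def)
  finally show ?thesis by (simp add: z0_def)
qed

lemma M0_split: "M0 x \<xi> = (\<Sum>j<K. M0 x (P j \<xi>))"
  by (simp add: M0_def M_split[symmetric])

text \<open>On each factor the hypothesis on the size of the average is inherited, as projections do not increase
  norms, so the bounds for the factors can be added.\<close>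

lemma averaged_bound:
  assumes x: "x \<in> \<Omega>" and r: "0 < r" "r \<le> 1"
    and k: "C1c k k'" "\<And>z. k z \<ge> 0" "(LINT z|lborel. k z) = 1" "\<And>z. k z \<noteq> 0 \<Longrightarrow> norm z < r"
    and f: "integrable lborel f" "\<And>y. y \<notin> \<Omega> \<Longrightarrow> f y = 0"
    and h: "integrable lborel (\<lambda>y. M0 y (C *\<^sub>R f y))"
    and small: "2 * C * norm (conv k f x) \<le> \<theta> r" and large: "\<And>y \<xi>. y \<in> \<Omega> \<Longrightarrow> \<theta> r \<le> norm \<xi> \<Longrightarrow> 1 \<le> M y \<xi>"
  shows "M x (conv k f x) \<le> 4 * conv k (\<lambda>y. M0 y (C *\<^sub>R f y)) x + 4 * real K"
proof -
  have [measurable]: "f \<in> borel_measurable borel" using f(1) by simp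
  have Cp: "C *\<^sub>R P j z = P j (C *\<^sub>R z)" for j z using P_linear[of j] by (simp add: linear_cmul)
  have hj: "integrable lborel (\<lambda>y. M0 y (C *\<^sub>R P j (f y)))" if "j < K" for j
  proof (rule Bochner_Integration.integrable_bound[OF h])
    have "P j \<in> borel_measurable borel"
      using P_linear[of j] by (intro borel_measurable_continuous_onI linear_continuous_on) (simp add: linear_conv_bounded_linear)
    then have [measurable]: "(\<lambda>y. C *\<^sub>R P j (f y)) \<in> borel_measurable borel" by measurable
    show "(\<lambda>y. M0 y (C *\<^sub>R P j (f y))) \<in> borel_measurable lborel" using M0_measurable by simp
    have "M0 y (C *\<^sub>R P j (f y)) \<le> M0 y (C *\<^sub>R f y)" for y
      unfolding M0_split[of y "C *\<^sub>R f y"] Cp using that M0_nonneg by (intro member_le_sum) auto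
    then show "AE y in lborel. norm (M0 y (C *\<^sub>R P j (f y))) \<le> norm (M0 y (C *\<^sub>R f y))" using M0_nonneg by simp
  qed
  have k1: "C1_grad k k'" using k(1) by (simp add: C1c_def)
  note kc = C1_grad_continuous(1)[OF k1, of UNIV]
  obtain B where B: "\<And>x. \<bar>k x\<bar> \<le> B" using C1c_bounded[OF k(1)] by metis
  have "M x (conv k f x) = (\<Sum>j<K. M x (P j (conv k f x)))" by (rule M_split[OF x])
  also have "\<dots> \<le> (\<Sum>j<K. 4 * conv k (\<lambda>y. M0 y (C *\<^sub>R P j (f y))) x + 4)"
    by (intro sum_mono averaged_bound_component[OF x r _ k f _ small large] hj) auto
  also have "\<dots> = 4 * (\<Sum>j<K. conv k (\<lambda>y. M0 y (C *\<^sub>R P j (f y))) x) + 4 * real K"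
    by (simp add: sum.distrib sum_distrib_left mult.commute)
  also have "(\<Sum>j<K. conv k (\<lambda>y. M0 y (C *\<^sub>R P j (f y))) x) = (LINT y|lborel. (\<Sum>j<K. k (x - y) *\<^sub>R M0 y (C *\<^sub>R P j (f y))))"
    unfolding conv_def by (rule Bochner_Integration.integral_sum[symmetric]) (rule conv_integrable[OF kc B hj], simp)
  also have "(LINT y|lborel. (\<Sum>j<K. k (x - y) *\<^sub>R M0 y (C *\<^sub>R P j (f y)))) = conv k (\<lambda>y. M0 y (C *\<^sub>R f y)) x"
    unfolding conv_def Cp sum_distrib_left[symmetric] scaleR_sum_right[symmetric] M0_split[symmetric] ..
  finally show ?thesis .
qed

lemma eventually_theta: "\<exists>d>0. \<forall>r. 0 < r \<and> r < d \<longrightarrow> r \<le> 1 \<and> A * r powr (\<gamma> - 1) \<le> \<theta> r \<and> A \<le> \<theta> r"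
proof -
  obtain d where d: "d > 0" "\<And>r. 0 < r \<and> r < d \<Longrightarrow> max A 0 * r powr (\<gamma> - 1) \<le> \<theta> r"
    using theta_growth[of "max A 0"] by blast
  show ?thesis
  proof (intro exI[of _ "min d 1"] conjI allI impI)
    fix r :: real assume r: "0 < r \<and> r < min d 1"
    then have 1: "max A 0 * r powr (\<gamma> - 1) \<le> \<theta> r" using d(2) by simp
    have 2: "r powr (\<gamma> - 1) \<ge> 1"
    proof -
      have "r powr 0 \<le> r powr (\<gamma> - 1)" using r gamma by (intro powr_mono') auto
      then show ?thesis using r by simp
    qed
    show "r \<le> 1" using r by simp
    have "A * r powr (\<gamma> - 1) \<le> max A 0 * r powr (\<gamma> - 1)" using 2 by (intro mult_right_mono) auto
    then show "A * r powr (\<gamma> - 1) \<le> \<theta> r" using 1 by linarith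
    have "max A 0 * 1 \<le> max A 0 * r powr (\<gamma> - 1)" using 2 by (intro mult_left_mono) auto
    then show "A \<le> \<theta> r" using 1 by linarith
  qed (use d in auto)
qed

lemma kern_scaled:
  assumes "norm a + c \<le> 1" "c > 0" "\<delta> > 0"
  shows "kern (\<delta> *\<^sub>R a) (\<delta> * c) z \<noteq> 0 \<Longrightarrow> norm z < \<delta>"
    and "grad (kern (\<delta> *\<^sub>R a) (\<delta> * c)) z \<noteq> 0 \<Longrightarrow> norm z \<le> \<delta>"
proof -
  have dc: "\<delta> * c > 0" using assms by simp
  have n: "\<delta> * norm a + \<delta> * c \<le> \<delta>"
    using mult_left_mono[OF assms(1), of \<delta>] assms(3) by (simp add: distrib_left)
  have tri: "norm z \<le> \<delta> * norm a + dist (\<delta> *\<^sub>R a) z" for z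
    using norm_triangle_sub[of z "\<delta> *\<^sub>R a"] assms(3) by (simp add: dist_norm norm_minus_commute)
  show 1: "norm z < \<delta>" if "kern (\<delta> *\<^sub>R a) (\<delta> * c) z \<noteq> 0" for z
    using kern_support[OF dc that] tri[of z] n by linarith
  show "norm z \<le> \<delta>" if "grad (kern (\<delta> *\<^sub>R a) (\<delta> * c)) z \<noteq> 0"
  proof (rule ccontr)
    assume "\<not> norm z \<le> \<delta>"
    then have "z \<notin> cball 0 \<delta>" by simp
    moreover have "closure {x. kern (\<delta> *\<^sub>R a) (\<delta> * c) x \<noteq> 0} \<subseteq> cball 0 \<delta>"
    proof (rule closure_minimal)
      show "{x. kern (\<delta> *\<^sub>R a) (\<delta> * c) x \<noteq> 0} \<subseteq> cball 0 \<delta>"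
      proof
        fix x assume "x \<in> {x. kern (\<delta> *\<^sub>R a) (\<delta> * c) x \<noteq> 0}"
        then have "norm x < \<delta>" using 1 by simp
        then show "x \<in> cball 0 \<delta>" by simp
      qed
    qed simp
    ultimately have "z \<notin> closure {x. kern (\<delta> *\<^sub>R a) (\<delta> * c) x \<noteq> 0}" by blast
    from C1c_zero_outside(2)[OF kern_C1c[OF dc] this] show False using that by simp
  qed
qed

text \<open>The condition \<open>geo\<close> says that kernels supported in the ball of centre \<open>\<delta> a\<close> and radius \<open>\<delta> c\<close> map \<open>w\<close> to
  a function with compact support in \<open>\<Omega>\<close>. Hoelder continuity makes the mollified gradient of order
  \<open>\<delta>\<close> to the power \<open>\<gamma> - 1\<close>, so the averaged bound applies for small \<open>\<delta>\<close>. It provides an integrable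
  majorant, up to the error \<open>k * h - h\<close> with \<open>h = M(\<cdot>, C f)\<close>, which vanishes in the mean.\<close>

lemma local_approximation:
  assumes w: "W0 w g" "\<And>x. x \<notin> \<Omega> \<Longrightarrow> w x = 0" "\<And>x. x \<notin> \<Omega> \<Longrightarrow> g x = 0"
    and fin: "\<And>s. modular0 (\<lambda>x. s *\<^sub>R g x) < \<infinity>"
    and hol: "\<And>x y. x \<noteq> y \<Longrightarrow> \<bar>w x - w y\<bar> \<le> H * norm (x - y) powr \<gamma>"
    and a: "norm a + c \<le> 1" "c > 0"
    and d0: "d0 > 0"
    and geo: "\<And>\<delta>. 0 < \<delta> \<Longrightarrow> \<delta> < d0 \<Longrightarrow> \<exists>S. compact S \<and> S \<subseteq> \<Omega> \<and> (\<forall>y z. w y \<noteq> 0 \<longrightarrow> norm (z - \<delta> *\<^sub>R a) \<le> \<delta> * c \<longrightarrow> y + z \<in> S)"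
  shows "approximable w g"
  unfolding approximable_def
proof (intro allI impI)
  fix l \<epsilon> :: real assume l: "l > 0" and eps: "\<epsilon> > 0"
  note wi = W0_integrable[OF w(1)]
  have [measurable]: "w \<in> borel_measurable borel" "g \<in> borel_measurable borel" using wi by auto
  note [measurable] = M0_measurable
  \<comment> \<open>The factor 2 pays for splitting the difference of gradients by convexity.\<close>
  define f where "f x = (2 * l) *\<^sub>R g x" for x
  define h where "h x = M0 x (C *\<^sub>R f x)" for x
  have fi: "integrable lborel f" using wi(2) by (simp add: f_def[abs_def])
  have f0: "f x = 0" if "x \<notin> \<Omega>" for x using w(3)[OF that] by (simp add: f_def)
  have [measurable]: "f \<in> borel_measurable borel" using fi by simp
  have hm [measurable]: "h \<in> borel_measurable borel" unfolding h_def[abs_def] by measurable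
  have h_nn: "h x \<ge> 0" for x by (simp add: h_def M0_nonneg)
  have hi: "integrable lborel h"
    using fin[of "C * (2 * l)"] h_nn unfolding integrable_iff_bounded
    by (simp add: h_def[abs_def] f_def modular0_def M0_nonneg hm[unfolded h_def[abs_def] f_def])
  obtain D where D: "D \<ge> 0" "\<And>a s. s > 0 \<Longrightarrow> (LINT x|lborel. norm (grad (kern (a::'a) s) x)) = D / s"
    using kern_grad_integral[where 'a='a] by blast
  obtain R where R: "\<And>y \<xi>. y \<in> \<Omega> \<Longrightarrow> R \<le> norm \<xi> \<Longrightarrow> 1 \<le> M y \<xi>" using M_lower by blast
  \<comment> \<open>For small radii \<open>\<theta>\<close> exceeds A times the power in the gradient bound. The first entry then makes M at least 1 beyond the threshold, the second makes the mollified gradient small enough for the averaged bound.\<close>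
  define A where "A = max R (2 * C * (2 * l) * (\<bar>H\<bar> * D / c))"
  obtain d1 where d1: "d1 > 0" "\<And>r. 0 < r \<Longrightarrow> r < d1 \<Longrightarrow> r \<le> 1 \<and> A * r powr (\<gamma> - 1) \<le> \<theta> r \<and> A \<le> \<theta> r"
    using eventually_theta[of A] by metis
  define kk where "kk \<delta> = kern (\<delta> *\<^sub>R a) (\<delta> * c)" for \<delta>
  have ex: "\<exists>\<delta>. 0 < \<delta> \<and> \<delta> < d0 \<and> \<delta> < d1 \<and>
      (\<integral>\<^sup>+x. ennreal (norm (conv (kk \<delta>) w x - w x)) \<partial>lborel) \<le> ennreal e \<and>
      (\<integral>\<^sup>+x. ennreal (norm (conv (kk \<delta>) g x - g x)) \<partial>lborel) \<le> ennreal e \<and>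
      (\<integral>\<^sup>+x. ennreal (norm (conv (kk \<delta>) h x - h x)) \<partial>lborel) \<le> ennreal e" if e: "e > 0" for e
  proof -
    from conv_tendsto_L1[OF wi(1) e] obtain e1 where e1: "e1 > 0" "\<forall>k k'. C1c k k' \<and> (\<forall>z. k z \<ge> 0) \<and> (LINT z|lborel. k z) = 1 \<and> (\<forall>z. k z \<noteq> 0 \<longrightarrow> norm z < e1)
     \<longrightarrow> (\<integral>\<^sup>+x. ennreal (norm (conv k w x - w x)) \<partial>lborel) \<le> ennreal e" by (elim exE conjE)
    from conv_tendsto_L1[OF wi(2) e] obtain e2 where e2: "e2 > 0" "\<forall>k k'. C1c k k' \<and> (\<forall>z. k z \<ge> 0) \<and> (LINT z|lborel. k z) = 1 \<and> (\<forall>z. k z \<noteq> 0 \<longrightarrow> norm z < e2)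
     \<longrightarrow> (\<integral>\<^sup>+x. ennreal (norm (conv k g x - g x)) \<partial>lborel) \<le> ennreal e" by (elim exE conjE)
    from conv_tendsto_L1[OF hi e] obtain e3 where e3: "e3 > 0" "\<forall>k k'. C1c k k' \<and> (\<forall>z. k z \<ge> 0) \<and> (LINT z|lborel. k z) = 1 \<and> (\<forall>z. k z \<noteq> 0 \<longrightarrow> norm z < e3)
     \<longrightarrow> (\<integral>\<^sup>+x. ennreal (norm (conv k h x - h x)) \<partial>lborel) \<le> ennreal e" by (elim exE conjE)
    define \<delta> where "\<delta> = min (min d0 d1) (min e1 (min e2 e3)) / 2"
    have \<delta>: "0 < \<delta>" "\<delta> < d0" "\<delta> < d1" "\<delta> < e1" "\<delta> < e2" "\<delta> < e3"
      using d0 d1(1) e1(1) e2(1) e3(1) by (auto simp: \<delta>_def)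
    have dc: "\<delta> * c > 0" using \<delta> a by simp
    have k: "C1c (kk \<delta>) (grad (kk \<delta>))" "\<forall>z. kk \<delta> z \<ge> 0" "(LINT z|lborel. kk \<delta> z) = 1"
      using kern_C1c[OF dc] kern_nonneg[OF dc] kern_integral[OF dc] by (auto simp: kk_def)
    have ks: "\<forall>z. kk \<delta> z \<noteq> 0 \<longrightarrow> norm z < e" if "\<delta> < e" for e
      using kern_scaled(1)[OF a \<delta>(1)] that unfolding kk_def by (meson less_trans)
    show ?thesis
      using \<delta> e1(2) e2(2) e3(2) k ks[OF \<delta>(4)] ks[OF \<delta>(5)] ks[OF \<delta>(6)] by (intro exI[of _ \<delta>] conjI) blast+
  qed
  have "\<forall>n. \<exists>\<delta>. 0 < \<delta> \<and> \<delta> < d0 \<and> \<delta> < d1 \<and>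
      (\<integral>\<^sup>+x. ennreal (norm (conv (kk \<delta>) w x - w x)) \<partial>lborel) \<le> ennreal (inverse (real (Suc n))) \<and>
      (\<integral>\<^sup>+x. ennreal (norm (conv (kk \<delta>) g x - g x)) \<partial>lborel) \<le> ennreal (inverse (real (Suc n))) \<and>
      (\<integral>\<^sup>+x. ennreal (norm (conv (kk \<delta>) h x - h x)) \<partial>lborel) \<le> ennreal (inverse (real (Suc n)))"
    by (intro allI ex) simp
  from choice[OF this] obtain \<delta> where \<delta>: "\<And>n. 0 < \<delta> n" "\<And>n. \<delta> n < d0" "\<And>n. \<delta> n < d1"
    and L: "\<And>n. (\<integral>\<^sup>+x. ennreal (norm (conv (kk (\<delta> n)) w x - w x)) \<partial>lborel) \<le> ennreal (inverse (real (Suc n)))"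
      "\<And>n. (\<integral>\<^sup>+x. ennreal (norm (conv (kk (\<delta> n)) g x - g x)) \<partial>lborel) \<le> ennreal (inverse (real (Suc n)))"
      "\<And>n. (\<integral>\<^sup>+x. ennreal (norm (conv (kk (\<delta> n)) h x - h x)) \<partial>lborel) \<le> ennreal (inverse (real (Suc n)))"
    by (elim exE) blast
  define k where "k n = kk (\<delta> n)" for n
  define \<phi> where "\<phi> n = conv (k n) w" for n
  have dc: "\<delta> n * c > 0" for n using \<delta>(1) a by simp
  have k: "C1c (k n) (grad (k n))" "\<And>z. k n z \<ge> 0" "(LINT z|lborel. k n z) = 1" "\<And>z. k n z \<noteq> 0 \<Longrightarrow> norm z < \<delta> n"
    "smooth (k n)" "bounded {x. k n x \<noteq> 0}" for n
    using kern_C1c[OF dc[of n]] kern_nonneg[OF dc[of n]] kern_integral[OF dc[of n]] kern_scaled(1)[OF a \<delta>(1)[of n]] kern_smooth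
    by (auto simp: k_def kk_def C1c_def)
  have km [measurable]: "k n \<in> borel_measurable borel" for n using C1c_integrable(1)[OF k(1)] by simp
  have phi_test: "\<phi> n \<in> test_functions \<Omega>" for n
  proof -
    obtain S where S: "compact S" "S \<subseteq> \<Omega>" "\<And>y z. w y \<noteq> 0 \<Longrightarrow> norm (z - \<delta> n *\<^sub>R a) \<le> \<delta> n * c \<Longrightarrow> y + z \<in> S"
      using geo[OF \<delta>(1,2)] by metis
    have "smooth (\<phi> n)" unfolding \<phi>_def by (rule smooth_conv[OF k(5,6) wi(1)])
    moreover have "{x. \<phi> n x \<noteq> 0} \<subseteq> S"
    proof
      fix x assume "x \<in> {x. \<phi> n x \<noteq> 0}"
      have "\<exists>y. k n (x - y) *\<^sub>R w y \<noteq> 0"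
      proof (rule ccontr)
        assume "\<nexists>y. k n (x - y) *\<^sub>R w y \<noteq> 0"
        then have "(\<lambda>y. k n (x - y) *\<^sub>R w y) = (\<lambda>y. 0)" by blast
        then have "\<phi> n x = 0" unfolding \<phi>_def conv_def by (simp only: Bochner_Integration.integral_zero)
        then show False using \<open>x \<in> {x. \<phi> n x \<noteq> 0}\<close> by simp
      qed
      then obtain y where y: "k n (x - y) \<noteq> 0" "w y \<noteq> 0" by auto
      have "dist (\<delta> n *\<^sub>R a) (x - y) < \<delta> n * c"
        using kern_support[OF dc[of n], of "\<delta> n *\<^sub>R a" "x - y"] y(1) by (simp add: k_def kk_def)
      then have "norm ((x - y) - \<delta> n *\<^sub>R a) \<le> \<delta> n * c" by (simp add: dist_norm norm_minus_commute)
      from S(3)[OF y(2) this] show "x \<in> S" by simp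
    qed
    ultimately show ?thesis using S(1,2) by (rule test_functionsI)
  qed
  have gphi: "grad (\<phi> n) = conv (k n) g" for n
    unfolding \<phi>_def using grad_conv(1)[OF w(1) k(1)] by blast
  have [measurable]: "\<phi> n \<in> borel_measurable borel" "conv (k n) g \<in> borel_measurable borel" "conv (k n) h \<in> borel_measurable borel" for n
    unfolding \<phi>_def by (intro conv_measurable; measurable)+
  have bound: "M0 x (conv (k n) f x) \<le> 4 * h x + 4 * norm (conv (k n) h x - h x) + indicator \<Omega> x * (4 * real K)" for n x
  proof (cases "x \<in> \<Omega>")
    case True
    let ?E = "\<bar>H\<bar> * \<delta> n powr \<gamma>"
    have r: "\<delta> n \<le> 1" "A * \<delta> n powr (\<gamma> - 1) \<le> \<theta> (\<delta> n)" "A \<le> \<theta> (\<delta> n)"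
      using d1(2)[OF \<delta>(1,3)] by auto
    have "norm (conv (k n) g x) \<le> ?E * (LINT z|lborel. norm (grad (k n) z))"
    proof (rule conv_grad_bound[OF w(1) k(1)])
      show "grad (k n) z \<noteq> 0 \<Longrightarrow> norm z \<le> \<delta> n" for z
        using kern_scaled(2)[OF a \<delta>(1)] by (simp add: k_def kk_def)
      show "\<bar>w y - w x\<bar> \<le> ?E" if "norm (x - y) \<le> \<delta> n" for y
      proof (cases "x = y")
        case False
        have "\<bar>w y - w x\<bar> \<le> H * norm (x - y) powr \<gamma>" using hol[OF False] by (simp add: abs_minus_commute)
        also have "\<dots> \<le> ?E" using that gamma by (intro mult_mono powr_mono2) auto
        finally show ?thesis .
      qed simp
    qed simp
    also have "\<dots> = (\<bar>H\<bar> * D / c) * \<delta> n powr (\<gamma> - 1)"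
      using D(2)[OF dc] \<delta>(1)[of n] by (simp add: k_def kk_def powr_diff mult_ac)
    finally have "2 * C * norm (conv (k n) f x) \<le> 2 * C * (2 * l) * ((\<bar>H\<bar> * D / c) * \<delta> n powr (\<gamma> - 1))"
    proof -
      assume *: "norm (conv (k n) g x) \<le> (\<bar>H\<bar> * D / c) * \<delta> n powr (\<gamma> - 1)"
      have "conv (k n) f x = (2 * l) *\<^sub>R conv (k n) g x"
        unfolding f_def[abs_def] by (rule conv_scaleR)
      then have "2 * C * norm (conv (k n) f x) = 2 * C * (2 * l) * norm (conv (k n) g x)" using l by simp
      also have "\<dots> \<le> 2 * C * (2 * l) * ((\<bar>H\<bar> * D / c) * \<delta> n powr (\<gamma> - 1))"
        using * l C_gt by (intro mult_left_mono) auto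
      finally show ?thesis .
    qed
    also have "\<dots> \<le> A * \<delta> n powr (\<gamma> - 1)"
      unfolding mult.assoc[symmetric] by (intro mult_right_mono) (auto simp: A_def mult.assoc)
    finally have small: "2 * C * norm (conv (k n) f x) \<le> \<theta> (\<delta> n)" using r(2) by linarith
    have "M x (conv (k n) f x) \<le> 4 * conv (k n) (\<lambda>y. M0 y (C *\<^sub>R f y)) x + 4 * real K"
    proof (rule averaged_bound[OF True \<delta>(1) r(1) k(1-4) fi f0 _ small])
      show "integrable lborel (\<lambda>y. M0 y (C *\<^sub>R f y))" using hi by (simp add: h_def[abs_def])
      show "1 \<le> M y \<xi>" if "y \<in> \<Omega>" "\<theta> (\<delta> n) \<le> norm \<xi>" for y \<xi>
      proof (rule R[OF that(1)])
        have "R \<le> A" by (simp add: A_def)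
        then show "R \<le> norm \<xi>" using r(3) that(2) by linarith
      qed
    qed
    then have "M x (conv (k n) f x) \<le> 4 * conv (k n) h x + 4 * real K" by (simp add: h_def[abs_def])
    also have "\<dots> \<le> 4 * h x + 4 * norm (conv (k n) h x - h x) + indicator \<Omega> x * (4 * real K)"
      using True abs_ge_self[of "conv (k n) h x - h x"] by (simp del: abs_ge_self)
    finally show ?thesis using True by (simp add: M0_def)
  next
    case False
    then show ?thesis using h_nn[of x] by (simp add: M0_def)
  qed
  let ?G = "\<lambda>x. ennreal (2 * h x + indicator \<Omega> x * (2 * real K) + M0 x (f x) / 2)"
  let ?E = "\<lambda>n x. ennreal (2 * norm (conv (k n) h x - h x))"
  let ?F = "\<lambda>n x. ennreal (M0 x (l *\<^sub>R (conv (k n) g x - g x)))"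
  have [measurable]: "\<Omega> \<in> sets borel" using open_Omega by simp
  have FG: "?F n x \<le> ?G x + ?E n x" for n x
  proof -
    have *: "l *\<^sub>R (conv (k n) g x - g x) = (l *\<^sub>R conv (k n) g x) - (l *\<^sub>R g x)" by (simp add: scaleR_diff_right)
    have **: "conv (k n) f x = 2 *\<^sub>R (l *\<^sub>R conv (k n) g x)"
      unfolding f_def[abs_def] conv_scaleR by simp
    have "M0 x (l *\<^sub>R (conv (k n) g x - g x)) \<le> M0 x (conv (k n) f x) / 2 + M0 x (f x) / 2"
      unfolding * ** f_def using M0_diff[of x "l *\<^sub>R conv (k n) g x" "l *\<^sub>R g x"] by simp
    also have "\<dots> \<le> (2 * h x + indicator \<Omega> x * (2 * real K) + M0 x (f x) / 2) + 2 * norm (conv (k n) h x - h x)"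
      using bound[of x n] by (simp add: field_simps)
    finally have le: "M0 x (l *\<^sub>R (conv (k n) g x - g x)) \<le>
      (2 * h x + indicator \<Omega> x * (2 * real K) + M0 x (f x) / 2) + 2 * norm (conv (k n) h x - h x)" .
    have p1: "0 \<le> 2 * h x + indicator \<Omega> x * (2 * real K) + M0 x (f x) / 2"
      using h_nn[of x] M0_nonneg[of x "f x"] by simp
    have p2: "0 \<le> 2 * norm (conv (k n) h x - h x)" by simp
    show ?thesis unfolding ennreal_plus[OF p1 p2, symmetric] by (rule ennreal_leI[OF le])
  qed
  have Gfin: "(\<integral>\<^sup>+x. ?G x \<partial>lborel) < \<infinity>"
  proof -
    have i1: "integrable lborel (\<lambda>x. M0 x (f x))"
      using fin[of "2 * l"] unfolding integrable_iff_bounded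
      by (simp add: f_def[abs_def] modular0_def M0_nonneg)
    have i2: "integrable lborel (\<lambda>x. indicator \<Omega> x * (2 * real K))"
      using emeasure_bounded_finite[OF bounded_Omega] by (intro integrable_mult_left integrable_real_indicator) auto
    have "integrable lborel (\<lambda>x. 2 * h x + indicator \<Omega> x * (2 * real K) + M0 x (f x) / 2)"
      using hi i1 i2 by (intro Bochner_Integration.integrable_add) auto
    moreover have "2 * h x + indicator \<Omega> x * (2 * real K) + M0 x (f x) / 2 \<ge> 0" for x
      using h_nn[of x] M0_nonneg[of x "f x"] by simp
    ultimately show ?thesis by (simp add: integrable_iff_bounded)
  qed
  have inv0: "(\<lambda>n. ennreal (inverse (real (Suc n)))) \<longlonglongrightarrow> 0"
    using tendsto_ennrealI[OF LIMSEQ_inverse_real_of_nat] by simp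
  have dm: "(\<lambda>x. conv (k n) g x - g x) \<in> borel_measurable lborel" for n by measurable
  obtain r :: "nat \<Rightarrow> nat" where r: "strict_mono r" "AE x in lborel. (\<lambda>n. conv (k (r n)) g x - g x) \<longlonglongrightarrow> 0"
    using tendsto_L1_AE_subseq[OF L1_rate[OF dm L(2)[folded k_def]]] by blast
  have E0: "(\<lambda>n. \<integral>\<^sup>+x. ?E n x \<partial>lborel) \<longlonglongrightarrow> 0"
  proof (rule tendsto_sandwich[OF always_eventually always_eventually tendsto_const])
    show "(\<lambda>n. ennreal 2 * ennreal (inverse (real (Suc n)))) \<longlonglongrightarrow> 0"
      using ennreal_tendsto_cmult[OF _ inv0, of "ennreal 2"] by simp
    show "\<forall>n. (\<integral>\<^sup>+x. ?E n x \<partial>lborel) \<le> ennreal 2 * ennreal (inverse (real (Suc n)))"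
    proof
      fix n
      have "(\<integral>\<^sup>+x. ?E n x \<partial>lborel) = ennreal 2 * (\<integral>\<^sup>+x. ennreal (norm (conv (k n) h x - h x)) \<partial>lborel)"
        by (subst nn_integral_cmult[symmetric]) (auto simp: ennreal_mult)
      also have "\<dots> \<le> ennreal 2 * ennreal (inverse (real (Suc n)))"
        using L(3)[of n] by (intro mult_left_mono) (auto simp: k_def)
      finally show "(\<integral>\<^sup>+x. ?E n x \<partial>lborel) \<le> ennreal 2 * ennreal (inverse (real (Suc n)))" .
    qed
  qed simp
  have "\<forall>\<^sub>F n in sequentially. (\<integral>\<^sup>+x. ?F (r n) x \<partial>lborel) < ennreal \<epsilon>"
  proof (rule nn_integral_dominated_perturbed[where G="?G" and E="\<lambda>n. ?E (r n)" and F'="\<lambda>_. 0"])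
    show "(\<lambda>n. \<integral>\<^sup>+x. ?E (r n) x \<partial>lborel) \<longlonglongrightarrow> 0"
      using LIMSEQ_subseq_LIMSEQ[OF E0 r(1)] by (simp add: o_def)
    show "AE x in lborel. (\<lambda>n. ?F (r n) x) \<longlonglongrightarrow> 0"
      using r(2)
    proof eventually_elim
      fix x assume "(\<lambda>n. conv (k (r n)) g x - g x) \<longlonglongrightarrow> 0"
      from tendsto_scaleR[OF tendsto_const this, of l]
      have "(\<lambda>n. l *\<^sub>R (conv (k (r n)) g x - g x)) \<longlonglongrightarrow> 0" by simp
      from tendsto_ennrealI[OF M0_tendsto_zero[OF this, of x]] show "(\<lambda>n. ?F (r n) x) \<longlonglongrightarrow> 0" by simp
    qed
  qed (use FG Gfin eps in auto)
  moreover have "\<forall>\<^sub>F n in sequentially. ennreal (inverse (real (Suc (r n)))) < ennreal \<epsilon>"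
    using order_tendstoD(2)[OF LIMSEQ_subseq_LIMSEQ[OF inv0 r(1)], of "ennreal \<epsilon>"] eps by (simp add: o_def)
  ultimately have "\<forall>\<^sub>F n in sequentially. (\<integral>\<^sup>+x. ?F (r n) x \<partial>lborel) < ennreal \<epsilon> \<and> ennreal (inverse (real (Suc (r n)))) < ennreal \<epsilon>"
    by (rule eventually_conj)
  then obtain n where n: "(\<integral>\<^sup>+x. ?F (r n) x \<partial>lborel) < ennreal \<epsilon>" "ennreal (inverse (real (Suc (r n)))) < ennreal \<epsilon>"
    unfolding eventually_sequentially by blast
  show "\<exists>\<phi>\<in>test_functions \<Omega>. (\<integral>\<^sup>+x. ennreal \<bar>\<phi> x - w x\<bar> \<partial>lborel) \<le> ennreal \<epsilon> \<and>
     (\<integral>\<^sup>+x. ennreal (norm (grad \<phi> x - g x)) \<partial>lborel) \<le> ennreal \<epsilon> \<and>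
     modular0 (\<lambda>x. l *\<^sub>R (grad \<phi> x - g x)) \<le> ennreal \<epsilon>"
  proof (intro bexI[OF _ phi_test[of "r n"]] conjI)
    show "(\<integral>\<^sup>+x. ennreal \<bar>\<phi> (r n) x - w x\<bar> \<partial>lborel) \<le> ennreal \<epsilon>"
      using L(1)[of "r n"] n(2) unfolding \<phi>_def k_def real_norm_def by simp
    show "(\<integral>\<^sup>+x. ennreal (norm (grad (\<phi> (r n)) x - g x)) \<partial>lborel) \<le> ennreal \<epsilon>"
      using L(2)[of "r n"] n(2) unfolding gphi k_def by simp
    show "modular0 (\<lambda>x. l *\<^sub>R (grad (\<phi> (r n)) x - g x)) \<le> ennreal \<epsilon>"
      using n(1) unfolding modular0_def gphi by simp
  qed
qed

end

section \<open>Localisation\<close>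

text \<open>The square of the positive part is the simplest function that is continuously differentiable, constant
  on one side and increasing on the other. Two of them make a step.\<close>

definition pos_sq :: "real \<Rightarrow> real" where "pos_sq t = (max 0 t)\<^sup>2"

lemma pos_sq_deriv: "(pos_sq has_real_derivative 2 * max 0 t) (at t)"
proof -
  consider "t < 0" | "t = 0" | "t > 0" by linarith
  then show ?thesis
  proof cases
    case 1
    have "((\<lambda>_. 0::real) has_real_derivative 0) (at t)" by simp
    moreover have "eventually (\<lambda>x. (0::real) = pos_sq x) (nhds t)"
      using eventually_nhds_in_open[of "{..<0}" t] 1 by (auto simp: pos_sq_def elim!: eventually_mono)
    ultimately show ?thesis using DERIV_cong_ev[of t t "\<lambda>_. 0" pos_sq 0 0] 1 by simp
  next
    case 2
    have "((\<lambda>h. pos_sq h / h) \<longlongrightarrow> 0) (at 0)"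
    proof (rule Lim_null_comparison)
      show "((\<lambda>h::real. \<bar>h\<bar>) \<longlongrightarrow> 0) (at 0)" by (auto intro!: tendsto_eq_intros)
      have "norm (pos_sq h / h) \<le> \<bar>h\<bar>" for h :: real
        by (cases "h > 0") (auto simp: pos_sq_def power2_eq_square)
      then show "\<forall>\<^sub>F h in at 0. norm (pos_sq h / h) \<le> \<bar>h\<bar>" by simp
    qed
    then have "(pos_sq has_real_derivative 0) (at 0)" by (simp add: DERIV_def pos_sq_def[of 0])
    then show ?thesis using 2 by simp
  next
    case 3
    have "((\<lambda>x. x\<^sup>2) has_real_derivative 2 * t) (at t)" by (auto intro!: derivative_eq_intros)
    moreover have "eventually (\<lambda>x. x\<^sup>2 = pos_sq x) (nhds t)"
      using eventually_nhds_in_open[of "{0<..}" t] 3 by (auto simp: pos_sq_def elim!: eventually_mono)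
    ultimately show ?thesis using DERIV_cong_ev[of t t "\<lambda>x. x\<^sup>2" pos_sq "2 * t" "2 * t"] 3 by simp
  qed
qed

definition step_fun :: "real \<Rightarrow> real" where "step_fun t = 1 - pos_sq (1 - pos_sq t)"
definition step_fun' :: "real \<Rightarrow> real" where "step_fun' t = 4 * max 0 (1 - pos_sq t) * max 0 t"

lemma step_fun_deriv: "(step_fun has_real_derivative step_fun' t) (at t)"
proof -
  have "((\<lambda>t. 1 - pos_sq t) has_real_derivative - (2 * max 0 t)) (at t)"
    by (auto intro!: derivative_eq_intros pos_sq_deriv)
  from DERIV_chain2[OF pos_sq_deriv this]
  show ?thesis unfolding step_fun_def[abs_def] step_fun'_def
    by (auto intro!: derivative_eq_intros)
qed

lemma step_fun_props:
  "t \<le> 0 \<Longrightarrow> step_fun t = 0" "t \<ge> 1 \<Longrightarrow> step_fun t = 1" "0 \<le> step_fun t" "step_fun t \<le> 1"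
  "t \<le> 0 \<Longrightarrow> step_fun' t = 0" "t \<ge> 1 \<Longrightarrow> step_fun' t = 0" "\<bar>step_fun' t\<bar> \<le> 4"
proof -
  have ge1: "pos_sq t \<ge> 1" if "t \<ge> 1" for t using that by (simp add: pos_sq_def)
  have le0: "pos_sq t = 0" if "t \<le> 0" for t using that by (simp add: pos_sq_def)
  have nn: "pos_sq t \<ge> 0" for t by (simp add: pos_sq_def)
  have le1: "pos_sq t \<le> 1" if "t \<le> 1" for t
    unfolding pos_sq_def by (rule power_le_one) (use that in auto)
  show "t \<le> 0 \<Longrightarrow> step_fun t = 0" by (simp add: step_fun_def le0) (simp add: pos_sq_def)
  show "t \<ge> 1 \<Longrightarrow> step_fun t = 1" using ge1[of t] by (simp add: step_fun_def le0)
  show "0 \<le> step_fun t" using le1[of "1 - pos_sq t"] nn[of t] by (simp add: step_fun_def)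
  show "step_fun t \<le> 1" using nn[of "1 - pos_sq t"] by (simp add: step_fun_def)
  show "t \<le> 0 \<Longrightarrow> step_fun' t = 0" by (simp add: step_fun'_def)
  show g: "t \<ge> 1 \<Longrightarrow> step_fun' t = 0" using ge1[of t] by (simp add: step_fun'_def)
  show "\<bar>step_fun' t\<bar> \<le> 4"
  proof (cases "t \<ge> 1")
    case True then show ?thesis using g by simp
  next
    case False
    have "max 0 (1 - pos_sq t) * max 0 t \<le> 1 * 1" using False nn[of t] by (intro mult_mono) auto
    moreover have "max 0 (1 - pos_sq t) * max 0 t \<ge> 0" by simp
    ultimately show ?thesis unfolding step_fun'_def by (simp add: mult.assoc)
  qed
qed

lemma step_fun'_cont: "continuous_on S step_fun'"
proof -
  have "continuous_on S pos_sq" unfolding pos_sq_def[abs_def] by (intro continuous_intros)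
  then show ?thesis unfolding step_fun'_def[abs_def] by (intro continuous_intros)
qed

lemma C1_cutoff:
  fixes p :: "'a::euclidean_space"
  assumes "0 < r1" "r1 < r2"
  obtains t t' B where "C1_grad t t'" "\<And>x. 0 \<le> t x" "\<And>x. t x \<le> 1" "B \<ge> 0" "\<And>x. norm (t' x) \<le> B"
    "\<And>x. x \<in> ball p r1 \<Longrightarrow> t x = 1" "\<And>x. x \<notin> ball p r2 \<Longrightarrow> t x = 0"
proof -
  define d where "d = r2\<^sup>2 - r1\<^sup>2"
  have d: "d > 0" using assms by (simp add: d_def power_strict_mono)
  define q where "q x = (r2\<^sup>2 - (x - p) \<bullet> (x - p)) / d" for x
  have "((\<lambda>x. q x) has_derivative (\<lambda>h. (- (2 / d) *\<^sub>R (x - p)) \<bullet> h)) (at x)" for x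
  proof -
    have "((\<lambda>x. r2\<^sup>2 - (x - p) \<bullet> (x - p)) has_derivative (\<lambda>h. - 2 * ((x - p) \<bullet> h))) (at x)"
      by (auto intro!: derivative_eq_intros simp: inner_commute)
    from has_derivative_mult_right[OF this, of "1 / d"]
    show ?thesis unfolding q_def by (simp add: mult.assoc)
  qed
  moreover have "continuous_on UNIV (\<lambda>x. - (2 / d) *\<^sub>R (x - p))" by (intro continuous_intros)
  ultimately have "C1_grad q (\<lambda>x. - (2 / d) *\<^sub>R (x - p))"
    unfolding C1_grad_def by blast
  from C1_grad_compose[OF this step_fun_deriv step_fun'_cont]
  have C1: "C1_grad (\<lambda>x. step_fun (q x)) (\<lambda>x. step_fun' (q x) *\<^sub>R - (2 / d) *\<^sub>R (x - p))" .
  have sq: "(x - p) \<bullet> (x - p) = (dist p x)\<^sup>2" for x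
    using power2_norm_eq_inner[of "x - p"] dist_norm[of x p] dist_commute[of p x] by simp
  have in1: "step_fun (q x) = 1" if "x \<in> ball p r1" for x
  proof -
    have "(dist p x)\<^sup>2 \<le> r1\<^sup>2" using that by (intro power_mono) auto
    then have "q x \<ge> 1" using d by (simp add: q_def sq d_def)
    then show ?thesis by (rule step_fun_props(2))
  qed
  have out: "step_fun (q x) = 0" if "x \<notin> ball p r2" for x
  proof -
    have "(dist p x)\<^sup>2 \<ge> r2\<^sup>2" using that assms by (intro power_mono) auto
    then have "q x \<le> 0" using d by (simp add: q_def sq divide_le_0_iff)
    then show ?thesis by (rule step_fun_props(1))
  qed
  have "{x. step_fun (q x) \<noteq> 0} \<subseteq> ball p r2" using out by blast
  then have "bounded {x. step_fun (q x) \<noteq> 0}" using bounded_ball bounded_subset by blast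
  define t where "t x = step_fun (q x)" for x
  define t' where "t' x = step_fun' (q x) *\<^sub>R - (2 / d) *\<^sub>R (x - p)" for x
  have t: "C1_grad t t'" using C1 by (simp only: t_def[abs_def] t'_def[abs_def])
  moreover have "bounded {x. t x \<noteq> 0}" using \<open>bounded {x. step_fun (q x) \<noteq> 0}\<close> by (simp only: t_def)
  ultimately have "C1c t t'" by (simp add: C1c_def)
  then obtain B where B: "B \<ge> 0" "\<And>x. norm (t' x) \<le> B" using C1c_bounded[of t t'] by metis
  show ?thesis
  proof (rule that[OF t _ _ B])
    show "0 \<le> t x" "t x \<le> 1" for x unfolding t_def by (rule step_fun_props(3), rule step_fun_props(4))
    show "t x = 1" if "x \<in> ball p r1" for x unfolding t_def by (rule in1[OF that])
    show "t x = 0" if "x \<notin> ball p r2" for x unfolding t_def by (rule out[OF that])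
  qed
qed

lemma W0_cmult: assumes "W0 w g" shows "W0 (\<lambda>x. c * w x) (\<lambda>x. c *\<^sub>R g x)"
proof -
  have "C1_grad (\<lambda>x::'a. c) (\<lambda>x. 0)" by (simp add: C1_grad_def)
  from W0_mult[OF assms this, of "\<bar>c\<bar>"] show ?thesis by simp
qed

context musielak
begin

text \<open>The gradient of a product \<open>t w\<close> of a cut-off function and a bounded function \<open>w\<close> has this form, where
  \<open>q\<close> is \<open>w\<close> times the gradient of \<open>t\<close>.\<close>

lemma modular0_multiplier:
  assumes [measurable]: "g \<in> borel_measurable borel" "t \<in> borel_measurable borel" "q \<in> borel_measurable borel"
    and t: "\<And>x. 0 \<le> t x" "\<And>x. t x \<le> 1" and q: "\<And>x. norm (q x) \<le> B"
    and fin: "\<And>s. modular0 (\<lambda>x. s *\<^sub>R g x) < \<infinity>"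
  shows "modular0 (\<lambda>x. s *\<^sub>R (t x *\<^sub>R g x + q x)) < \<infinity>"
proof -
  have "modular0 (\<lambda>x. s *\<^sub>R (t x *\<^sub>R g x + q x)) = modular0 (\<lambda>x. s *\<^sub>R t x *\<^sub>R g x + s *\<^sub>R q x)"
    by (simp add: scaleR_add_right)
  also have "\<dots> \<le> modular0 (\<lambda>x. 2 *\<^sub>R s *\<^sub>R t x *\<^sub>R g x) + modular0 (\<lambda>x. 2 *\<^sub>R s *\<^sub>R q x)"
    by (rule modular0_add) measurable
  also have "modular0 (\<lambda>x. 2 *\<^sub>R s *\<^sub>R t x *\<^sub>R g x) \<le> modular0 (\<lambda>x. (2 * s) *\<^sub>R g x)"
    unfolding modular0_def
  proof (rule nn_integral_mono, rule ennreal_leI)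
    fix x
    have "M0 x (t x *\<^sub>R ((2 * s) *\<^sub>R g x)) \<le> M0 x (1 *\<^sub>R ((2 * s) *\<^sub>R g x))"
      by (rule M0_mono_scale[OF t])
    then show "M0 x (2 *\<^sub>R s *\<^sub>R t x *\<^sub>R g x) \<le> M0 x ((2 * s) *\<^sub>R g x)" by (simp add: mult_ac)
  qed
  finally have le: "modular0 (\<lambda>x. s *\<^sub>R (t x *\<^sub>R g x + q x)) \<le> modular0 (\<lambda>x. (2 * s) *\<^sub>R g x) + modular0 (\<lambda>x. 2 *\<^sub>R s *\<^sub>R q x)"
    by (simp add: add_right_mono)
  have "modular0 (\<lambda>x. (2 * s) *\<^sub>R q x) < \<infinity>" by (rule modular0_bounded[OF q])
  then have "modular0 (\<lambda>x. (2 * s) *\<^sub>R g x) + modular0 (\<lambda>x. 2 *\<^sub>R s *\<^sub>R q x) < \<infinity>" using fin[of "2 * s"] by simp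
  with le show ?thesis by (rule order_le_less_trans)
qed

end

text \<open>Near \<open>p\<close>, shifting points of \<open>\<Omega>\<close> by the vectors in the support of a kernel with centre \<open>\<delta> a\<close> and radius
  \<open>\<delta> c\<close> leads into a compact subset of \<open>\<Omega>\<close>, which may depend on \<open>\<delta>\<close>. The bound on \<open>norm a + c\<close> keeps these vectors
  in the ball of radius \<open>\<delta>\<close>, where the balance condition is used.\<close>

definition inward_cone :: "'a::euclidean_space set \<Rightarrow> 'a \<Rightarrow> real \<Rightarrow> bool" where
  "inward_cone \<Omega> p r \<longleftrightarrow> (\<exists>a c d0. norm a + c \<le> 1 \<and> c > 0 \<and> d0 > 0 \<and>
     (\<forall>\<delta>. 0 < \<delta> \<and> \<delta> < d0 \<longrightarrow> (\<exists>S. compact S \<and> S \<subseteq> \<Omega> \<and>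
        (\<forall>y z. y \<in> \<Omega> \<inter> cball p r \<longrightarrow> norm (z - \<delta> *\<^sub>R a) \<le> \<delta> * c \<longrightarrow> y + z \<in> S))))"

context balanced_musielak
begin

text \<open>For points at distance at most \<open>1\<close> a Lipschitz bound is stronger than a Hoelder bound, and for other
  points the oscillation of \<open>t\<close> is at most \<open>1\<close>.\<close>

lemma holder_mult:
  assumes w: "\<And>x y. x \<noteq> y \<Longrightarrow> \<bar>w x - w y\<bar> \<le> H * norm (x - y) powr \<gamma>" "\<And>x. \<bar>w x\<bar> \<le> W"
    and t: "C1_grad t t'" "\<And>x. norm (t' x) \<le> B" "\<And>x. 0 \<le> t x" "\<And>x. t x \<le> 1" "B \<ge> 0"
    and xy: "x \<noteq> y"
  shows "\<bar>t x * w x - t y * w y\<bar> \<le> (H + (B + 1) * W) * norm (x - y) powr \<gamma>"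
proof -
  have n: "norm (x - y) > 0" using xy by simp
  have tl: "\<bar>t x - t y\<bar> \<le> (B + 1) * norm (x - y) powr \<gamma>"
  proof (cases "norm (x - y) \<le> 1")
    case True
    have "\<bar>t x - t y\<bar> \<le> B * norm (x - y)" by (rule C1_grad_lipschitz[OF t(1,2)])
    also have "norm (x - y) \<le> norm (x - y) powr \<gamma>"
      using powr_mono'[OF gamma(2), of "norm (x - y)"] True n by simp
    then have "B * norm (x - y) \<le> (B + 1) * norm (x - y) powr \<gamma>" using t(5) n by (intro mult_mono) auto
    finally show ?thesis .
  next
    case False
    have "\<bar>t x - t y\<bar> \<le> 1" using t(3)[of x] t(3)[of y] t(4)[of x] t(4)[of y] by linarith
    also have "1 \<le> norm (x - y) powr \<gamma>" using False gamma by (intro ge_one_powr_ge_zero) auto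
    also have "\<dots> \<le> (B + 1) * norm (x - y) powr \<gamma>" using t(5) by (simp add: distrib_right)
    finally show ?thesis .
  qed
  have "t x * w x - t y * w y = (t x - t y) * w x + t y * (w x - w y)" by (simp add: algebra_simps)
  then have "\<bar>t x * w x - t y * w y\<bar> \<le> \<bar>t x - t y\<bar> * \<bar>w x\<bar> + \<bar>t y\<bar> * \<bar>w x - w y\<bar>"
    by (metis abs_mult abs_triangle_ineq)
  also have "\<dots> \<le> ((B + 1) * norm (x - y) powr \<gamma>) * W + 1 * (H * norm (x - y) powr \<gamma>)"
    using tl w t(3,4,5) xy by (intro add_mono mult_mono) auto
  finally show ?thesis by (simp add: algebra_simps)
qed

text \<open>One ball of the cover is removed at a time, by writing \<open>w = t w + (1 - t) w\<close> with a cut-off function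
  \<open>t\<close> that is \<open>1\<close> on the half ball. The first summand is approximable by a single mollification, the
  second vanishes on the half ball and is covered by the remaining ones. The Hoelder constant grows in
  each step, so it is generalised in the induction.\<close>

lemma approximable_cover:
  assumes "finite I" "\<And>i. i \<in> I \<Longrightarrow> 0 < rad i \<and> inward_cone \<Omega> (ctr i) (rad i)"
    and "W0 w g" "\<And>x. x \<notin> \<Omega> \<Longrightarrow> w x = 0" "\<And>x. x \<notin> \<Omega> \<Longrightarrow> g x = 0"
    and "\<And>s. modular0 (\<lambda>x. s *\<^sub>R g x) < \<infinity>"
    and "\<And>x y. x \<noteq> y \<Longrightarrow> \<bar>w x - w y\<bar> \<le> H * norm (x - y) powr \<gamma>" "\<And>x. \<bar>w x\<bar> \<le> W"
    and "\<And>x. w x \<noteq> 0 \<Longrightarrow> \<exists>i\<in>I. x \<in> ball (ctr i) (rad i / 2)"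
  shows "approximable w g"
  using assms
proof (induction I arbitrary: w g H W rule: finite_induct)
  case empty
  show ?case
  proof (rule local_approximation[OF empty.prems(2-6), where a=0 and c=1 and ?d0.0=1])
    fix \<delta> :: real
    show "\<exists>S. compact S \<and> S \<subseteq> \<Omega> \<and> (\<forall>y z. w y \<noteq> 0 \<longrightarrow> norm (z - \<delta> *\<^sub>R 0) \<le> \<delta> * 1 \<longrightarrow> y + z \<in> S)"
    proof -
      have "w y = 0" for y using empty.prems(8)[of y] by blast
      then show ?thesis by (intro exI[of _ "{}"]) simp
    qed
  qed auto
next
  case (insert i I)
  note pr = insert.prems
  have ri: "0 < rad i" "inward_cone \<Omega> (ctr i) (rad i)" using pr(1)[of i] by auto
  obtain t t' B where t: "C1_grad t t'" "\<And>x. 0 \<le> t x" "\<And>x. t x \<le> 1" "B \<ge> 0" "\<And>x. norm (t' x) \<le> B"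
    "\<And>x. x \<in> ball (ctr i) (rad i / 2) \<Longrightarrow> t x = 1" "\<And>x. x \<notin> ball (ctr i) (rad i) \<Longrightarrow> t x = 0"
  proof -
    have "0 < rad i / 2" "rad i / 2 < rad i" using ri(1) by auto
    from C1_cutoff[OF this, where p="ctr i"] show ?thesis using that by blast
  qed
  note wi = W0_integrable[OF pr(2)]
  have [measurable]: "w \<in> borel_measurable borel" "g \<in> borel_measurable borel" using wi by auto
  have [measurable]: "t \<in> borel_measurable borel" "t' \<in> borel_measurable borel"
    using C1_grad_continuous[OF t(1)] by (auto intro: borel_measurable_continuous_onI)
  have W0: "W \<ge> 0" using pr(7)[of 0] by linarith
  have nb: "norm (w x *\<^sub>R t' x) \<le> W * B" for x
    using pr(7)[of x] t(5)[of x] W0 by (simp add: mult_mono)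
  define s where "s x = 1 - t x" for x
  have s: "C1_grad s (\<lambda>x. - t' x)"
    using t(1) unfolding s_def[abs_def] C1_grad_def by (auto intro!: derivative_eq_intros continuous_intros)
  have s01: "0 \<le> s x" "s x \<le> 1" "norm (- t' x) \<le> B" for x using t(2,3,5)[of x] by (auto simp: s_def)
  have [measurable]: "s \<in> borel_measurable borel" unfolding s_def[abs_def] by measurable
  define w1 where "w1 x = t x * w x" for x
  define g1 where "g1 x = t x *\<^sub>R g x + w x *\<^sub>R t' x" for x
  define w2 where "w2 x = s x * w x" for x
  define g2 where "g2 x = s x *\<^sub>R g x + w x *\<^sub>R (- t' x)" for x
  have W1: "W0 w1 g1" unfolding w1_def[abs_def] g1_def[abs_def]
    by (rule W0_mult[OF pr(2) t(1), of "max 1 B"]) (use t(2-5) in \<open>auto simp: le_max_iff_disj\<close>)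
  have W2: "W0 w2 g2" unfolding w2_def[abs_def] g2_def[abs_def]
    by (rule W0_mult[OF pr(2) s, of "max 1 B"]) (use s01 in \<open>auto simp: le_max_iff_disj\<close>)
  have a1: "approximable w1 g1"
  proof -
    obtain a c d0 where ac: "norm a + c \<le> 1" "c > 0" "d0 > 0"
      "\<And>\<delta>. 0 < \<delta> \<Longrightarrow> \<delta> < d0 \<Longrightarrow> (\<exists>S. compact S \<and> S \<subseteq> \<Omega> \<and>
        (\<forall>y z. y \<in> \<Omega> \<inter> cball (ctr i) (rad i) \<longrightarrow> norm (z - \<delta> *\<^sub>R a) \<le> \<delta> * c \<longrightarrow> y + z \<in> S))"
      using ri(2) unfolding inward_cone_def by blast
    show ?thesis
    proof (rule local_approximation[OF W1 _ _ _ _ ac(1-3)])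
      show "x \<notin> \<Omega> \<Longrightarrow> w1 x = 0" "x \<notin> \<Omega> \<Longrightarrow> g1 x = 0" for x using pr(3,4) by (auto simp: w1_def g1_def)
      show "modular0 (\<lambda>x. s *\<^sub>R g1 x) < \<infinity>" for s
        unfolding g1_def by (rule modular0_multiplier[OF _ _ _ t(2,3) nb pr(5)]) measurable
      show "\<bar>w1 x - w1 y\<bar> \<le> (H + (B + 1) * W) * norm (x - y) powr \<gamma>" if "x \<noteq> y" for x y
        unfolding w1_def by (rule holder_mult[OF pr(6,7) t(1,5,2,3,4) that])
      fix \<delta> :: real assume "0 < \<delta>" "\<delta> < d0"
      from ac(4)[OF this] obtain S where S: "compact S" "S \<subseteq> \<Omega>"
        "\<forall>y z. y \<in> \<Omega> \<inter> cball (ctr i) (rad i) \<longrightarrow> norm (z - \<delta> *\<^sub>R a) \<le> \<delta> * c \<longrightarrow> y + z \<in> S" by blast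
      have "y \<in> \<Omega> \<inter> cball (ctr i) (rad i)" if "w1 y \<noteq> 0" for y
      proof -
        have "w y \<noteq> 0" "t y \<noteq> 0" using that by (auto simp: w1_def)
        then have "y \<in> \<Omega>" "y \<in> ball (ctr i) (rad i)" using pr(3)[of y] t(7)[of y] by blast+
        then show ?thesis by simp
      qed
      then show "\<exists>S. compact S \<and> S \<subseteq> \<Omega> \<and> (\<forall>y z. w1 y \<noteq> 0 \<longrightarrow> norm (z - \<delta> *\<^sub>R a) \<le> \<delta> * c \<longrightarrow> y + z \<in> S)"
        using S by blast
    qed
  qed
  have a2: "approximable w2 g2"
  proof (rule insert.IH[of w2 g2 "H + (B + 1) * W" W])
    show "0 < rad j \<and> inward_cone \<Omega> (ctr j) (rad j)" if "j \<in> I" for j using pr(1)[of j] that by simp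
    show "W0 w2 g2" by (rule W2)
    show "x \<notin> \<Omega> \<Longrightarrow> w2 x = 0" "x \<notin> \<Omega> \<Longrightarrow> g2 x = 0" for x using pr(3,4) by (auto simp: w2_def g2_def)
    have nb': "norm (w x *\<^sub>R - t' x) \<le> W * B" for x using nb[of x] by simp
    show "modular0 (\<lambda>x. r *\<^sub>R g2 x) < \<infinity>" for r
      unfolding g2_def by (rule modular0_multiplier[OF _ _ _ s01(1,2) nb' pr(5)]) measurable
    show "\<bar>w2 x - w2 y\<bar> \<le> (H + (B + 1) * W) * norm (x - y) powr \<gamma>" if "x \<noteq> y" for x y
      unfolding w2_def by (rule holder_mult[OF pr(6,7) s s01(3,1,2) t(4) that])
    show "\<bar>w2 x\<bar> \<le> W" for x
    proof -
      have "\<bar>w2 x\<bar> \<le> 1 * W" unfolding w2_def abs_mult using s01[of x] pr(7)[of x] by (intro mult_mono) auto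
      then show ?thesis by simp
    qed
    show "\<exists>j\<in>I. x \<in> ball (ctr j) (rad j / 2)" if "w2 x \<noteq> 0" for x
    proof -
      have "w x \<noteq> 0" "t x \<noteq> 1" using that by (auto simp: w2_def s_def)
      then show ?thesis using pr(8)[of x] t(6)[of x] by blast
    qed
  qed
  have "approximable (\<lambda>x. w1 x + w2 x) (\<lambda>x. g1 x + g2 x)"
    by (rule approximable_add[OF _ _ _ _ a1 a2]) (use W0_integrable[OF W1] W0_integrable[OF W2] in auto)
  moreover have "(\<lambda>x. w1 x + w2 x) = w" by (auto simp: w1_def w2_def s_def algebra_simps)
  moreover have "(\<lambda>x. g1 x + g2 x) = g" by (auto simp: g1_def g2_def s_def algebra_simps)
  ultimately show ?case by simp
qed

lemma approximable_holder:
  assumes cone: "\<And>p. p \<in> closure \<Omega> \<Longrightarrow> \<exists>r>0. inward_cone \<Omega> p r"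
    and w: "W0 w g" "\<And>x. x \<notin> \<Omega> \<Longrightarrow> w x = 0" "\<And>x. x \<notin> \<Omega> \<Longrightarrow> g x = 0"
    "\<And>s. modular0 (\<lambda>x. s *\<^sub>R g x) < \<infinity>"
    "\<And>x y. x \<noteq> y \<Longrightarrow> \<bar>w x - w y\<bar> \<le> H * norm (x - y) powr \<gamma>" "\<And>x. \<bar>w x\<bar> \<le> W"
  shows "approximable w g"
proof -
  have "\<forall>p. \<exists>r. p \<in> closure \<Omega> \<longrightarrow> r > 0 \<and> inward_cone \<Omega> p r" using cone by blast
  from choice[OF this] obtain rad where rad: "\<And>p. p \<in> closure \<Omega> \<Longrightarrow> rad p > 0 \<and> inward_cone \<Omega> p (rad p)" by blast
  have "compact (closure \<Omega>)" using bounded_Omega by simp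
  moreover have "closure \<Omega> \<subseteq> (\<Union>p\<in>closure \<Omega>. ball p (rad p / 2))" using rad by fastforce
  ultimately obtain I where I: "I \<subseteq> closure \<Omega>" "finite I" "closure \<Omega> \<subseteq> (\<Union>p\<in>I. ball p (rad p / 2))"
    by (elim compactE_image) auto
  show ?thesis
  proof (rule approximable_cover[where ctr="\<lambda>p. p" and rad=rad, OF I(2) _ w])
    show "0 < rad p \<and> inward_cone \<Omega> p (rad p)" if "p \<in> I" for p using rad[of p] that I(1) by blast
    show "\<exists>i\<in>I. x \<in> ball i (rad i / 2)" if "w x \<noteq> 0" for x
    proof -
      have "x \<in> closure \<Omega>" using that w(2)[of x] closure_subset[of \<Omega>] by blast
      then show ?thesis using I(3) by blast
    qed
  qed
qed

text \<open>Truncation by \<open>s / (1 + \<epsilon> s\<^sup>2)\<close>, which is smooth, bounded and has a derivative between \<open>-1\<close> and \<open>1\<close>. The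
  bound on the derivative keeps gradients, and so their modulars, from growing.\<close>

lemma truncation_props:
  fixes \<epsilon> s :: real
  assumes e: "0 < \<epsilon>" "\<epsilon> \<le> 1"
  shows "((\<lambda>s. s / (1 + \<epsilon> * s\<^sup>2)) has_real_derivative (1 - \<epsilon> * s\<^sup>2) / (1 + \<epsilon> * s\<^sup>2)\<^sup>2) (at s)"
    and "\<bar>(1 - \<epsilon> * s\<^sup>2) / (1 + \<epsilon> * s\<^sup>2)\<^sup>2\<bar> \<le> 1"
    and "\<bar>s / (1 + \<epsilon> * s\<^sup>2)\<bar> \<le> 1 / \<epsilon>"
    and "\<bar>s / (1 + \<epsilon> * s\<^sup>2)\<bar> \<le> \<bar>s\<bar>"
proof -
  have p: "1 + \<epsilon> * s\<^sup>2 \<ge> 1" using e by simp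
  then have p0: "1 + \<epsilon> * s\<^sup>2 > 0" by linarith
  have "((\<lambda>s. s / (1 + \<epsilon> * s\<^sup>2)) has_real_derivative (1 * (1 + \<epsilon> * s\<^sup>2) - s * (\<epsilon> * (2 * s))) / ((1 + \<epsilon> * s\<^sup>2) * (1 + \<epsilon> * s\<^sup>2))) (at s)"
    by (rule DERIV_divide) (use p0 in \<open>auto intro!: derivative_eq_intros\<close>)
  moreover have "1 * (1 + \<epsilon> * s\<^sup>2) - s * (\<epsilon> * (2 * s)) = 1 - \<epsilon> * s\<^sup>2" by (simp add: power2_eq_square algebra_simps)
  ultimately show "((\<lambda>s. s / (1 + \<epsilon> * s\<^sup>2)) has_real_derivative (1 - \<epsilon> * s\<^sup>2) / (1 + \<epsilon> * s\<^sup>2)\<^sup>2) (at s)"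
    by (simp add: power2_eq_square)
  have "\<bar>1 - \<epsilon> * s\<^sup>2\<bar> \<le> 1 + \<epsilon> * s\<^sup>2" using e by (simp add: abs_le_iff)
  also have "\<dots> \<le> (1 + \<epsilon> * s\<^sup>2)\<^sup>2" using mult_left_mono[OF p, of "1 + \<epsilon> * s\<^sup>2"] p0 by (simp add: power2_eq_square)
  finally show "\<bar>(1 - \<epsilon> * s\<^sup>2) / (1 + \<epsilon> * s\<^sup>2)\<^sup>2\<bar> \<le> 1" using p0 by (simp add: divide_le_eq)
  have "\<bar>s\<bar> \<le> 1 + s\<^sup>2"
  proof (cases "\<bar>s\<bar> \<le> 1")
    case False
    then have "\<bar>s\<bar> * 1 \<le> \<bar>s\<bar> * \<bar>s\<bar>" by (intro mult_left_mono) auto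
    then show ?thesis by (simp add: power2_eq_square)
  qed (simp add: add_increasing2)
  then have "\<epsilon> * \<bar>s\<bar> \<le> \<epsilon> * (1 + s\<^sup>2)" using e by (intro mult_left_mono) auto
  also have "\<dots> \<le> 1 + \<epsilon> * s\<^sup>2" using e by (simp add: distrib_left)
  finally show "\<bar>s / (1 + \<epsilon> * s\<^sup>2)\<bar> \<le> 1 / \<epsilon>" using p0 e by (simp add: field_simps)
  have "\<bar>s\<bar> * 1 \<le> \<bar>s\<bar> * (1 + \<epsilon> * s\<^sup>2)" using p by (intro mult_left_mono) auto
  then show "\<bar>s / (1 + \<epsilon> * s\<^sup>2)\<bar> \<le> \<bar>s\<bar>" using p0 by (simp add: field_simps)
qed

text \<open>For \<open>\<gamma> = 0\<close> every bounded function satisfies the Hoelder condition. The truncations of \<open>w\<close> are bounded,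
  and they converge to \<open>w\<close> together with their gradients, in the modular sense by domination with the
  modular of \<open>2 l g\<close>.\<close>

lemma approximable_unbounded:
  assumes g0: "\<gamma> = 0"
    and cone: "\<And>p. p \<in> closure \<Omega> \<Longrightarrow> \<exists>r>0. inward_cone \<Omega> p r"
    and w: "W0 w g" "\<And>x. x \<notin> \<Omega> \<Longrightarrow> w x = 0" "\<And>x. x \<notin> \<Omega> \<Longrightarrow> g x = 0"
    and fin: "\<And>s. modular0 (\<lambda>x. s *\<^sub>R g x) < \<infinity>"
  shows "approximable w g"
proof -
  note wi = W0_integrable[OF w(1)]
  have wm [measurable]: "w \<in> borel_measurable borel" "g \<in> borel_measurable borel" using wi by auto
  note [measurable] = M0_measurable
  define \<epsilon> where "\<epsilon> n = inverse (real (Suc n))" for n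
  have e: "0 < \<epsilon> n" "\<epsilon> n \<le> 1" for n by (auto simp: \<epsilon>_def field_simps)
  have e0: "\<epsilon> \<longlonglongrightarrow> 0" unfolding \<epsilon>_def by (rule LIMSEQ_inverse_real_of_nat)
  define T where "T n s = s / (1 + \<epsilon> n * s\<^sup>2)" for n s
  define T' where "T' n s = (1 - \<epsilon> n * s\<^sup>2) / (1 + \<epsilon> n * s\<^sup>2)\<^sup>2" for n s
  note T = truncation_props[OF e, folded T_def T'_def]
  have den: "1 + \<epsilon> n * s\<^sup>2 \<noteq> 0" for n s
  proof -
    have "1 + \<epsilon> n * s\<^sup>2 \<ge> 1" using e[of n] by simp
    then show ?thesis by linarith
  qed
  have T'c: "continuous_on UNIV (T' n)" for n
    unfolding T'_def[abs_def] using den by (intro continuous_intros) auto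
  have Tc: "continuous_on UNIV (T n)" for n
    unfolding T_def[abs_def] using den by (intro continuous_intros) auto
  have [measurable]: "T n \<in> borel_measurable borel" "T' n \<in> borel_measurable borel" for n
    using Tc T'c by (auto intro: borel_measurable_continuous_onI)
  have T0: "T n 0 = 0" for n by (simp add: T_def)
  have Tlim: "(\<lambda>n. T n s) \<longlonglongrightarrow> s" for s
  proof -
    have "(\<lambda>n. s / (1 + \<epsilon> n * s\<^sup>2)) \<longlonglongrightarrow> s / (1 + 0 * s\<^sup>2)" by (intro tendsto_intros e0) auto
    then show ?thesis by (simp add: T_def)
  qed
  have T'lim: "(\<lambda>n. T' n s) \<longlonglongrightarrow> 1" for s
  proof -
    have "(\<lambda>n. (1 - \<epsilon> n * s\<^sup>2) / (1 + \<epsilon> n * s\<^sup>2)\<^sup>2) \<longlonglongrightarrow> (1 - 0 * s\<^sup>2) / (1 + 0 * s\<^sup>2)\<^sup>2" by (intro tendsto_intros e0) auto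
    then show ?thesis by (simp add: T'_def)
  qed
  define wn where "wn n x = T n (w x)" for n x
  define gn where "gn n x = T' n (w x) *\<^sub>R g x" for n x
  have Wn: "W0 (wn n) (gn n)" for n
    unfolding wn_def[abs_def] gn_def[abs_def] by (rule W0_compose[OF w(1) T(1) T'c T0 T(2)])
  have [measurable]: "wn n \<in> borel_measurable borel" "gn n \<in> borel_measurable borel" for n
    unfolding wn_def[abs_def] gn_def[abs_def] by measurable
  have finn: "modular0 (\<lambda>x. s *\<^sub>R gn n x) < \<infinity>" for n s
  proof -
    have "modular0 (\<lambda>x. s *\<^sub>R gn n x) \<le> modular0 (\<lambda>x. s *\<^sub>R g x)"
      unfolding modular0_def
    proof (rule nn_integral_mono, rule ennreal_leI)
      fix x
      have ev: "M0 x (s *\<^sub>R gn n x) = M0 x (\<bar>T' n (w x)\<bar> *\<^sub>R (s *\<^sub>R g x))"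
      proof (cases "T' n (w x) \<ge> 0")
        case True then show ?thesis by (simp add: gn_def mult.commute)
      next
        case False
        have "M0 x (- (s *\<^sub>R gn n x)) = M0 x (s *\<^sub>R gn n x)" by (simp add: M0_def M_even)
        then show ?thesis using False by (simp add: gn_def mult.commute)
      qed
      show "M0 x (s *\<^sub>R gn n x) \<le> M0 x (s *\<^sub>R g x)"
        unfolding ev using M0_mono_scale[of "\<bar>T' n (w x)\<bar>" 1 x "s *\<^sub>R g x"] T(2)[of n "w x"] by simp
    qed
    then show ?thesis using fin[of s] by (rule order_le_less_trans)
  qed
  have an: "approximable (wn n) (gn n)" for n
  proof (rule approximable_holder[OF cone Wn _ _ finn])
    show "x \<notin> \<Omega> \<Longrightarrow> wn n x = 0" "x \<notin> \<Omega> \<Longrightarrow> gn n x = 0" for x using w(2,3) T0 by (auto simp: wn_def gn_def)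
    show b: "\<bar>wn n x\<bar> \<le> 1 / \<epsilon> n" for x unfolding wn_def by (rule T(3))
    show "\<bar>wn n x - wn n y\<bar> \<le> (2 / \<epsilon> n) * norm (x - y) powr \<gamma>" if "x \<noteq> y" for x y
    proof -
      have "\<bar>wn n x - wn n y\<bar> \<le> 1 / \<epsilon> n + 1 / \<epsilon> n" using b[of x] b[of y] by linarith
      then show ?thesis using that g0 by simp
    qed
  qed
  have l1: "(\<lambda>n. \<integral>\<^sup>+x. ennreal \<bar>wn n x - w x\<bar> \<partial>lborel) \<longlonglongrightarrow> (\<integral>\<^sup>+x. 0 \<partial>(lborel :: 'a measure))"
  proof (rule nn_integral_dominated_convergence[where w="\<lambda>x. ennreal (2 * \<bar>w x\<bar>)"])
    show "AE x in lborel. ennreal \<bar>wn n x - w x\<bar> \<le> ennreal (2 * \<bar>w x\<bar>)" for n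
    proof (intro AE_I2 ennreal_leI)
      fix x show "\<bar>wn n x - w x\<bar> \<le> 2 * \<bar>w x\<bar>" using T(4)[of n "w x"] by (simp add: wn_def)
    qed
    show "(\<integral>\<^sup>+x. ennreal (2 * \<bar>w x\<bar>) \<partial>lborel) < \<infinity>"
    proof -
      have "integrable lborel (\<lambda>x. 2 * \<bar>w x\<bar>)" using wi(1) by auto
      from nn_integral_eq_integral[OF this] show ?thesis by simp
    qed
    show "AE x in lborel. (\<lambda>n. ennreal \<bar>wn n x - w x\<bar>) \<longlonglongrightarrow> 0"
    proof (rule AE_I2)
      fix x
      have "(\<lambda>n. \<bar>wn n x - w x\<bar>) \<longlonglongrightarrow> \<bar>w x - w x\<bar>" unfolding wn_def by (intro tendsto_intros Tlim)
      from tendsto_ennrealI[OF this] show "(\<lambda>n. ennreal \<bar>wn n x - w x\<bar>) \<longlonglongrightarrow> 0" by simp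
    qed
  qed auto
  have gd: "gn n x - g x = - ((1 - T' n (w x)) *\<^sub>R g x)" for n x by (simp add: gn_def algebra_simps)
  have T'b: "0 \<le> 1 - T' n s" "1 - T' n s \<le> 2" for n s using T(2)[of n s] by auto
  have l2: "(\<lambda>n. \<integral>\<^sup>+x. ennreal (norm (gn n x - g x)) \<partial>lborel) \<longlonglongrightarrow> (\<integral>\<^sup>+x. 0 \<partial>(lborel :: 'a measure))"
  proof (rule nn_integral_dominated_convergence[where w="\<lambda>x. ennreal (2 * norm (g x))"])
    show "AE x in lborel. ennreal (norm (gn n x - g x)) \<le> ennreal (2 * norm (g x))" for n
      by (intro AE_I2 ennreal_leI) (use T'b in \<open>simp add: gd mult_right_mono\<close>)
    show "(\<integral>\<^sup>+x. ennreal (2 * norm (g x)) \<partial>lborel) < \<infinity>"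
    proof -
      have "integrable lborel (\<lambda>x. 2 * norm (g x))" using wi(2) by auto
      from nn_integral_eq_integral[OF this] show ?thesis by simp
    qed
    show "AE x in lborel. (\<lambda>n. ennreal (norm (gn n x - g x))) \<longlonglongrightarrow> 0"
    proof (rule AE_I2)
      fix x
      have "(\<lambda>n. norm (gn n x - g x)) \<longlonglongrightarrow> norm (1 *\<^sub>R g x - g x)" unfolding gn_def by (intro tendsto_intros T'lim)
      from tendsto_ennrealI[OF this] show "(\<lambda>n. ennreal (norm (gn n x - g x))) \<longlonglongrightarrow> 0" by simp
    qed
  qed auto
  have l3: "(\<lambda>n. modular0 (\<lambda>x. l *\<^sub>R (gn n x - g x))) \<longlonglongrightarrow> (\<integral>\<^sup>+x. 0 \<partial>(lborel :: 'a measure))" for l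
    unfolding modular0_def
  proof (rule nn_integral_dominated_convergence[where w="\<lambda>x. ennreal (M0 x ((2 * l) *\<^sub>R g x))"])
    show "AE x in lborel. ennreal (M0 x (l *\<^sub>R (gn n x - g x))) \<le> ennreal (M0 x ((2 * l) *\<^sub>R g x))" for n
    proof (intro AE_I2 ennreal_leI)
      fix x
      have "M0 x (l *\<^sub>R (gn n x - g x)) = M0 x ((1 - T' n (w x)) *\<^sub>R (l *\<^sub>R g x))"
        unfolding gd by (simp add: M0_def M_even mult.commute)
      also have "\<dots> \<le> M0 x (2 *\<^sub>R (l *\<^sub>R g x))" by (rule M0_mono_scale[OF T'b])
      finally show "M0 x (l *\<^sub>R (gn n x - g x)) \<le> M0 x ((2 * l) *\<^sub>R g x)" by simp
    qed
    show "(\<integral>\<^sup>+x. ennreal (M0 x ((2 * l) *\<^sub>R g x)) \<partial>lborel) < \<infinity>"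
      using fin[of "2 * l"] by (simp add: modular0_def)
    show "AE x in lborel. (\<lambda>n. ennreal (M0 x (l *\<^sub>R (gn n x - g x)))) \<longlonglongrightarrow> 0"
    proof (rule AE_I2)
      fix x
      have "(\<lambda>n. l *\<^sub>R (gn n x - g x)) \<longlonglongrightarrow> l *\<^sub>R (1 *\<^sub>R g x - g x)" unfolding gn_def by (intro tendsto_intros T'lim)
      then have "(\<lambda>n. l *\<^sub>R (gn n x - g x)) \<longlonglongrightarrow> 0" by simp
      from tendsto_ennrealI[OF M0_tendsto_zero[OF this, of x]]
      show "(\<lambda>n. ennreal (M0 x (l *\<^sub>R (gn n x - g x)))) \<longlonglongrightarrow> 0" by simp
    qed
  qed auto
  show ?thesis
  proof (rule approximable_limit[OF wm])
    fix l \<eta> :: real assume "l > 0" and eta: "\<eta> > 0"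
    have "\<forall>\<^sub>F n in sequentially. (\<integral>\<^sup>+x. ennreal \<bar>wn n x - w x\<bar> \<partial>lborel) < ennreal \<eta> \<and>
      (\<integral>\<^sup>+x. ennreal (norm (gn n x - g x)) \<partial>lborel) < ennreal \<eta> \<and> modular0 (\<lambda>x. l *\<^sub>R (gn n x - g x)) < ennreal \<eta>"
      using order_tendstoD(2)[OF l1, of "ennreal \<eta>"] order_tendstoD(2)[OF l2, of "ennreal \<eta>"]
        order_tendstoD(2)[OF l3, of "ennreal \<eta>" l] eta by (intro eventually_conj) auto
    then obtain n where n: "(\<integral>\<^sup>+x. ennreal \<bar>wn n x - w x\<bar> \<partial>lborel) < ennreal \<eta>"
      "(\<integral>\<^sup>+x. ennreal (norm (gn n x - g x)) \<partial>lborel) < ennreal \<eta>" "modular0 (\<lambda>x. l *\<^sub>R (gn n x - g x)) < ennreal \<eta>"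
      unfolding eventually_sequentially by blast
    show "\<exists>w' g'. w' \<in> borel_measurable borel \<and> g' \<in> borel_measurable borel \<and> approximable w' g' \<and>
      (\<integral>\<^sup>+x. ennreal \<bar>w' x - w x\<bar> \<partial>lborel) \<le> ennreal \<eta> \<and> (\<integral>\<^sup>+x. ennreal (norm (g' x - g x)) \<partial>lborel) \<le> ennreal \<eta> \<and>
      modular0 (\<lambda>x. l *\<^sub>R (g' x - g x)) \<le> ennreal \<eta>"
      using n an[of n] by (intro exI[of _ "wn n"] exI[of _ "gn n"] conjI less_imp_le) auto
  qed
qed

end

section \<open>Geometry of Lipschitz domains\<close>

lemma inward_cone_interior:
  fixes \<Omega> :: "'a::euclidean_space set"
  assumes "open \<Omega>" "p \<in> \<Omega>" shows "\<exists>r>0. inward_cone \<Omega> p r"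
proof -
  obtain s where s: "s > 0" "cball p s \<subseteq> \<Omega>" using assms open_contains_cball by blast
  have "inward_cone \<Omega> p (s / 2)"
    unfolding inward_cone_def
  proof (rule exI[of _ "0::'a"], rule exI[of _ "1::real"], rule exI[of _ "s / 2"], intro exI[of _ "cball p s"] conjI allI impI)
    show "norm (0::'a) + 1 \<le> 1" "(1::real) > 0" "s / 2 > 0" "compact (cball p s)" "cball p s \<subseteq> \<Omega>" using s by auto
    fix \<delta> :: real and y z :: 'a
    assume d: "0 < \<delta> \<and> \<delta> < s / 2" and y: "y \<in> \<Omega> \<inter> cball p (s / 2)" and z: "norm (z - \<delta> *\<^sub>R 0) \<le> \<delta> * 1"
    have "dist p (y + z) \<le> dist p y + norm z"
      using norm_triangle_ineq4[of "p - y" z] by (simp add: dist_norm algebra_simps)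
    then show "y + z \<in> cball p s" using d y z by simp
  qed
  then show ?thesis using s by (intro exI[of _ "s / 2"]) auto
qed

text \<open>Moving up by \<open>\<delta> / 2\<close> and then by a vector \<open>u\<close> of length at most \<open>\<delta> c\<close> raises the height by at least
  \<open>\<delta> / 2 - \<delta> c\<close>, and the graph by at most \<open>L \<delta> c\<close>. With \<open>(L + 1) c = 1 / 4\<close> the point stays above the graph. The
  estimate has a margin, so it also holds for the closure of the set of starting points, and this makes
  the image compact in \<open>\<Omega>\<close>.\<close>

lemma inward_cone_graph:
  fixes e :: "'a::euclidean_space"
  assumes r: "r > 0" and e: "norm e = 1" and lip: "lipschitz_on L {y. y \<bullet> e = 0} \<phi>"
    and chart: "\<Omega> \<inter> ball p r = {x \<in> ball p r. \<phi> (x - (x \<bullet> e) *\<^sub>R e) < x \<bullet> e}"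
  shows "inward_cone \<Omega> p (r / 4)"
proof -
  have L: "L \<ge> 0" using lip by (rule lipschitz_on_nonneg)
  define c where "c = 1 / (4 * (L + 1))"
  have c: "c > 0" "c \<le> 1 / 4" "(L + 1) * c = 1 / 4" using L by (auto simp: c_def field_simps)
  define h where "h x = x - (x \<bullet> e) *\<^sub>R e" for x
  have ee: "e \<bullet> e = 1" using e by (simp add: norm_eq_sqrt_inner)
  have hh: "h x \<bullet> e = 0" for x by (simp add: h_def inner_diff_left ee)
  have hl: "h (x + y) = h x + h y" "h (x - y) = h x - h y" for x y by (auto simp: h_def inner_add_left inner_diff_left algebra_simps)
  have hn: "norm (h x) \<le> norm x" for x
  proof -
    have "(norm (h x))\<^sup>2 = (norm x)\<^sup>2 - (x \<bullet> e)\<^sup>2"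
      unfolding power2_norm_eq_inner h_def
      by (simp add: inner_diff_left inner_diff_right ee inner_commute[of e x] power2_eq_square algebra_simps)
    then have "(norm (h x))\<^sup>2 \<le> (norm x)\<^sup>2" by simp
    then show ?thesis using power2_le_imp_le norm_ge_zero by blast
  qed
  have lips: "\<bar>\<phi> (h x) - \<phi> (h y)\<bar> \<le> L * norm (h x - h y)" for x y
    using lipschitz_onD[OF lip, of "h x" "h y"] hh by (simp add: dist_norm)
  have hc: "continuous_on S h" for S unfolding h_def[abs_def] by (intro continuous_intros)
  have cont: "continuous_on S (\<lambda>x. x \<bullet> e - \<phi> (h x))" for S
    by (intro continuous_intros continuous_on_compose2[OF lipschitz_on_continuous_on[OF lip] hc]) (use hh in auto)
  have ge: "y \<bullet> e - \<phi> (h y) \<ge> 0" if "y \<in> closure (\<Omega> \<inter> cball p (r / 4))" for y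
  proof (rule continuous_ge_on_closure[OF cont that])
    fix x assume "x \<in> \<Omega> \<inter> cball p (r / 4)"
    then have "x \<in> \<Omega> \<inter> ball p r" using r by auto
    then show "0 \<le> x \<bullet> e - \<phi> (h x)" unfolding chart h_def by simp
  qed
  have cl: "closure (\<Omega> \<inter> cball p (r / 4)) \<subseteq> cball p (r / 4)" by (rule closure_minimal) auto
  show ?thesis
    unfolding inward_cone_def
  proof (rule exI[of _ "(1/2) *\<^sub>R e"], rule exI[of _ c], rule exI[of _ "r / 4"], intro conjI allI impI)
    show "norm ((1 / 2) *\<^sub>R e) + c \<le> 1" "c > 0" "r / 4 > 0" using e c r by auto
    fix \<delta> :: real assume d: "0 < \<delta> \<and> \<delta> < r / 4"
    let ?Y = "closure (\<Omega> \<inter> cball p (r / 4))" and ?Z = "cball (\<delta> *\<^sub>R (1/2) *\<^sub>R e) (\<delta> * c)"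
    let ?S = "{y + z | y z. y \<in> ?Y \<and> z \<in> ?Z}"
    show "\<exists>S. compact S \<and> S \<subseteq> \<Omega> \<and> (\<forall>y z. y \<in> \<Omega> \<inter> cball p (r / 4) \<longrightarrow> norm (z - \<delta> *\<^sub>R (1/2) *\<^sub>R e) \<le> \<delta> * c \<longrightarrow> y + z \<in> S)"
    proof (intro exI[of _ ?S] conjI allI impI)
      have "bounded (\<Omega> \<inter> cball p (r / 4))" by (rule bounded_subset[OF bounded_cball]) auto
      then show "compact ?S" by (intro compact_sums) auto
      show "?S \<subseteq> \<Omega>"
      proof
        fix x assume "x \<in> ?S"
        then obtain y z where x: "x = y + z" and y: "y \<in> ?Y" and z: "z \<in> ?Z" by blast
        define u where "u = z - \<delta> *\<^sub>R (1/2) *\<^sub>R e"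
        have u: "norm u \<le> \<delta> * c" using z by (simp add: u_def dist_norm norm_minus_commute)
        have zu: "z = u + (\<delta> / 2) *\<^sub>R e" by (simp add: u_def)
        have "h ((\<delta> / 2) *\<^sub>R e) = 0" by (simp add: h_def ee)
        then have hx: "h x = h y + h u" by (simp add: x zu hl(1))
        have "\<bar>u \<bullet> e\<bar> \<le> \<delta> * c" using Cauchy_Schwarz_ineq2[of u e] e u by simp
        then have ze: "z \<bullet> e \<ge> \<delta> / 2 - \<delta> * c" by (simp add: zu inner_add_left ee)
        have "\<phi> (h x) \<le> \<phi> (h y) + L * norm (h u)" using lips[of x y] hx by simp
        also have "\<dots> \<le> y \<bullet> e + L * (\<delta> * c)"
          using ge[OF y] mult_left_mono[OF order_trans[OF hn[of u] u] L] by linarith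
        also have "\<dots> < y \<bullet> e + (\<delta> / 2 - \<delta> * c)"
        proof -
          have "\<delta> * ((L + 1) * c) < \<delta> / 2" using d c(3) by simp
          then show ?thesis by (simp add: algebra_simps)
        qed
        also have "\<dots> \<le> x \<bullet> e" using ze by (simp add: x inner_add_left)
        finally have lt: "\<phi> (h x) < x \<bullet> e" .
        have "norm z \<le> \<delta> * c + \<delta> / 2" using norm_triangle_ineq[of u "(\<delta> / 2) *\<^sub>R e"] u e d by (simp add: zu)
        also have "\<dots> \<le> \<delta>"
        proof -
          have "\<delta> * c \<le> \<delta> * (1 / 4)" using d by (intro mult_left_mono c(2)) simp
          then show ?thesis using d by linarith
        qed
        finally have "norm z < r / 4" using d by simp
        moreover have "dist p y \<le> r / 4" using y cl by auto
        moreover have "dist p x \<le> dist p y + norm z"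
          using norm_triangle_ineq4[of "p - y" z] by (simp add: dist_norm x algebra_simps)
        ultimately have "x \<in> ball p r" using r by simp
        then have "x \<in> {x \<in> ball p r. \<phi> (x - (x \<bullet> e) *\<^sub>R e) < x \<bullet> e}" using lt by (simp add: h_def)
        then show "x \<in> \<Omega>" using chart by blast
      qed
      fix y z assume "y \<in> \<Omega> \<inter> cball p (r / 4)" "norm (z - \<delta> *\<^sub>R (1/2) *\<^sub>R e) \<le> \<delta> * c"
      then have "y \<in> ?Y" "z \<in> ?Z"
        using closure_subset[of "\<Omega> \<inter> cball p (r / 4)"] by (auto simp: dist_norm norm_minus_commute)
      then show "y + z \<in> ?S" by blast
    qed
  qed
qed

lemma lipschitz_domain_inward_cone:
  assumes "lipschitz_domain \<Omega>" "p \<in> closure \<Omega>" shows "\<exists>r>0. inward_cone \<Omega> p r"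
proof (cases "p \<in> \<Omega>")
  case True
  then show ?thesis using inward_cone_interior assms(1) by (auto simp: lipschitz_domain_def)
next
  case False
  have "open \<Omega>" using assms(1) by (simp add: lipschitz_domain_def)
  then have "p \<in> frontier \<Omega>" using False assms(2) by (simp add: frontier_def interior_open)
  then obtain r e \<phi> C where "r > 0" "norm e = 1" "lipschitz_on C {y. y \<bullet> e = 0} \<phi>"
    "\<Omega> \<inter> ball p r = {x \<in> ball p r. \<phi> (x - (x \<bullet> e) *\<^sub>R e) < x \<bullet> e}"
    using assms(1) unfolding lipschitz_domain_def by blast
  from inward_cone_graph[OF this] show ?thesis using \<open>r > 0\<close> by (intro exI[of _ "r / 4"]) auto
qed

lemma lipschitz_domain_exterior:
  fixes \<Omega> :: "'a::euclidean_space set"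
  assumes "lipschitz_domain \<Omega>" "p \<in> frontier \<Omega>" "\<rho> > 0"
  shows "\<exists>y \<eta>. \<eta> > 0 \<and> ball y \<eta> \<subseteq> ball p \<rho> - \<Omega>"
proof -
  obtain r e \<phi> L where r: "r > 0" and e: "norm e = 1" and lip: "lipschitz_on L {y. y \<bullet> e = 0} \<phi>"
    and chart: "\<Omega> \<inter> ball p r = {x \<in> ball p r. \<phi> (x - (x \<bullet> e) *\<^sub>R e) < x \<bullet> e}"
    using assms(1,2) unfolding lipschitz_domain_def by blast
  have "open \<Omega>" using assms(1) by (simp add: lipschitz_domain_def)
  then have "p \<notin> \<Omega>" using assms(2) by (simp add: frontier_def interior_open)
  then have "p \<notin> {x \<in> ball p r. \<phi> (x - (x \<bullet> e) *\<^sub>R e) < x \<bullet> e}" unfolding chart[symmetric] by blast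
  then have pe: "p \<bullet> e \<le> \<phi> (p - (p \<bullet> e) *\<^sub>R e)" using r by simp
  define h where "h x = x - (x \<bullet> e) *\<^sub>R e" for x
  have ee: "e \<bullet> e = 1" using e by (simp add: norm_eq_sqrt_inner)
  have hh: "h x \<bullet> e = 0" for x by (simp add: h_def inner_diff_left ee)
  have hc: "continuous_on S h" for S unfolding h_def[abs_def] by (intro continuous_intros)
  have cont: "continuous_on UNIV (\<lambda>x. \<phi> (h x))"
    by (intro continuous_on_compose2[OF lipschitz_on_continuous_on[OF lip] hc]) (use hh in auto)
  define t where "t = min r \<rho> / 2"
  have t: "t > 0" "t < r" "t < \<rho>" using r assms(3) by (auto simp: t_def)
  define y where "y = p - t *\<^sub>R e"
  define U where "U = {x. x \<bullet> e < \<phi> (h x)} \<inter> ball p (min r \<rho>)"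
  have "open U" unfolding U_def using cont by (intro open_Int open_Collect_less open_ball continuous_intros) auto
  moreover have "y \<in> U"
  proof -
    have "h y = h p" by (simp add: y_def h_def inner_diff_left ee algebra_simps)
    moreover have "y \<bullet> e < p \<bullet> e" using t by (simp add: y_def inner_diff_left ee)
    ultimately have "y \<bullet> e < \<phi> (h y)" using pe by (simp add: h_def)
    then show ?thesis using t e by (simp add: U_def y_def dist_norm)
  qed
  ultimately obtain \<eta> where eta: "\<eta> > 0" "ball y \<eta> \<subseteq> U" using open_contains_ball by blast
  have "U \<subseteq> ball p \<rho> - \<Omega>"
  proof
    fix x assume x: "x \<in> U"
    then have "x \<in> ball p r" "x \<in> ball p \<rho>" "\<not> \<phi> (x - (x \<bullet> e) *\<^sub>R e) < x \<bullet> e" by (auto simp: U_def h_def)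
    then have "x \<notin> \<Omega> \<inter> ball p r" unfolding chart by blast
    then show "x \<in> ball p \<rho> - \<Omega>" using \<open>x \<in> ball p r\<close> \<open>x \<in> ball p \<rho>\<close> by blast
  qed
  then show ?thesis using eta by blast
qed

text \<open>Composing with a step turns \<open>w\<close>, near \<open>p\<close>, into the indicator of \<open>\<Omega>\<close>, with zero gradient there. Its
  mollification is then constant near \<open>p\<close>. But it is \<open>1\<close> at points inside \<open>\<Omega>\<close> and \<open>0\<close> at points below the
  graph, and both kinds of points with a ball around them exist near \<open>p\<close>.\<close>

lemma no_positive_trace:
  fixes \<Omega> :: "'a::euclidean_space set"
  assumes \<Omega>: "lipschitz_domain \<Omega>" and p: "p \<in> frontier \<Omega>" and w: "W0 w g" "\<And>x. x \<notin> \<Omega> \<Longrightarrow> w x = 0"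
    and a: "a > 0" "\<rho> > 0" "\<And>x. x \<in> \<Omega> \<inter> ball p \<rho> \<Longrightarrow> a \<le> w x"
  shows False
proof -
  have oO: "open \<Omega>" using \<Omega> by (simp add: lipschitz_domain_def)
  define v where "v x = (1 / a) * w x" for x
  define f where "f x = step_fun (v x)" for x
  define g' where "g' x = step_fun' (v x) *\<^sub>R ((1 / a) *\<^sub>R g x)" for x
  have s0: "step_fun 0 = 0" by (rule step_fun_props(1)) simp
  have F: "W0 f g'" unfolding f_def[abs_def] g'_def[abs_def] v_def[abs_def]
    by (rule W0_compose[OF W0_cmult[OF w(1)] step_fun_deriv step_fun'_cont s0 step_fun_props(7)])
  have f1: "f x = 1" if "x \<in> \<Omega> \<inter> ball p \<rho>" for x
    unfolding f_def by (rule step_fun_props(2)) (use a(1) a(3)[OF that] in \<open>simp add: v_def field_simps\<close>)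
  have f0: "f x = 0" if "x \<notin> \<Omega>" for x using w(2)[OF that] s0 by (simp add: f_def v_def)
  have g0: "g' x = 0" if "x \<in> ball p \<rho>" for x
  proof (cases "x \<in> \<Omega>")
    case True
    then have "v x \<ge> 1" using a(1) a(3)[of x] that by (simp add: v_def field_simps)
    then show ?thesis by (simp add: g'_def step_fun_props(6))
  next
    case False
    then have "v x \<le> 0" using w(2) by (simp add: v_def)
    then show ?thesis by (simp add: g'_def step_fun_props(5))
  qed
  have "p \<in> closure \<Omega>" using p by (simp add: frontier_def)
  then obtain y1 where "y1 \<in> \<Omega>" "dist y1 p < \<rho> / 2"
    using a(2) unfolding closure_approachable by (meson half_gt_zero)
  then have "y1 \<in> \<Omega> \<inter> ball p (\<rho> / 2)" by (simp add: dist_commute)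
  moreover have "open (\<Omega> \<inter> ball p (\<rho> / 2))" using oO by auto
  ultimately obtain n1 where n1: "n1 > 0" "ball y1 n1 \<subseteq> \<Omega> \<inter> ball p (\<rho> / 2)" using open_contains_ball by blast
  obtain y2 n2 where n2: "n2 > 0" "ball y2 n2 \<subseteq> ball p (\<rho> / 2) - \<Omega>"
    using lipschitz_domain_exterior[OF \<Omega> p, of "\<rho> / 2"] a(2) by auto
  define \<delta> where "\<delta> = min (min n1 n2) \<rho> / 2"
  have d: "\<delta> > 0" "\<delta> < n1" "\<delta> < n2" "\<delta> \<le> \<rho> / 2" using n1 n2 a(2) by (auto simp: \<delta>_def)
  let ?k = "kern (0::'a) \<delta>"
  have ks: "y \<in> ball x \<delta>" if "?k (x - y) \<noteq> 0" for x y
    using kern_support[OF d(1) that] by (simp add: dist_norm norm_minus_commute)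
  have "\<exists>c. \<forall>x\<in>ball p (\<rho> / 2). conv ?k f x = c"
  proof (rule has_derivative_zero_constant)
    fix x assume x: "x \<in> ball p (\<rho> / 2)"
    have "?k (x - y) *\<^sub>R g' y = 0" for y
    proof (cases "?k (x - y) = 0")
      case False
      then have "dist x y < \<rho> / 2" using ks[OF False] d(4) by simp
      then have "y \<in> ball p \<rho>" using x dist_triangle[of p y x] by simp
      then show ?thesis using g0 by simp
    qed simp
    then have "(\<lambda>y. ?k (x - y) *\<^sub>R g' y) = (\<lambda>y. 0)" by blast
    then have "conv ?k g' x = 0" unfolding conv_def by (simp only: Bochner_Integration.integral_zero)
    then have "(conv ?k f has_derivative (\<lambda>h. 0)) (at x)"
      using grad_conv(2)[OF F kern_C1c[OF d(1), of 0], of x] by simp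
    then show "(conv ?k f has_derivative (\<lambda>h. 0)) (at x within ball p (\<rho> / 2))" by (rule has_derivative_at_withinI)
  qed (rule convex_ball)
  then obtain c where c: "\<And>x. x \<in> ball p (\<rho> / 2) \<Longrightarrow> conv ?k f x = c" by blast
  have "y1 \<in> ball p (\<rho> / 2)" using n1 by (metis Int_iff centre_in_ball subsetD)
  moreover have "conv ?k f y1 = 1"
  proof -
    have "?k (y1 - y) *\<^sub>R f y = ?k (y1 - y)" for y
    proof (cases "?k (y1 - y) = 0")
      case False
      have "y \<in> ball y1 n1" using ks[OF False] d(2) by simp
      then have "y \<in> \<Omega> \<inter> ball p \<rho>" using n1(2) a(2) by auto
      then show ?thesis using f1 by simp
    qed simp
    then have "(\<lambda>y. ?k (y1 - y) *\<^sub>R f y) = (\<lambda>y. ?k (y1 - y))" by blast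
    then have "conv ?k f y1 = (LINT y|lborel. ?k (y1 - y))" unfolding conv_def by (rule arg_cong)
    also have "\<dots> = (LINT y|lborel. ?k y)"
    proof -
      have "?k \<in> borel_measurable borel" using C1c_integrable(1)[OF kern_C1c[OF d(1), of "0::'a"]] by simp
      from lborel_integral_affine[OF this, of "-1" y1] show ?thesis by simp
    qed
    also have "\<dots> = 1" by (rule kern_integral[OF d(1)])
    finally show ?thesis .
  qed
  ultimately have c1: "c = 1" using c by force
  have "y2 \<in> ball p (\<rho> / 2)" using n2 by (metis Diff_iff centre_in_ball subsetD)
  moreover have "conv ?k f y2 = 0"
  proof -
    have "?k (y2 - y) *\<^sub>R f y = 0" for y
    proof (cases "?k (y2 - y) = 0")
      case False
      have "y \<in> ball y2 n2" using ks[OF False] d(3) by simp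
      then have "y \<notin> \<Omega>" using n2(2) by auto
      then show ?thesis using f0 by simp
    qed simp
    then have "(\<lambda>y. ?k (y2 - y) *\<^sub>R f y) = (\<lambda>y. 0)" by blast
    then show ?thesis unfolding conv_def by (simp only: Bochner_Integration.integral_zero)
  qed
  ultimately show False using c c1 by force
qed

text \<open>The values of \<open>w\<close> at points of \<open>\<Omega>\<close> that approach a boundary point \<open>p\<close> have limit \<open>0\<close> by the absence of
  jumps, so the Hoelder estimate extends to pairs of a point of \<open>\<Omega>\<close> and a boundary point. A segment from a
  point of \<open>\<Omega>\<close> to a point of the complement meets the boundary.\<close>

lemma holder_zero_extension:
  fixes \<Omega> :: "'a::euclidean_space set"
  assumes \<Omega>: "lipschitz_domain \<Omega>" and w: "W0 w g" "\<And>x. x \<notin> \<Omega> \<Longrightarrow> w x = 0"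
    and g: "\<gamma> > 0" and H: "H \<ge> 0" and hol: "\<And>x y. x \<in> \<Omega> \<Longrightarrow> y \<in> \<Omega> \<Longrightarrow> x \<noteq> y \<Longrightarrow> \<bar>w x - w y\<bar> \<le> H * norm (x - y) powr \<gamma>"
    and xy: "x \<noteq> y"
  shows "\<bar>w x - w y\<bar> \<le> H * norm (x - y) powr \<gamma>"
proof -
  have oO: "open \<Omega>" using \<Omega> by (simp add: lipschitz_domain_def)
  have one: "u x \<le> H * norm (x - p) powr \<gamma>"
    if p: "p \<in> frontier \<Omega>" and x: "x \<in> \<Omega>" and u: "W0 u g1" "\<And>x. x \<notin> \<Omega> \<Longrightarrow> u x = 0"
      "\<And>x y. x \<in> \<Omega> \<Longrightarrow> y \<in> \<Omega> \<Longrightarrow> x \<noteq> y \<Longrightarrow> \<bar>u x - u y\<bar> \<le> H * norm (x - y) powr \<gamma>" for u g1 p x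
  proof (rule ccontr)
    assume "\<not> ?thesis"
    then have lt: "H * norm (x - p) powr \<gamma> < u x" by simp
    \<comment> \<open>Half of the excess remains as a lower bound near p, by the Hoelder estimate from x.\<close>
    define a where "a = (u x - H * norm (x - p) powr \<gamma>) / 2"
    have a: "a > 0" using lt by (simp add: a_def)
    have "p \<notin> \<Omega>" using p oO by (simp add: frontier_def interior_open)
    then have xp: "x \<noteq> p" using x by blast
    have "((\<lambda>y. H * norm (x - y) powr \<gamma>) \<longlongrightarrow> H * norm (x - p) powr \<gamma>) (at p)"
      using xp by (intro tendsto_intros) auto
    moreover have "H * norm (x - p) powr \<gamma> < u x - a" using lt by (simp add: a_def field_simps)
    ultimately have "\<forall>\<^sub>F y in at p. H * norm (x - y) powr \<gamma> < u x - a" by (rule order_tendstoD(2))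
    then obtain d where d: "d > 0" "\<And>y. y \<noteq> p \<Longrightarrow> dist y p < d \<Longrightarrow> H * norm (x - y) powr \<gamma> < u x - a"
      unfolding eventually_at by auto
    show False
    proof (rule no_positive_trace[OF \<Omega> p u(1,2) a d(1)])
      fix y assume y: "y \<in> \<Omega> \<inter> ball p d"
      show "a \<le> u y"
      proof (cases "x = y")
        case True
        have "H * norm (x - p) powr \<gamma> \<ge> 0" using H by simp
        then show ?thesis using True lt by (simp add: a_def)
      next
        case False
        have "y \<noteq> p" using y \<open>p \<notin> \<Omega>\<close> by blast
        then have "H * norm (x - y) powr \<gamma> < u x - a" using d(2)[of y] y by (simp add: dist_commute)
        moreover have "\<bar>u x - u y\<bar> \<le> H * norm (x - y) powr \<gamma>" using u(3) x y False by blast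
        ultimately show ?thesis by linarith
      qed
    qed
  qed
  have bd: "\<bar>w x\<bar> \<le> H * norm (x - p) powr \<gamma>" if "p \<in> frontier \<Omega>" "x \<in> \<Omega>" for x p
  proof -
    have "w x \<le> H * norm (x - p) powr \<gamma>" by (rule one[OF that w]) (use hol in auto)
    moreover have "W0 (\<lambda>x. - w x) (\<lambda>x. - g x)" using W0_cmult[OF w(1), of "-1"] by simp
    then have "- w x \<le> H * norm (x - p) powr \<gamma>"
      by (rule one[OF that]) (use hol w(2) in \<open>auto simp: abs_minus_commute\<close>)
    ultimately show ?thesis by linarith
  qed
  have mixed: "\<bar>w x - w y\<bar> \<le> H * norm (x - y) powr \<gamma>" if x: "x \<in> \<Omega>" and y: "y \<notin> \<Omega>" for x y
  proof -
    have "closed_segment x y \<inter> frontier \<Omega> \<noteq> {}"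
      by (rule connected_Int_frontier[OF connected_segment]) (use x y in auto)
    then obtain z where z: "z \<in> closed_segment x y" "z \<in> frontier \<Omega>" by blast
    have "norm (x - z) \<le> norm (x - y)" using segment_bound1[OF z(1)] by (simp add: norm_minus_commute)
    then have "H * norm (x - z) powr \<gamma> \<le> H * norm (x - y) powr \<gamma>"
      using g H by (intro mult_left_mono powr_mono2) auto
    then show ?thesis using bd[OF z(2) x] w(2)[OF y] by simp
  qed
  consider "x \<in> \<Omega>" "y \<in> \<Omega>" | "x \<in> \<Omega>" "y \<notin> \<Omega>" | "x \<notin> \<Omega>" "y \<in> \<Omega>" | "x \<notin> \<Omega>" "y \<notin> \<Omega>" by blast
  then show ?thesis
  proof cases
    case 1 then show ?thesis using hol xy by blast
  next
    case 2 then show ?thesis by (rule mixed)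
  next
    case 3 then show ?thesis using mixed[of y x] by (simp add: abs_minus_commute norm_minus_commute)
  next
    case 4 then show ?thesis using w(2) H by simp
  qed
qed

section \<open>Consequences of the structural hypotheses\<close>

text \<open>A nonempty open set is not negligible.\<close>

lemma AE_le_everywhere:
  fixes h :: "'a::euclidean_space \<Rightarrow> real"
  assumes U: "open U" and h: "continuous_on U h" and ae: "AE x in lebesgue_on U. h x \<le> c" and x: "x \<in> U"
  shows "h x \<le> c"
proof (rule ccontr)
  assume "\<not> h x \<le> c"
  let ?V = "h -` {c<..} \<inter> U"
  have "open ?V" using h U continuous_on_open_vimage[OF U] open_greaterThan by blast
  moreover have "x \<in> ?V" using x \<open>\<not> h x \<le> c\<close> by simp
  ultimately have "\<not> negligible ?V" using open_not_negligible by blast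
  moreover have "negligible {x. \<not> (x \<in> U \<longrightarrow> h x \<le> c)}"
    using ae unfolding AE_lebesgue_on_iff[OF U] AE_lborel_negligible .
  then have "negligible ?V" by (rule negligible_subset) auto
  ultimately show False by blast
qed

lemma esssup_continuous:
  fixes f h :: "'a::euclidean_space \<Rightarrow> real"
  assumes U: "open U" and h: "continuous_on U h" and f: "f \<in> borel_measurable (lebesgue_on U)"
    and ae: "AE x in lebesgue_on U. f x = h x"
  shows "x \<in> U \<Longrightarrow> ereal (h x) \<le> esssup (lebesgue_on U) (\<lambda>y. ereal (f y))"
    and "(\<And>x. x \<in> U \<Longrightarrow> h x \<le> c) \<Longrightarrow> esssup (lebesgue_on U) (\<lambda>y. ereal (f y)) \<le> ereal c"
proof -
  let ?S = "esssup (lebesgue_on U) (\<lambda>y. ereal (f y))"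
  show "ereal (h x) \<le> ?S" if x: "x \<in> U"
  proof (rule ccontr)
    assume "\<not> ereal (h x) \<le> ?S"
    then have "?S < ereal (h x)" by (simp only: not_le)
    from ereal_dense2[OF this] obtain c where c: "?S < ereal c" "ereal c < ereal (h x)" by blast
    have "AE y in lebesgue_on U. h y \<le> c"
      using esssup_AE[of "\<lambda>y. ereal (f y)" "lebesgue_on U"] ae
    proof eventually_elim
      fix y assume "ereal (f y) \<le> ?S" "f y = h y"
      then have "ereal (h y) < ereal c" using le_less_trans[OF _ c(1), of "ereal (f y)"] by simp
      then show "h y \<le> c" by simp
    qed
    from AE_le_everywhere[OF U h this x] c(2) show False by simp
  qed
  assume le: "\<And>x. x \<in> U \<Longrightarrow> h x \<le> c"
  have "AE y in lebesgue_on U. y \<in> U" using U by (simp add: AE_lebesgue_on_iff)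
  with ae have "AE y in lebesgue_on U. ereal (f y) \<le> ereal c" by eventually_elim (use le in auto)
  then show "?S \<le> ereal c" using f by (intro esssup_I) auto
qed

lemma N_minus_continuous:
  fixes N M :: "'a::euclidean_space \<Rightarrow> 'a \<Rightarrow> real"
  assumes U: "open (B \<inter> \<Omega>)" "B \<inter> \<Omega> \<noteq> {}" and M: "continuous_on (B \<inter> \<Omega>) (\<lambda>y. M y \<xi>)" "\<And>y. y \<in> \<Omega> \<Longrightarrow> 0 \<le> M y \<xi>"
    and N: "(\<lambda>y. N y \<xi>) \<in> borel_measurable (lebesgue_on (B \<inter> \<Omega>))" "AE y in lebesgue_on (B \<inter> \<Omega>). N y \<xi> = M y \<xi>"
  shows "N_minus \<Omega> N B \<xi> = ereal (INF y\<in>B \<inter> \<Omega>. M y \<xi>)"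
proof -
  let ?U = "B \<inter> \<Omega>" and ?I = "INF y\<in>B \<inter> \<Omega>. M y \<xi>"
  let ?S = "esssup (lebesgue_on ?U) (\<lambda>y. ereal (- N y \<xi>))"
  have bdd: "bdd_below ((\<lambda>y. M y \<xi>) ` ?U)" using M(2) by (intro bdd_belowI2[of _ 0]) auto
  have c: "continuous_on ?U (\<lambda>y. - M y \<xi>)" using M(1) by (intro continuous_intros)
  have m: "(\<lambda>y. - N y \<xi>) \<in> borel_measurable (lebesgue_on ?U)" using N(1) by simp
  have ae: "AE y in lebesgue_on ?U. - N y \<xi> = - M y \<xi>" using N(2) by eventually_elim simp
  have ge: "ereal (- M y \<xi>) \<le> ?S" if "y \<in> ?U" for y by (rule esssup_continuous(1)[OF U(1) c m ae that])
  have le: "?S \<le> ereal (- ?I)"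
    by (rule esssup_continuous(2)[OF U(1) c m ae]) (use cINF_lower[OF bdd] in auto)
  obtain y0 where "y0 \<in> ?U" using U(2) by blast
  have "?S \<noteq> \<infinity>" "?S \<noteq> -\<infinity>" using ge[OF \<open>y0 \<in> ?U\<close>] le by auto
  then obtain s where s: "?S = ereal s" by (cases ?S) auto
  have "- s \<le> ?I" by (rule cINF_greatest[OF U(2)]) (use ge s in force)
  moreover have "s \<le> - ?I" using le s by simp
  ultimately have "?S = ereal (- ?I)" using s by simp
  then show ?thesis by (simp add: N_minus_def)
qed

text \<open>The conditions are inequalities between continuous functions of \<open>x\<close>, so they extend from almost every to
  every point. Convexity and \<open>m1 0 = 0\<close> make \<open>m1\<close> grow at least linearly, and \<open>m2\<close> is bounded on bounded
  intervals by convexity.\<close>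

lemma weak_N_function_musielak:
  fixes M :: "'a::euclidean_space \<Rightarrow> 'a \<Rightarrow> real"
  assumes \<Omega>: "open \<Omega>" "bounded \<Omega>" and M: "weak_N_function \<Omega> UNIV M" and c: "continuous_on (\<Omega> \<times> UNIV) (\<lambda>(x, \<xi>). M x \<xi>)"
  shows "musielak \<Omega> M"
proof -
  have cx: "continuous_on \<Omega> (\<lambda>x. M x \<xi>)" for \<xi>
  proof -
    have "continuous_on \<Omega> (\<lambda>x. (\<lambda>(x, \<xi>). M x \<xi>) (x, \<xi>))"
      by (rule continuous_on_compose2[OF c]) (auto intro!: continuous_intros)
    then show ?thesis by simp
  qed
  have nn: "0 \<le> M x \<xi>" if "x \<in> \<Omega>" for x \<xi> using M that by (simp add: weak_N_function_def)
  have ae1: "AE x in lebesgue_on \<Omega>. M x 0 = 0 \<and> convex_on UNIV (M x)"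
    and ae2: "AE x in lebesgue_on \<Omega>. \<forall>\<xi>. M x \<xi> = M x (- \<xi>)"
    using M by (auto simp: weak_N_function_def)
  obtain m1 m2 :: "real \<Rightarrow> real" where m: "convex_on {0..} m1" "convex_on {0..} m2"
    "\<And>s. s \<ge> 0 \<Longrightarrow> 0 \<le> m1 s" "\<And>s. s \<ge> 0 \<Longrightarrow> 0 \<le> m2 s" "m1 0 = 0" "\<And>s. s > 0 \<Longrightarrow> 0 < m1 s"
    and ae3: "AE x in lebesgue_on \<Omega>. \<forall>\<xi>. m1 (norm \<xi>) \<le> M x \<xi> \<and> M x \<xi> \<le> m2 (norm \<xi>)"
    using M unfolding weak_N_function_def by auto
  have zero: "M x 0 = 0" if x: "x \<in> \<Omega>" for x
  proof -
    have "AE x in lebesgue_on \<Omega>. M x 0 \<le> 0" using ae1 by eventually_elim simp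
    from AE_le_everywhere[OF \<Omega>(1) cx this x] nn[OF x] show ?thesis by (simp add: order_antisym)
  qed
  have conv: "convex_on UNIV (M x)" if x: "x \<in> \<Omega>" for x
    unfolding convex_on_def
  proof (intro conjI convex_UNIV ballI allI impI)
    fix a b :: 'a and u v :: real assume uv: "0 \<le> u" "0 \<le> v" "u + v = 1"
    have "AE x in lebesgue_on \<Omega>. M x (u *\<^sub>R a + v *\<^sub>R b) - (u * M x a + v * M x b) \<le> 0"
      using ae1 by eventually_elim (use uv in \<open>auto simp: convex_on_def\<close>)
    moreover have "continuous_on \<Omega> (\<lambda>x. M x (u *\<^sub>R a + v *\<^sub>R b) - (u * M x a + v * M x b))"
      by (intro continuous_intros cx)
    ultimately show "M x (u *\<^sub>R a + v *\<^sub>R b) \<le> u * M x a + v * M x b"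
      using AE_le_everywhere[OF \<Omega>(1) _ _ x] by fastforce
  qed
  have even_le: "M x \<xi> \<le> M x (- \<xi>)" if x: "x \<in> \<Omega>" for x \<xi>
  proof -
    have "AE x in lebesgue_on \<Omega>. M x \<xi> - M x (- \<xi>) \<le> 0" using ae2 by eventually_elim (simp add: diff_le_eq)
    moreover have "continuous_on \<Omega> (\<lambda>x. M x \<xi> - M x (- \<xi>))" by (intro continuous_intros cx)
    ultimately show ?thesis using AE_le_everywhere[OF \<Omega>(1) _ _ x] by fastforce
  qed
  have up: "M x \<xi> \<le> m2 (norm \<xi>)" if x: "x \<in> \<Omega>" for x \<xi>
  proof -
    have "AE x in lebesgue_on \<Omega>. M x \<xi> \<le> m2 (norm \<xi>)" using ae3 by eventually_elim simp
    then show ?thesis by (rule AE_le_everywhere[OF \<Omega>(1) cx _ x])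
  qed
  have lo: "m1 (norm \<xi>) \<le> M x \<xi>" if x: "x \<in> \<Omega>" for x \<xi>
  proof -
    have "AE x in lebesgue_on \<Omega>. - M x \<xi> \<le> - m1 (norm \<xi>)" using ae3 by eventually_elim simp
    moreover have "continuous_on \<Omega> (\<lambda>x. - M x \<xi>)" by (intro continuous_intros cx)
    ultimately show ?thesis using AE_le_everywhere[OF \<Omega>(1) _ _ x] by fastforce
  qed
  show ?thesis
  proof
    show "M x (- \<xi>) = M x \<xi>" if "x \<in> \<Omega>" for x \<xi>
      using even_le[OF that, of \<xi>] even_le[OF that, of "- \<xi>"] by simp
    show "\<exists>B. \<forall>x\<in>\<Omega>. \<forall>\<xi>. norm \<xi> \<le> R \<longrightarrow> M x \<xi> \<le> B" for R
    proof (intro exI ballI allI impI)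
      fix x \<xi> :: 'a assume x: "x \<in> \<Omega>" and n: "norm \<xi> \<le> R"
      define S where "S = max R 1"
      define t where "t = norm \<xi> / S"
      have S: "S > 0" "norm \<xi> \<le> S" using n by (auto simp: S_def)
      have t: "0 \<le> t" "t \<le> 1" "norm \<xi> = t * S" using S by (auto simp: t_def)
      have "m2 ((1 - t) *\<^sub>R 0 + t *\<^sub>R S) \<le> (1 - t) * m2 0 + t * m2 S"
        using convex_onD[OF m(2) t(1,2), of 0 S] S by simp
      also have "\<dots> \<le> 1 * m2 0 + 1 * m2 S" using t m(4)[of 0] m(4)[of S] S by (intro add_mono mult_right_mono) auto
      finally have "m2 (norm \<xi>) \<le> m2 0 + m2 (max R 1)" using t(3) by (simp add: S_def)
      then show "M x \<xi> \<le> m2 0 + m2 (max R 1)" using up[OF x, of \<xi>] by linarith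
    qed
    show "\<exists>R. \<forall>x\<in>\<Omega>. \<forall>\<xi>. R \<le> norm \<xi> \<longrightarrow> 1 \<le> M x \<xi>"
    proof (intro exI ballI allI impI)
      fix x \<xi> :: 'a assume x: "x \<in> \<Omega>" and n: "max 1 (1 / m1 1) \<le> norm \<xi>"
      define s where "s = norm \<xi>"
      have s: "s \<ge> 1" "1 / m1 1 \<le> s" using n by (auto simp: s_def)
      have m11: "m1 1 > 0" using m(6) by simp
      have "m1 ((1 - 1 / s) *\<^sub>R 0 + (1 / s) *\<^sub>R s) \<le> (1 - 1 / s) * m1 0 + (1 / s) * m1 s"
        using convex_onD[OF m(1), of "1 / s" 0 s] s(1) by simp
      then have "s * m1 1 \<le> m1 s" using s(1) m(5) by (simp add: field_simps)
      moreover have "1 \<le> s * m1 1" using s(2) m11 by (simp add: field_simps)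
      ultimately show "1 \<le> M x \<xi>" using lo[OF x, of \<xi>] by (simp add: s_def)
    qed
  qed (use \<Omega> c zero conv nn in auto)
qed

lemma block_proj_facts:
  fixes b :: "'n::finite \<Rightarrow> nat"
  shows "linear (block_proj b j)" "norm (block_proj b j \<xi>) \<le> norm \<xi>"
    "block_proj b i (block_proj b j \<xi>) = (if i = j then block_proj b j \<xi> else 0)"
    "block_proj b j \<xi> = \<xi> \<longleftrightarrow> \<xi> \<in> block_space b j" "block_proj b j \<xi> \<in> block_space b j"
proof -
  show "linear (block_proj b j)"
    by (rule linearI) (auto simp: block_proj_def vec_eq_iff)
  show "norm (block_proj b j \<xi>) \<le> norm \<xi>"
    by (rule norm_le_componentwise_cart) (simp add: block_proj_def)
qed (auto simp: block_proj_def block_space_def vec_eq_iff)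

text \<open>The summands \<open>Mj\<close> are only measurable in \<open>x\<close>. For almost every \<open>x\<close>, however, \<open>Mj j x\<close> is the restriction of
  \<open>M x\<close> to the factor, because the other summands vanish at \<open>0\<close>. On the factor, the essential bounds of
  \<open>Mj\<close> are therefore the bounds of the continuous function \<open>M\<close>.\<close>

lemma cond_B_balanced:
  fixes \<Omega> :: "(real^'n::finite) set"
  assumes m: "musielak \<Omega> M" and g: "0 \<le> \<gamma>" "\<gamma> \<le> 1" and cond: "cond_B_gen_plus \<gamma> \<Omega> M"
  shows "\<exists>K P C \<theta>. balanced_musielak \<Omega> M K P C \<theta> \<gamma>"
proof -
  interpret musielak \<Omega> M by (rule m)
  obtain K :: nat and b :: "'n \<Rightarrow> nat" and Mj C \<theta> where
    rb: "range b = {..<K}" and wN: "\<And>j. j < K \<Longrightarrow> weak_N_function \<Omega> (block_space b j) (Mj j)"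
    and split: "\<And>x \<xi>. x \<in> \<Omega> \<Longrightarrow> M x \<xi> = (\<Sum>j<K. Mj j x (block_proj b j \<xi>))"
    and C: "C > 1" and th: "\<And>r. r \<in> {0<..1} \<Longrightarrow> \<theta> r > 0"
    and lim: "((\<lambda>r. 1 / (\<theta> r * r powr (1 - \<gamma>))) \<longlongrightarrow> 0) (at_right 0)"
    and bal: "\<And>c r j \<xi>. r \<in> {0<..1} \<Longrightarrow> j < K \<Longrightarrow> \<xi> \<in> block_space b j \<Longrightarrow>
        N_minus \<Omega> (Mj j) (ball c r) (C *\<^sub>R \<xi>)
                \<le> (SUP \<eta>\<in>{\<eta> \<in> block_space b j. norm \<eta> = 1}. N_minus \<Omega> (Mj j) (ball c r) (\<theta> r *\<^sub>R \<eta>)) \<Longrightarrow>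
              N_plus \<Omega> (Mj j) (ball c r) \<xi> \<le> N_minus \<Omega> (Mj j) (ball c r) (C *\<^sub>R \<xi>) + 1"
    using cond unfolding cond_B_gen_plus_def by (elim exE conjE) (rule that, auto)
  note bp = block_proj_facts[where b=b]
  have z: "AE x in lebesgue_on \<Omega>. \<forall>j<K. Mj j x 0 = 0"
  proof -
    have "AE x in lebesgue_on \<Omega>. \<forall>j\<in>{..<K}. Mj j x 0 = 0"
    proof (rule AE_finite_allI)
      fix j assume "j \<in> {..<K}"
      then have "AE x in lebesgue_on \<Omega>. Mj j x 0 = 0 \<and> convex_on (block_space b j) (Mj j x)"
        using wN[of j] by (simp add: weak_N_function_def)
      then show "AE x in lebesgue_on \<Omega>. Mj j x 0 = 0" by eventually_elim simp
    qed simp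
    then show ?thesis by eventually_elim simp
  qed
  have inO: "AE x in lebesgue_on \<Omega>. x \<in> \<Omega>" using open_Omega by (simp add: AE_lebesgue_on_iff)
  have MMj: "AE x in lebesgue_on \<Omega>. \<forall>\<xi>. \<forall>i<K. M x (block_proj b i \<xi>) = Mj i x (block_proj b i \<xi>)"
    using z inO
  proof eventually_elim
    fix x assume z: "\<forall>j<K. Mj j x 0 = 0" and x: "x \<in> \<Omega>"
    show "\<forall>\<xi>. \<forall>i<K. M x (block_proj b i \<xi>) = Mj i x (block_proj b i \<xi>)"
    proof (intro allI impI)
      fix \<xi> i assume i: "i < K"
      have "M x (block_proj b i \<xi>) = (\<Sum>j<K. if j = i then Mj i x (block_proj b i \<xi>) else 0)"
        unfolding split[OF x] by (intro sum.cong) (use z in \<open>auto simp: bp(3)\<close>)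
      then show "M x (block_proj b i \<xi>) = Mj i x (block_proj b i \<xi>)" using i by simp
    qed
  qed
  have cx: "continuous_on \<Omega> (\<lambda>x. M x \<xi>)" for \<xi>
  proof -
    have "continuous_on \<Omega> (\<lambda>x. (\<lambda>(x, \<xi>). M x \<xi>) (x, \<xi>))"
      by (rule continuous_on_compose2[OF M_cont]) (auto intro!: continuous_intros)
    then show ?thesis by simp
  qed
  have Msplit: "M x \<xi> = (\<Sum>j<K. M x (block_proj b j \<xi>))" if x: "x \<in> \<Omega>" for x \<xi>
  proof -
    have ae: "AE x in lebesgue_on \<Omega>. M x \<xi> = (\<Sum>j<K. M x (block_proj b j \<xi>))"
      using MMj inO
    proof eventually_elim
      fix x assume *: "\<forall>\<xi>. \<forall>i<K. M x (block_proj b i \<xi>) = Mj i x (block_proj b i \<xi>)" and "x \<in> \<Omega>"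
      from split[OF this(2)] have "M x \<xi> = (\<Sum>j<K. Mj j x (block_proj b j \<xi>))" .
      also have "\<dots> = (\<Sum>j<K. M x (block_proj b j \<xi>))" by (rule sum.cong) (use * in auto)
      finally show "M x \<xi> = (\<Sum>j<K. M x (block_proj b j \<xi>))" .
    qed
    have c1: "continuous_on \<Omega> (\<lambda>x. M x \<xi> - (\<Sum>j<K. M x (block_proj b j \<xi>)))"
      and c2: "continuous_on \<Omega> (\<lambda>x. (\<Sum>j<K. M x (block_proj b j \<xi>)) - M x \<xi>)"
      by (intro continuous_intros cx)+
    have a1: "AE x in lebesgue_on \<Omega>. M x \<xi> - (\<Sum>j<K. M x (block_proj b j \<xi>)) \<le> 0"
      using ae by eventually_elim linarith
    have a2: "AE x in lebesgue_on \<Omega>. (\<Sum>j<K. M x (block_proj b j \<xi>)) - M x \<xi> \<le> 0"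
      using ae by eventually_elim linarith
    show ?thesis
      using AE_le_everywhere[OF open_Omega c1 a1 x] AE_le_everywhere[OF open_Omega c2 a2 x] by linarith
  qed
  have Nf: "N_minus \<Omega> (Mj j) (ball x r) \<zeta> = ereal (INF y\<in>ball x r \<inter> \<Omega>. M y \<zeta>)"
    "y \<in> ball x r \<inter> \<Omega> \<Longrightarrow> ereal (M y \<zeta>) \<le> N_plus \<Omega> (Mj j) (ball x r) \<zeta>"
    if x: "x \<in> \<Omega>" "0 < r" and j: "j < K" and ze: "\<zeta> \<in> block_space b j" for x r j \<zeta> y
  proof -
    have "x \<in> ball x r \<inter> \<Omega>" using x by simp
    then have U: "open (ball x r \<inter> \<Omega>)" "ball x r \<inter> \<Omega> \<noteq> {}" using open_Omega by (simp add: open_Int, blast)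
    have c: "continuous_on (ball x r \<inter> \<Omega>) (\<lambda>y. M y \<zeta>)" by (rule continuous_on_subset[OF cx]) auto
    have "(\<lambda>y. Mj j y \<zeta>) \<in> borel_measurable (lebesgue_on \<Omega>)"
      using wN[OF j] ze by (simp add: weak_N_function_def)
    then have mm: "(\<lambda>y. Mj j y \<zeta>) \<in> borel_measurable (lebesgue_on (ball x r \<inter> \<Omega>))"
      by (rule measurable_restrict_mono) auto
    have "AE y in lborel. y \<in> \<Omega> \<longrightarrow> (\<forall>\<xi>. \<forall>i<K. M y (block_proj b i \<xi>) = Mj i y (block_proj b i \<xi>))"
      using MMj unfolding AE_lebesgue_on_iff[OF open_Omega] .
    then have ae: "AE y in lebesgue_on (ball x r \<inter> \<Omega>). Mj j y \<zeta> = M y \<zeta>"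
      unfolding AE_lebesgue_on_iff[OF U(1)]
    proof eventually_elim
      fix y assume "y \<in> \<Omega> \<longrightarrow> (\<forall>\<xi>. \<forall>i<K. M y (block_proj b i \<xi>) = Mj i y (block_proj b i \<xi>))"
      moreover have "block_proj b j \<zeta> = \<zeta>" using ze bp(4) by blast
      ultimately show "y \<in> ball x r \<inter> \<Omega> \<longrightarrow> Mj j y \<zeta> = M y \<zeta>" using j by (metis IntD2)
    qed
    show "N_minus \<Omega> (Mj j) (ball x r) \<zeta> = ereal (INF y\<in>ball x r \<inter> \<Omega>. M y \<zeta>)"
      by (rule N_minus_continuous[where N="Mj j" and M=M and \<xi>=\<zeta>, OF U c M_nonneg mm ae])
    show "ereal (M y \<zeta>) \<le> N_plus \<Omega> (Mj j) (ball x r) \<zeta>" if "y \<in> ball x r \<inter> \<Omega>"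
      unfolding N_plus_def by (rule esssup_continuous(1)[OF U(1) c mm ae that])
  qed
  have sc: "s *\<^sub>R \<xi> \<in> block_space b j" if "\<xi> \<in> block_space b j" for s \<xi> j
    using that by (simp add: block_space_def)
  have "balanced_musielak \<Omega> M K (block_proj b) C \<theta> \<gamma>"
  proof (intro balanced_musielak.intro balanced_musielak_axioms.intro musielak_axioms)
    show "linear (block_proj b j)" for j by (rule bp(1))
    show "norm (block_proj b j \<xi>) \<le> norm \<xi>" for j \<xi> by (rule bp(2))
    show "block_proj b j (block_proj b j \<xi>) = block_proj b j \<xi>" for j \<xi> by (simp add: bp(3))
    show "\<exists>\<eta>. block_proj b j \<eta> = \<eta> \<and> norm \<eta> = 1" if "j < K" for j
    proof -
      have "j \<in> range b" using that rb by simp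
      then obtain i where "b i = j" by blast
      then show ?thesis
        by (intro exI[of _ "axis i 1"] conjI norm_axis_1) (simp add: block_proj_def vec_eq_iff axis_def)
    qed
    show "x \<in> \<Omega> \<Longrightarrow> M x \<xi> = (\<Sum>j<K. M x (block_proj b j \<xi>))" for x \<xi> by (rule Msplit)
    show "1 < C" "0 \<le> \<gamma>" "\<gamma> \<le> 1" using C g by auto
    show tp: "0 < r \<Longrightarrow> r \<le> 1 \<Longrightarrow> 0 < \<theta> r" for r using th by simp
    show "\<exists>d>0. \<forall>r. 0 < r \<and> r < d \<longrightarrow> A * r powr (\<gamma> - 1) \<le> \<theta> r" for A
    proof -
      define A' where "A' = max A 1"
      have "\<forall>\<^sub>F r in at_right 0. 1 / (\<theta> r * r powr (1 - \<gamma>)) < 1 / A'"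
        by (rule order_tendstoD(2)[OF lim]) (simp add: A'_def)
      then obtain d where d: "d > 0" "\<And>r. 0 < r \<Longrightarrow> r < d \<Longrightarrow> 1 / (\<theta> r * r powr (1 - \<gamma>)) < 1 / A'"
        unfolding eventually_at_right_field by auto
      show ?thesis
      proof (intro exI[of _ "min d 1"] conjI allI impI)
        fix r :: real assume r: "0 < r \<and> r < min d 1"
        have t: "\<theta> r > 0" using r tp by simp
        have "1 / (\<theta> r * r powr (1 - \<gamma>)) < 1 / A'" using r d(2) by simp
        then have "A' < \<theta> r * r powr (1 - \<gamma>)" using t r by (simp add: A'_def field_simps)
        then have "A' * r powr (\<gamma> - 1) \<le> \<theta> r * r powr (1 - \<gamma>) * r powr (\<gamma> - 1)"
          using r by (intro mult_right_mono) auto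
        also have "\<dots> = \<theta> r" using r by (simp add: mult.assoc powr_add[symmetric])
        finally have "A' * r powr (\<gamma> - 1) \<le> \<theta> r" .
        moreover have "A * r powr (\<gamma> - 1) \<le> A' * r powr (\<gamma> - 1)" by (intro mult_right_mono) (auto simp: A'_def)
        ultimately show "A * r powr (\<gamma> - 1) \<le> \<theta> r" by linarith
      qed (use d in auto)
    qed
    fix x r j \<xi> \<eta> y
    assume x: "x \<in> \<Omega>" and r: "0 < r" "r \<le> 1" and j: "j < K" and xi: "block_proj b j \<xi> = \<xi>" and eta: "block_proj b j \<eta> = \<eta>" "norm \<eta> = 1"
      and le: "(INF y\<in>ball x r \<inter> \<Omega>. M y (C *\<^sub>R \<xi>)) \<le> (INF y\<in>ball x r \<inter> \<Omega>. M y (\<theta> r *\<^sub>R \<eta>))" and y: "y \<in> ball x r \<inter> \<Omega>"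
    have xs: "\<xi> \<in> block_space b j" "\<eta> \<in> block_space b j" using xi eta bp(4) by blast+
    have "N_minus \<Omega> (Mj j) (ball x r) (C *\<^sub>R \<xi>) \<le> N_minus \<Omega> (Mj j) (ball x r) (\<theta> r *\<^sub>R \<eta>)"
      using le Nf(1)[OF x r(1) j sc[OF xs(1)]] Nf(1)[OF x r(1) j sc[OF xs(2)]] by simp
    also have "\<dots> \<le> (SUP \<eta>\<in>{\<eta> \<in> block_space b j. norm \<eta> = 1}. N_minus \<Omega> (Mj j) (ball x r) (\<theta> r *\<^sub>R \<eta>))"
      by (rule SUP_upper) (use xs eta in auto)
    finally have "N_plus \<Omega> (Mj j) (ball x r) \<xi> \<le> N_minus \<Omega> (Mj j) (ball x r) (C *\<^sub>R \<xi>) + 1"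
      by (intro bal j xs(1)) (use r in auto)
    moreover have "ereal (M x \<xi>) \<le> N_plus \<Omega> (Mj j) (ball x r) \<xi>"
      by (rule Nf(2)[OF x r(1) j xs(1)]) (use x r in auto)
    ultimately have "ereal (M x \<xi>) \<le> ereal (INF y\<in>ball x r \<inter> \<Omega>. M y (C *\<^sub>R \<xi>)) + 1"
      unfolding Nf(1)[OF x r(1) j sc[OF xs(1)]] by (meson order_trans)
    then have "M x \<xi> \<le> (INF y\<in>ball x r \<inter> \<Omega>. M y (C *\<^sub>R \<xi>)) + 1" by (simp add: one_ereal_def)
    also have "(INF y\<in>ball x r \<inter> \<Omega>. M y (C *\<^sub>R \<xi>)) \<le> M y (C *\<^sub>R \<xi>)"
      by (rule cINF_lower[OF _ y]) (use M_nonneg in \<open>auto intro!: bdd_belowI2[of _ 0]\<close>)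
    finally show "M x \<xi> \<le> M y (C *\<^sub>R \<xi>) + 1" by simp
  qed
  then show ?thesis by blast
qed

text \<open>For simple \<open>u\<close> the composition is a finite sum, and continuity in the second argument passes to limits
  of simple functions.\<close>

lemma caratheodory_measurable:
  fixes F :: "'a \<Rightarrow> 'c::euclidean_space \<Rightarrow> real"
  assumes F: "\<And>p. (\<lambda>x. F x p) \<in> borel_measurable N" "\<And>x. x \<in> space N \<Longrightarrow> continuous_on UNIV (F x)"
    and u: "u \<in> borel_measurable N"
  shows "(\<lambda>x. F x (u x)) \<in> borel_measurable N"
proof -
  obtain s where s: "\<And>i. simple_function N (s i)" "\<And>x. x \<in> space N \<Longrightarrow> (\<lambda>i. s i x) \<longlonglongrightarrow> u x"
    using borel_measurable_implies_sequence_metric[OF u, of 0] by blast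
  show ?thesis
  proof (rule borel_measurable_LIMSEQ_real)
    show "(\<lambda>i. F x (s i x)) \<longlonglongrightarrow> F x (u x)" if "x \<in> space N" for x
    proof -
      have "isCont (F x) (u x)" using F(2)[OF that] by (simp add: continuous_on_eq_continuous_at)
      from isCont_tendsto_compose[OF this s(2)[OF that]] show ?thesis .
    qed
    fix i
    have fin: "finite (s i ` space N)" using s(1) by (rule simple_functionD)
    have "(\<lambda>x. \<Sum>a\<in>s i ` space N. indicator (s i -` {a} \<inter> space N) x * F x a) \<in> borel_measurable N"
      using F(1) simple_functionD(2)[OF s(1)]
      by (intro borel_measurable_sum borel_measurable_times borel_measurable_indicator) auto
    moreover have "F x (s i x) = (\<Sum>a\<in>s i ` space N. indicator (s i -` {a} \<inter> space N) x * F x a)" if x: "x \<in> space N" for x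
    proof -
      have "(\<Sum>a\<in>s i ` space N. indicator (s i -` {a} \<inter> space N) x * F x a) = (\<Sum>a\<in>s i ` space N. if a = s i x then F x a else 0)"
        by (rule sum.cong) (use x in \<open>auto simp: indicator_def\<close>)
      then show ?thesis using fin x by simp
    qed
    ultimately show "(\<lambda>x. F x (s i x)) \<in> borel_measurable N"
      by (simp cong: measurable_cong)
  qed
qed

context musielak
begin

lemma M_section_measurable: "(\<lambda>x. M x \<xi>) \<in> borel_measurable (lebesgue_on \<Omega>)"
proof -
  have "(\<lambda>x. M0 x ((\<lambda>_. \<xi>) x)) \<in> borel_measurable borel" by (rule M0_measurable) simp
  then have "(\<lambda>x. M0 x \<xi>) \<in> borel_measurable (lebesgue_on \<Omega>)"
    by (intro measurable_restrict_space1 measurable_completion) simp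
  then show ?thesis by (rule measurable_cong[THEN iffD1, rotated]) (simp add: M0_def)
qed

lemma M_compose_measurable:
  assumes "h \<in> borel_measurable (lebesgue_on \<Omega>)"
  shows "(\<lambda>x. M x (h x)) \<in> borel_measurable (lebesgue_on \<Omega>)"
proof (rule caratheodory_measurable[OF M_section_measurable _ assms])
  fix x assume "x \<in> space (lebesgue_on \<Omega>)"
  then have x: "x \<in> \<Omega>" by simp
  have "continuous_on UNIV (\<lambda>\<xi>. (\<lambda>(x, \<xi>). M x \<xi>) (x, \<xi>))"
    by (rule continuous_on_compose2[OF M_cont]) (use x in \<open>auto intro!: continuous_intros\<close>)
  then show "continuous_on UNIV (M x)" by simp
qed

lemma AE_in_Omega: "AE x in lebesgue_on \<Omega>. x \<in> \<Omega>"
  using open_Omega by (simp add: AE_lebesgue_on_iff)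

lemma modular_mono:
  assumes "AE x in lebesgue_on \<Omega>. x \<in> \<Omega> \<longrightarrow> M x (f x) \<le> M x (g x)"
  shows "modular \<Omega> M f \<le> modular \<Omega> M g"
  unfolding modular_def
proof (rule nn_integral_mono_AE)
  show "AE x in lebesgue_on \<Omega>. ennreal (M x (f x)) \<le> ennreal (M x (g x))"
    using assms AE_in_Omega by eventually_elim (simp add: ennreal_leI)
qed

lemma modular_add:
  assumes [measurable]: "f \<in> borel_measurable (lebesgue_on \<Omega>)" "g \<in> borel_measurable (lebesgue_on \<Omega>)"
  shows "modular \<Omega> M (\<lambda>x. f x + g x) \<le> modular \<Omega> M (\<lambda>x. 2 *\<^sub>R f x) + modular \<Omega> M (\<lambda>x. 2 *\<^sub>R g x)"
proof -
  have [measurable]: "(\<lambda>x. M x (2 *\<^sub>R f x)) \<in> borel_measurable (lebesgue_on \<Omega>)" "(\<lambda>x. M x (2 *\<^sub>R g x)) \<in> borel_measurable (lebesgue_on \<Omega>)"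
    by (intro M_compose_measurable; measurable)+
  have "modular \<Omega> M (\<lambda>x. f x + g x) \<le> (\<integral>\<^sup>+x. ennreal (M x (2 *\<^sub>R f x)) + ennreal (M x (2 *\<^sub>R g x)) \<partial>lebesgue_on \<Omega>)"
    unfolding modular_def
  proof (rule nn_integral_mono_AE)
    show "AE x in lebesgue_on \<Omega>. ennreal (M x (f x + g x)) \<le> ennreal (M x (2 *\<^sub>R f x)) + ennreal (M x (2 *\<^sub>R g x))"
      using AE_in_Omega
    proof eventually_elim
      fix x assume x: "x \<in> \<Omega>"
      have "M x (f x + g x) \<le> M x (2 *\<^sub>R f x) + M x (2 *\<^sub>R g x)"
        using M_add[OF x, of "f x" "g x"] M_nonneg[OF x, of "2 *\<^sub>R f x"] M_nonneg[OF x, of "2 *\<^sub>R g x"] by linarith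
      then show "ennreal (M x (f x + g x)) \<le> ennreal (M x (2 *\<^sub>R f x)) + ennreal (M x (2 *\<^sub>R g x))"
        using M_nonneg[OF x] by (simp flip: ennreal_plus add: ennreal_leI)
    qed
  qed
  also have "\<dots> = modular \<Omega> M (\<lambda>x. 2 *\<^sub>R f x) + modular \<Omega> M (\<lambda>x. 2 *\<^sub>R g x)"
    unfolding modular_def by (rule nn_integral_add) auto
  finally show ?thesis .
qed

lemma modular_scale_mono:
  assumes "\<bar>s\<bar> \<le> t" shows "modular \<Omega> M (\<lambda>x. s *\<^sub>R f x) \<le> modular \<Omega> M (\<lambda>x. t *\<^sub>R f x)"
proof (rule modular_mono, intro AE_I2 impI)
  fix x assume x: "x \<in> \<Omega>"
  have "M x (s *\<^sub>R f x) = M x (\<bar>s\<bar> *\<^sub>R f x)" using M_even[OF x, of "s *\<^sub>R f x"] by (cases "s \<ge> 0") auto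
  also have "\<dots> \<le> M x (t *\<^sub>R f x)" using assms by (intro M_mono_scale[OF x]) auto
  finally show "M x (s *\<^sub>R f x) \<le> M x (t *\<^sub>R f x)" .
qed

lemma modular_bounded:
  assumes "\<And>x. x \<in> \<Omega> \<Longrightarrow> norm (f x) \<le> B" shows "modular \<Omega> M f < \<infinity>"
proof -
  obtain D where D: "\<And>x \<xi>. x \<in> \<Omega> \<Longrightarrow> norm \<xi> \<le> B \<Longrightarrow> M x \<xi> \<le> D" using M_upper[of B] by blast
  have "modular \<Omega> M f \<le> (\<integral>\<^sup>+x. ennreal D \<partial>lebesgue_on \<Omega>)"
    unfolding modular_def
  proof (rule nn_integral_mono_AE)
    show "AE x in lebesgue_on \<Omega>. ennreal (M x (f x)) \<le> ennreal D"
      using AE_in_Omega by eventually_elim (intro ennreal_leI D assms)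
  qed
  also have "\<dots> = ennreal D * emeasure lebesgue \<Omega>"
    using open_Omega by (simp add: emeasure_restrict_space)
  also have "\<dots> < \<infinity>"
    using emeasure_bounded_finite[OF bounded_Omega] open_Omega by (simp add: ennreal_mult_less_top)
  finally show ?thesis .
qed

text \<open>The functions with these two properties form a linear space that contains all functions of finite
  modular.\<close>

lemma L_space_D:
  assumes "\<xi> \<in> L_space \<Omega> M"
  shows "\<xi> \<in> borel_measurable (lebesgue_on \<Omega>)" "\<exists>l>0. modular \<Omega> M (\<lambda>x. \<xi> x /\<^sub>R l) < \<infinity>"
proof -
  define S where "S = {\<xi> \<in> borel_measurable (lebesgue_on \<Omega>). \<exists>l>0. modular \<Omega> M (\<lambda>x. \<xi> x /\<^sub>R l) < \<infinity>}"
  have "is_linear_space S"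
    unfolding is_linear_space_def
  proof (intro conjI ballI allI)
    show "(\<lambda>x. 0) \<in> S" unfolding S_def
      using modular_bounded[of "\<lambda>x. 0 /\<^sub>R 1" 0] by (auto intro!: exI[of _ 1])
    fix f assume f: "f \<in> S"
    then obtain l where l: "l > 0" "modular \<Omega> M (\<lambda>x. f x /\<^sub>R l) < \<infinity>" and fm [measurable]: "f \<in> borel_measurable (lebesgue_on \<Omega>)"
      by (auto simp: S_def)
    {
      fix g assume g: "g \<in> S"
      then obtain k where k: "k > 0" "modular \<Omega> M (\<lambda>x. g x /\<^sub>R k) < \<infinity>" and gm [measurable]: "g \<in> borel_measurable (lebesgue_on \<Omega>)"
        by (auto simp: S_def)
      define m where "m = 2 * max l k"
      have m: "m > 0" using l by (simp add: m_def)
      have le: "\<bar>2 * inverse m\<bar> \<le> inverse l" "\<bar>2 * inverse m\<bar> \<le> inverse k"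
        using l k by (auto simp: m_def field_simps max_def)
      have "modular \<Omega> M (\<lambda>x. (f x + g x) /\<^sub>R m) = modular \<Omega> M (\<lambda>x. inverse m *\<^sub>R f x + inverse m *\<^sub>R g x)"
        by (simp add: scaleR_add_right)
      also have "\<dots> \<le> modular \<Omega> M (\<lambda>x. 2 *\<^sub>R inverse m *\<^sub>R f x) + modular \<Omega> M (\<lambda>x. 2 *\<^sub>R inverse m *\<^sub>R g x)"
        by (rule modular_add) measurable
      also have "\<dots> \<le> modular \<Omega> M (\<lambda>x. f x /\<^sub>R l) + modular \<Omega> M (\<lambda>x. g x /\<^sub>R k)"
        using modular_scale_mono[OF le(1), of f] modular_scale_mono[OF le(2), of g] by (intro add_mono) auto
      also have "\<dots> < \<infinity>" using l(2) k(2) by simp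
      finally show "(\<lambda>x. f x + g x) \<in> S" using m by (auto simp: S_def)
    }
    fix c :: real
    have le: "\<bar>inverse (l * (\<bar>c\<bar> + 1)) * c\<bar> \<le> inverse l"
    proof -
      have "\<bar>c\<bar> / (\<bar>c\<bar> + 1) \<le> 1" by (simp add: divide_le_eq add_nonneg_pos)
      then have "inverse l * (\<bar>c\<bar> / (\<bar>c\<bar> + 1)) \<le> inverse l * 1" using l(1) by (intro mult_left_mono) auto
      then show ?thesis using l(1) by (simp add: abs_mult divide_inverse mult_ac)
    qed
    have "modular \<Omega> M (\<lambda>x. (c *\<^sub>R f x) /\<^sub>R (l * (\<bar>c\<bar> + 1))) \<le> modular \<Omega> M (\<lambda>x. f x /\<^sub>R l)"
      using modular_scale_mono[OF le, of f] by simp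
    also have "\<dots> < \<infinity>" by (rule l(2))
    finally show "(\<lambda>x. c *\<^sub>R f x) \<in> S" using l(1) by (auto simp: S_def intro!: exI[of _ "l * (\<bar>c\<bar> + 1)"])
  qed
  moreover have "{\<xi> \<in> borel_measurable (lebesgue_on \<Omega>). modular \<Omega> M \<xi> < \<infinity>} \<subseteq> S"
    by (auto simp: S_def intro!: exI[of _ 1])
  ultimately have "\<xi> \<in> S" using assms unfolding L_space_def by blast
  then show "\<xi> \<in> borel_measurable (lebesgue_on \<Omega>)" "\<exists>l>0. modular \<Omega> M (\<lambda>x. \<xi> x /\<^sub>R l) < \<infinity>"
    by (auto simp: S_def)
qed

lemma L_space_diff:
  assumes "f \<in> L_space \<Omega> M" "g \<in> L_space \<Omega> M" shows "(\<lambda>x. f x - g x) \<in> L_space \<Omega> M"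
  unfolding L_space_def
proof (intro InterI)
  fix S assume S: "S \<in> {S. is_linear_space S \<and> {\<xi> \<in> borel_measurable (lebesgue_on \<Omega>). modular \<Omega> M \<xi> < \<infinity>} \<subseteq> S}"
  then have fg: "f \<in> S" "g \<in> S" and l: "is_linear_space S" using assms unfolding L_space_def by auto
  then have "(\<lambda>x. (-1) *\<^sub>R g x) \<in> S" unfolding is_linear_space_def by blast
  from l[unfolded is_linear_space_def, THEN conjunct2, THEN conjunct1, rule_format, OF fg(1) this]
  have "(\<lambda>x. f x + (-1) *\<^sub>R g x) \<in> S" .
  then show "(\<lambda>x. f x - g x) \<in> S" by simp
qed

text \<open>A bounded function has finite modular, and an element of \<open>E_space\<close> differs from a bounded function by
  one whose modular is at most \<open>1\<close> even after multiplication by \<open>2 s\<close>. Here \<open>L_space\<close> matters: it guarantees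
  that the set in the definition of the Luxemburg norm is nonempty.\<close>

lemma E_space_D:
  assumes "\<xi> \<in> E_space \<Omega> M"
  shows "\<xi> \<in> borel_measurable (lebesgue_on \<Omega>)" "modular \<Omega> M (\<lambda>x. s *\<^sub>R \<xi> x) < \<infinity>"
proof -
  have xL: "\<xi> \<in> L_space \<Omega> M" using assms by (simp add: E_space_def)
  show [measurable]: "\<xi> \<in> borel_measurable (lebesgue_on \<Omega>)" by (rule L_space_D(1)[OF xL])
  define e where "e = 1 / (2 * (\<bar>s\<bar> + 1))"
  have e: "e > 0" by (simp add: e_def add_nonneg_pos)
  then obtain z where z: "z \<in> L_space \<Omega> M" "bounded (z ` \<Omega>)" "luxemburg_norm \<Omega> M (\<lambda>x. \<xi> x - z x) < e"
    using assms unfolding E_space_def by blast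
  have [measurable]: "z \<in> borel_measurable (lebesgue_on \<Omega>)" by (rule L_space_D(1)[OF z(1)])
  let ?L = "{l. l > 0 \<and> modular \<Omega> M (\<lambda>x. (\<xi> x - z x) /\<^sub>R l) \<le> 1}"
  obtain l0 where l0: "l0 > 0" "modular \<Omega> M (\<lambda>x. (\<xi> x - z x) /\<^sub>R l0) < \<infinity>"
    using L_space_D(2)[OF L_space_diff[OF xL z(1)]] by blast
  have "?L \<noteq> {}"
  proof -
    obtain m where m: "m \<ge> 0" "modular \<Omega> M (\<lambda>x. (\<xi> x - z x) /\<^sub>R l0) = ennreal m"
      using l0(2) by (cases "modular \<Omega> M (\<lambda>x. (\<xi> x - z x) /\<^sub>R l0)") auto
    define t where "t = max m 1"
    have t: "t \<ge> 1" "t \<ge> m" by (auto simp: t_def)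
    have mm [measurable]: "(\<lambda>x. M x ((\<xi> x - z x) /\<^sub>R l0)) \<in> borel_measurable (lebesgue_on \<Omega>)"
      by (rule M_compose_measurable) measurable
    have "modular \<Omega> M (\<lambda>x. (\<xi> x - z x) /\<^sub>R (t * l0)) \<le> (\<integral>\<^sup>+x. ennreal (1 / t) * ennreal (M x ((\<xi> x - z x) /\<^sub>R l0)) \<partial>lebesgue_on \<Omega>)"
      unfolding modular_def
    proof (rule nn_integral_mono_AE)
      show "AE x in lebesgue_on \<Omega>. ennreal (M x ((\<xi> x - z x) /\<^sub>R (t * l0))) \<le> ennreal (1 / t) * ennreal (M x ((\<xi> x - z x) /\<^sub>R l0))"
        using AE_in_Omega
      proof eventually_elim
        fix x assume x: "x \<in> \<Omega>"
        have "M x ((1 / t) *\<^sub>R ((\<xi> x - z x) /\<^sub>R l0)) \<le> (1 / t) * M x ((\<xi> x - z x) /\<^sub>R l0)"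
          using t by (intro M_scale[OF x]) auto
        moreover have "(\<xi> x - z x) /\<^sub>R (t * l0) = (1 / t) *\<^sub>R ((\<xi> x - z x) /\<^sub>R l0)" by (simp add: inverse_eq_divide)
        ultimately have "M x ((\<xi> x - z x) /\<^sub>R (t * l0)) \<le> (1 / t) * M x ((\<xi> x - z x) /\<^sub>R l0)" by metis
        from ennreal_leI[OF this]
        show "ennreal (M x ((\<xi> x - z x) /\<^sub>R (t * l0))) \<le> ennreal (1 / t) * ennreal (M x ((\<xi> x - z x) /\<^sub>R l0))"
          using t M_nonneg[OF x] by (subst ennreal_mult[symmetric]) auto
      qed
    qed
    also have "\<dots> = ennreal (1 / t) * modular \<Omega> M (\<lambda>x. (\<xi> x - z x) /\<^sub>R l0)"
      unfolding modular_def by (rule nn_integral_cmult) simp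
    also have "\<dots> = ennreal (1 / t * m)" unfolding m(2) using t by (intro ennreal_mult[symmetric] m(1)) auto
    also have "\<dots> \<le> 1" using t by (simp add: ennreal_le_1)
    finally have "t * l0 \<in> ?L" using t l0(1) by simp
    then show ?thesis by blast
  qed
  moreover have "bdd_below ?L" by (intro bdd_belowI[of _ 0]) auto
  ultimately obtain l where l: "l > 0" "modular \<Omega> M (\<lambda>x. (\<xi> x - z x) /\<^sub>R l) \<le> 1" "l < e"
    using z(3) unfolding luxemburg_norm_def by (subst (asm) cInf_less_iff) auto
  obtain B where B: "\<And>x. x \<in> \<Omega> \<Longrightarrow> norm (z x) \<le> B" using z(2) by (auto simp: bounded_iff)
  have le: "\<bar>2 * s\<bar> \<le> inverse l"
  proof -
    have "\<bar>2 * s\<bar> \<le> inverse e" by (simp add: e_def)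
    also have "\<dots> \<le> inverse l" using l(1,3) by (intro le_imp_inverse_le) auto
    finally show ?thesis .
  qed
  have "modular \<Omega> M (\<lambda>x. s *\<^sub>R \<xi> x) = modular \<Omega> M (\<lambda>x. s *\<^sub>R (\<xi> x - z x) + s *\<^sub>R z x)"
    by (simp add: scaleR_diff_right)
  also have "\<dots> \<le> modular \<Omega> M (\<lambda>x. 2 *\<^sub>R s *\<^sub>R (\<xi> x - z x)) + modular \<Omega> M (\<lambda>x. 2 *\<^sub>R s *\<^sub>R z x)"
    by (rule modular_add) measurable
  also have "modular \<Omega> M (\<lambda>x. 2 *\<^sub>R s *\<^sub>R (\<xi> x - z x)) \<le> 1"
    using order_trans[OF modular_scale_mono[OF le, of "\<lambda>x. \<xi> x - z x"] l(2)] by simp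
  finally have "modular \<Omega> M (\<lambda>x. s *\<^sub>R \<xi> x) \<le> 1 + modular \<Omega> M (\<lambda>x. 2 *\<^sub>R s *\<^sub>R z x)" by (simp add: add_right_mono)
  also have "\<dots> < \<infinity>"
  proof -
    have "modular \<Omega> M (\<lambda>x. 2 *\<^sub>R s *\<^sub>R z x) < \<infinity>"
    proof (rule modular_bounded)
      show "norm (2 *\<^sub>R s *\<^sub>R z x) \<le> 2 * \<bar>s\<bar> * B" if "x \<in> \<Omega>" for x
        using mult_left_mono[OF B[OF that], of "2 * \<bar>s\<bar>"] by (simp add: mult.assoc)
    qed
    then show ?thesis by simp
  qed
  finally show "modular \<Omega> M (\<lambda>x. s *\<^sub>R \<xi> x) < \<infinity>" .
qed

lemma bounded_E_space:
  assumes f [measurable]: "f \<in> borel_measurable (lebesgue_on \<Omega>)" and B: "AE x in lebesgue_on \<Omega>. norm (f x) \<le> B" "B \<ge> 0"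
  shows "f \<in> E_space \<Omega> M"
proof -
  define z where "z x = (if norm (f x) \<le> B then f x else 0)" for x
  have zm [measurable]: "z \<in> borel_measurable (lebesgue_on \<Omega>)" unfolding z_def[abs_def] by measurable
  have zb: "norm (z x) \<le> B" for x using B(2) by (simp add: z_def)
  have fz: "AE x in lebesgue_on \<Omega>. f x = z x" using B(1) by eventually_elim (simp add: z_def)
  have LI: "h \<in> L_space \<Omega> M" if "h \<in> borel_measurable (lebesgue_on \<Omega>)" "modular \<Omega> M h < \<infinity>" for h
    using that unfolding L_space_def by blast
  have zfin: "modular \<Omega> M z < \<infinity>" by (rule modular_bounded[of _ B]) (rule zb)
  have "modular \<Omega> M f \<le> modular \<Omega> M z" by (rule modular_mono) (use fz in \<open>auto elim: eventually_mono\<close>)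
  then have fL: "f \<in> L_space \<Omega> M" using zfin by (intro LI f) (rule order_le_less_trans)
  have zL: "z \<in> L_space \<Omega> M" by (rule LI[OF zm zfin])
  have "modular \<Omega> M (\<lambda>x. (f x - z x) /\<^sub>R l) \<le> 1" for l
  proof -
    have "modular \<Omega> M (\<lambda>x. (f x - z x) /\<^sub>R l) \<le> modular \<Omega> M (\<lambda>x. 0)"
      by (rule modular_mono) (use fz in \<open>auto elim: eventually_mono\<close>)
    also have "\<dots> \<le> (\<integral>\<^sup>+x. 0 \<partial>lebesgue_on \<Omega>)"
      unfolding modular_def by (rule nn_integral_mono_AE) (use AE_in_Omega in eventually_elim, simp add: M_zero)
    finally show ?thesis by (simp add: order_trans)
  qed
  then have L: "{l. l > 0 \<and> modular \<Omega> M (\<lambda>x. (f x - z x) /\<^sub>R l) \<le> 1} = {0<..}" by auto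
  have "luxemburg_norm \<Omega> M (\<lambda>x. f x - z x) < e" if "e > 0" for e
    unfolding luxemburg_norm_def L using that by simp
  moreover have "bounded (z ` \<Omega>)" using zb by (auto simp: bounded_iff)
  ultimately show ?thesis unfolding E_space_def using fL zL by blast
qed

lemma test_functions_V1E_0:
  assumes p: "\<phi> \<in> test_functions \<Omega>" shows "\<phi> \<in> V1E_0 \<Omega> M"
proof -
  obtain B where B: "B \<ge> 0" "\<And>x. norm (grad \<phi> x) \<le> B" using C1c_bounded[OF test_functionsD(4)[OF p]] by metis
  note wg = weak_gradient_AE[OF open_Omega test_functions_weak_gradient[OF open_Omega p]]
  have "\<phi> \<in> W11 \<Omega>" using test_functions_W11_0[OF open_Omega p] by (simp add: W11_0_def)
  from W11_weak_gradient(3)[OF open_Omega this]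
  have "weak_gradient \<Omega> \<phi> \<in> borel_measurable (lebesgue_on \<Omega>)" by (rule borel_measurable_integrable)
  moreover have "AE x in lebesgue_on \<Omega>. norm (weak_gradient \<Omega> \<phi> x) \<le> B"
    using wg(2) by eventually_elim (simp add: B)
  ultimately have "weak_gradient \<Omega> \<phi> \<in> E_space \<Omega> M" using B(1) by (rule bounded_E_space)
  then show ?thesis using test_functions_W11_0[OF open_Omega p] by (simp add: V1E_0_def)
qed

lemma test_functions_holder:
  assumes p: "\<phi> \<in> test_functions \<Omega>" and g: "0 < \<gamma>" "\<gamma> \<le> 1" shows "\<phi> \<in> holder_space \<gamma> \<Omega>"
proof -
  obtain B where B: "B \<ge> 0" "\<And>x. norm (grad \<phi> x) \<le> B" using C1c_bounded[OF test_functionsD(4)[OF p]] by metis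
  have c1: "C1_grad \<phi> (grad \<phi>)" using test_functionsD(4)[OF p] by (simp add: C1c_def)
  obtain R where R: "\<And>x. x \<in> \<Omega> \<Longrightarrow> norm x \<le> R" using bounded_Omega by (auto simp: bounded_iff)
  have "\<bar>\<phi> x - \<phi> y\<bar> / dist x y powr \<gamma> \<le> B * (2 * R) powr (1 - \<gamma>)" if xy: "x \<in> \<Omega>" "y \<in> \<Omega>" "x \<noteq> y" for x y
  proof -
    have d: "dist x y > 0" using xy by simp
    have d2: "dist x y \<le> 2 * R" using R[OF xy(1)] R[OF xy(2)] norm_triangle_ineq4[of x y] by (simp add: dist_norm)
    have "\<bar>\<phi> x - \<phi> y\<bar> \<le> B * dist x y" using C1_grad_lipschitz[OF c1 B(2)] by (simp add: dist_norm)
    also have "dist x y = dist x y powr \<gamma> * dist x y powr (1 - \<gamma>)" using d by (simp add: powr_add[symmetric])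
    also have "B * \<dots> \<le> B * (dist x y powr \<gamma> * (2 * R) powr (1 - \<gamma>))"
      using B(1) d d2 g by (intro mult_left_mono powr_mono2) auto
    finally show ?thesis using d by (simp add: divide_le_eq mult_ac)
  qed
  then show ?thesis unfolding holder_space_def mem_Collect_eq
    by (intro bdd_aboveI[of _ "B * (2 * R) powr (1 - \<gamma>)"]) blast
qed

lemma modular_eq_modular0:
  assumes "AE x in lebesgue_on \<Omega>. f x = h x"
  shows "modular \<Omega> M f = modular0 h"
proof -
  have s: "\<Omega> \<inter> space lebesgue \<in> sets lebesgue" using open_Omega by simp
  have "modular \<Omega> M f = (\<integral>\<^sup>+x. ennreal (M0 x (h x)) \<partial>lebesgue_on \<Omega>)"
    unfolding modular_def by (rule nn_integral_cong_AE) (use assms AE_in_Omega in \<open>eventually_elim, simp add: M0_def\<close>)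
  also have "\<dots> = (\<integral>\<^sup>+x. ennreal (M0 x (h x)) * indicator \<Omega> x \<partial>lebesgue)"
    by (rule nn_integral_restrict_space[OF s])
  also have "(\<lambda>x. ennreal (M0 x (h x)) * indicator \<Omega> x) = (\<lambda>x. ennreal (M0 x (h x)))"
    by (auto simp: M0_def indicator_def)
  finally show ?thesis by (simp add: modular0_def nn_integral_completion)
qed

lemma nn_integral_transfer:
  fixes f h :: "'a \<Rightarrow> 'b::euclidean_space"
  assumes "AE x in lebesgue_on \<Omega>. f x = h x" "h \<in> borel_measurable borel" "\<And>x. x \<notin> \<Omega> \<Longrightarrow> h x = 0"
  shows "(\<integral>\<^sup>+x. ennreal (norm (f x)) \<partial>lebesgue_on \<Omega>) = (\<integral>\<^sup>+x. ennreal (norm (h x)) \<partial>lborel)"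
proof -
  have "(\<integral>\<^sup>+x. ennreal (norm (f x)) \<partial>lebesgue_on \<Omega>) = (\<integral>\<^sup>+x. ennreal (norm (h x)) \<partial>lebesgue_on \<Omega>)"
    by (rule nn_integral_cong_AE) (use assms(1) in \<open>eventually_elim, simp\<close>)
  then show ?thesis using lebesgue_on_borel_transfer(3)[OF open_Omega assms(2,3)] by simp
qed

end

section \<open>Equality of the infima\<close>

lemma weak_gradient_add_AE:
  assumes \<Omega>: "open \<Omega>" and u: "has_weak_gradient \<Omega> u gu" and v: "has_weak_gradient \<Omega> v gv"
  shows "AE x in lebesgue_on \<Omega>. weak_gradient \<Omega> (\<lambda>x. u x + v x) x = gu x + gv x"
  using weak_gradient_AE(2)[OF \<Omega> has_weak_gradient_add[OF \<Omega> u v, of 1]] by simp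

lemma energy_nonneg_integrand:
  assumes \<Omega>: "open \<Omega>" and F: "\<And>x z \<xi>. x \<in> \<Omega> \<Longrightarrow> 0 \<le> F x z \<xi>"
    and g: "AE x in lebesgue_on \<Omega>. weak_gradient \<Omega> u x = g x"
  shows "energy \<Omega> F u = enn2ereal (\<integral>\<^sup>+x. ennreal (F x (u x) (g x)) \<partial>lebesgue_on \<Omega>)"
proof -
  have inO: "AE x in lebesgue_on \<Omega>. x \<in> \<Omega>" using \<Omega> by (simp add: AE_lebesgue_on_iff)
  have 1: "(\<integral>\<^sup>+x. ennreal (F x (u x) (weak_gradient \<Omega> u x)) \<partial>lebesgue_on \<Omega>) = (\<integral>\<^sup>+x. ennreal (F x (u x) (g x)) \<partial>lebesgue_on \<Omega>)"
    by (rule nn_integral_cong_AE) (use g in \<open>eventually_elim, simp\<close>)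
  have "(\<integral>\<^sup>+x. ennreal (- F x (u x) (weak_gradient \<Omega> u x)) \<partial>lebesgue_on \<Omega>) = (\<integral>\<^sup>+x. 0 \<partial>lebesgue_on \<Omega>)"
    by (rule nn_integral_cong_AE) (use inO in \<open>eventually_elim, simp add: ennreal_neg F\<close>)
  then show ?thesis unfolding energy_def 1 by (simp add: zero_ennreal.rep_eq)
qed

context musielak
begin

text \<open>The test functions \<open>\<phi> n\<close> approximate \<open>v\<close> with multiplier \<open>2\<close>. Writing \<open>G\<close> for the gradient of the limit, convexity
  gives \<open>M(x, G + d) \<le> M(x, 2 G) / 2 + M(x, 2 d) / 2\<close>. The first term is integrable as both gradients are in
  \<open>E_space\<close>, and for \<open>d\<close> the error of the gradients the second term vanishes in the mean.\<close>

lemma energy_recovery: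
  fixes F :: "'a \<Rightarrow> real \<Rightarrow> 'a \<Rightarrow> real"
  assumes Fm: "\<And>z \<xi>. (\<lambda>x. F x z \<xi>) \<in> borel_measurable (lebesgue_on \<Omega>)"
    and Fc: "\<And>x. x \<in> \<Omega> \<Longrightarrow> continuous_on UNIV (\<lambda>(z, \<xi>). F x z \<xi>)"
    and F0: "\<And>x z \<xi>. x \<in> \<Omega> \<Longrightarrow> 0 \<le> F x z \<xi>"
    and FL: "\<And>x z \<xi>. x \<in> \<Omega> \<Longrightarrow> F x z \<xi> \<le> L * (M x \<xi> + 1)" and L: "L > 0"
    and u0: "u0 \<in> V1E \<Omega> M" and v: "v \<in> V1E_0 \<Omega> M"
    and w: "w \<in> borel_measurable borel" "\<And>x. x \<notin> \<Omega> \<Longrightarrow> w x = 0" "AE x in lebesgue_on \<Omega>. v x = w x"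
    and g: "g \<in> borel_measurable borel" "\<And>x. x \<notin> \<Omega> \<Longrightarrow> g x = 0" "AE x in lebesgue_on \<Omega>. weak_gradient \<Omega> v x = g x"
    and a: "approximable w g"
  shows "(INF u\<in>translate u0 (test_functions \<Omega>). energy \<Omega> F u) \<le> energy \<Omega> F (\<lambda>x. u0 x + v x)"
proof -
  let ?N = "lebesgue_on \<Omega>"
  have u0W: "u0 \<in> W11 \<Omega>" and u0E: "weak_gradient \<Omega> u0 \<in> E_space \<Omega> M" using u0 by (auto simp: V1E_def)
  have vW: "v \<in> W11 \<Omega>" and vE: "weak_gradient \<Omega> v \<in> E_space \<Omega> M" using v by (auto simp: V1E_0_def W11_0_def)
  note wu = W11_weak_gradient[OF open_Omega u0W] and wv = W11_weak_gradient[OF open_Omega vW]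
  let ?G0 = "weak_gradient \<Omega> u0" and ?Gv = "weak_gradient \<Omega> v"
  have [measurable]: "u0 \<in> borel_measurable ?N" "v \<in> borel_measurable ?N" "?G0 \<in> borel_measurable ?N" "?Gv \<in> borel_measurable ?N"
    using wu(2,3) wv(2,3) by auto
  have [measurable]: "w \<in> borel_measurable ?N" "g \<in> borel_measurable ?N"
    using w(1) g(1) by (auto intro!: measurable_restrict_space1 measurable_completion)
  define G where "G x = ?G0 x + ?Gv x" for x
  have Gm [measurable]: "G \<in> borel_measurable ?N" unfolding G_def[abs_def] by measurable
  have "\<forall>n. \<exists>\<phi>. \<phi> \<in> test_functions \<Omega> \<and>
     (\<integral>\<^sup>+x. ennreal \<bar>\<phi> x - w x\<bar> \<partial>lborel) \<le> ennreal (inverse (real (Suc n))) \<and>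
     (\<integral>\<^sup>+x. ennreal (norm (grad \<phi> x - g x)) \<partial>lborel) \<le> ennreal (inverse (real (Suc n))) \<and>
     modular0 (\<lambda>x. 2 *\<^sub>R (grad \<phi> x - g x)) \<le> ennreal (inverse (real (Suc n)))"
    using a unfolding approximable_def Bex_def by (intro allI) simp
  from choice[OF this] obtain \<phi> where \<phi>: "\<And>n. \<phi> n \<in> test_functions \<Omega>"
     "\<And>n. (\<integral>\<^sup>+x. ennreal \<bar>\<phi> n x - w x\<bar> \<partial>lborel) \<le> ennreal (inverse (real (Suc n)))"
     "\<And>n. (\<integral>\<^sup>+x. ennreal (norm (grad (\<phi> n) x - g x)) \<partial>lborel) \<le> ennreal (inverse (real (Suc n)))"
     "\<And>n. modular0 (\<lambda>x. 2 *\<^sub>R (grad (\<phi> n) x - g x)) \<le> ennreal (inverse (real (Suc n)))" by blast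
  note t = test_functionsD[OF \<phi>(1)]
  note tb = test_borel[OF \<phi>(1)]
  have [measurable]: "\<phi> n \<in> borel_measurable ?N" "grad (\<phi> n) \<in> borel_measurable ?N" for n
    using tb by (auto intro!: measurable_restrict_space1 measurable_completion)
  have dw: "(\<integral>\<^sup>+x. ennreal (norm (\<phi> n x - v x)) \<partial>?N) \<le> ennreal (inverse (real (Suc n)))" for n
  proof -
    have "(\<integral>\<^sup>+x. ennreal (norm (\<phi> n x - v x)) \<partial>?N) = (\<integral>\<^sup>+x. ennreal (norm (\<phi> n x - w x)) \<partial>lborel)"
    proof (rule nn_integral_transfer)
      show "AE x in ?N. \<phi> n x - v x = \<phi> n x - w x" using w(3) by eventually_elim simp
    qed (use tb w t(5) in auto)
    then show ?thesis using \<phi>(2) by simp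
  qed
  have dg: "(\<integral>\<^sup>+x. ennreal (norm (grad (\<phi> n) x - ?Gv x)) \<partial>?N) \<le> ennreal (inverse (real (Suc n)))" for n
  proof -
    have "(\<integral>\<^sup>+x. ennreal (norm (grad (\<phi> n) x - ?Gv x)) \<partial>?N) = (\<integral>\<^sup>+x. ennreal (norm (grad (\<phi> n) x - g x)) \<partial>lborel)"
    proof (rule nn_integral_transfer)
      show "AE x in ?N. grad (\<phi> n) x - ?Gv x = grad (\<phi> n) x - g x" using g(3) by eventually_elim simp
    qed (use tb g t(6) in auto)
    then show ?thesis using \<phi>(3) by simp
  qed
  have dM: "modular \<Omega> M (\<lambda>x. 2 *\<^sub>R (grad (\<phi> n) x - ?Gv x)) \<le> ennreal (inverse (real (Suc n)))" for n
  proof -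
    have "modular \<Omega> M (\<lambda>x. 2 *\<^sub>R (grad (\<phi> n) x - ?Gv x)) = modular0 (\<lambda>x. 2 *\<^sub>R (grad (\<phi> n) x - g x))"
      by (rule modular_eq_modular0) (use g(3) in \<open>eventually_elim, simp\<close>)
    then show ?thesis using \<phi>(4) by simp
  qed
  have m1: "(\<lambda>x. \<phi> n x - v x) \<in> borel_measurable ?N" and m2: "(\<lambda>x. grad (\<phi> n) x - ?Gv x) \<in> borel_measurable ?N" for n
    by measurable
  obtain r1 :: "nat \<Rightarrow> nat" where r1: "strict_mono r1" "AE x in ?N. (\<lambda>n. \<phi> (r1 n) x - v x) \<longlonglongrightarrow> 0"
    using tendsto_L1_AE_subseq[OF L1_rate[OF m1 dw]] by blast
  have "(\<lambda>n. LINT x|?N. norm (grad (\<phi> (r1 n)) x - ?Gv x)) \<longlonglongrightarrow> 0"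
    using LIMSEQ_subseq_LIMSEQ[OF L1_rate(2)[OF m2 dg] r1(1)] by (simp add: o_def)
  from tendsto_L1_AE_subseq[OF L1_rate(1)[OF m2 dg] this]
  obtain r2 :: "nat \<Rightarrow> nat" where r2: "strict_mono r2" "AE x in ?N. (\<lambda>n. grad (\<phi> (r1 (r2 n))) x - ?Gv x) \<longlonglongrightarrow> 0"
    by blast
  define r where "r n = r1 (r2 n)" for n
  have rm: "strict_mono r" using strict_mono_o[OF r1(1) r2(1)] by (simp add: r_def[abs_def] o_def)
  have lim1: "AE x in ?N. (\<lambda>n. \<phi> (r n) x - v x) \<longlonglongrightarrow> 0"
    using r1(2) by eventually_elim (use LIMSEQ_subseq_LIMSEQ[OF _ r2(1)] in \<open>force simp: r_def o_def\<close>)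
  have lim2: "AE x in ?N. (\<lambda>n. grad (\<phi> (r n)) x - ?Gv x) \<longlonglongrightarrow> 0" using r2(2) by (simp add: r_def)
  define FF where "FF z h x = ennreal (F x (z x) (h x))" for z :: "'a \<Rightarrow> real" and h :: "'a \<Rightarrow> 'a" and x
  have FFm: "FF z h \<in> borel_measurable ?N" if [measurable]: "z \<in> borel_measurable ?N" "h \<in> borel_measurable ?N" for z h
  proof -
    have "(\<lambda>x. (\<lambda>x p. case p of (z, \<xi>) \<Rightarrow> F x z \<xi>) x (z x, h x)) \<in> borel_measurable ?N"
    proof (rule caratheodory_measurable[where F="\<lambda>x p. case p of (z, \<xi>) \<Rightarrow> F x z \<xi>" and u="\<lambda>x. (z x, h x)"])
      show "(\<lambda>x. case p of (z, \<xi>) \<Rightarrow> F x z \<xi>) \<in> borel_measurable ?N" for p :: "real \<times> 'a"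
        using Fm by (cases p) simp
      show "continuous_on UNIV (\<lambda>(z, \<xi>). F x z \<xi>)" if "x \<in> space ?N" for x using Fc that by simp
      show "(\<lambda>x. (z x, h x)) \<in> borel_measurable ?N" by measurable
    qed
    then show ?thesis unfolding FF_def[abs_def] by simp
  qed
  define u where "u n x = u0 x + \<phi> (r n) x" for n x
  define gu where "gu n x = ?G0 x + grad (\<phi> (r n)) x" for n x
  have en: "energy \<Omega> F (u n) = enn2ereal (\<integral>\<^sup>+x. FF (u n) (gu n) x \<partial>?N)" for n
    unfolding FF_def u_def[abs_def] gu_def[abs_def]
    by (rule energy_nonneg_integrand[OF open_Omega F0 weak_gradient_add_AE[OF open_Omega wu(1) test_functions_weak_gradient[OF open_Omega \<phi>(1)]]])
  have ev: "energy \<Omega> F (\<lambda>x. u0 x + v x) = enn2ereal (\<integral>\<^sup>+x. FF (\<lambda>x. u0 x + v x) G x \<partial>?N)"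
    unfolding FF_def G_def[abs_def]
    by (rule energy_nonneg_integrand[OF open_Omega F0 weak_gradient_add_AE[OF open_Omega wu(1) wv(1)]])
  let ?H = "\<lambda>x. ennreal (L * (M x (2 *\<^sub>R G x) / 2 + 1))"
  let ?E = "\<lambda>n x. ennreal (L / 2) * ennreal (M x (2 *\<^sub>R (grad (\<phi> (r n)) x - ?Gv x)))"
  have M2m [measurable]: "(\<lambda>x. M x (2 *\<^sub>R G x)) \<in> borel_measurable ?N"
    "(\<lambda>x. M x (2 *\<^sub>R (grad (\<phi> n) x - ?Gv x))) \<in> borel_measurable ?N" for n
    by (rule M_compose_measurable; measurable)+
  have Efin: "(\<integral>\<^sup>+x. ?E n x \<partial>?N) \<le> ennreal (L / 2) * ennreal (inverse (real (Suc (r n))))" for n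
  proof -
    have "(\<integral>\<^sup>+x. ?E n x \<partial>?N) = ennreal (L / 2) * modular \<Omega> M (\<lambda>x. 2 *\<^sub>R (grad (\<phi> (r n)) x - ?Gv x))"
      unfolding modular_def by (rule nn_integral_cmult) simp
    then show ?thesis using dM[of "r n"] by (simp add: mult_left_mono)
  qed
  have inv0: "(\<lambda>n. ennreal (inverse (real (Suc (r n))))) \<longlonglongrightarrow> 0"
    using LIMSEQ_subseq_LIMSEQ[OF tendsto_ennrealI[OF LIMSEQ_inverse_real_of_nat] rm] by (simp add: o_def)
  have E0: "(\<lambda>n. \<integral>\<^sup>+x. ?E n x \<partial>?N) \<longlonglongrightarrow> 0"
  proof (rule tendsto_sandwich[OF always_eventually always_eventually tendsto_const])
    show "(\<lambda>n. ennreal (L / 2) * ennreal (inverse (real (Suc (r n))))) \<longlonglongrightarrow> 0"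
      using ennreal_tendsto_cmult[OF _ inv0, of "ennreal (L / 2)"] by simp
  qed (use Efin in auto)
  have Hfin: "(\<integral>\<^sup>+x. ?H x \<partial>?N) < \<infinity>"
  proof -
    have 1: "modular \<Omega> M (\<lambda>x. 2 *\<^sub>R G x) < \<infinity>"
    proof -
      have "modular \<Omega> M (\<lambda>x. 2 *\<^sub>R G x) = modular \<Omega> M (\<lambda>x. 2 *\<^sub>R ?G0 x + 2 *\<^sub>R ?Gv x)" by (simp add: G_def scaleR_add_right)
      also have "\<dots> \<le> modular \<Omega> M (\<lambda>x. 2 *\<^sub>R 2 *\<^sub>R ?G0 x) + modular \<Omega> M (\<lambda>x. 2 *\<^sub>R 2 *\<^sub>R ?Gv x)"
        by (rule modular_add) measurable
      also have "\<dots> < \<infinity>" using E_space_D(2)[OF u0E, of 4] E_space_D(2)[OF vE, of 4] by simp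
      finally show ?thesis .
    qed
    have "(\<integral>\<^sup>+x. ?H x \<partial>?N) = (\<integral>\<^sup>+x. ennreal (L / 2) * ennreal (M x (2 *\<^sub>R G x)) + ennreal L \<partial>?N)"
    proof (rule nn_integral_cong_AE)
      show "AE x in ?N. ?H x = ennreal (L / 2) * ennreal (M x (2 *\<^sub>R G x)) + ennreal L"
        using AE_in_Omega
      proof eventually_elim
        fix x assume x: "x \<in> \<Omega>"
        have "ennreal (L / 2) * ennreal (M x (2 *\<^sub>R G x)) + ennreal L = ennreal (L / 2 * M x (2 *\<^sub>R G x) + L)"
          using L M_nonneg[OF x] by (simp add: ennreal_mult[symmetric] ennreal_plus[symmetric] del: ennreal_plus)
        then show "?H x = ennreal (L / 2) * ennreal (M x (2 *\<^sub>R G x)) + ennreal L" by (simp add: algebra_simps)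
      qed
    qed
    also have "\<dots> = ennreal (L / 2) * modular \<Omega> M (\<lambda>x. 2 *\<^sub>R G x) + ennreal L * emeasure lebesgue \<Omega>"
      using open_Omega unfolding modular_def by (simp add: nn_integral_add nn_integral_cmult emeasure_restrict_space)
    also have "\<dots> < \<infinity>"
      using 1 emeasure_bounded_finite[OF bounded_Omega] open_Omega by (simp add: ennreal_mult_less_top)
    finally show ?thesis .
  qed
  have um [measurable]: "u n \<in> borel_measurable ?N" "gu n \<in> borel_measurable ?N" for n
    unfolding u_def[abs_def] gu_def[abs_def] by measurable
  have evt: "\<forall>\<^sub>F n in sequentially. (\<integral>\<^sup>+x. FF (u n) (gu n) x \<partial>?N) < e"
    if e: "(\<integral>\<^sup>+x. FF (\<lambda>x. u0 x + v x) G x \<partial>?N) < e" for e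
  proof (rule nn_integral_dominated_perturbed[where G="?H" and E="?E" and F'="FF (\<lambda>x. u0 x + v x) G"])
    show "FF (u n) (gu n) \<in> borel_measurable ?N" for n by (rule FFm) measurable
    show "FF (\<lambda>x. u0 x + v x) G \<in> borel_measurable ?N" by (rule FFm) measurable
    show "AE x in ?N. FF (u n) (gu n) x \<le> ?H x + ?E n x" for n
      using AE_in_Omega
    proof eventually_elim
      fix x assume x: "x \<in> \<Omega>"
      have eq: "gu n x = G x + (grad (\<phi> (r n)) x - ?Gv x)" by (simp add: gu_def G_def)
      have "F x (u n x) (gu n x) \<le> L * (M x (gu n x) + 1)" by (rule FL[OF x])
      also have "\<dots> \<le> L * ((M x (2 *\<^sub>R G x) / 2 + M x (2 *\<^sub>R (grad (\<phi> (r n)) x - ?Gv x)) / 2) + 1)"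
        unfolding eq using M_add[OF x] L by (intro mult_left_mono add_right_mono) auto
      also have "\<dots> = L * (M x (2 *\<^sub>R G x) / 2 + 1) + L / 2 * M x (2 *\<^sub>R (grad (\<phi> (r n)) x - ?Gv x))"
        by (simp add: algebra_simps)
      finally have "FF (u n) (gu n) x \<le> ennreal (L * (M x (2 *\<^sub>R G x) / 2 + 1) + L / 2 * M x (2 *\<^sub>R (grad (\<phi> (r n)) x - ?Gv x)))"
        unfolding FF_def by (rule ennreal_leI)
      also have "\<dots> = ?H x + ?E n x"
        using L M_nonneg[OF x] by (simp add: ennreal_plus[symmetric] ennreal_mult[symmetric] del: ennreal_plus)
      finally show "FF (u n) (gu n) x \<le> ?H x + ?E n x" .
    qed
    show "AE x in ?N. FF (\<lambda>x. u0 x + v x) G x \<le> ?H x"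
      using AE_in_Omega
    proof eventually_elim
      fix x assume x: "x \<in> \<Omega>"
      have "M x (G x) \<le> M x (2 *\<^sub>R G x) / 2" using M_scale[OF x, of "1/2" "2 *\<^sub>R G x"] by simp
      then have "L * (M x (G x) + 1) \<le> L * (M x (2 *\<^sub>R G x) / 2 + 1)" using L by simp
      then show "FF (\<lambda>x. u0 x + v x) G x \<le> ?H x"
        unfolding FF_def using FL[OF x, of "u0 x + v x" "G x"] by (intro ennreal_leI) linarith
    qed
    show "AE x in ?N. (\<lambda>n. FF (u n) (gu n) x) \<longlonglongrightarrow> FF (\<lambda>x. u0 x + v x) G x"
      using lim1 lim2 AE_in_Omega
    proof eventually_elim
      fix x assume l1: "(\<lambda>n. \<phi> (r n) x - v x) \<longlonglongrightarrow> 0" and l2: "(\<lambda>n. grad (\<phi> (r n)) x - ?Gv x) \<longlonglongrightarrow> 0" and x: "x \<in> \<Omega>"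
      have "(\<lambda>n. u n x) \<longlonglongrightarrow> u0 x + v x" unfolding u_def using l1 by (intro tendsto_intros) (simp add: LIM_zero_iff)
      moreover have "(\<lambda>n. gu n x) \<longlonglongrightarrow> G x" unfolding gu_def G_def using l2 by (intro tendsto_intros) (simp add: LIM_zero_iff)
      ultimately have "(\<lambda>n. (u n x, gu n x)) \<longlonglongrightarrow> (u0 x + v x, G x)" by (rule tendsto_Pair)
      moreover have "isCont (\<lambda>(z, \<xi>). F x z \<xi>) (u0 x + v x, G x)" using Fc[OF x] by (simp add: continuous_on_eq_continuous_at)
      ultimately have "(\<lambda>n. (\<lambda>(z, \<xi>). F x z \<xi>) (u n x, gu n x)) \<longlonglongrightarrow> (\<lambda>(z, \<xi>). F x z \<xi>) (u0 x + v x, G x)"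
        by (rule isCont_tendsto_compose[rotated])
      then show "(\<lambda>n. FF (u n) (gu n) x) \<longlonglongrightarrow> FF (\<lambda>x. u0 x + v x) G x"
        unfolding FF_def by (intro tendsto_ennrealI) simp
    qed
  qed (use Hfin E0 e in auto)
  let ?J = "INF u\<in>translate u0 (test_functions \<Omega>). energy \<Omega> F u"
  have J_le: "?J \<le> enn2ereal (\<integral>\<^sup>+x. FF (u n) (gu n) x \<partial>?N)" for n
    unfolding en[symmetric]
    by (rule INF_lower) (use \<phi>(1) in \<open>auto simp: translate_def u_def[abs_def]\<close>)
  have "e2ennreal ?J \<le> (\<integral>\<^sup>+x. FF (\<lambda>x. u0 x + v x) G x \<partial>?N)"
  proof (rule dense_ge)
    fix e assume "(\<integral>\<^sup>+x. FF (\<lambda>x. u0 x + v x) G x \<partial>?N) < e"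
    from evt[OF this] obtain n where n: "(\<integral>\<^sup>+x. FF (u n) (gu n) x \<partial>?N) < e"
      unfolding eventually_sequentially by blast
    have "e2ennreal ?J \<le> e2ennreal (enn2ereal (\<integral>\<^sup>+x. FF (u n) (gu n) x \<partial>?N))" by (rule e2ennreal_mono[OF J_le])
    then show "e2ennreal ?J \<le> e" using n by simp
  qed
  then have "enn2ereal (e2ennreal ?J) \<le> enn2ereal (\<integral>\<^sup>+x. FF (\<lambda>x. u0 x + v x) G x \<partial>?N)"
    by (simp add: less_eq_ennreal.rep_eq)
  moreover have "?J \<le> enn2ereal (e2ennreal ?J)"
    by (cases "0 \<le> ?J") (simp_all add: enn2ereal_e2ennreal order_trans[OF _ enn2ereal_nonneg])
  ultimately show ?thesis unfolding ev by (rule order_trans[rotated])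
qed

lemma gradient_representative:
  assumes v: "v \<in> V1E_0 \<Omega> M"
  obtains g where "g \<in> borel_measurable borel" "\<And>x. x \<notin> \<Omega> \<Longrightarrow> g x = 0"
    "AE x in lebesgue_on \<Omega>. weak_gradient \<Omega> v x = g x" "\<And>s. modular0 (\<lambda>x. s *\<^sub>R g x) < \<infinity>"
proof -
  have vE: "weak_gradient \<Omega> v \<in> E_space \<Omega> M" using v by (simp add: V1E_0_def)
  obtain g where g: "g \<in> borel_measurable borel" "\<And>x. x \<notin> \<Omega> \<Longrightarrow> g x = 0"
    "AE x in lebesgue_on \<Omega>. weak_gradient \<Omega> v x = g x"
    using borel_representative[OF open_Omega E_space_D(1)[OF vE]] by blast
  have "modular0 (\<lambda>x. s *\<^sub>R g x) < \<infinity>" for s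
  proof -
    have "modular \<Omega> M (\<lambda>x. s *\<^sub>R weak_gradient \<Omega> v x) = modular0 (\<lambda>x. s *\<^sub>R g x)"
      by (rule modular_eq_modular0) (use g(3) in \<open>eventually_elim, simp\<close>)
    then show ?thesis using E_space_D(2)[OF vE, of s] by simp
  qed
  with g show ?thesis by (rule that)
qed

end

context balanced_musielak
begin

lemma V1E_0_approximable:
  assumes \<Omega>: "lipschitz_domain \<Omega>" and g0: "\<gamma> = 0" and v: "v \<in> V1E_0 \<Omega> M"
  obtains w g where "w \<in> borel_measurable borel" "\<And>x. x \<notin> \<Omega> \<Longrightarrow> w x = 0" "AE x in lebesgue_on \<Omega>. v x = w x"
    "g \<in> borel_measurable borel" "\<And>x. x \<notin> \<Omega> \<Longrightarrow> g x = 0" "AE x in lebesgue_on \<Omega>. weak_gradient \<Omega> v x = g x" "approximable w g"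
proof -
  have v0: "v \<in> W11_0 \<Omega>" "v \<in> W11 \<Omega>" using v by (auto simp: V1E_0_def W11_0_def)
  obtain w where w: "w \<in> borel_measurable borel" "\<And>x. x \<notin> \<Omega> \<Longrightarrow> w x = 0" "AE x in lebesgue_on \<Omega>. v x = w x"
    using borel_representative[OF open_Omega borel_measurable_integrable[OF W11_weak_gradient(2)[OF open_Omega v0(2)]]] by blast
  obtain g where g: "g \<in> borel_measurable borel" "\<And>x. x \<notin> \<Omega> \<Longrightarrow> g x = 0"
    "AE x in lebesgue_on \<Omega>. weak_gradient \<Omega> v x = g x" "\<And>s. modular0 (\<lambda>x. s *\<^sub>R g x) < \<infinity>"
    using gradient_representative[OF v] by blast
  have "W0 w g" by (rule W11_0_extension[OF open_Omega v0(1) w g(1-3)])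
  from approximable_unbounded[OF g0 lipschitz_domain_inward_cone[OF \<Omega>] this w(2) g(2,4)]
  have "approximable w g" .
  with w g(1-3) show ?thesis by (rule that)
qed

lemma V1E_0_holder_approximable:
  assumes \<Omega>: "lipschitz_domain \<Omega>" and g0: "\<gamma> > 0" and v: "v \<in> V1E_0 \<Omega> M" "v \<in> holder_space \<gamma> \<Omega>"
  obtains w g where "w \<in> borel_measurable borel" "\<And>x. x \<notin> \<Omega> \<Longrightarrow> w x = 0" "AE x in lebesgue_on \<Omega>. v x = w x"
    "g \<in> borel_measurable borel" "\<And>x. x \<notin> \<Omega> \<Longrightarrow> g x = 0" "AE x in lebesgue_on \<Omega>. weak_gradient \<Omega> v x = g x" "approximable w g"
proof -
  have v0: "v \<in> W11_0 \<Omega>" using v by (auto simp: V1E_0_def)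
  obtain H0 where H0: "\<And>x y. x \<in> \<Omega> \<Longrightarrow> y \<in> \<Omega> \<Longrightarrow> x \<noteq> y \<Longrightarrow> \<bar>v x - v y\<bar> / dist x y powr \<gamma> \<le> H0"
    using v(2) unfolding holder_space_def bdd_above_def by blast
  define H where "H = max H0 0"
  have H: "H \<ge> 0" by (simp add: H_def)
  have hol: "\<bar>v x - v y\<bar> \<le> H * norm (x - y) powr \<gamma>" if "x \<in> \<Omega>" "y \<in> \<Omega>" "x \<noteq> y" for x y
  proof -
    have "\<bar>v x - v y\<bar> / dist x y powr \<gamma> \<le> H" using H0[OF that] by (simp add: H_def)
    then show ?thesis using that(3) by (simp add: divide_le_eq dist_norm)
  qed
  define w where "w x = (if x \<in> \<Omega> then v x else 0)" for x
  have vc: "continuous_on \<Omega> v"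
    unfolding continuous_on_def
  proof
    fix x assume x: "x \<in> \<Omega>"
    have "((\<lambda>y. H * norm (x - y) powr \<gamma>) \<longlongrightarrow> H * norm (x - x) powr \<gamma>) (at x within \<Omega>)"
      using g0 by (intro tendsto_intros tendsto_powr') auto
    then have "((\<lambda>y. H * norm (x - y) powr \<gamma>) \<longlongrightarrow> 0) (at x within \<Omega>)" by simp
    moreover have "\<forall>\<^sub>F y in at x within \<Omega>. norm (v y - v x) \<le> H * norm (x - y) powr \<gamma>"
      unfolding eventually_at_filter
    proof (intro always_eventually allI impI)
      fix y assume y: "y \<noteq> x" "y \<in> \<Omega>"
      show "norm (v y - v x) \<le> H * norm (x - y) powr \<gamma>"
        using hol[OF x y(2)] y(1) by (simp add: abs_minus_commute)
    qed
    ultimately have "((\<lambda>y. v y - v x) \<longlongrightarrow> 0) (at x within \<Omega>)" by (rule Lim_null_comparison[rotated])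
    then show "(v \<longlongrightarrow> v x) (at x within \<Omega>)" by (simp add: LIM_zero_iff)
  qed
  have w: "w \<in> borel_measurable borel" "\<And>x. x \<notin> \<Omega> \<Longrightarrow> w x = 0" "AE x in lebesgue_on \<Omega>. v x = w x"
  proof -
    have "(\<lambda>x. indicator \<Omega> x *\<^sub>R v x) \<in> borel_measurable borel"
      by (rule borel_measurable_continuous_on_indicator[OF _ vc]) (simp add: open_Omega)
    moreover have "(\<lambda>x. indicator \<Omega> x *\<^sub>R v x) = w" by (auto simp: w_def indicator_def)
    ultimately show "w \<in> borel_measurable borel" by simp
    show "AE x in lebesgue_on \<Omega>. v x = w x" using AE_in_Omega by eventually_elim (simp add: w_def)
  qed (simp add: w_def)
  obtain g where g: "g \<in> borel_measurable borel" "\<And>x. x \<notin> \<Omega> \<Longrightarrow> g x = 0"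
    "AE x in lebesgue_on \<Omega>. weak_gradient \<Omega> v x = g x" "\<And>s. modular0 (\<lambda>x. s *\<^sub>R g x) < \<infinity>"
    using gradient_representative[OF v(1)] by blast
  have W: "W0 w g" by (rule W11_0_extension[OF open_Omega v0 w g(1-3)])
  have holw: "\<bar>w x - w y\<bar> \<le> H * norm (x - y) powr \<gamma>" if "x \<noteq> y" for x y
    by (rule holder_zero_extension[OF \<Omega> W w(2) g0 H _ that]) (use hol in \<open>auto simp: w_def\<close>)
  obtain x0 where x0: "x0 \<in> \<Omega>" using \<Omega> by (auto simp: lipschitz_domain_def)
  obtain R where R: "\<And>x. x \<in> \<Omega> \<Longrightarrow> norm x \<le> R" using bounded_Omega by (auto simp: bounded_iff)
  have wb: "\<bar>w x\<bar> \<le> \<bar>w x0\<bar> + H * (2 * R) powr \<gamma>" for x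
  proof (cases "x \<in> \<Omega> \<and> x \<noteq> x0")
    case True
    have "norm (x - x0) \<le> 2 * R" using R[of x] R[OF x0] True norm_triangle_ineq4[of x x0] by simp
    then have "H * norm (x - x0) powr \<gamma> \<le> H * (2 * R) powr \<gamma>" using g0 H by (intro mult_left_mono powr_mono2) auto
    moreover have "\<bar>w x - w x0\<bar> \<le> H * norm (x - x0) powr \<gamma>" using holw True by blast
    ultimately show ?thesis by linarith
  next
    case False
    have "H * (2 * R) powr \<gamma> \<ge> 0" using H by simp
    then show ?thesis using False w(2)[of x] by (cases "x = x0") auto
  qed
  from approximable_holder[OF lipschitz_domain_inward_cone[OF \<Omega>] W w(2) g(2,4) holw wb]
  have "approximable w g" .
  with w g(1-3) show ?thesis by (rule that)
qed

end

theorem theorem4: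
  fixes \<Omega> :: "(real^'n::finite) set"
    and F :: "real^'n \<Rightarrow> real \<Rightarrow> real^'n \<Rightarrow> real"
    and M :: "real^'n \<Rightarrow> real^'n \<Rightarrow> real"
    and \<nu> \<beta> L :: real
  assumes "bounded \<Omega>" and "lipschitz_domain \<Omega>"
    and "\<And>z \<xi>. (\<lambda>x. F x z \<xi>) \<in> borel_measurable (lebesgue_on \<Omega>)"
    and "\<And>x. x \<in> \<Omega> \<Longrightarrow> continuous_on UNIV (\<lambda>(z, \<xi>). F x z \<xi>)"
    and "weak_N_function \<Omega> UNIV M"
    and "continuous_on (\<Omega> \<times> UNIV) (\<lambda>(x, \<xi>). M x \<xi>)"
    and "0 < \<nu>" and "\<nu> < 1" and "0 < \<beta>" and "\<beta> < 1" and "1 < L"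
    and "\<And>x z \<xi>. x \<in> \<Omega> \<Longrightarrow>
           \<nu> * M x (\<beta> *\<^sub>R \<xi>) \<le> F x z \<xi> \<and> F x z \<xi> \<le> L * (M x \<xi> + 1)"
  shows "(\<forall>u0. u0 \<in> V1E \<Omega> M \<and> cond_B_gen_plus 0 \<Omega> M \<longrightarrow>
            (INF u\<in>translate u0 (V1E_0 \<Omega> M). energy \<Omega> F u)
              = (INF u\<in>translate u0 (test_functions \<Omega>). energy \<Omega> F u))
       \<and> (\<forall>\<gamma> u0. 0 < \<gamma> \<and> \<gamma> \<le> 1 \<and> u0 \<in> V1E \<Omega> M \<inter> holder_space \<gamma> \<Omega> \<and> cond_B_gen_plus \<gamma> \<Omega> M \<longrightarrow>
            (INF u\<in>translate u0 (V1E_0 \<Omega> M \<inter> holder_space \<gamma> \<Omega>). energy \<Omega> F u)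
              = (INF u\<in>translate u0 (test_functions \<Omega>). energy \<Omega> F u))"
proof -
  note F = assms(12)
  have open_Omega: "open \<Omega>" using assms(2) by (simp add: lipschitz_domain_def)
  interpret musielak \<Omega> M by (rule weak_N_function_musielak[OF open_Omega assms(1,5,6)])
  have F0: "0 \<le> F x z \<xi>" if "x \<in> \<Omega>" for x z \<xi>
    using F[OF that, of \<xi> z] M_nonneg[OF that, of "\<beta> *\<^sub>R \<xi>"] assms(7)
    by (meson mult_nonneg_nonneg less_imp_le order_trans)
  have FL: "F x z \<xi> \<le> L * (M x \<xi> + 1)" if "x \<in> \<Omega>" for x z \<xi> using F[OF that] by blast
  have L: "L > 0" using assms(11) by simp
  have recovery: "(INF u\<in>translate u0 (test_functions \<Omega>). energy \<Omega> F u) \<le> energy \<Omega> F (\<lambda>x. u0 x + v x)"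
    if "u0 \<in> V1E \<Omega> M" "v \<in> V1E_0 \<Omega> M"
      "w \<in> borel_measurable borel" "\<And>x. x \<notin> \<Omega> \<Longrightarrow> w x = 0" "AE x in lebesgue_on \<Omega>. v x = w x"
      "g \<in> borel_measurable borel" "\<And>x. x \<notin> \<Omega> \<Longrightarrow> g x = 0" "AE x in lebesgue_on \<Omega>. weak_gradient \<Omega> v x = g x"
      "approximable w g" for u0 v w g
    by (rule energy_recovery[OF _ _ _ _ L that]) (use assms(3,4) F0 FL in auto)
  show ?thesis
  proof (intro conjI allI impI; elim conjE; rule antisym)
    fix u0 assume u0: "u0 \<in> V1E \<Omega> M" and B: "cond_B_gen_plus 0 \<Omega> M"
    show "(INF u\<in>translate u0 (V1E_0 \<Omega> M). energy \<Omega> F u) \<le> (INF u\<in>translate u0 (test_functions \<Omega>). energy \<Omega> F u)"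
      using test_functions_V1E_0 by (intro INF_superset_mono) (auto simp: translate_def)
    obtain K P C \<theta> where "balanced_musielak \<Omega> M K P C \<theta> 0"
      using cond_B_balanced[OF musielak_axioms _ _ B] by auto
    then interpret balanced_musielak \<Omega> M K P C \<theta> 0 .
    show "(INF u\<in>translate u0 (test_functions \<Omega>). energy \<Omega> F u) \<le> (INF u\<in>translate u0 (V1E_0 \<Omega> M). energy \<Omega> F u)"
    proof (rule INF_greatest)
      fix u assume "u \<in> translate u0 (V1E_0 \<Omega> M)"
      then obtain v where u: "u = (\<lambda>x. u0 x + v x)" and v: "v \<in> V1E_0 \<Omega> M" by (auto simp: translate_def)
      show "(INF u\<in>translate u0 (test_functions \<Omega>). energy \<Omega> F u) \<le> energy \<Omega> F u"
        unfolding u by (rule V1E_0_approximable[OF assms(2) refl v]) (rule recovery[OF u0 v])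
    qed
  next
    fix \<gamma> u0 assume \<gamma>: "0 < \<gamma>" "\<gamma> \<le> 1" and u0: "u0 \<in> V1E \<Omega> M \<inter> holder_space \<gamma> \<Omega>" and B: "cond_B_gen_plus \<gamma> \<Omega> M"
    show "(INF u\<in>translate u0 (V1E_0 \<Omega> M \<inter> holder_space \<gamma> \<Omega>). energy \<Omega> F u)
        \<le> (INF u\<in>translate u0 (test_functions \<Omega>). energy \<Omega> F u)"
      using test_functions_V1E_0 test_functions_holder[OF _ \<gamma>] by (intro INF_superset_mono) (auto simp: translate_def)
    obtain K P C \<theta> where "balanced_musielak \<Omega> M K P C \<theta> \<gamma>"
      using cond_B_balanced[OF musielak_axioms _ _ B] \<gamma> by auto
    then interpret balanced_musielak \<Omega> M K P C \<theta> \<gamma> .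
    show "(INF u\<in>translate u0 (test_functions \<Omega>). energy \<Omega> F u)
        \<le> (INF u\<in>translate u0 (V1E_0 \<Omega> M \<inter> holder_space \<gamma> \<Omega>). energy \<Omega> F u)"
    proof (rule INF_greatest)
      fix u assume "u \<in> translate u0 (V1E_0 \<Omega> M \<inter> holder_space \<gamma> \<Omega>)"
      then obtain v where u: "u = (\<lambda>x. u0 x + v x)" and v: "v \<in> V1E_0 \<Omega> M" "v \<in> holder_space \<gamma> \<Omega>"
        by (auto simp: translate_def)
      show "(INF u\<in>translate u0 (test_functions \<Omega>). energy \<Omega> F u) \<le> energy \<Omega> F u"
        unfolding u by (rule V1E_0_holder_approximable[OF assms(2) \<gamma>(1) v]) (rule recovery[OF IntD1[OF u0] v(1)])
    qed
  qed
qed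

end
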